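(* Let $(M,\omega)$ be a symplectic manifold admitting a metaplectic structure $(\pi_P,\Lambda)$ and let $J$ be a Kuiper map. Then the reduced higher oscillator bundle $\mathcal{H}^\bullet_R\to M$ with the Hilbert $C^*$-bundle structure induced by the Kuiper map $J$ is a smooth Hilbert $CH$-bundle for any compatible positive almost complex structure on $(M,\omega)$.
   Context: **Algebra.** $(V,\omega_0)$ is a real symplectic vector space of dimension $2n=\dim M$, $n\ge 1$; $G=Sp(V,\omega_0)$; $\lambda:\widetilde G\to G$ is its connected double cover. $J_0$ is a linear complex structure on $V$ such that $g_0(u,v)=\omega_0(J_0u,v)$ is an inner product; $K=O(V,g_0)\cap G$, $\widetilde K=\lambda^{-1}(K)$. $L\subset V$ is a Lagrangian subspace, $\check H=L^2(L)$ (complex valued); scalar products are anti-linear in the left variable. $\check\sigma:\widetilde G\to U(\check H)$ is a fixed Segal--Shale--Weil representation: the strongly continuous unitary representation with $\check\sigma(g)r(v,t)\check\sigma(g)^{-1}=r(\lambda(g)v,t)$, where $r$ is the Schrödinger representation of the Heisenberg group $V\times\mathbb{R}$ on $L^2(L)$. $H$ is the continuous dual of $\check H$; for $f\in H$, $f^\sharp\in\check H$ is defined by $f(v)=(f^\sharp,v)_{\check H}$; for $v\in\check H$, $v^\flat=(v,\cdot)_{\check H}$; $(f,g)_H=(g^\sharp,f^\sharp)_{\check H}$. $\sigma(g)f=f\circ\check\sigma(g)^{-1}$. For $u\in\check H$, $v\in H$, $u\otimes v$ is the operator $w\mapsto v(w)u$. $CH$ is the $C^*$-algebra of compact operators on $\check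 H$ and $\rho(g)a=\check\sigma(g)\circ a\circ\check\sigma(g)^{-1}$. $H^k=\bigwedge^kV^*\otimes_{\mathbb{R}}H$, $\sigma^k(g)(\alpha\otimes f)=\lambda^{*\wedge k}(g)\alpha\otimes\sigma(g)f$ ($\lambda^{*\wedge k}$: $k$-th exterior power of the dual of $\lambda$), $H^\bullet=\bigoplus_{k=0}^{2n}H^k$. $H^\bullet$ is a Hilbert $CH$-module via $(\alpha\otimes u)\cdot a=\alpha\otimes(u\circ a)$ and $(\alpha\otimes u,\beta\otimes v)=g_0(\alpha,\beta)u^\sharp\otimes v$ (with $g_0$ extended to $\bigwedge^\bullet V^*$), extended additively. **Geometry.** $\mathcal{Q}\to M$ is the principal $G$-bundle of symplectic frames $A:V\to T_mM$ ($\omega_m(Au,Av)=\omega_0(u,v)$; right action $A\mapsto A\circ g$). A metaplectic structure is a pair $(\pi_P,\Lambda)$ of a principal $\widetilde G$-bundle $\pi_P:\mathcal{P}\to M$ and a smooth map $\Lambda:\mathcal{P}\to\mathcal{Q}$ over $\mathrm{Id}_M$ with $\Lambda(rg)=\Lambda(r)\lambda(g)$. Associated bundles are quotients by $(r,v)\sim(rg^{-1},\kappa(g)v)$: $\mathcal{H}^k=\mathcal{P}\times_{\sigma^k}H^k\cong\bigwedge^kT^*M\otimes\mathcal{H}$, $\mathcal{H}=\mathcal{H}^0$ with bundle projection $p_0$, $\check{\mathcal{H}}=\mathcal{P}\times_{\check\sigma}\check H$, $\mathcal{CH}=\mathcal{P}\times_\rho CH$. $\mathcal{H}$ has the fiberwise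 scalar product $([(r,v)],[(r,w)])_S=(v,w)_H$. A compatible positive almost complex structure $J_M$ is one for which $\omega(J_M\cdot,\cdot)$ is a Riemannian metric. $\mathcal{P}_R\subset\mathcal{P}$ is the $\Lambda$-preimage of the frames with $AJ_0=J_MA$, a principal $\widetilde K$-bundle; $\mathcal{H}^\bullet_R$, $\mathcal{CH}_R$ are the bundles associated to it (same total spaces as $\mathcal{H}^\bullet=\bigoplus_k\mathcal{H}^k$, $\mathcal{CH}$). **Kuiper structure.** A Kuiper map is a homeomorphism $J:\mathcal{H}\to M\times H$ over $\mathrm{Id}_M$ that is linear and unitary on each fiber. $\check J(\tilde v)=(J(\tilde v^\flat))^\sharp$ (fiberwise $\flat$, $\sharp$). $J_{CH}:\mathcal{CH}\to M\times CH$ is the fiberwise linear, operator-norm continuous extension of $J_{CH}([(r,v\otimes f)])=(\pi_P(r),\mathrm{pr}_2\check J([(r,v)])\otimes\mathrm{pr}_2J([(r,f)]))$. The Hilbert $C^*$-bundle structure induced by $J$ is: on $\mathcal{H}^0_R$ the atlas $\mathcal{A}=\{(U,\mu J|_{p_0^{-1}(U)}):\mu\in\mathbb{C}^\times,\ U\subset M\text{ open}\}$, and on $\mathcal{H}^k_R\cong\bigwedge^kT^*M\otimes\mathcal{H}$ the tensor product of the smooth structure of $\bigwedge^kT^*M$ with $\mathcal{A}$. The $CH$-action and $CH$-valued product are, for $f,h\in(\mathcal{H}^\bullet_R)_m$ and $a\in CH$, $h\cdot a=h\cdot_{\mathcal{H}}J_{CH}^{-1}(m,a)$ and $(f,h)=\mathrm{pr}_2J_{CH}((f,h)_{\mathcal{CH}})$,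 where $[(q,f)]\cdot_{\mathcal{H}}[(q,a)]=[(q,f\cdot a)]$ and, for $q\in\mathcal{P}_R$, $([(q,v)],[(q,w)])_{\mathcal{CH}}=[(q,(v,w))]$. **Smooth Hilbert $CH$-bundle.** This means a bundle with: a smooth (infinitely Fréchet differentiable in the charts) right action of $CH$ on the total space and a smooth $CH$-valued product on the fiber product of the bundle with itself, restricting on each fiber to a Hilbert $CH$-module action and a Hilbert $CH$-product, and a smooth atlas whose transition functions take values in $\mathrm{Aut}_{CH}(H^\bullet)$, the linear homeomorphisms of the typical fiber $H^\bullet$ commuting with the $CH$-action. *)

theory Defs
  imports "HOL-Analysis.Analysis"
begin

text \<open>HOL-Analysis has no class of complex vector spaces. Complex normed spaces are real normed
  spaces with a compatible complex scaling; \<open>cinner\<close> is anti-linear in its left argument.\<close>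

class scaleC =
  fixes scaleC :: "complex \<Rightarrow> 'a \<Rightarrow> 'a" (infixr "*\<^sub>C" 75)

class complex_normed_vector = scaleC + real_normed_vector +
  assumes scaleC_add_right: "c *\<^sub>C (x + y) = c *\<^sub>C x + c *\<^sub>C y"
    and scaleC_add_left: "(c + d) *\<^sub>C x = c *\<^sub>C x + d *\<^sub>C x"
    and scaleC_scaleC: "c *\<^sub>C d *\<^sub>C x = (c * d) *\<^sub>C x"
    and scaleC_of_real: "complex_of_real r *\<^sub>C x = r *\<^sub>R x"
    and norm_scaleC: "norm (c *\<^sub>C x) = cmod c * norm x"

class cinner =
  fixes cinner :: "'a \<Rightarrow> 'a \<Rightarrow> complex"

class complex_inner = cinner + complex_normed_vector + real_inner +
  assumes cinner_commute: "cinner x y = cnj (cinner y x)"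
    and cinner_add_right: "cinner x (y + z) = cinner x y + cinner x z"
    and cinner_scaleC_right: "cinner x (c *\<^sub>C y) = c * cinner x y"
    and Re_cinner: "Re (cinner x y) = x \<bullet> y"

definition clinear :: "('a::complex_normed_vector \<Rightarrow> 'b::complex_normed_vector) \<Rightarrow> bool"
  where "clinear T \<longleftrightarrow> (\<forall>x y. T (x + y) = T x + T y) \<and> (\<forall>c x. T (c *\<^sub>C x) = c *\<^sub>C T x)"

instantiation complex :: complex_normed_vector
begin
definition scaleC_complex :: "complex \<Rightarrow> complex \<Rightarrow> complex" where "scaleC_complex = (*)"
instance
  by standard (auto simp: scaleC_complex_def algebra_simps scaleR_conv_of_real norm_mult)
end

lemma cinner_add_left: "cinner (x + y) z = cinner x z + cinner y z"
  for x y z :: "'a::complex_inner"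
  by (metis cinner_add_right cinner_commute complex_cnj_add)

lemma cinner_scaleC_left: "cinner (c *\<^sub>C x) y = cnj c * cinner x y"
  for x y :: "'a::complex_inner"
  by (metis cinner_scaleC_right cinner_commute complex_cnj_mult)

lemma cinner_Cauchy_Schwarz: "cmod (cinner x y) \<le> norm x * norm y"
  for x y :: "'a::complex_inner"
proof (cases "cinner x y = 0")
  case False
  define c where "c = cnj (cinner x y) / cmod (cinner x y)"
  have c: "cmod c = 1" using False by (simp add: c_def norm_divide)
  have "c * cinner x y = of_real (cmod (cinner x y))"
    using False by (simp add: c_def complex_norm_square[symmetric] power2_eq_square field_simps)
  then have "cmod (cinner x y) = Re (cinner x (c *\<^sub>C y))"
    by (simp add: cinner_scaleC_right)
  also have "\<dots> = x \<bullet> (c *\<^sub>C y)" by (simp add: Re_cinner)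
  also have "\<dots> \<le> norm x * norm (c *\<^sub>C y)" by (rule norm_cauchy_schwarz)
  finally show ?thesis by (simp add: norm_scaleC c)
qed simp

lemma scaleC_0_right [simp]: "c *\<^sub>C (0::'a::complex_normed_vector) = 0"
  using scaleC_add_right[of c 0 0] by simp

lemma scaleC_0_left [simp]: "0 *\<^sub>C x = 0" for x :: "'a::complex_normed_vector"
  using scaleC_of_real[of 0 x] by simp

lemma scaleC_1 [simp]: "1 *\<^sub>C x = x" for x :: "'a::complex_normed_vector"
  using scaleC_of_real[of 1 x] by simp

lemma scaleC_minus_right: "c *\<^sub>C (- x) = - (c *\<^sub>C x)" for x :: "'a::complex_normed_vector"
  by (metis add.right_inverse add_eq_0_iff scaleC_0_right scaleC_add_right)

lemma scaleC_scaleR: "c *\<^sub>C r *\<^sub>R x = r *\<^sub>R c *\<^sub>C x" for x :: "'a::complex_normed_vector"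
  by (simp flip: scaleC_of_real add: scaleC_scaleC mult.commute)

lemma bounded_linear_scaleC: "bounded_linear (\<lambda>x. c *\<^sub>C (x::'a::complex_normed_vector))"
  by (rule bounded_linear_intro[where K="cmod c"])
    (simp_all add: scaleC_add_right scaleC_scaleR norm_scaleC)


definition square_integrable :: "('l::euclidean_space \<Rightarrow> complex) \<Rightarrow> bool"
  where "square_integrable f \<longleftrightarrow>
    f \<in> borel_measurable lborel \<and> integrable lborel (\<lambda>x. (cmod (f x))\<^sup>2)"

lemma square_integrable_mult:
  assumes "square_integrable f" "square_integrable g"
  shows "integrable lborel (\<lambda>x. f x * g x)" "integrable lborel (\<lambda>x. cnj (f x) * g x)"
proof -
  note [measurable] = assms[unfolded square_integrable_def, THEN conjunct1]
  have [measurable]: "cnj \<in> borel_measurable borel"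
    by (intro borel_measurable_continuous_onI continuous_intros)
  have *: "integrable lborel (\<lambda>x. (cmod (f x))\<^sup>2 + (cmod (g x))\<^sup>2)"
    using assms by (auto simp: square_integrable_def)
  have le: "cmod u * cmod v \<le> (cmod u)\<^sup>2 + (cmod v)\<^sup>2" for u v :: complex
    using sum_squares_bound[of "cmod u" "cmod v"]
      mult_nonneg_nonneg[OF norm_ge_zero norm_ge_zero, of u v] by (simp del: mult_nonneg_nonneg)
  show "integrable lborel (\<lambda>x. f x * g x)"
    by (rule Bochner_Integration.integrable_bound[OF *]) (auto simp: norm_mult le intro!: AE_I2)
  show "integrable lborel (\<lambda>x. cnj (f x) * g x)"
    by (rule Bochner_Integration.integrable_bound[OF *]) (auto simp: norm_mult le intro!: AE_I2)
qed

lemma square_integrable_add: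
  assumes "square_integrable f" "square_integrable g"
  shows "square_integrable (\<lambda>x. f x + g x)"
proof -
  note [measurable] = assms[unfolded square_integrable_def, THEN conjunct1]
  have *: "integrable lborel (\<lambda>x. 2 * (cmod (f x))\<^sup>2 + 2 * (cmod (g x))\<^sup>2)"
    using assms by (auto simp: square_integrable_def)
  have le: "(cmod (u + v))\<^sup>2 \<le> 2 * (cmod u)\<^sup>2 + 2 * (cmod v)\<^sup>2" for u v :: complex
  proof -
    have "(cmod (u + v))\<^sup>2 \<le> (cmod u + cmod v)\<^sup>2"
      by (simp add: norm_triangle_ineq power_mono)
    also have "\<dots> \<le> 2 * (cmod u)\<^sup>2 + 2 * (cmod v)\<^sup>2"
      using sum_squares_bound[of "cmod u" "cmod v"] by (simp add: power2_sum)
    finally show ?thesis .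
  qed
  have "integrable lborel (\<lambda>x. (cmod (f x + g x))\<^sup>2)"
    by (rule Bochner_Integration.integrable_bound[OF *]) (auto simp: le intro!: AE_I2)
  then show ?thesis by (simp add: square_integrable_def)
qed

lemma square_integrable_cmult:
  "square_integrable f \<Longrightarrow> square_integrable (\<lambda>x. c * f x)"
  by (auto simp: square_integrable_def norm_mult power_mult_distrib)

lemma square_integrable_0: "square_integrable (\<lambda>x. 0)"
  by (simp add: square_integrable_def)

text \<open>\<open>'l l2\<close> is $L^2$ of the Euclidean space \<open>'l\<close>, complex valued: square integrable functions
  modulo equality almost everywhere.\<close>

quotient_type (overloaded) 'l l2 = "'l::euclidean_space \<Rightarrow> complex" / partial:
  "\<lambda>f g. square_integrable f \<and> square_integrable g \<and> (AE x in lborel. f x = g x)"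
  by (rule part_equivpI) (auto intro!: exI[of _ "\<lambda>x. 0"] sympI transpI square_integrable_0)

instantiation l2 :: (euclidean_space) scaleC
begin
lift_definition scaleC_l2 :: "complex \<Rightarrow> 'a l2 \<Rightarrow> 'a l2" is "\<lambda>c f x. c * f x"
  by (auto intro: square_integrable_cmult)
instance ..
end

instantiation l2 :: (euclidean_space) cinner
begin
lift_definition cinner_l2 :: "'a l2 \<Rightarrow> 'a l2 \<Rightarrow> complex" is "\<lambda>f g. \<integral>x. cnj (f x) * g x \<partial>lborel"
  by (rule integral_cong_AE) (auto dest: square_integrable_mult(2)[THEN borel_measurable_integrable])
instance ..
end

lemma cinner_l2_commute: "cinner f g = cnj (cinner g f)" for f g :: "'a::euclidean_space l2"
  by transfer (simp flip: Bochner_Integration.integral_cnj add: mult.commute)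

lemma cinner_l2_scaleC_right: "cinner f (c *\<^sub>C g) = c * cinner f g"
  for f g :: "'a::euclidean_space l2"
  by transfer (auto simp: mult.left_commute)

lemma cinner_l2_scaleC_left: "cinner (c *\<^sub>C f) g = cnj c * cinner f g"
  for f g :: "'a::euclidean_space l2"
  by (metis cinner_l2_scaleC_right cinner_l2_commute complex_cnj_mult)

lemma scaleC_scaleC_l2: "c *\<^sub>C d *\<^sub>C f = (c * d) *\<^sub>C f" for f :: "'a::euclidean_space l2"
  by transfer (auto simp: mult.assoc intro: square_integrable_cmult)

lemma cnj_mult_self: "cnj z * z = complex_of_real ((cmod z)\<^sup>2)"
  by (simp only: complex_norm_square mult.commute[of "cnj z"])

instantiation l2 :: (euclidean_space) real_inner
begin

lift_definition zero_l2 :: "'a l2" is "\<lambda>x. 0" by (simp add: square_integrable_0)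

lift_definition plus_l2 :: "'a l2 \<Rightarrow> 'a l2 \<Rightarrow> 'a l2" is "\<lambda>f g x. f x + g x"
  by (auto intro: square_integrable_add)

definition uminus_l2 :: "'a l2 \<Rightarrow> 'a l2" where "uminus_l2 f = (- 1) *\<^sub>C f"
definition minus_l2 :: "'a l2 \<Rightarrow> 'a l2 \<Rightarrow> 'a l2" where "minus_l2 f g = f + (- g)"
definition scaleR_l2 :: "real \<Rightarrow> 'a l2 \<Rightarrow> 'a l2" where "scaleR_l2 r f = complex_of_real r *\<^sub>C f"
definition inner_l2 :: "'a l2 \<Rightarrow> 'a l2 \<Rightarrow> real" where "inner_l2 f g = Re (cinner f g)"
definition norm_l2 :: "'a l2 \<Rightarrow> real" where "norm_l2 f = sqrt (f \<bullet> f)"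
definition dist_l2 :: "'a l2 \<Rightarrow> 'a l2 \<Rightarrow> real" where "dist_l2 f g = norm (f - g)"
definition sgn_l2 :: "'a l2 \<Rightarrow> 'a l2" where "sgn_l2 f = scaleR (inverse (norm f)) f"
definition uniformity_l2 :: "('a l2 \<times> 'a l2) filter"
  where "uniformity_l2 = (INF e\<in>{0 <..}. principal {(x, y). dist x y < e})"
definition open_l2 :: "'a l2 set \<Rightarrow> bool"
  where "open_l2 S = (\<forall>x\<in>S. \<forall>\<^sub>F (x', y) in uniformity. x' = x \<longrightarrow> y \<in> S)"

instance
proof
  fix f g h :: "'a l2" and r s :: real
  show "f + g + h = f + (g + h)"
    by transfer (auto simp: add.assoc intro: square_integrable_add)
  show comm: "f + g = g + f" for f g :: "'a l2"
    by transfer (auto simp: add.commute intro: square_integrable_add)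
  show "0 + f = f" by transfer auto
  show "- f + f = 0"
    unfolding uminus_l2_def by transfer (auto intro: square_integrable_add square_integrable_cmult
      square_integrable_0)
  show "f - g = f + - g" by (simp add: minus_l2_def)
  show "r *\<^sub>R (f + g) = r *\<^sub>R f + r *\<^sub>R g" unfolding scaleR_l2_def
    by transfer (auto simp: distrib_left intro: square_integrable_add square_integrable_cmult)
  show "(r + s) *\<^sub>R f = r *\<^sub>R f + s *\<^sub>R f" unfolding scaleR_l2_def
    by transfer (auto simp: distrib_right intro: square_integrable_add square_integrable_cmult)
  show "r *\<^sub>R s *\<^sub>R f = (r * s) *\<^sub>R f" by (simp add: scaleR_l2_def scaleC_scaleC_l2)
  show "1 *\<^sub>R f = f" unfolding scaleR_l2_def by transfer auto
  show "f \<bullet> g = g \<bullet> f" by (subst inner_l2_def, subst cinner_l2_commute, simp add: inner_l2_def)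
  show "(f + g) \<bullet> h = f \<bullet> h + g \<bullet> h"
    unfolding inner_l2_def by transfer (simp add: distrib_right square_integrable_mult(2))
  show "r *\<^sub>R f \<bullet> g = r * (f \<bullet> g)"
    by (simp add: inner_l2_def scaleR_l2_def cinner_l2_scaleC_left)
  show "0 \<le> f \<bullet> f"
    unfolding inner_l2_def by transfer (simp only: cnj_mult_self integral_complex_of_real, simp)
  show "(f \<bullet> f = 0) = (f = 0)"
    unfolding inner_l2_def
  proof (transfer, goal_cases)
    case (1 f)
    then have f: "square_integrable f" by simp
    have "(\<integral>x. cnj (f x) * f x \<partial>lborel) = of_real (\<integral>x. (cmod (f x))\<^sup>2 \<partial>lborel)"
      by (simp only: cnj_mult_self integral_complex_of_real)
    moreover have "(\<integral>x. (cmod (f x))\<^sup>2 \<partial>lborel) = 0 \<longleftrightarrow> (AE x in lborel. (cmod (f x))\<^sup>2 = 0)"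
      using f by (intro integral_nonneg_eq_0_iff_AE) (auto simp: square_integrable_def)
    ultimately have "Re (\<integral>x. cnj (f x) * f x \<partial>lborel) = 0 \<longleftrightarrow> (AE x in lborel. f x = 0)"
      by simp
    then show ?case using f by (simp add: square_integrable_0)
  qed
  show "norm f = sqrt (f \<bullet> f)" by (simp add: norm_l2_def)
  show "dist f g = norm (f - g)" by (simp add: dist_l2_def)
  show "sgn f = scaleR (inverse (norm f)) f" by (simp add: sgn_l2_def)
  show "uniformity = (INF e\<in>{0 <..}. principal {(x, y::'a l2). dist x y < e})"
    by (simp add: uniformity_l2_def)
  show "open U = (\<forall>x\<in>U. \<forall>\<^sub>F (x', y) in uniformity. x' = x \<longrightarrow> y \<in> U)" for U :: "'a l2 set"
    by (simp add: open_l2_def)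
qed

end

instance l2 :: (euclidean_space) complex_inner
proof
  fix f g h :: "'a l2" and c d :: complex and r :: real
  show "c *\<^sub>C (f + g) = c *\<^sub>C f + c *\<^sub>C g"
    by transfer (auto simp: distrib_left intro: square_integrable_add square_integrable_cmult)
  show "(c + d) *\<^sub>C f = c *\<^sub>C f + d *\<^sub>C f"
    by transfer (auto simp: distrib_right intro: square_integrable_add square_integrable_cmult)
  show "c *\<^sub>C d *\<^sub>C f = (c * d) *\<^sub>C f" by (rule scaleC_scaleC_l2)
  show "complex_of_real r *\<^sub>C f = r *\<^sub>R f" by (simp add: scaleR_l2_def)
  show "cinner f g = cnj (cinner g f)" by (rule cinner_l2_commute)
  show "cinner f (g + h) = cinner f g + cinner f h"
    by transfer (simp add: distrib_left square_integrable_mult(2))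
  show "cinner f (c *\<^sub>C g) = c * cinner f g" by (rule cinner_l2_scaleC_right)
  show "Re (cinner f g) = f \<bullet> g" by (simp add: inner_l2_def)
  have "norm (c *\<^sub>C f) = sqrt (Re (cnj c * c * cinner f f))"
    by (simp only: norm_l2_def inner_l2_def cinner_l2_scaleC_left cinner_l2_scaleC_right
      mult.left_commute mult.assoc)
  then show "norm (c *\<^sub>C f) = cmod c * norm f"
    by (simp only: norm_l2_def inner_l2_def cnj_mult_self) (simp add: real_sqrt_mult)
qed

instantiation blinfun :: (real_normed_vector, complex_normed_vector) complex_normed_vector
begin

lift_definition scaleC_blinfun :: "complex \<Rightarrow> ('a \<Rightarrow>\<^sub>L 'b) \<Rightarrow> ('a \<Rightarrow>\<^sub>L 'b)"
  is "\<lambda>c f x. c *\<^sub>C f x"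
  by (rule bounded_linear_compose[OF bounded_linear_scaleC])

instance
proof
  fix c d :: complex and r :: real and f g :: "'a \<Rightarrow>\<^sub>L 'b"
  show "c *\<^sub>C (f + g) = c *\<^sub>C f + c *\<^sub>C g" by transfer (simp add: scaleC_add_right)
  show "(c + d) *\<^sub>C f = c *\<^sub>C f + d *\<^sub>C f" by transfer (simp add: scaleC_add_left)
  show assoc: "c *\<^sub>C d *\<^sub>C f = (c * d) *\<^sub>C f" for c d and f :: "'a \<Rightarrow>\<^sub>L 'b"
    by transfer (simp add: scaleC_scaleC)
  show "complex_of_real r *\<^sub>C f = r *\<^sub>R f" by transfer (simp add: scaleC_of_real)
  have le: "norm (c *\<^sub>C f) \<le> cmod c * norm f" for c and f :: "'a \<Rightarrow>\<^sub>L 'b"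
  proof (rule norm_blinfun_bound)
    fix x
    have "cmod c * norm (f x) \<le> cmod c * (norm f * norm x)"
      by (rule mult_left_mono[OF norm_blinfun norm_ge_zero])
    then show "norm ((c *\<^sub>C f) x) \<le> cmod c * norm f * norm x"
      by (simp add: scaleC_blinfun.rep_eq norm_scaleC mult.assoc)
  qed simp
  show "norm (c *\<^sub>C f) = cmod c * norm f"
  proof (cases "c = 0")
    case True
    have "0 *\<^sub>C f = 0" by transfer simp
    then show ?thesis by (simp add: True)
  next
    case False
    have "1 *\<^sub>C f = f" by transfer simp
    then have "f = inverse c *\<^sub>C c *\<^sub>C f" using False by (simp add: assoc)
    then have "norm f \<le> inverse (cmod c) * norm (c *\<^sub>C f)"
      using le[of "inverse c" "c *\<^sub>C f"] by (simp add: norm_inverse)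
    then have "cmod c * norm f \<le> norm (c *\<^sub>C f)" using False by (simp add: field_simps)
    with le[of c f] show ?thesis by simp
  qed
qed

end

lemma clinear_blinfun_plus:
  "clinear (blinfun_apply f) \<Longrightarrow> clinear (blinfun_apply g) \<Longrightarrow> clinear (blinfun_apply (f + g))"
  by (auto simp: clinear_def blinfun.add_left scaleC_add_right)

lemma clinear_blinfun_scaleC:
  "clinear (blinfun_apply f) \<Longrightarrow> clinear (blinfun_apply (c *\<^sub>C f))"
  by (auto simp: clinear_def scaleC_blinfun.rep_eq scaleC_add_right scaleC_scaleC mult.commute)

lemma clinear_blinfun_scaleR:
  "clinear (blinfun_apply f) \<Longrightarrow> clinear (blinfun_apply (r *\<^sub>R f))"
  by (simp flip: scaleC_of_real add: clinear_blinfun_scaleC)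

lemma clinear_blinfun_uminus:
  "clinear (blinfun_apply f) \<Longrightarrow> clinear (blinfun_apply (- f))"
  using clinear_blinfun_scaleR[of f "-1"] by simp

lemma clinear_blinfun_minus:
  "clinear (blinfun_apply f) \<Longrightarrow> clinear (blinfun_apply g) \<Longrightarrow> clinear (blinfun_apply (f - g))"
  using clinear_blinfun_plus[OF _ clinear_blinfun_uminus, of f g] by simp

lemma clinear_blinfun_zero: "clinear (blinfun_apply 0)"
  by (auto simp: clinear_def)

lemma clinear_compose: "clinear S \<Longrightarrow> clinear T \<Longrightarrow> clinear (\<lambda>x. S (T x))"
  by (auto simp: clinear_def)

lemma clinear_blinfun_compose:
  "clinear (blinfun_apply f) \<Longrightarrow> clinear (blinfun_apply g) \<Longrightarrow> clinear (blinfun_apply (f o\<^sub>L g))"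
  by (auto simp: clinear_def)

text \<open>Continuous complex-linear functionals, with the operator norm.\<close>

typedef (overloaded) 'a cdual =
  "{f :: 'a::complex_normed_vector \<Rightarrow>\<^sub>L complex. clinear (blinfun_apply f)}"
  by (rule exI[of _ 0]) (simp add: clinear_blinfun_zero)

setup_lifting type_definition_cdual

instantiation cdual :: (complex_normed_vector) complex_normed_vector
begin
lift_definition zero_cdual :: "'a cdual" is 0 by (rule clinear_blinfun_zero)
lift_definition plus_cdual :: "'a cdual \<Rightarrow> 'a cdual \<Rightarrow> 'a cdual" is "(+)"
  by (rule clinear_blinfun_plus)
lift_definition uminus_cdual :: "'a cdual \<Rightarrow> 'a cdual" is uminus by (rule clinear_blinfun_uminus)
lift_definition minus_cdual :: "'a cdual \<Rightarrow> 'a cdual \<Rightarrow> 'a cdual" is "(-)"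
  by (rule clinear_blinfun_minus)
lift_definition scaleR_cdual :: "real \<Rightarrow> 'a cdual \<Rightarrow> 'a cdual" is scaleR
  by (rule clinear_blinfun_scaleR)
lift_definition scaleC_cdual :: "complex \<Rightarrow> 'a cdual \<Rightarrow> 'a cdual" is scaleC
  by (rule clinear_blinfun_scaleC)
lift_definition norm_cdual :: "'a cdual \<Rightarrow> real" is norm .
definition dist_cdual :: "'a cdual \<Rightarrow> 'a cdual \<Rightarrow> real" where "dist_cdual f g = norm (f - g)"
definition sgn_cdual :: "'a cdual \<Rightarrow> 'a cdual" where "sgn_cdual f = scaleR (inverse (norm f)) f"
definition uniformity_cdual :: "('a cdual \<times> 'a cdual) filter"
  where "uniformity_cdual = (INF e\<in>{0 <..}. principal {(x, y). dist x y < e})"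
definition open_cdual :: "'a cdual set \<Rightarrow> bool"
  where "open_cdual S = (\<forall>x\<in>S. \<forall>\<^sub>F (x', y) in uniformity. x' = x \<longrightarrow> y \<in> S)"
instance
proof
  fix f g h :: "'a cdual" and c d :: complex and r s :: real
  show "f + g + h = f + (g + h)" by transfer (rule add.assoc)
  show "f + g = g + f" by transfer (rule add.commute)
  show "0 + f = f" by transfer simp
  show "- f + f = 0" by transfer simp
  show "f - g = f + - g" by transfer simp
  show "r *\<^sub>R (f + g) = r *\<^sub>R f + r *\<^sub>R g" by transfer (rule scaleR_add_right)
  show "(r + s) *\<^sub>R f = r *\<^sub>R f + s *\<^sub>R f" by transfer (rule scaleR_add_left)
  show "r *\<^sub>R s *\<^sub>R f = (r * s) *\<^sub>R f" by transfer (rule scaleR_scaleR)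
  show "1 *\<^sub>R f = f" by transfer simp
  show "dist f g = norm (f - g)" by (rule dist_cdual_def)
  show "sgn f = scaleR (inverse (norm f)) f" by (rule sgn_cdual_def)
  show "uniformity = (INF e\<in>{0 <..}. principal {(x, y::'a cdual). dist x y < e})"
    by (rule uniformity_cdual_def)
  show "open U = (\<forall>x\<in>U. \<forall>\<^sub>F (x', y) in uniformity. x' = x \<longrightarrow> y \<in> U)" for U :: "'a cdual set"
    by (rule open_cdual_def)
  show "(norm f = 0) = (f = 0)" by transfer simp
  show "norm (f + g) \<le> norm f + norm g" by transfer (rule norm_triangle_ineq)
  show "norm (r *\<^sub>R f) = \<bar>r\<bar> * norm f" by transfer simp
  show "c *\<^sub>C (f + g) = c *\<^sub>C f + c *\<^sub>C g" by transfer (rule scaleC_add_right)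
  show "(c + d) *\<^sub>C f = c *\<^sub>C f + d *\<^sub>C f" by transfer (rule scaleC_add_left)
  show "c *\<^sub>C d *\<^sub>C f = (c * d) *\<^sub>C f" by transfer (rule scaleC_scaleC)
  show "complex_of_real r *\<^sub>C f = r *\<^sub>R f" by transfer (rule scaleC_of_real)
  show "norm (c *\<^sub>C f) = cmod c * norm f" by transfer (rule norm_scaleC)
qed
end

definition compact_op :: "('a::real_normed_vector \<Rightarrow>\<^sub>L 'b::real_normed_vector) \<Rightarrow> bool"
  where "compact_op T \<longleftrightarrow> compact (closure (blinfun_apply T ` cball 0 1))"

lemma compact_op_iff: "compact_op T \<longleftrightarrow> (\<exists>K. compact K \<and> blinfun_apply T ` cball 0 1 \<subseteq> K)"
proof
  assume "compact_op T"
  then show "\<exists>K. compact K \<and> blinfun_apply T ` cball 0 1 \<subseteq> K"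
    unfolding compact_op_def by (intro exI conjI) (assumption, rule closure_subset)
next
  assume "\<exists>K. compact K \<and> blinfun_apply T ` cball 0 1 \<subseteq> K"
  then obtain K where K: "compact K" "blinfun_apply T ` cball 0 1 \<subseteq> K" by blast
  then have "closure (blinfun_apply T ` cball 0 1) \<subseteq> K"
    by (intro closure_minimal compact_imp_closed)
  then have "K \<inter> closure (blinfun_apply T ` cball 0 1) = closure (blinfun_apply T ` cball 0 1)"
    by (rule Int_absorb1)
  moreover have "compact (K \<inter> closure (blinfun_apply T ` cball 0 1))"
    by (rule compact_Int_closed[OF K(1) closed_closure])
  ultimately show "compact_op T" unfolding compact_op_def by simp
qed

lemma compact_op_plus: "compact_op S \<Longrightarrow> compact_op T \<Longrightarrow> compact_op (S + T)"
  for S T :: "'a::real_normed_vector \<Rightarrow>\<^sub>L 'b::real_normed_vector"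
  unfolding compact_op_iff
proof clarify
  fix K L assume K: "compact K" "S ` cball 0 1 \<subseteq> K" and L: "compact L" "T ` cball 0 1 \<subseteq> L"
  have "compact {x + y | x y. x \<in> K \<and> y \<in> L}" using K(1) L(1) by (rule compact_sums)
  moreover have "(S + T) ` cball 0 1 \<subseteq> {x + y | x y. x \<in> K \<and> y \<in> L}"
  proof (rule image_subsetI)
    fix x :: 'a assume "x \<in> cball 0 1"
    with K(2) L(2) have "S x \<in> K" "T x \<in> L" by blast+
    then show "(S + T) x \<in> {x + y | x y. x \<in> K \<and> y \<in> L}"
      unfolding blinfun.add_left by blast
  qed
  ultimately show "\<exists>K. compact K \<and> (S + T) ` cball 0 1 \<subseteq> K" by blast
qed

lemma compact_op_compose_left: "compact_op T \<Longrightarrow> compact_op (S o\<^sub>L T)"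
  unfolding compact_op_iff
proof clarify
  fix K assume K: "compact K" "T ` cball 0 1 \<subseteq> K"
  have "compact (S ` K)"
    by (rule compact_continuous_image[OF _ K(1)]) (intro continuous_intros)
  moreover have "(S o\<^sub>L T) ` cball 0 1 \<subseteq> S ` K" using K(2) by auto
  ultimately show "\<exists>K. compact K \<and> (S o\<^sub>L T) ` cball 0 1 \<subseteq> K" by blast
qed

lemma compact_op_compose_right: "compact_op T \<Longrightarrow> compact_op (T o\<^sub>L S)"
  unfolding compact_op_iff
proof clarify
  fix K assume K: "compact K" "T ` cball 0 1 \<subseteq> K"
  have "compact ((\<lambda>x. norm S *\<^sub>R x) ` K)"
    by (rule compact_continuous_image[OF _ K(1)]) (intro continuous_intros)
  moreover have "T (S x) \<in> (\<lambda>x. norm S *\<^sub>R x) ` K" if x: "norm x \<le> 1" for x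
  proof (cases "norm S = 0")
    case True
    have "T 0 \<in> K" using K(2) by (metis centre_in_cball image_subset_iff zero_le_one)
    moreover have "T (S x) = norm S *\<^sub>R T 0" using True by simp
    ultimately show ?thesis by blast
  next
    case False
    have "norm (S x) \<le> norm S"
      using norm_blinfun[of S x] x by (metis mult.right_neutral mult_left_mono norm_ge_zero order_trans)
    then have "norm ((1 / norm S) *\<^sub>R S x) \<le> 1" using False by (simp add: field_simps)
    then have "T ((1 / norm S) *\<^sub>R S x) \<in> K" using K(2) by (metis image_subset_iff mem_cball_0)
    moreover have "T (S x) = norm S *\<^sub>R T ((1 / norm S) *\<^sub>R S x)"
      using False by (simp add: blinfun.scaleR_right)
    ultimately show ?thesis by blast
  qed
  ultimately show "\<exists>K. compact K \<and> (T o\<^sub>L S) ` cball 0 1 \<subseteq> K"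
    by (intro exI conjI) (auto simp: mem_cball_0)
qed

lemma compact_op_zero: "compact_op 0"
  by (auto simp: compact_op_iff intro!: exI[of _ "{0}"])

lemma compact_op_scaleC: "compact_op (c *\<^sub>C T)"
  if "compact_op T" for T :: "'a::real_normed_vector \<Rightarrow>\<^sub>L 'b::complex_normed_vector"
proof -
  have "c *\<^sub>C T = (c *\<^sub>C id_blinfun) o\<^sub>L T"
    by (rule blinfun_eqI) (simp add: scaleC_blinfun.rep_eq)
  then show ?thesis using compact_op_compose_left[OF that] by simp
qed

lemma compact_op_scaleR: "compact_op T \<Longrightarrow> compact_op (r *\<^sub>R T)"
proof -
  assume "compact_op T"
  then have "compact_op ((r *\<^sub>R id_blinfun) o\<^sub>L T)" by (rule compact_op_compose_left)
  moreover have "(r *\<^sub>R id_blinfun) o\<^sub>L T = r *\<^sub>R T"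
    by (rule blinfun_eqI) (simp add: blinfun.scaleR_left)
  ultimately show "compact_op (r *\<^sub>R T)" by simp
qed

lemma compact_op_uminus: "compact_op T \<Longrightarrow> compact_op (- T)"
  using compact_op_scaleR[of T "-1"] by simp

lemma compact_op_minus: "compact_op S \<Longrightarrow> compact_op T \<Longrightarrow> compact_op (S - T)"
  using compact_op_plus[OF _ compact_op_uminus, of S T] by simp

text \<open>Compact complex-linear operators, with the operator norm.\<close>

typedef (overloaded) 'a cpt =
  "{T :: 'a::complex_normed_vector \<Rightarrow>\<^sub>L 'a. clinear (blinfun_apply T) \<and> compact_op T}"
  by (rule exI[of _ 0]) (simp add: clinear_blinfun_zero compact_op_zero)

setup_lifting type_definition_cpt

instantiation cpt :: (complex_normed_vector) complex_normed_vector
begin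
lift_definition zero_cpt :: "'a cpt" is 0 by (simp add: clinear_blinfun_zero compact_op_zero)
lift_definition plus_cpt :: "'a cpt \<Rightarrow> 'a cpt \<Rightarrow> 'a cpt" is "(+)"
  by (simp add: clinear_blinfun_plus compact_op_plus)
lift_definition scaleC_cpt :: "complex \<Rightarrow> 'a cpt \<Rightarrow> 'a cpt" is scaleC
  by (simp add: clinear_blinfun_scaleC compact_op_scaleC)
lift_definition scaleR_cpt :: "real \<Rightarrow> 'a cpt \<Rightarrow> 'a cpt" is scaleR
  by (simp add: clinear_blinfun_scaleR compact_op_scaleR)
lift_definition uminus_cpt :: "'a cpt \<Rightarrow> 'a cpt" is uminus
  by (simp add: clinear_blinfun_uminus compact_op_uminus)
lift_definition minus_cpt :: "'a cpt \<Rightarrow> 'a cpt \<Rightarrow> 'a cpt" is "(-)"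
  by (simp add: clinear_blinfun_minus compact_op_minus)
lift_definition norm_cpt :: "'a cpt \<Rightarrow> real" is norm .
definition dist_cpt :: "'a cpt \<Rightarrow> 'a cpt \<Rightarrow> real" where "dist_cpt f g = norm (f - g)"
definition sgn_cpt :: "'a cpt \<Rightarrow> 'a cpt" where "sgn_cpt f = scaleR (inverse (norm f)) f"
definition uniformity_cpt :: "('a cpt \<times> 'a cpt) filter"
  where "uniformity_cpt = (INF e\<in>{0 <..}. principal {(x, y). dist x y < e})"
definition open_cpt :: "'a cpt set \<Rightarrow> bool"
  where "open_cpt S = (\<forall>x\<in>S. \<forall>\<^sub>F (x', y) in uniformity. x' = x \<longrightarrow> y \<in> S)"
instance
proof
  fix f g h :: "'a cpt" and c d :: complex and r s :: real
  show "f + g + h = f + (g + h)" by transfer (rule add.assoc)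
  show "f + g = g + f" by transfer (rule add.commute)
  show "0 + f = f" by transfer simp
  show "- f + f = 0" by transfer simp
  show "f - g = f + - g" by transfer simp
  show "r *\<^sub>R (f + g) = r *\<^sub>R f + r *\<^sub>R g" by transfer (rule scaleR_add_right)
  show "(r + s) *\<^sub>R f = r *\<^sub>R f + s *\<^sub>R f" by transfer (rule scaleR_add_left)
  show "r *\<^sub>R s *\<^sub>R f = (r * s) *\<^sub>R f" by transfer (rule scaleR_scaleR)
  show "1 *\<^sub>R f = f" by transfer simp
  show "dist f g = norm (f - g)" by (rule dist_cpt_def)
  show "sgn f = scaleR (inverse (norm f)) f" by (rule sgn_cpt_def)
  show "uniformity = (INF e\<in>{0 <..}. principal {(x, y::'a cpt). dist x y < e})"
    by (rule uniformity_cpt_def)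
  show "open U = (\<forall>x\<in>U. \<forall>\<^sub>F (x', y) in uniformity. x' = x \<longrightarrow> y \<in> U)" for U :: "'a cpt set"
    by (rule open_cpt_def)
  show "(norm f = 0) = (f = 0)" by transfer simp
  show "norm (f + g) \<le> norm f + norm g" by transfer (rule norm_triangle_ineq)
  show "norm (r *\<^sub>R f) = \<bar>r\<bar> * norm f" by transfer simp
  show "c *\<^sub>C (f + g) = c *\<^sub>C f + c *\<^sub>C g" by transfer (rule scaleC_add_right)
  show "(c + d) *\<^sub>C f = c *\<^sub>C f + d *\<^sub>C f" by transfer (rule scaleC_add_left)
  show "c *\<^sub>C d *\<^sub>C f = (c * d) *\<^sub>C f" by transfer (rule scaleC_scaleC)
  show "complex_of_real r *\<^sub>C f = r *\<^sub>R f" by transfer (rule scaleC_of_real)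
  show "norm (c *\<^sub>C f) = cmod c * norm f" by transfer (rule norm_scaleC)
qed
end

lift_definition flat :: "'a::complex_inner \<Rightarrow> 'a cdual" is "\<lambda>v. Blinfun (cinner v)"
proof -
  fix v :: 'a
  have "bounded_linear (cinner v)"
  proof (rule bounded_linear_intro)
    show "cinner v (x + y) = cinner v x + cinner v y" for x y by (rule cinner_add_right)
    show "cinner v (r *\<^sub>R x) = r *\<^sub>R cinner v x" for r x
      by (simp add: cinner_scaleC_right scaleR_conv_of_real flip: scaleC_of_real)
    show "norm (cinner v x) \<le> norm x * norm v" for x
      using cinner_Cauchy_Schwarz[of v x] by (simp add: mult.commute)
  qed
  then have "blinfun_apply (Blinfun (cinner v)) = cinner v" by (rule bounded_linear_Blinfun_apply)
  then show "clinear (blinfun_apply (Blinfun (cinner v)))"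
    by (simp add: clinear_def cinner_add_right cinner_scaleC_right scaleC_complex_def)
qed

lift_definition ev :: "'a::complex_normed_vector cdual \<Rightarrow> 'a \<Rightarrow> complex" is blinfun_apply .

lemma ev_flat: "ev (flat v) w = cinner v w"
proof -
  have "bounded_linear (cinner v)"
  proof (rule bounded_linear_intro)
    show "cinner v (x + y) = cinner v x + cinner v y" for x y by (rule cinner_add_right)
    show "cinner v (r *\<^sub>R x) = r *\<^sub>R cinner v x" for r x
      by (simp add: cinner_scaleC_right scaleR_conv_of_real flip: scaleC_of_real)
    show "norm (cinner v x) \<le> norm x * norm v" for x
      using cinner_Cauchy_Schwarz[of v x] by (simp add: mult.commute)
  qed
  then show ?thesis by (simp add: ev.rep_eq flat.rep_eq bounded_linear_Blinfun_apply)
qed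

definition sharp :: "'a::complex_inner cdual \<Rightarrow> 'a"
  where "sharp f = (THE u. \<forall>v. ev f v = cinner u v)"

lemma sharp_flat: "sharp (flat v) = v"
  unfolding sharp_def
proof (rule the_equality)
  show "\<forall>w. ev (flat v) w = cinner v w" by (simp add: ev_flat)
next
  fix u assume "\<forall>w. ev (flat v) w = cinner u w"
  then have "cinner v w = cinner u w" for w by (simp add: ev_flat)
  then have "v \<bullet> w = u \<bullet> w" for w by (metis Re_cinner)
  then show "u = v" by (metis vector_eq_rdot)
qed

definition dual_inner :: "'a::complex_inner cdual \<Rightarrow> 'a cdual \<Rightarrow> complex"
  where "dual_inner f g = cinner (sharp g) (sharp f)"

lift_definition cpt_apply :: "'a::complex_normed_vector cpt \<Rightarrow> 'a \<Rightarrow> 'a" is blinfun_apply .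

lift_definition cpt_compose :: "'a::complex_normed_vector cpt \<Rightarrow> 'a cpt \<Rightarrow> 'a cpt"
  is "(o\<^sub>L)"
  by (simp add: clinear_blinfun_compose compact_op_compose_left)

lift_definition dual_compose :: "'a::complex_normed_vector cdual \<Rightarrow> 'a cpt \<Rightarrow> 'a cdual"
  is "(o\<^sub>L)"
  by (simp add: clinear_blinfun_compose)

lemma bounded_linear_scaleC_left: "bounded_linear (\<lambda>c. c *\<^sub>C (u::'a::complex_normed_vector))"
proof (rule bounded_linear_intro)
  show "(c + d) *\<^sub>C u = c *\<^sub>C u + d *\<^sub>C u" for c d by (rule scaleC_add_left)
  show "(r *\<^sub>R c) *\<^sub>C u = r *\<^sub>R c *\<^sub>C u" for r c
    by (simp add: scaleR_conv_of_real scaleC_scaleC flip: scaleC_of_real)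
  show "norm (c *\<^sub>C u) \<le> norm c * norm u" for c by (simp add: norm_scaleC)
qed

lift_definition rank_one :: "'a::complex_normed_vector \<Rightarrow> 'a cdual \<Rightarrow> 'a cpt"
  is "\<lambda>u f. Blinfun (\<lambda>c. c *\<^sub>C u) o\<^sub>L f"
proof (intro conjI)
  fix u :: 'a and f :: "'a \<Rightarrow>\<^sub>L complex"
  assume f: "clinear (blinfun_apply f)"
  have u: "blinfun_apply (Blinfun (\<lambda>c. c *\<^sub>C u)) = (\<lambda>c. c *\<^sub>C u)"
    by (rule bounded_linear_Blinfun_apply[OF bounded_linear_scaleC_left])
  show "clinear (blinfun_apply (Blinfun (\<lambda>c. c *\<^sub>C u) o\<^sub>L f))"
    using f by (simp add: clinear_def u scaleC_add_left scaleC_scaleC scaleC_complex_def)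
  have "compact_op f" unfolding compact_op_iff
  proof (intro exI conjI)
    show "compact (cball (0::complex) (norm f))" by (rule compact_cball)
    show "f ` cball 0 1 \<subseteq> cball 0 (norm f)"
    proof (rule image_subsetI)
      fix x :: 'a assume "x \<in> cball 0 1"
      then have "norm f * norm x \<le> norm f * 1"
        by (intro mult_left_mono) (simp_all add: mem_cball_0)
      with norm_blinfun[of f x] show "f x \<in> cball 0 (norm f)" by (simp add: mem_cball_0)
    qed
  qed
  then show "compact_op (Blinfun (\<lambda>c. c *\<^sub>C u) o\<^sub>L f)" by (rule compact_op_compose_left)
qed

lemma cpt_apply_rank_one: "cpt_apply (rank_one u f) w = ev f w *\<^sub>C u"
  by (simp add: cpt_apply.rep_eq rank_one.rep_eq ev.rep_eq
    bounded_linear_Blinfun_apply[OF bounded_linear_scaleC_left])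

definition cpt_adjoint :: "'a::complex_inner cpt \<Rightarrow> 'a cpt"
  where "cpt_adjoint a = (THE b. \<forall>x y. cinner (cpt_apply b x) y = cinner x (cpt_apply a y))"

definition multilinear :: "('v::real_vector list \<Rightarrow> 'h::real_vector) \<Rightarrow> bool"
  where "multilinear F \<longleftrightarrow>
    (\<forall>us u v vs. F (us @ (u + v) # vs) = F (us @ u # vs) + F (us @ v # vs)) \<and>
    (\<forall>us r u vs. F (us @ (r *\<^sub>R u) # vs) = r *\<^sub>R F (us @ u # vs))"

definition alternating :: "('v list \<Rightarrow> 'h::zero) \<Rightarrow> bool"
  where "alternating F \<longleftrightarrow> (\<forall>us u vs ws. F (us @ u # vs @ u # ws) = 0)"

lemma multilinear_plus: "multilinear F \<Longrightarrow> multilinear G \<Longrightarrow> multilinear (\<lambda>vs. F vs + G vs)"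
  by (simp add: multilinear_def scaleR_add_right)

lemma multilinear_linear: "linear T \<Longrightarrow> multilinear F \<Longrightarrow> multilinear (\<lambda>vs. T (F vs))"
  by (simp add: multilinear_def linear_add linear_scale)

lemma alternating_linear: "linear T \<Longrightarrow> alternating F \<Longrightarrow> alternating (\<lambda>vs. T (F vs))"
  by (simp add: alternating_def linear_0)

lemma multilinear_map: "linear A \<Longrightarrow> multilinear F \<Longrightarrow> multilinear (\<lambda>vs. F (map A vs))"
  by (simp add: multilinear_def linear_add linear_scale)

lemma alternating_map: "alternating F \<Longrightarrow> alternating (\<lambda>vs. F (map A vs))"
  by (simp add: alternating_def)

text \<open>\<open>('v, 'h) form\<close> is $\bigoplus_k \bigwedge^k V^* \otimes_{\mathbb R} H$: since $V$ is finite dimensional,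
  $\bigwedge^k V^* \otimes H$ is the space of alternating $k$-linear maps $V^k \to H$. A form is given as
  one function on lists of vectors whose restriction to lists of length $k$ is the component of
  degree $k$; \<open>form_tensor \<alpha> u\<close> is $\alpha \otimes u$. On lists longer than the dimension it is
  necessarily zero. The exterior algebra factor being finite dimensional, all reasonable norms are
  equivalent; the one below uses the values on the standard basis.\<close>

typedef (overloaded) ('v, 'h) form =
  "{F :: 'v::euclidean_space list \<Rightarrow> 'h::real_normed_vector. multilinear F \<and> alternating F}"
  morphisms form_apply Abs_form
  by (rule exI[of _ "\<lambda>_. 0"]) (simp add: multilinear_def alternating_def)

setup_lifting type_definition_form

definition basis_lists :: "'v::euclidean_space list set"
  where "basis_lists = {bs. set bs \<subseteq> Basis \<and> length bs \<le> DIM('v)}"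

lemma finite_basis_lists [simp]: "finite basis_lists"
  unfolding basis_lists_def by (rule finite_lists_length_le) simp

lemma multilinear_sum:
  assumes F: "multilinear F" and "finite I"
  shows "F (us @ (\<Sum>i\<in>I. c i *\<^sub>R b i) # vs) = (\<Sum>i\<in>I. c i *\<^sub>R F (us @ b i # vs))"
  using \<open>finite I\<close>
proof induction
  case empty
  have "F (us @ (0 *\<^sub>R 0) # vs) = 0 *\<^sub>R F (us @ 0 # vs)"
    using F unfolding multilinear_def by blast
  then show ?case by simp
next
  case (insert i I)
  then show ?case using F by (simp add: multilinear_def)
qed

lemma form_eq_0:
  fixes F :: "'v::euclidean_space list \<Rightarrow> 'h::real_vector"
  assumes F: "multilinear F" "alternating F" and 0: "\<And>bs. bs \<in> basis_lists \<Longrightarrow> F bs = 0"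
  shows "F vs = 0"
proof -
  have *: "F bs = 0" if "set bs \<subseteq> Basis" for bs
  proof (cases "length bs \<le> DIM('v)")
    case True
    with that show ?thesis by (intro 0) (simp add: basis_lists_def)
  next
    case False
    have "\<not> distinct bs"
    proof
      assume "distinct bs"
      then have "length bs = card (set bs)" by (simp add: distinct_card)
      also have "\<dots> \<le> DIM('v)" by (rule card_mono[OF finite_Basis that])
      finally show False using False by simp
    qed
    then obtain us u xs ys where "bs = us @ [u] @ xs @ [u] @ ys"
      using not_distinct_decomp by blast
    then show ?thesis using F(2) by (simp add: alternating_def)
  qed
  have "F (bs @ vs) = 0" if "set bs \<subseteq> Basis" for bs
    using that
  proof (induction vs arbitrary: bs)
    case Nil
    then show ?case by (simp add: *)
  next
    case (Cons v vs)
    have "F (bs @ b # vs) = 0" if "b \<in> Basis" for b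
      using Cons.IH[of "bs @ [b]"] Cons.prems that by simp
    then have "F (bs @ (\<Sum>b\<in>Basis. (v \<bullet> b) *\<^sub>R b) # vs) = 0"
      by (simp add: multilinear_sum[OF F(1) finite_Basis])
    then show ?case by (simp add: euclidean_representation)
  qed
  from this[of "[]"] show ?thesis by simp
qed

instantiation form :: (euclidean_space, real_normed_vector) real_normed_vector
begin
lift_definition zero_form :: "('a, 'b) form" is "\<lambda>_. 0"
  by (simp add: multilinear_def alternating_def)
lift_definition plus_form :: "('a, 'b) form \<Rightarrow> ('a, 'b) form \<Rightarrow> ('a, 'b) form"
  is "\<lambda>F G vs. F vs + G vs"
  by (simp add: multilinear_def alternating_def scaleR_add_right)
lift_definition uminus_form :: "('a, 'b) form \<Rightarrow> ('a, 'b) form" is "\<lambda>F vs. - F vs"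
  by (simp add: multilinear_def alternating_def)
lift_definition minus_form :: "('a, 'b) form \<Rightarrow> ('a, 'b) form \<Rightarrow> ('a, 'b) form"
  is "\<lambda>F G vs. F vs - G vs"
  by (simp add: multilinear_def alternating_def scaleR_diff_right)
lift_definition scaleR_form :: "real \<Rightarrow> ('a, 'b) form \<Rightarrow> ('a, 'b) form" is "\<lambda>r F vs. r *\<^sub>R F vs"
  by (simp add: multilinear_def alternating_def scaleR_add_right scaleR_left_commute)
definition norm_form :: "('a, 'b) form \<Rightarrow> real"
  where "norm_form F = (\<Sum>bs\<in>basis_lists. norm (form_apply F bs))"
definition dist_form :: "('a, 'b) form \<Rightarrow> ('a, 'b) form \<Rightarrow> real"
  where "dist_form f g = norm (f - g)"
definition sgn_form :: "('a, 'b) form \<Rightarrow> ('a, 'b) form"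
  where "sgn_form f = scaleR (inverse (norm f)) f"
definition uniformity_form :: "(('a, 'b) form \<times> ('a, 'b) form) filter"
  where "uniformity_form = (INF e\<in>{0 <..}. principal {(x, y). dist x y < e})"
definition open_form :: "('a, 'b) form set \<Rightarrow> bool"
  where "open_form S = (\<forall>x\<in>S. \<forall>\<^sub>F (x', y) in uniformity. x' = x \<longrightarrow> y \<in> S)"
instance
proof
  fix f g h :: "('a, 'b) form" and r s :: real
  show "f + g + h = f + (g + h)" by transfer (simp add: add.assoc)
  show "f + g = g + f" by transfer (simp add: add.commute)
  show "0 + f = f" by transfer simp
  show "- f + f = 0" by transfer simp
  show "f - g = f + - g" by transfer simp
  show "r *\<^sub>R (f + g) = r *\<^sub>R f + r *\<^sub>R g" by transfer (simp add: scaleR_add_right)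
  show "(r + s) *\<^sub>R f = r *\<^sub>R f + s *\<^sub>R f" by transfer (simp add: scaleR_add_left)
  show "r *\<^sub>R s *\<^sub>R f = (r * s) *\<^sub>R f" by transfer simp
  show "1 *\<^sub>R f = f" by transfer simp
  show "dist f g = norm (f - g)" by (rule dist_form_def)
  show "sgn f = scaleR (inverse (norm f)) f" by (rule sgn_form_def)
  show "uniformity = (INF e\<in>{0 <..}. principal {(x, y::('a, 'b) form). dist x y < e})"
    by (rule uniformity_form_def)
  show "open U = (\<forall>x\<in>U. \<forall>\<^sub>F (x', y) in uniformity. x' = x \<longrightarrow> y \<in> U)" for U :: "('a, 'b) form set"
    by (rule open_form_def)
  show "(norm f = 0) = (f = 0)"
  proof
    assume "norm f = 0"
    then have "form_apply f bs = 0" if "bs \<in> basis_lists" for bs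
      using that by (simp add: norm_form_def sum_nonneg_eq_0_iff)
    moreover have "multilinear (form_apply f)" "alternating (form_apply f)"
      using form_apply[of f] by simp_all
    ultimately have "form_apply f vs = 0" for vs
      using form_eq_0[of "form_apply f"] by blast
    then have "form_apply f = form_apply 0" by (simp add: fun_eq_iff zero_form.rep_eq)
    then show "f = 0" by (simp only: form_apply_inject)
  qed (simp add: norm_form_def zero_form.rep_eq)
  show "norm (f + g) \<le> norm f + norm g"
    unfolding norm_form_def sum.distrib[symmetric] plus_form.rep_eq
    by (intro sum_mono norm_triangle_ineq)
  show "norm (r *\<^sub>R f) = \<bar>r\<bar> * norm f"
    by (simp add: norm_form_def scaleR_form.rep_eq sum_distrib_left)
qed
end

instantiation form :: (euclidean_space, complex_normed_vector) complex_normed_vector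
begin
lift_definition scaleC_form :: "complex \<Rightarrow> ('a, 'b) form \<Rightarrow> ('a, 'b) form" is "\<lambda>c F vs. c *\<^sub>C F vs"
  by (simp add: multilinear_def alternating_def scaleC_add_right scaleC_scaleR)
instance
proof
  fix f g :: "('a, 'b) form" and c d :: complex and r :: real
  show "c *\<^sub>C (f + g) = c *\<^sub>C f + c *\<^sub>C g" by transfer (simp add: scaleC_add_right)
  show "(c + d) *\<^sub>C f = c *\<^sub>C f + d *\<^sub>C f" by transfer (simp add: scaleC_add_left)
  show "c *\<^sub>C d *\<^sub>C f = (c * d) *\<^sub>C f" by transfer (simp add: scaleC_scaleC)
  show "complex_of_real r *\<^sub>C f = r *\<^sub>R f" by transfer (simp add: scaleC_of_real)
  show "norm (c *\<^sub>C f) = cmod c * norm f"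
    by (simp add: norm_form_def scaleC_form.rep_eq sum_distrib_left norm_scaleC)
qed
end

lift_definition form_tensor ::
  "('v::euclidean_space, real) form \<Rightarrow> 'h::real_normed_vector \<Rightarrow> ('v, 'h) form"
  is "\<lambda>\<alpha> u vs. \<alpha> vs *\<^sub>R u"
  by (simp add: multilinear_def alternating_def scaleR_add_left)

text \<open>\<open>form_map A T\<close> is pullback along \<open>A\<close> tensor \<open>T\<close>; \<open>Abs_form\<close> is harmless for linear \<open>A\<close>, \<open>T\<close>, see
  \<open>form_apply_form_map\<close>.\<close>

definition form_map ::
  "('v::euclidean_space \<Rightarrow> 'v) \<Rightarrow> ('h::real_normed_vector \<Rightarrow> 'h) \<Rightarrow> ('v, 'h) form \<Rightarrow> ('v, 'h) form"
  where "form_map A T F = Abs_form (\<lambda>vs. T (form_apply F (map A vs)))"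

lemma form_apply_form_map:
  assumes "linear A" "linear T"
  shows "form_apply (form_map A T F) vs = T (form_apply F (map A vs))"
proof -
  have "multilinear (\<lambda>vs. T (form_apply F (map A vs)))"
    "alternating (\<lambda>vs. T (form_apply F (map A vs)))"
    using form_apply[of F] assms
    by (auto intro: multilinear_linear multilinear_map alternating_linear alternating_map)
  then show ?thesis by (simp add: form_map_def Abs_form_inverse)
qed

definition orthonormal_basis :: "('v::euclidean_space \<Rightarrow> 'v \<Rightarrow> real) \<Rightarrow> 'v set \<Rightarrow> bool"
  where "orthonormal_basis g B \<longleftrightarrow>
    finite B \<and> card B = DIM('v) \<and> (\<forall>e\<in>B. \<forall>f\<in>B. g e f = (if e = f then 1 else 0))"

text \<open>Inner product on $\bigwedge^\bullet V^*$ induced by an inner product \<open>g\<close> on $V$: the degrees are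
  orthogonal, and in degree $k$ it is the sum of $\alpha(e_I)\beta(e_I)$ over increasing multi-indices $I$
  of a \<open>g\<close>-orthonormal basis. Summing over all lists of length $k$ instead counts every increasing
  $I$ exactly $k!$ times. The value does not depend on the chosen basis. \<open>form_prod\<close> is the additive
  extension of $(\alpha\otimes u, \beta\otimes v) \mapsto g(\alpha,\beta)\, u^\sharp\otimes v$, see
  \<open>form_prod_tensor\<close>.\<close>

definition frame_lists :: "('v::euclidean_space \<Rightarrow> 'v \<Rightarrow> real) \<Rightarrow> 'v list set"
  where "frame_lists g =
    {es. set es \<subseteq> (SOME B. orthonormal_basis g B) \<and> length es \<le> DIM('v)}"

definition form_inner ::
  "('v::euclidean_space \<Rightarrow> 'v \<Rightarrow> real) \<Rightarrow> ('v, real) form \<Rightarrow> ('v, real) form \<Rightarrow> real"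
  where "form_inner g \<alpha> \<beta> =
    (\<Sum>es\<in>frame_lists g. (1 / fact (length es)) * (form_apply \<alpha> es * form_apply \<beta> es))"

definition form_prod :: "('v::euclidean_space \<Rightarrow> 'v \<Rightarrow> real) \<Rightarrow>
    ('v, 'x::complex_inner cdual) form \<Rightarrow> ('v, 'x cdual) form \<Rightarrow> 'x cpt"
  where "form_prod g F G =
    (\<Sum>es\<in>frame_lists g. (1 / fact (length es)) *\<^sub>R
      rank_one (sharp (form_apply F es)) (form_apply G es))"

lemma form_prod_tensor:
  fixes u :: "'x::complex_inner"
  shows "form_prod g (form_tensor \<alpha> (flat u)) (form_tensor \<beta> v) = form_inner g \<alpha> \<beta> *\<^sub>R rank_one u v"
proof -
  have flat: "r *\<^sub>R flat u = flat (r *\<^sub>R u)" for r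
  proof -
    have "ev (r *\<^sub>R flat u) w = ev (flat (r *\<^sub>R u)) w" for w
    proof -
      have "ev (r *\<^sub>R flat u) w = r *\<^sub>R ev (flat u) w"
        by (simp add: ev.rep_eq scaleR_cdual.rep_eq blinfun.scaleR_left)
      also have "\<dots> = cinner (complex_of_real r *\<^sub>C u) w"
        by (simp add: ev_flat cinner_scaleC_left scaleR_conv_of_real)
      finally show ?thesis by (simp add: ev_flat scaleC_of_real)
    qed
    then show ?thesis by (simp add: ev.rep_eq Rep_cdual_inject[symmetric] blinfun_eqI)
  qed
  have rank: "rank_one (r *\<^sub>R u) (s *\<^sub>R v) = (r * s) *\<^sub>R rank_one u v" for r s
  proof -
    have ev: "ev (s *\<^sub>R v) w = complex_of_real s * ev v w" for w
      by (simp add: ev.rep_eq scaleR_cdual.rep_eq blinfun.scaleR_left scaleR_conv_of_real)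
    have cpt: "cpt_apply (t *\<^sub>R a) w = complex_of_real t *\<^sub>C cpt_apply a w" for t w and a :: "'x cpt"
      by (simp add: cpt_apply.rep_eq scaleR_cpt.rep_eq blinfun.scaleR_left scaleC_of_real)
    have "cpt_apply (rank_one (r *\<^sub>R u) (s *\<^sub>R v)) w
        = cpt_apply ((r * s) *\<^sub>R rank_one u v) w" for w
      by (simp only: cpt cpt_apply_rank_one ev)
        (simp add: scaleC_scaleC mult_ac flip: scaleC_of_real)
    then show ?thesis by (simp add: cpt_apply.rep_eq Rep_cpt_inject[symmetric] blinfun_eqI)
  qed
  show ?thesis
    by (simp add: form_prod_def form_inner_def form_tensor.rep_eq flat sharp_flat rank
      scaleR_sum_left)
qed

definition form_act :: "('v::euclidean_space, 'x::complex_normed_vector cdual) form \<Rightarrow> 'x cpt \<Rightarrow>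
    ('v, 'x cdual) form"
  where "form_act F a = form_map id (\<lambda>f. dual_compose f a) F"

definition inner_product :: "('v::real_vector \<Rightarrow> 'v \<Rightarrow> real) \<Rightarrow> bool"
  where "inner_product g \<longleftrightarrow>
    bilinear g \<and> (\<forall>u v. g u v = g v u) \<and> (\<forall>v. v \<noteq> 0 \<longrightarrow> g v v > 0)"

definition linear_symplectic :: "('v::euclidean_space \<Rightarrow> 'v \<Rightarrow> real) \<Rightarrow> bool"
  where "linear_symplectic \<omega>\<^sub>0 \<longleftrightarrow>
    bilinear \<omega>\<^sub>0 \<and> (\<forall>v. \<omega>\<^sub>0 v v = 0) \<and> (\<forall>u. (\<forall>v. \<omega>\<^sub>0 u v = 0) \<longrightarrow> u = 0)"

definition metric_of :: "('v \<Rightarrow> 'v \<Rightarrow> real) \<Rightarrow> ('v \<Rightarrow> 'v) \<Rightarrow> 'v \<Rightarrow> 'v \<Rightarrow> real"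
  where "metric_of \<omega>\<^sub>0 J\<^sub>0 u v = \<omega>\<^sub>0 (J\<^sub>0 u) v"

definition linear_complex_structure :: "('v::euclidean_space \<Rightarrow> 'v \<Rightarrow> real) \<Rightarrow> ('v \<Rightarrow> 'v) \<Rightarrow> bool"
  where "linear_complex_structure \<omega>\<^sub>0 J\<^sub>0 \<longleftrightarrow>
    linear J\<^sub>0 \<and> (\<forall>v. J\<^sub>0 (J\<^sub>0 v) = - v) \<and> inner_product (metric_of \<omega>\<^sub>0 J\<^sub>0)"

definition lagrangian :: "('v::euclidean_space \<Rightarrow> 'v \<Rightarrow> real) \<Rightarrow> 'v set \<Rightarrow> bool"
  where "lagrangian \<omega>\<^sub>0 L \<longleftrightarrow> subspace L \<and> L = {v. \<forall>u\<in>L. \<omega>\<^sub>0 u v = 0}"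

text \<open>The Lagrangian subspace is $L = $ \<open>range \<iota>\<close>. The isometry \<open>\<iota>\<close> transports Lebesgue measure to the
  one $L$ carries as a Euclidean subspace of $(V, g_0)$, so that $L^2(L)$ is \<open>'l l2\<close>.\<close>

definition lagrangian_parametrization ::
  "('v::euclidean_space \<Rightarrow> 'v \<Rightarrow> real) \<Rightarrow> ('v \<Rightarrow> 'v) \<Rightarrow> ('l::euclidean_space \<Rightarrow> 'v) \<Rightarrow> bool"
  where "lagrangian_parametrization \<omega>\<^sub>0 J\<^sub>0 \<iota> \<longleftrightarrow>
    linear \<iota> \<and> (\<forall>x y. metric_of \<omega>\<^sub>0 J\<^sub>0 (\<iota> x) (\<iota> y) = x \<bullet> y) \<and> lagrangian \<omega>\<^sub>0 (range \<iota>)"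

definition Sp :: "('v::euclidean_space \<Rightarrow> 'v \<Rightarrow> real) \<Rightarrow> ('v \<Rightarrow>\<^sub>L 'v) set"
  where "Sp \<omega>\<^sub>0 = {A :: 'v \<Rightarrow>\<^sub>L 'v. \<forall>u v. \<omega>\<^sub>0 (A u) (A v) = \<omega>\<^sub>0 u v}"

text \<open>The covering group is written additively, because \<open>topological_group_add\<close> is the library's class
  of (not necessarily commutative) topological groups. Its Lie group structure is the one making
  \<open>lam\<close> a local diffeomorphism.\<close>

definition connected_double_cover :: "('v::euclidean_space \<Rightarrow> 'v \<Rightarrow> real) \<Rightarrow>
    ('g::topological_group_add \<Rightarrow> 'v \<Rightarrow>\<^sub>L 'v) \<Rightarrow> bool"
  where "connected_double_cover \<omega>\<^sub>0 lam \<longleftrightarrow>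
    connected (UNIV :: 'g set) \<and> covering_space UNIV lam (Sp \<omega>\<^sub>0) \<and>
    (\<forall>A\<in>Sp \<omega>\<^sub>0. card {g. lam g = A} = 2) \<and> (\<forall>g h. lam (g + h) = lam g o\<^sub>L lam h)"

text \<open>Heisenberg group law $(u,s)(v,t) = (u+v,\, s+t+\frac12\omega_0(u,v))$, polarization
  $V = L \oplus J_0 L$; for $v = q + w$ with $q\in L$, $w\in J_0L$:
  $(r(v,t)f)(x) = e^{i(t + \omega_0(w,\, x - q/2))} f(x-q)$.\<close>

definition schroedinger :: "('v::euclidean_space \<Rightarrow> 'v \<Rightarrow> real) \<Rightarrow> ('v \<Rightarrow> 'v) \<Rightarrow>
    ('l::euclidean_space \<Rightarrow> 'v) \<Rightarrow> 'v \<Rightarrow> real \<Rightarrow> 'l l2 \<Rightarrow> 'l l2"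
  where "schroedinger \<omega>\<^sub>0 J\<^sub>0 \<iota> v t f =
    (let q = (THE q. v - \<iota> q \<in> J\<^sub>0 ` range \<iota>)
     in abs_l2 (\<lambda>x. cis (t + \<omega>\<^sub>0 (v - \<iota> q) (\<iota> (x - q /\<^sub>R 2))) * rep_l2 f (x - q)))"

definition unitary_op :: "('x::complex_inner \<Rightarrow> 'x) \<Rightarrow> bool"
  where "unitary_op T \<longleftrightarrow> clinear T \<and> surj T \<and> (\<forall>x y. cinner (T x) (T y) = cinner x y)"

definition segal_shale_weil :: "('v::euclidean_space \<Rightarrow> 'v \<Rightarrow> real) \<Rightarrow> ('v \<Rightarrow> 'v) \<Rightarrow>
    ('l::euclidean_space \<Rightarrow> 'v) \<Rightarrow> ('g::topological_group_add \<Rightarrow> 'v \<Rightarrow>\<^sub>L 'v) \<Rightarrow>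
    ('g \<Rightarrow> 'l l2 \<Rightarrow>\<^sub>L 'l l2) \<Rightarrow> bool"
  where "segal_shale_weil \<omega>\<^sub>0 J\<^sub>0 \<iota> lam sw \<longleftrightarrow>
    (\<forall>g. unitary_op (sw g)) \<and> (\<forall>g h. sw (g + h) = sw g o\<^sub>L sw h) \<and>
    (\<forall>f. continuous_on UNIV (\<lambda>g. sw g f)) \<and>
    (\<forall>g v t f. sw g (schroedinger \<omega>\<^sub>0 J\<^sub>0 \<iota> v t (sw (- g) f)) = schroedinger \<omega>\<^sub>0 J\<^sub>0 \<iota> (lam g v) t f)"

text \<open>The representing maps below are inverse to \<open>Rep_cdual\<close>, \<open>Rep_cpt\<close> whenever the operators \<open>sw g\<close>
  are complex linear, and \<open>sw (- g)\<close> is the inverse of \<open>sw g\<close>.\<close>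

definition dual_rep :: "('g::group_add \<Rightarrow> 'x::complex_normed_vector \<Rightarrow>\<^sub>L 'x) \<Rightarrow> 'g \<Rightarrow> 'x cdual \<Rightarrow> 'x cdual"
  where "dual_rep sw g f = Abs_cdual (Rep_cdual f o\<^sub>L sw (- g))"

definition CH_rep :: "('g::group_add \<Rightarrow> 'x::complex_normed_vector \<Rightarrow>\<^sub>L 'x) \<Rightarrow> 'g \<Rightarrow> 'x cpt \<Rightarrow> 'x cpt"
  where "CH_rep sw g a = Abs_cpt (sw g o\<^sub>L Rep_cpt a o\<^sub>L sw (- g))"

definition form_rep :: "('g::group_add \<Rightarrow> 'v::euclidean_space \<Rightarrow>\<^sub>L 'v) \<Rightarrow>
    ('g \<Rightarrow> 'x::complex_normed_vector \<Rightarrow>\<^sub>L 'x) \<Rightarrow> 'g \<Rightarrow> ('v, 'x cdual) form \<Rightarrow> ('v, 'x cdual) form"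
  where "form_rep lam sw g F = form_map (lam (- g)) (dual_rep sw g) F"

text \<open>Infinite Frechet differentiability on an open set: \<open>D x vs\<close> is the \<open>length vs\<close>-th derivative at
  \<open>x\<close> in the directions \<open>vs\<close>. The \<open>k\<close>-th derivative is a bounded \<open>k\<close>-linear map and is Frechet
  differentiable with respect to the operator norm of \<open>k\<close>-linear maps, with derivative the
  \<open>(k+1)\<close>-st. On arbitrary subsets, such as submanifolds, a map is smooth if it locally extends to
  a smooth map.\<close>

definition smooth_on :: "'a::real_normed_vector set \<Rightarrow> ('a \<Rightarrow> 'b::real_normed_vector) \<Rightarrow> bool"
  where "smooth_on S f \<longleftrightarrow> open S \<and> (\<exists>D :: 'a \<Rightarrow> 'a list \<Rightarrow> 'b. \<forall>x\<in>S.
    D x [] = f x \<and> multilinear (D x) \<and>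
    (\<forall>k. \<exists>C. \<forall>vs. length vs = k \<longrightarrow> norm (D x vs) \<le> C * prod_list (map norm vs)) \<and>
    (\<forall>k. \<forall>e>0. \<forall>\<^sub>F y in at x. \<forall>vs. length vs = k \<longrightarrow>
      norm (D y vs - D x vs - D x ((y - x) # vs)) \<le> e * norm (y - x) * prod_list (map norm vs)))"

definition smooth_on_subset :: "'a::real_normed_vector set \<Rightarrow> ('a \<Rightarrow> 'b::real_normed_vector) \<Rightarrow> bool"
  where "smooth_on_subset S f \<longleftrightarrow>
    (\<forall>x\<in>S. \<exists>U F. x \<in> U \<and> smooth_on U F \<and> (\<forall>y\<in>S \<inter> U. F y = f y))"

type_synonym ('m, 'v) chart = "'m set \<times> ('m \<Rightarrow> 'v)"

definition chart_inv :: "('m, 'v) chart \<Rightarrow> 'v \<Rightarrow> 'm"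
  where "chart_inv c = inv_into (fst c) (snd c)"

text \<open>Charts take values in the vector space \<open>'v\<close>, which is also the symplectic vector space $V$; this
  makes the dimensions of $M$ and $V$ equal.\<close>

definition smooth_atlas :: "('m::topological_space, 'v::euclidean_space) chart set \<Rightarrow> bool"
  where "smooth_atlas MA \<longleftrightarrow>
    (\<Union>c\<in>MA. fst c) = UNIV \<and>
    (\<forall>c\<in>MA. open (fst c) \<and> open (snd c ` fst c) \<and>
      homeomorphism (fst c) (snd c ` fst c) (snd c) (chart_inv c)) \<and>
    (\<forall>c\<in>MA. \<forall>d\<in>MA. smooth_on (snd c ` (fst c \<inter> fst d)) (snd d \<circ> chart_inv c))"

type_synonym ('m, 'v) tvec = "('m, 'v) chart \<Rightarrow> 'v"

text \<open>A tangent vector at \<open>m\<close> is the family of its coordinate vectors in the charts around \<open>m\<close>, which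
  transform by the Jacobians; the family is zero at all other arguments. \<open>coord_vec MA c m u\<close> is the
  tangent vector with coordinates \<open>u\<close> in the chart \<open>c\<close>. Tangent vectors are added and scaled
  pointwise.\<close>

definition jacobian :: "('m, 'v::euclidean_space) chart \<Rightarrow> ('m, 'v) chart \<Rightarrow> 'm \<Rightarrow> 'v \<Rightarrow> 'v"
  where "jacobian c d m = frechet_derivative (snd d \<circ> chart_inv c) (at (snd c m))"

definition tangent_space ::
  "('m, 'v::euclidean_space) chart set \<Rightarrow> 'm \<Rightarrow> ('m, 'v) tvec set"
  where "tangent_space MA m = {\<tau>.
    (\<forall>c. \<not> (c \<in> MA \<and> m \<in> fst c) \<longrightarrow> \<tau> c = 0) \<and>
    (\<forall>c\<in>MA. \<forall>d\<in>MA. m \<in> fst c \<inter> fst d \<longrightarrow> \<tau> d = jacobian c d m (\<tau> c))}"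

definition coord_vec :: "('m, 'v::euclidean_space) chart set \<Rightarrow> ('m, 'v) chart \<Rightarrow> 'm \<Rightarrow> 'v \<Rightarrow> ('m, 'v) tvec"
  where "coord_vec MA c m u = (\<lambda>d. if d \<in> MA \<and> m \<in> fst d then jacobian c d m u else 0)"

definition tangent_bilinear :: "('m, 'v::euclidean_space) chart set \<Rightarrow> 'm \<Rightarrow>
    (('m, 'v) tvec \<Rightarrow> ('m, 'v) tvec \<Rightarrow> real) \<Rightarrow> bool"
  where "tangent_bilinear MA m B \<longleftrightarrow>
    (\<forall>\<rho>\<in>tangent_space MA m. \<forall>\<sigma>\<in>tangent_space MA m. \<forall>\<tau>\<in>tangent_space MA m. \<forall>r.
      B (\<lambda>c. \<rho> c + \<sigma> c) \<tau> = B \<rho> \<tau> + B \<sigma> \<tau> \<and> B (\<lambda>c. r *\<^sub>R \<rho> c) \<tau> = r * B \<rho> \<tau> \<and>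
      B \<tau> (\<lambda>c. \<rho> c + \<sigma> c) = B \<tau> \<rho> + B \<tau> \<sigma> \<and> B \<tau> (\<lambda>c. r *\<^sub>R \<rho> c) = r * B \<tau> \<rho>)"

definition coord_tensor :: "('m, 'v::euclidean_space) chart set \<Rightarrow>
    ('m \<Rightarrow> ('m, 'v) tvec \<Rightarrow> ('m, 'v) tvec \<Rightarrow> real) \<Rightarrow> ('m, 'v) chart \<Rightarrow> 'v \<Rightarrow> 'v \<Rightarrow> 'v \<Rightarrow> real"
  where "coord_tensor MA T c u v x =
    (let m = chart_inv c x in T m (coord_vec MA c m u) (coord_vec MA c m v))"

definition smooth_tensor :: "('m, 'v::euclidean_space) chart set \<Rightarrow>
    ('m \<Rightarrow> ('m, 'v) tvec \<Rightarrow> ('m, 'v) tvec \<Rightarrow> real) \<Rightarrow> bool"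
  where "smooth_tensor MA T \<longleftrightarrow>
    (\<forall>m. tangent_bilinear MA m (T m)) \<and>
    (\<forall>c\<in>MA. \<forall>u v. smooth_on (snd c ` fst c) (coord_tensor MA T c u v))"

definition closed_form :: "('m, 'v::euclidean_space) chart set \<Rightarrow>
    ('m \<Rightarrow> ('m, 'v) tvec \<Rightarrow> ('m, 'v) tvec \<Rightarrow> real) \<Rightarrow> bool"
  where "closed_form MA \<omega> \<longleftrightarrow> (\<forall>c\<in>MA. \<forall>x\<in>snd c ` fst c. \<forall>u v w.
    frechet_derivative (coord_tensor MA \<omega> c v w) (at x) u
    - frechet_derivative (coord_tensor MA \<omega> c u w) (at x) v
    + frechet_derivative (coord_tensor MA \<omega> c u v) (at x) w = 0)"

definition symplectic_manifold ::
  "('m::{t2_space, second_countable_topology}, 'v::euclidean_space) chart set \<Rightarrow>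
    ('m \<Rightarrow> ('m, 'v) tvec \<Rightarrow> ('m, 'v) tvec \<Rightarrow> real) \<Rightarrow> bool"
  where "symplectic_manifold MA \<omega> \<longleftrightarrow> smooth_atlas MA \<and> smooth_tensor MA \<omega> \<and>
    (\<forall>m. \<forall>\<sigma>\<in>tangent_space MA m. \<omega> m \<sigma> \<sigma> = 0) \<and>
    (\<forall>m. \<forall>\<sigma>\<in>tangent_space MA m. (\<forall>\<tau>\<in>tangent_space MA m. \<omega> m \<sigma> \<tau> = 0) \<longrightarrow> \<sigma> = (\<lambda>_. 0)) \<and>
    closed_form MA \<omega>"

definition riemannian_metric :: "('m, 'v::euclidean_space) chart set \<Rightarrow>
    ('m \<Rightarrow> ('m, 'v) tvec \<Rightarrow> ('m, 'v) tvec \<Rightarrow> real) \<Rightarrow> bool"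
  where "riemannian_metric MA g \<longleftrightarrow> smooth_tensor MA g \<and>
    (\<forall>m. \<forall>\<sigma>\<in>tangent_space MA m. \<forall>\<tau>\<in>tangent_space MA m. g m \<sigma> \<tau> = g m \<tau> \<sigma>) \<and>
    (\<forall>m. \<forall>\<sigma>\<in>tangent_space MA m. \<sigma> \<noteq> (\<lambda>_. 0) \<longrightarrow> g m \<sigma> \<sigma> > 0)"

definition compatible_positive_acs :: "('m, 'v::euclidean_space) chart set \<Rightarrow>
    ('m \<Rightarrow> ('m, 'v) tvec \<Rightarrow> ('m, 'v) tvec \<Rightarrow> real) \<Rightarrow> ('m \<Rightarrow> ('m, 'v) tvec \<Rightarrow> ('m, 'v) tvec) \<Rightarrow> bool"
  where "compatible_positive_acs MA \<omega> JM \<longleftrightarrow>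
    (\<forall>m. \<forall>\<sigma>\<in>tangent_space MA m. \<forall>\<tau>\<in>tangent_space MA m. \<forall>r.
      JM m \<sigma> \<in> tangent_space MA m \<and>
      JM m (\<lambda>c. \<sigma> c + \<tau> c) = (\<lambda>c. JM m \<sigma> c + JM m \<tau> c) \<and>
      JM m (\<lambda>c. r *\<^sub>R \<sigma> c) = (\<lambda>c. r *\<^sub>R JM m \<sigma> c) \<and>
      JM m (JM m \<sigma>) = (\<lambda>c. - \<sigma> c)) \<and>
    (\<forall>c\<in>MA. \<forall>u. smooth_on (snd c ` fst c)
      (\<lambda>x. JM (chart_inv c x) (coord_vec MA c (chart_inv c x) u) c)) \<and>
    riemannian_metric MA (\<lambda>m \<sigma> \<tau>. \<omega> m (JM m \<sigma>) \<tau>)"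

definition symplectic_frame :: "('v::euclidean_space \<Rightarrow> 'v \<Rightarrow> real) \<Rightarrow> ('m, 'v) chart set \<Rightarrow>
    ('m \<Rightarrow> ('m, 'v) tvec \<Rightarrow> ('m, 'v) tvec \<Rightarrow> real) \<Rightarrow> 'm \<Rightarrow> ('v \<Rightarrow> ('m, 'v) tvec) \<Rightarrow> bool"
  where "symplectic_frame \<omega>\<^sub>0 MA \<omega> m A \<longleftrightarrow>
    bij_betw A UNIV (tangent_space MA m) \<and>
    (\<forall>u v. A (u + v) = (\<lambda>c. A u c + A v c)) \<and> (\<forall>r u. A (r *\<^sub>R u) = (\<lambda>c. r *\<^sub>R A u c)) \<and>
    (\<forall>u v. \<omega> m (A u) (A v) = \<omega>\<^sub>0 u v)"

text \<open>A smooth principal bundle is given by equivariant local trivializations \<open>(U, \<Phi>)\<close>, of which only the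
  group component is recorded. The transition function between two of them is
  \<open>m \<mapsto> \<Psi> (triv_inv \<pi>P \<Phi> m 0)\<close>. It is continuous, hence smooth into the covering group iff its
  composition with \<open>lam\<close> is smooth.\<close>

definition triv_inv :: "('p \<Rightarrow> 'm) \<Rightarrow> ('p \<Rightarrow> 'b) \<Rightarrow> 'm \<Rightarrow> 'b \<Rightarrow> 'p"
  where "triv_inv \<pi> \<Phi> m b = (THE r. \<pi> r = m \<and> \<Phi> r = b)"

definition principal_bundle :: "('g::topological_group_add \<Rightarrow> 'v::euclidean_space \<Rightarrow>\<^sub>L 'v) \<Rightarrow>
    ('m::topological_space, 'v) chart set \<Rightarrow> ('p::topological_space \<Rightarrow> 'm) \<Rightarrow> ('p \<Rightarrow> 'g \<Rightarrow> 'p) \<Rightarrow>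
    ('m set \<times> ('p \<Rightarrow> 'g)) set \<Rightarrow> bool"
  where "principal_bundle lam MA \<pi>P ract PA \<longleftrightarrow>
    continuous_on UNIV \<pi>P \<and>
    (\<forall>r. ract r 0 = r) \<and> (\<forall>r g h. ract (ract r g) h = ract r (g + h)) \<and>
    (\<forall>r g. \<pi>P (ract r g) = \<pi>P r) \<and>
    (\<Union>(U, \<Phi>)\<in>PA. U) = UNIV \<and>
    (\<forall>(U, \<Phi>)\<in>PA. open U \<and>
      homeomorphic_map (top_of_set (\<pi>P -` U)) (prod_topology (top_of_set U) euclidean)
        (\<lambda>r. (\<pi>P r, \<Phi> r)) \<and>
      (\<forall>r\<in>\<pi>P -` U. \<forall>g. \<Phi> (ract r g) = \<Phi> r + g)) \<and>
    (\<forall>(U, \<Phi>)\<in>PA. \<forall>(W, \<Psi>)\<in>PA. \<forall>c\<in>MA.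
      smooth_on (snd c ` (U \<inter> W \<inter> fst c)) (\<lambda>x. lam (\<Psi> (triv_inv \<pi>P \<Phi> (chart_inv c x) 0))))"

text \<open>\<open>Lam r\<close> is a symplectic frame of the tangent space at \<open>\<pi>P r\<close>. Smoothness of \<open>Lam\<close> is expressed in
  the charts \<open>(x, A)\<close> of the total space, where \<open>x\<close> runs through a chart of the base and the
  element \<open>s A\<close> of the covering group is parametrized by \<open>A\<close> through a local section \<open>s\<close> of
  \<open>lam\<close>; in the frame bundle the coordinates are the base chart and the matrix of the frame.\<close>

definition metaplectic_structure :: "('v::euclidean_space \<Rightarrow> 'v \<Rightarrow> real) \<Rightarrow>
    ('g::topological_group_add \<Rightarrow> 'v \<Rightarrow>\<^sub>L 'v) \<Rightarrow> ('m::topological_space, 'v) chart set \<Rightarrow>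
    ('m \<Rightarrow> ('m, 'v) tvec \<Rightarrow> ('m, 'v) tvec \<Rightarrow> real) \<Rightarrow>
    ('p::topological_space \<Rightarrow> 'm) \<Rightarrow> ('p \<Rightarrow> 'g \<Rightarrow> 'p) \<Rightarrow> ('m set \<times> ('p \<Rightarrow> 'g)) set \<Rightarrow>
    ('p \<Rightarrow> 'v \<Rightarrow> ('m, 'v) tvec) \<Rightarrow> bool"
  where "metaplectic_structure \<omega>\<^sub>0 lam MA \<omega> \<pi>P ract PA Lam \<longleftrightarrow>
    principal_bundle lam MA \<pi>P ract PA \<and>
    (\<forall>r. symplectic_frame \<omega>\<^sub>0 MA \<omega> (\<pi>P r) (Lam r)) \<and>
    (\<forall>r g. Lam (ract r g) = Lam r \<circ> lam g) \<and>
    (\<forall>(U, \<Phi>)\<in>PA. \<forall>c\<in>MA. \<forall>W s.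
      openin (top_of_set (Sp \<omega>\<^sub>0)) W \<and> continuous_on W s \<and> (\<forall>A\<in>W. lam (s A) = A) \<longrightarrow>
      smooth_on_subset (snd c ` (U \<inter> fst c) \<times> W)
        (\<lambda>(x, A). Blinfun (\<lambda>v. Lam (triv_inv \<pi>P \<Phi> (chart_inv c x) (s A)) v c)))"

text \<open>The class of \<open>(r, v)\<close> in the bundle associated to a principal bundle \<open>R\<close> with group \<open>S\<close>, and the
  quotient topology on the set of these classes.\<close>

definition assoc_class ::
  "('p \<Rightarrow> 'g::group_add \<Rightarrow> 'p) \<Rightarrow> 'g set \<Rightarrow> ('g \<Rightarrow> 'f \<Rightarrow> 'f) \<Rightarrow> 'p \<times> 'f \<Rightarrow> ('p \<times> 'f) set"
  where "assoc_class ract S \<kappa> z = {(ract (fst z) (- g), \<kappa> g (snd z)) | g. g \<in> S}"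

definition assoc_topology :: "'p::topological_space set \<Rightarrow>
    ('p \<times> 'f::topological_space \<Rightarrow> ('p \<times> 'f) set) \<Rightarrow> ('p \<times> 'f) set topology"
  where "assoc_topology R cls = topology (\<lambda>W. W \<subseteq> cls ` (R \<times> UNIV) \<and>
    openin (top_of_set (R \<times> UNIV)) {z \<in> R \<times> UNIV. cls z \<in> W})"

lemma openin_assoc_topology:
  "openin (assoc_topology R cls) W \<longleftrightarrow> W \<subseteq> cls ` (R \<times> UNIV) \<and>
    openin (top_of_set (R \<times> UNIV)) {z \<in> R \<times> UNIV. cls z \<in> W}"
proof -
  have "istopology (\<lambda>W. W \<subseteq> cls ` (R \<times> UNIV) \<and>
      openin (top_of_set (R \<times> UNIV)) {z \<in> R \<times> UNIV. cls z \<in> W})"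
    unfolding istopology_def
  proof (intro conjI allI impI; (elim conjE)?)
    fix S T assume
      "openin (top_of_set (R \<times> UNIV)) {z \<in> R \<times> UNIV. cls z \<in> S}"
      "openin (top_of_set (R \<times> UNIV)) {z \<in> R \<times> UNIV. cls z \<in> T}"
    then have "openin (top_of_set (R \<times> UNIV))
        ({z \<in> R \<times> UNIV. cls z \<in> S} \<inter> {z \<in> R \<times> UNIV. cls z \<in> T})" by (rule openin_Int)
    moreover have "{z \<in> R \<times> UNIV. cls z \<in> S} \<inter> {z \<in> R \<times> UNIV. cls z \<in> T}
        = {z \<in> R \<times> UNIV. cls z \<in> S \<inter> T}" by blast
    ultimately show "openin (top_of_set (R \<times> UNIV)) {z \<in> R \<times> UNIV. cls z \<in> S \<inter> T}" by simp
  next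
    fix \<K> assume K: "\<forall>K\<in>\<K>. K \<subseteq> cls ` (R \<times> UNIV) \<and>
      openin (top_of_set (R \<times> UNIV)) {z \<in> R \<times> UNIV. cls z \<in> K}"
    have "openin (top_of_set (R \<times> UNIV)) (\<Union>K\<in>\<K>. {z \<in> R \<times> UNIV. cls z \<in> K})"
      using K by (intro openin_Union) blast
    moreover have "(\<Union>K\<in>\<K>. {z \<in> R \<times> UNIV. cls z \<in> K}) = {z \<in> R \<times> UNIV. cls z \<in> \<Union>\<K>}"
      by blast
    ultimately show "openin (top_of_set (R \<times> UNIV)) {z \<in> R \<times> UNIV. cls z \<in> \<Union>\<K>}" by simp
    show "\<Union>\<K> \<subseteq> cls ` (R \<times> UNIV)" using K by blast
  qed blast
  then show ?thesis by (simp add: assoc_topology_def topology_inverse')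
qed

lemma topspace_assoc_topology: "topspace (assoc_topology R cls) = cls ` (R \<times> UNIV)"
proof (rule antisym)
  show "topspace (assoc_topology R cls) \<subseteq> cls ` (R \<times> UNIV)"
    using openin_topspace[of "assoc_topology R cls"] unfolding openin_assoc_topology by blast
  have "{z \<in> R \<times> UNIV. cls z \<in> cls ` (R \<times> UNIV)} = R \<times> UNIV" by blast
  then have "openin (assoc_topology R cls) (cls ` (R \<times> UNIV))"
    by (simp add: openin_assoc_topology)
  then show "cls ` (R \<times> UNIV) \<subseteq> topspace (assoc_topology R cls)" by (rule openin_subset)
qed

text \<open>\<open>class_coord r x\<close> is the unique \<open>v\<close> with \<open>x = [(r, v)]\<close>; \<open>class_rep x\<close> is some \<open>r\<close> for which there
  is one.\<close>

definition class_rep :: "('p \<times> 'f) set \<Rightarrow> 'p"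
  where "class_rep x = fst (SOME z. z \<in> x)"

definition class_coord :: "'p \<Rightarrow> ('p \<times> 'f) set \<Rightarrow> 'f"
  where "class_coord r x = (THE v. (r, v) \<in> x)"

definition assoc_add :: "('p \<times> 'f \<Rightarrow> ('p \<times> 'f) set) \<Rightarrow> ('p \<times> 'f) set \<Rightarrow> ('p \<times> 'f::plus) set \<Rightarrow> ('p \<times> 'f) set"
  where "assoc_add cls x y =
    (let r = class_rep x in cls (r, class_coord r x + class_coord r y))"

definition assoc_scaleC :: "('p \<times> 'f \<Rightarrow> ('p \<times> 'f) set) \<Rightarrow> complex \<Rightarrow> ('p \<times> 'f::scaleC) set \<Rightarrow> ('p \<times> 'f) set"
  where "assoc_scaleC cls c x = (let r = class_rep x in cls (r, c *\<^sub>C class_coord r x))"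

definition kuiper_map :: "('p::topological_space \<Rightarrow> 'm::topological_space) \<Rightarrow> ('p \<Rightarrow> 'g::group_add \<Rightarrow> 'p) \<Rightarrow>
    ('g \<Rightarrow> 'x::complex_inner \<Rightarrow>\<^sub>L 'x) \<Rightarrow> (('p \<times> 'x cdual) set \<Rightarrow> 'm \<times> 'x cdual) \<Rightarrow> bool"
  where "kuiper_map \<pi>P ract sw J \<longleftrightarrow>
    (let cls = assoc_class ract UNIV (dual_rep sw) in
      homeomorphic_map (assoc_topology UNIV cls) euclidean J \<and>
      (\<forall>r f. fst (J (cls (r, f))) = \<pi>P r) \<and>
      (\<forall>r. clinear (\<lambda>f. snd (J (cls (r, f)))) \<and> surj (\<lambda>f. snd (J (cls (r, f)))) \<and>
        (\<forall>f h. dual_inner (snd (J (cls (r, f)))) (snd (J (cls (r, h)))) = dual_inner f h)))"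

definition kuiper_check :: "(('p \<times> 'x::complex_inner cdual) set \<Rightarrow> 'm \<times> 'x cdual) \<Rightarrow>
    ('p \<times> 'x) set \<Rightarrow> 'm \<times> 'x"
  where "kuiper_check J x = map_prod id sharp (J (map_prod id flat ` x))"

definition kuiper_CH :: "('p \<Rightarrow> 'm) \<Rightarrow> ('p \<Rightarrow> 'g::group_add \<Rightarrow> 'p) \<Rightarrow>
    ('g \<Rightarrow> 'x::complex_inner \<Rightarrow>\<^sub>L 'x) \<Rightarrow> (('p \<times> 'x cdual) set \<Rightarrow> 'm \<times> 'x cdual) \<Rightarrow>
    ('p \<times> 'x cpt) set \<Rightarrow> 'm \<times> 'x cpt"
  where "kuiper_CH \<pi>P ract sw J = (SOME JCH.
    (let cls = assoc_class ract UNIV (CH_rep sw) in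
      (\<forall>r a. fst (JCH (cls (r, a))) = \<pi>P r) \<and>
      (\<forall>r. clinear (\<lambda>a. snd (JCH (cls (r, a)))) \<and> continuous_on UNIV (\<lambda>a. snd (JCH (cls (r, a))))) \<and>
      (\<forall>r v f. JCH (cls (r, rank_one v f)) = (\<pi>P r,
        rank_one (snd (kuiper_check J (assoc_class ract UNIV (\<lambda>g. sw g) (r, v))))
          (snd (J (assoc_class ract UNIV (dual_rep sw) (r, f))))))))"

definition reduced_frames :: "('v \<Rightarrow> 'v) \<Rightarrow> ('p \<Rightarrow> 'm) \<Rightarrow> ('p \<Rightarrow> 'v \<Rightarrow> ('m, 'v) tvec) \<Rightarrow>
    ('m \<Rightarrow> ('m, 'v) tvec \<Rightarrow> ('m, 'v) tvec) \<Rightarrow> 'p set"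
  where "reduced_frames J\<^sub>0 \<pi>P Lam JM = {r. \<forall>v. Lam r (J\<^sub>0 v) = JM (\<pi>P r) (Lam r v)}"

definition K_tilde :: "('v::euclidean_space \<Rightarrow> 'v \<Rightarrow> real) \<Rightarrow> ('g \<Rightarrow> 'v \<Rightarrow>\<^sub>L 'v) \<Rightarrow> 'g set"
  where "K_tilde g\<^sub>0 lam = {k. \<forall>u v. g\<^sub>0 (lam k u) (lam k v) = g\<^sub>0 u v}"

text \<open>For \<open>q\<close> in the reduced bundle the class of \<open>(q, v)\<close> under the small group is identified with the
  class under the whole covering group by inclusion. Accordingly a point of the bundle of compact
  operators is always represented by its full class, also when it is written as $[(q,a)]$ with \<open>q\<close>
  reduced, and the Kuiper map is applied to full classes.\<close>

definition reduced_class :: "('v::euclidean_space \<Rightarrow> 'v \<Rightarrow> real) \<Rightarrow> ('g::group_add \<Rightarrow> 'v \<Rightarrow>\<^sub>L 'v) \<Rightarrow>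
    ('g \<Rightarrow> 'x::complex_normed_vector \<Rightarrow>\<^sub>L 'x) \<Rightarrow> ('p \<Rightarrow> 'g \<Rightarrow> 'p) \<Rightarrow> 'p \<times> ('v, 'x cdual) form \<Rightarrow>
    ('p \<times> ('v, 'x cdual) form) set"
  where "reduced_class g\<^sub>0 lam sw ract = assoc_class ract (K_tilde g\<^sub>0 lam) (form_rep lam sw)"

definition reduced_act :: "('v::euclidean_space \<Rightarrow> 'v \<Rightarrow> real) \<Rightarrow> ('g::group_add \<Rightarrow> 'v \<Rightarrow>\<^sub>L 'v) \<Rightarrow>
    ('g \<Rightarrow> 'x::complex_inner \<Rightarrow>\<^sub>L 'x) \<Rightarrow> ('p \<Rightarrow> 'm) \<Rightarrow> ('p \<Rightarrow> 'g \<Rightarrow> 'p) \<Rightarrow>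
    (('p \<times> 'x cdual) set \<Rightarrow> 'm \<times> 'x cdual) \<Rightarrow>
    ('p \<times> ('v, 'x cdual) form) set \<Rightarrow> 'x cpt \<Rightarrow> ('p \<times> ('v, 'x cdual) form) set"
  where "reduced_act g\<^sub>0 lam sw \<pi>P ract J h a =
    (let q = class_rep h;
         y = inv_into (assoc_class ract UNIV (CH_rep sw) ` UNIV) (kuiper_CH \<pi>P ract sw J) (\<pi>P q, a)
     in reduced_class g\<^sub>0 lam sw ract (q, form_act (class_coord q h) (class_coord q y)))"

definition reduced_prod :: "('v::euclidean_space \<Rightarrow> 'v \<Rightarrow> real) \<Rightarrow>
    ('g::group_add \<Rightarrow> 'x::complex_inner \<Rightarrow>\<^sub>L 'x) \<Rightarrow> ('p \<Rightarrow> 'm) \<Rightarrow> ('p \<Rightarrow> 'g \<Rightarrow> 'p) \<Rightarrow>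
    (('p \<times> 'x cdual) set \<Rightarrow> 'm \<times> 'x cdual) \<Rightarrow>
    ('p \<times> ('v, 'x cdual) form) set \<Rightarrow> ('p \<times> ('v, 'x cdual) form) set \<Rightarrow> 'x cpt"
  where "reduced_prod g\<^sub>0 sw \<pi>P ract J f h =
    (let q = class_rep f
     in snd (kuiper_CH \<pi>P ract sw J (assoc_class ract UNIV (CH_rep sw)
          (q, form_prod g\<^sub>0 (class_coord q f) (class_coord q h)))))"

text \<open>Over the domain of a chart \<open>c\<close> the coordinate frame trivializes $\bigwedge^k T^*M$. Under
  $[(q, \alpha\otimes f)] \mapsto (\alpha\circ\Lambda(q)^{-1}) \otimes [(q,f)]$ its tensor product with the
  chart $\mu J$ of the degree zero bundle is the map below; the factors $\mu$ may be chosen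
  separately in each degree \<open>k\<close>.\<close>

definition induced_chart :: "('m, 'v::euclidean_space) chart set \<Rightarrow>
    ('g::group_add \<Rightarrow> 'x::complex_inner \<Rightarrow>\<^sub>L 'x) \<Rightarrow> ('p \<Rightarrow> 'm) \<Rightarrow> ('p \<Rightarrow> 'g \<Rightarrow> 'p) \<Rightarrow>
    ('p \<Rightarrow> 'v \<Rightarrow> ('m, 'v) tvec) \<Rightarrow> (('p \<times> 'x cdual) set \<Rightarrow> 'm \<times> 'x cdual) \<Rightarrow>
    ('m, 'v) chart \<Rightarrow> (nat \<Rightarrow> complex) \<Rightarrow> ('p \<times> ('v, 'x cdual) form) set \<Rightarrow> ('v, 'x cdual) form"
  where "induced_chart MA sw \<pi>P ract Lam J c \<mu> h =
    (let q = class_rep h in Abs_form (\<lambda>vs. \<mu> (length vs) *\<^sub>C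
      snd (J (assoc_class ract UNIV (dual_rep sw)
        (q, form_apply (class_coord q h)
          (map (\<lambda>u. inv_into UNIV (Lam q) (coord_vec MA c (\<pi>P q) u)) vs))))))"

definition induced_atlas :: "('m::topological_space, 'v::euclidean_space) chart set \<Rightarrow>
    ('g::group_add \<Rightarrow> 'x::complex_inner \<Rightarrow>\<^sub>L 'x) \<Rightarrow> ('p \<Rightarrow> 'm) \<Rightarrow> ('p \<Rightarrow> 'g \<Rightarrow> 'p) \<Rightarrow>
    ('p \<Rightarrow> 'v \<Rightarrow> ('m, 'v) tvec) \<Rightarrow> (('p \<times> 'x cdual) set \<Rightarrow> 'm \<times> 'x cdual) \<Rightarrow>
    ('m set \<times> (('p \<times> ('v, 'x cdual) form) set \<Rightarrow> ('v, 'x cdual) form)) set"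
  where "induced_atlas MA sw \<pi>P ract Lam J =
    {(U, induced_chart MA sw \<pi>P ract Lam J c \<mu>) | U c \<mu>.
      c \<in> MA \<and> open U \<and> U \<subseteq> fst c \<and> (\<forall>k. \<mu> k \<noteq> 0)}"

text \<open>A Hilbert module with underlying set \<open>E\<close>: a complex vector space with a right action of the
  compact operators and a product linear in the right argument, positive definite (positive elements
  being those of the form $b^*b$), and complete in the norm $\sqrt{\|(x,x)\|}$.\<close>

definition hilbert_CH_module :: "'e set \<Rightarrow> ('e \<Rightarrow> 'e \<Rightarrow> 'e) \<Rightarrow> (complex \<Rightarrow> 'e \<Rightarrow> 'e) \<Rightarrow>
    ('e \<Rightarrow> 'x::complex_inner cpt \<Rightarrow> 'e) \<Rightarrow> ('e \<Rightarrow> 'e \<Rightarrow> 'x cpt) \<Rightarrow> bool"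
  where "hilbert_CH_module E add smul act ip \<longleftrightarrow>
    (\<forall>x\<in>E. \<forall>y\<in>E. \<forall>z\<in>E. add x y \<in> E \<and> add (add x y) z = add x (add y z) \<and> add x y = add y x) \<and>
    (\<exists>o\<^sub>E\<in>E. (\<forall>x\<in>E. add x o\<^sub>E = x) \<and> (\<forall>x\<in>E. \<exists>y\<in>E. add x y = o\<^sub>E) \<and>
      (\<forall>x\<in>E. ip x x = 0 \<longrightarrow> x = o\<^sub>E)) \<and>
    (\<forall>x\<in>E. \<forall>y\<in>E. \<forall>c d. smul c x \<in> E \<and> smul c (add x y) = add (smul c x) (smul c y) \<and>
      smul (c + d) x = add (smul c x) (smul d x) \<and> smul c (smul d x) = smul (c * d) x \<and>
      smul 1 x = x) \<and>
    (\<forall>x\<in>E. \<forall>y\<in>E. \<forall>a b c. act x a \<in> E \<and> act (add x y) a = add (act x a) (act y a) \<and>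
      act x (a + b) = add (act x a) (act x b) \<and> act x (cpt_compose a b) = act (act x a) b \<and>
      act (smul c x) a = smul c (act x a) \<and> act x (c *\<^sub>C a) = smul c (act x a)) \<and>
    (\<forall>x\<in>E. \<forall>y\<in>E. \<forall>z\<in>E. \<forall>a c. ip x (add y z) = ip x y + ip x z \<and>
      ip x (smul c y) = c *\<^sub>C ip x y \<and> ip x (act y a) = cpt_compose (ip x y) a \<and>
      ip y x = cpt_adjoint (ip x y)) \<and>
    (\<forall>x\<in>E. \<exists>b. ip x x = cpt_compose (cpt_adjoint b) b) \<and>
    (let d = (\<lambda>x y. let z = add x (smul (-1) y) in sqrt (norm (ip z z))) in
      \<forall>s. (\<forall>n::nat. s n \<in> E) \<and> (\<forall>e>0. \<exists>N. \<forall>m\<ge>N. \<forall>n\<ge>N. d (s m) (s n) < e) \<longrightarrow>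
        (\<exists>x\<in>E. (\<lambda>n. d (s n) x) \<longlonglongrightarrow> 0))"

definition CH_automorphism :: "('f::complex_normed_vector \<Rightarrow> 'x::complex_normed_vector cpt \<Rightarrow> 'f) \<Rightarrow> ('f \<Rightarrow> 'f) \<Rightarrow> bool"
  where "CH_automorphism fa T \<longleftrightarrow> clinear T \<and> homeomorphism UNIV UNIV T (inv T) \<and>
    (\<forall>h a. T (fa h a) = fa (T h) a)"

text \<open>\<open>TA\<close> is a set of local trivializations, given by the domain in the base and the fibre component.
  Smoothness refers to the charts of the total space consisting of a chart \<open>c\<close> of the base and a
  trivialization. \<open>fa\<close> is the action on the typical fibre.\<close>

definition fibre_inv :: "'e topology \<Rightarrow> ('e \<Rightarrow> 'm) \<Rightarrow> ('e \<Rightarrow> 'f) \<Rightarrow> 'm \<Rightarrow> 'f \<Rightarrow> 'e"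
  where "fibre_inv E p \<psi> m b = (THE x. x \<in> topspace E \<and> p x = m \<and> \<psi> x = b)"

definition smooth_hilbert_CH_bundle ::
  "('m::topological_space, 'v::euclidean_space) chart set \<Rightarrow>
    ('f::complex_normed_vector \<Rightarrow> 'x::complex_inner cpt \<Rightarrow> 'f) \<Rightarrow>
    'e topology \<Rightarrow> ('e \<Rightarrow> 'm) \<Rightarrow> ('e \<Rightarrow> 'e \<Rightarrow> 'e) \<Rightarrow> (complex \<Rightarrow> 'e \<Rightarrow> 'e) \<Rightarrow>
    ('e \<Rightarrow> 'x cpt \<Rightarrow> 'e) \<Rightarrow> ('e \<Rightarrow> 'e \<Rightarrow> 'x cpt) \<Rightarrow> ('m set \<times> ('e \<Rightarrow> 'f)) set \<Rightarrow> bool"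
  where "smooth_hilbert_CH_bundle MA fa E p add smul act ip TA \<longleftrightarrow>
    continuous_map E euclidean p \<and>
    (\<forall>m. hilbert_CH_module {x \<in> topspace E. p x = m} add smul act ip) \<and>
    (\<Union>(U, \<psi>)\<in>TA. U) = UNIV \<and>
    (\<forall>(U, \<psi>)\<in>TA. open U \<and>
      homeomorphic_map (subtopology E {x. p x \<in> U}) (prod_topology (top_of_set U) euclidean)
        (\<lambda>x. (p x, \<psi> x)) \<and>
      (\<forall>x\<in>topspace E. \<forall>y\<in>topspace E. p x \<in> U \<and> p y = p x \<longrightarrow>
        \<psi> (add x y) = \<psi> x + \<psi> y \<and> (\<forall>c. \<psi> (smul c x) = c *\<^sub>C \<psi> x))) \<and>
    (\<forall>(U, \<psi>)\<in>TA. \<forall>(W, \<phi>)\<in>TA.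
      (\<forall>m\<in>U \<inter> W. CH_automorphism fa (\<lambda>b. \<phi> (fibre_inv E p \<psi> m b))) \<and>
      (\<forall>c\<in>MA. smooth_on (snd c ` (U \<inter> W \<inter> fst c) \<times> UNIV)
        (\<lambda>(x, b). \<phi> (fibre_inv E p \<psi> (chart_inv c x) b)))) \<and>
    (\<forall>(U, \<psi>)\<in>TA. \<forall>c\<in>MA.
      smooth_on (snd c ` (U \<inter> fst c) \<times> UNIV \<times> UNIV)
        (\<lambda>(x, b, a). \<psi> (act (fibre_inv E p \<psi> (chart_inv c x) b) a)) \<and>
      smooth_on (snd c ` (U \<inter> fst c) \<times> UNIV \<times> UNIV)
        (\<lambda>(x, b, b'). ip (fibre_inv E p \<psi> (chart_inv c x) b) (fibre_inv E p \<psi> (chart_inv c x) b')))"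

end

theory Submission
  imports Defs
begin

text \<open>Evaluating the Kuiper map at a point \<open>q\<close> of the metaplectic bundle gives a unitary operator \<open>U q\<close>
  of the typical fibre, and conjugation by it is the map induced on compact operators. In the charts
  of the induced atlas the action is therefore the constant right multiplication, and the product is
  the constant one contracted with the inverse of the metric of $J_M$. The transition functions are
  exterior powers of the Jacobians of the manifold, tensored with scalars.

  A reduced frame need not extend to a smooth reduced section, so the inverse metric is not read off
  reduced frames: the bivector $\sum_e J_0e\otimes e$ is invariant under the symplectic group, hence
  $-(J_M\otimes 1)(L\otimes L)\sum_e J_0e\otimes e$ is the inverse metric for every symplectic frame $L$,
  and smooth sections of such frames exist. That the charts are homeomorphisms rests on the projection
  of the reduced bundle being open and on the joint continuity of $(q,f)\mapsto U(q)^{-1}f$, which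
  follows from unitarity.\<close>

subsection \<open>Smooth maps\<close>

text \<open>The Kuiper map is only a homeomorphism, so the operators \<open>U q\<close> are known to
  depend on \<open>q\<close> strongly continuously and no better; every smoothness claim has to come
  from their cancellation. In transitions \<open>U q\<close> meets \<open>iU q\<close> in the same
  frame, in the action it meets the conjugation built into \<open>kuiper_CH\<close>, and in the
  product conjugation by \<open>cU q\<close> amounts to applying \<open>U q\<close> to both
  arguments. What is left depends on the base point through finitely many scalar functions and on
  the fibre variables linearly or bilinearly. Hence the calculus on infinite dimensional spaces can
  stop at bounded linear and bilinear maps, with the chain rule reserved for Euclidean domains.
  \<open>kuiper_CH\<close> is a choice, pinned down by the density of finite rank operators.
  \<open>sharp\<close> is a definite description, which completeness turns into an inverse of
  \<open>flat\<close>. Positivity of the module product asks for a factorization through some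
  \<open>b\<close>; it is built by placing the components of the form along pairwise orthogonal
  vectors, whence the orthonormal sequence in the fibre.\<close>

definition bounded_multilinear :: "('a::real_normed_vector list \<Rightarrow> 'b::real_normed_vector) \<Rightarrow> bool"
  where "bounded_multilinear M \<longleftrightarrow> multilinear M \<and>
    (\<forall>k. \<exists>C. \<forall>vs. length vs = k \<longrightarrow> norm (M vs) \<le> C * prod_list (map norm vs))"

definition jet_derivative :: "('a::real_normed_vector \<Rightarrow> 'a list \<Rightarrow> 'b::real_normed_vector) \<Rightarrow> 'a \<Rightarrow> bool"
  where "jet_derivative D x \<longleftrightarrow> (\<forall>k. \<forall>e>0. \<forall>\<^sub>F y in at x. \<forall>vs. length vs = k \<longrightarrow>
    norm (D y vs - D x vs - D x ((y - x) # vs)) \<le> e * norm (y - x) * prod_list (map norm vs))"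

lemma smooth_on_iff: "smooth_on S f \<longleftrightarrow> open S \<and>
    (\<exists>D. \<forall>x\<in>S. D x [] = f x \<and> bounded_multilinear (D x) \<and> jet_derivative D x)"
  unfolding smooth_on_def bounded_multilinear_def jet_derivative_def by (simp add: conj_assoc)

lemma smooth_onI:
  assumes "open S" "\<And>x. x \<in> S \<Longrightarrow> D x [] = f x" "\<And>x. x \<in> S \<Longrightarrow> bounded_multilinear (D x)"
    "\<And>x. x \<in> S \<Longrightarrow> jet_derivative D x"
  shows "smooth_on S f"
  unfolding smooth_on_iff using assms by blast

lemma smooth_on_open: "smooth_on S f \<Longrightarrow> open S"
  by (simp add: smooth_on_iff)

lemma prod_list_norm_nonneg [simp]: "0 \<le> prod_list (map norm vs)"
  by (induction vs) auto

lemma prod_list_norm_comp_nonneg [simp]: "0 \<le> prod_list (map (norm \<circ> A) vs)"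
  by (induction vs) auto

text \<open>The sum of the absolute values of the constants for the single lengths serves all
  lengths up to \<open>k\<close> at once. The Leibniz estimates need this, since they split a list
  of directions into shorter ones.\<close>

lemma bounded_multilinear_bound:
  assumes "bounded_multilinear M"
  obtains C where "C \<ge> 0" "\<And>vs. length vs \<le> k \<Longrightarrow> norm (M vs) \<le> C * prod_list (map norm vs)"
proof -
  have "\<forall>k. \<exists>C. \<forall>vs. length vs = k \<longrightarrow> norm (M vs) \<le> C * prod_list (map norm vs)"
    using assms by (simp add: bounded_multilinear_def)
  from choice[OF this] obtain C
    where C': "\<forall>k. \<forall>vs. length vs = k \<longrightarrow> norm (M vs) \<le> C k * prod_list (map norm vs)" ..
  note C = C'[rule_format, OF refl]
  show ?thesis
  proof (rule that[of "\<Sum>j\<le>k. \<bar>C j\<bar>"])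
    fix vs :: "'a list" assume "length vs \<le> k"
    then have "\<bar>C (length vs)\<bar> \<le> (\<Sum>j\<le>k. \<bar>C j\<bar>)"
      by (intro member_le_sum) auto
    then have "C (length vs) * prod_list (map norm vs) \<le> (\<Sum>j\<le>k. \<bar>C j\<bar>) * prod_list (map norm vs)"
      by (intro mult_right_mono) auto
    with C[of vs] show "norm (M vs) \<le> (\<Sum>j\<le>k. \<bar>C j\<bar>) * prod_list (map norm vs)"
      by linarith
  qed (simp add: sum_nonneg)
qed

lemma multilinear_Cons: "multilinear M \<Longrightarrow> multilinear (\<lambda>vs. M (v # vs))"
  unfolding multilinear_def by (metis append_Cons)

lemma multilinear_append: "multilinear M \<Longrightarrow> multilinear (\<lambda>vs. M (vs @ ws))"
  unfolding multilinear_def by simp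

lemma multilinear_head:
  assumes "multilinear M"
  shows "M ((u + v) # vs) = M (u # vs) + M (v # vs)" "M ((r *\<^sub>R u) # vs) = r *\<^sub>R M (u # vs)"
  using assms unfolding multilinear_def by (metis append_Nil)+

lemma bounded_linear_multilinear_head:
  assumes "bounded_multilinear M"
  shows "bounded_linear (\<lambda>h. M (h # vs))"
proof -
  have M: "multilinear M" using assms by (simp add: bounded_multilinear_def)
  obtain C where C: "norm (M vs') \<le> C * prod_list (map norm vs')" if "length vs' \<le> Suc (length vs)" for vs'
    using bounded_multilinear_bound[OF assms] by metis
  show ?thesis
    by (rule bounded_linear_intro[where K = "C * prod_list (map norm vs)"])
      (use M C[of "_ # vs"] in \<open>auto simp: multilinear_head mult_ac\<close>)
qed

lemma jet_derivativeD:
  assumes "jet_derivative D x" "e > 0"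
  shows "\<forall>\<^sub>F y in at x. \<forall>vs. length vs \<le> k \<longrightarrow>
    norm (D y vs - D x vs - D x ((y - x) # vs)) \<le> e * norm (y - x) * prod_list (map norm vs)"
proof -
  have "\<forall>\<^sub>F y in at x. \<forall>j\<in>{..k}. \<forall>vs. length vs = j \<longrightarrow>
    norm (D y vs - D x vs - D x ((y - x) # vs)) \<le> e * norm (y - x) * prod_list (map norm vs)"
    using assms unfolding jet_derivative_def by (intro eventually_ball_finite) auto
  then show ?thesis by eventually_elim auto
qed

lemma jet_derivative_has_derivative:
  assumes "jet_derivative D x" "bounded_multilinear (D x)"
  shows "((\<lambda>y. D y vs) has_derivative (\<lambda>h. D x (h # vs))) (at x)"
  unfolding has_derivative_iff_norm
proof (intro conjI bounded_linear_multilinear_head[OF assms(2)] tendstoI)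
  fix e :: real assume "e > 0"
  define p where "p = prod_list (map norm vs)"
  have p: "p \<ge> 0" by (simp add: p_def)
  \<comment> \<open>\<open>1 + p\<close> keeps the denominator positive when some direction
    vanishes; the factor 2 makes the final inequality strict.\<close>
  define e' where "e' = e / (2 * (1 + p))"
  have e': "e' > 0" "e' * p < e"
  proof -
    show "e' > 0" using \<open>e > 0\<close> p by (auto simp: e'_def intro!: divide_pos_pos)
    have "e' * p \<le> e' * (1 + p)" using \<open>e' > 0\<close> by (intro mult_left_mono) auto
    also have "\<dots> = e / 2" using p by (simp add: e'_def field_simps)
    finally show "e' * p < e" using \<open>e > 0\<close> by simp
  qed
  have "\<forall>\<^sub>F y in at x. y \<noteq> x" by (simp add: eventually_at_filter)
  with jet_derivativeD[OF assms(1) e'(1), of "length vs"]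
  show "\<forall>\<^sub>F y in at x. dist (norm (D y vs - D x vs - D x ((y - x) # vs)) / norm (y - x)) 0 < e"
  proof eventually_elim
    case (elim y)
    then have "norm (D y vs - D x vs - D x ((y - x) # vs)) \<le> e' * norm (y - x) * p"
      unfolding p_def by blast
    then have "norm (D y vs - D x vs - D x ((y - x) # vs)) / norm (y - x) \<le> e' * p"
      using elim by (simp add: divide_le_eq mult_ac)
    then show ?case using e' by simp
  qed
qed

text \<open>Pasting local derivative families needs their uniqueness: they are the iterated directional
  derivatives, which depend on the germ only.\<close>

fun iter_deriv :: "('a::real_normed_vector \<Rightarrow> 'b::real_normed_vector) \<Rightarrow> 'a list \<Rightarrow> 'a \<Rightarrow> 'b" where
  "iter_deriv f [] = f"
| "iter_deriv f (v # vs) = (\<lambda>x. frechet_derivative (iter_deriv f vs) (at x) v)"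

lemma iter_deriv_unique:
  assumes "open S" "\<And>x. x \<in> S \<Longrightarrow> D x [] = f x" "\<And>x. x \<in> S \<Longrightarrow> bounded_multilinear (D x)"
    "\<And>x. x \<in> S \<Longrightarrow> jet_derivative D x" "x \<in> S"
  shows "D x vs = iter_deriv f vs x"
  using \<open>x \<in> S\<close>
proof (induction vs arbitrary: x)
  case (Cons v vs)
  have "((\<lambda>y. D y vs) has_derivative (\<lambda>h. D x (h # vs))) (at x)"
    using assms Cons.prems by (intro jet_derivative_has_derivative) auto
  then have "(iter_deriv f vs has_derivative (\<lambda>h. D x (h # vs))) (at x)"
    by (rule has_derivative_transform_within_open[OF _ assms(1) Cons.prems Cons.IH])
  then show ?case by (simp add: frechet_derivative_at[symmetric])
qed (use assms in auto)

text \<open>The full neighbourhood filter is used because the estimate also mentions the family at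
  \<open>x\<close> itself.\<close>

lemma jet_derivative_cong:
  assumes "\<forall>\<^sub>F y in nhds x. D y = D' y"
  shows "jet_derivative D x \<longleftrightarrow> jet_derivative D' x"
proof -
  have *: "\<forall>\<^sub>F y in at x. D y = D' y"
    using assms eventually_nhds_conv_at by blast
  have x: "D x = D' x" using assms by (rule eventually_nhds_x_imp_x)
  have "jet_derivative D' x" if "\<forall>\<^sub>F y in at x. D y = D' y" "D x = D' x" and D: "jet_derivative D x"
    for D D' :: "'a \<Rightarrow> 'a list \<Rightarrow> 'b"
    unfolding jet_derivative_def
  proof (intro allI impI)
    fix k and e :: real assume e: "e > 0"
    from jet_derivativeD[OF D e, of k] that(1) show "\<forall>\<^sub>F y in at x. \<forall>vs. length vs = k \<longrightarrow>
      norm (D' y vs - D' x vs - D' x ((y - x) # vs)) \<le> e * norm (y - x) * prod_list (map norm vs)"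
      by eventually_elim (simp add: that(2))
  qed
  moreover have "\<forall>\<^sub>F y in at x. D' y = D y" using * by eventually_elim simp
  ultimately show ?thesis using * x by metis
qed

text \<open>Any witness of smoothness coincides with the iterated derivatives, so from here on one
  canonical family, determined by \<open>f\<close> alone, replaces the existential one.\<close>

lemma smooth_on_iter_deriv:
  assumes "smooth_on S f" "x \<in> S"
  shows "bounded_multilinear (\<lambda>vs. iter_deriv f vs x)" "jet_derivative (\<lambda>x vs. iter_deriv f vs x) x"
proof -
  obtain D where S: "open S" and D: "\<And>x. x \<in> S \<Longrightarrow> D x [] = f x"
    "\<And>x. x \<in> S \<Longrightarrow> bounded_multilinear (D x)" "\<And>x. x \<in> S \<Longrightarrow> jet_derivative D x"
    using assms(1) by (auto simp: smooth_on_iff)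
  have eq: "D y = (\<lambda>vs. iter_deriv f vs y)" if "y \<in> S" for y
    using iter_deriv_unique[of S D f, OF S D that] by blast
  show "bounded_multilinear (\<lambda>vs. iter_deriv f vs x)"
    using D(2)[OF assms(2)] eq[OF assms(2)] by simp
  have "\<forall>\<^sub>F y in nhds x. D y = (\<lambda>vs. iter_deriv f vs y)"
    using eventually_nhds_in_open[OF S assms(2)] by eventually_elim (rule eq)
  from jet_derivative_cong[OF this] D(3)[OF assms(2)]
  show "jet_derivative (\<lambda>x vs. iter_deriv f vs x) x" by simp
qed

lemma iter_deriv_cong:
  assumes "open S" "\<And>x. x \<in> S \<Longrightarrow> f x = g x" "x \<in> S"
  shows "iter_deriv f vs x = iter_deriv g vs x"
  using assms(3)
proof (induction vs arbitrary: x)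
  case (Cons v vs)
  \<comment> \<open>\<open>frechet_derivative\<close> is a choice among derivatives, so the two
    functions must have the same candidates \<open>F\<close>, whether or not there is one.\<close>
  have "(iter_deriv f vs has_derivative F) (at x) \<longleftrightarrow> (iter_deriv g vs has_derivative F) (at x)" for F
    using has_derivative_transform_within_open[OF _ assms(1) Cons.prems, of "iter_deriv f vs" F UNIV "iter_deriv g vs"]
      has_derivative_transform_within_open[OF _ assms(1) Cons.prems, of "iter_deriv g vs" F UNIV "iter_deriv f vs"]
      Cons.IH by (metis)
  then show ?case by (simp add: frechet_derivative_def)
qed (use assms in auto)

lemma iter_deriv_has_derivative:
  assumes "smooth_on S f" "x \<in> S"
  shows "(iter_deriv f vs has_derivative (\<lambda>h. iter_deriv f (h # vs) x)) (at x)"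
  using jet_derivative_has_derivative[OF smooth_on_iter_deriv(2,1)[OF assms], of vs] by simp

lemma iter_deriv_add:
  assumes "smooth_on S f" "smooth_on S g" "x \<in> S"
  shows "iter_deriv (\<lambda>x. f x + g x) vs x = iter_deriv f vs x + iter_deriv g vs x"
  using assms(3)
proof (induction vs arbitrary: x)
  case (Cons v vs)
  have "((\<lambda>x. iter_deriv f vs x + iter_deriv g vs x) has_derivative
      (\<lambda>h. iter_deriv f (h # vs) x + iter_deriv g (h # vs) x)) (at x)"
    using assms Cons.prems by (intro has_derivative_add iter_deriv_has_derivative)
  then have "(iter_deriv (\<lambda>x. f x + g x) vs has_derivative
      (\<lambda>h. iter_deriv f (h # vs) x + iter_deriv g (h # vs) x)) (at x)"
    by (rule has_derivative_transform_within_open[OF _ smooth_on_open[OF assms(1)] Cons.prems]) (simp add: Cons.IH)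
  from fun_cong[OF frechet_derivative_at[OF this], of v] show ?case
    unfolding iter_deriv.simps by (rule sym)
qed simp

lemma iter_deriv_linear:
  assumes "bounded_linear T" "smooth_on S f" "x \<in> S"
  shows "iter_deriv (\<lambda>x. T (f x)) vs x = T (iter_deriv f vs x)"
  using assms(3)
proof (induction vs arbitrary: x)
  case (Cons v vs)
  have "((\<lambda>x. T (iter_deriv f vs x)) has_derivative (\<lambda>h. T (iter_deriv f (h # vs) x))) (at x)"
    by (rule bounded_linear.has_derivative[OF assms(1) iter_deriv_has_derivative[OF assms(2) Cons.prems]])
  then have "(iter_deriv (\<lambda>x. T (f x)) vs has_derivative (\<lambda>h. T (iter_deriv f (h # vs) x))) (at x)"
    by (rule has_derivative_transform_within_open[OF _ smooth_on_open[OF assms(2)] Cons.prems]) (simp add: Cons.IH)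
  from fun_cong[OF frechet_derivative_at[OF this], of v] show ?case
    unfolding iter_deriv.simps by (rule sym)
qed simp

text \<open>The family \<open>iter_deriv f\<close> exists globally from the start; near each point
  it agrees with that of the local function \<open>g\<close>, which supplies the estimates.\<close>

lemma smooth_on_local:
  assumes "\<And>x. x \<in> S \<Longrightarrow> \<exists>T g. open T \<and> x \<in> T \<and> smooth_on T g \<and> (\<forall>y\<in>T \<inter> S. g y = f y)" "open S"
  shows "smooth_on S f"
proof (rule smooth_onI[where D = "\<lambda>x vs. iter_deriv f vs x"])
  fix x assume "x \<in> S"
  then obtain T g where T: "open T" "x \<in> T" "smooth_on T g" "\<And>y. y \<in> T \<inter> S \<Longrightarrow> g y = f y"
    using assms(1) by metis
  have eq: "iter_deriv g vs y = iter_deriv f vs y" if "y \<in> T \<inter> S" for y vs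
    by (rule iter_deriv_cong[of "T \<inter> S"]) (use T assms(2) that in auto)
  have x: "x \<in> T \<inter> S" using T \<open>x \<in> S\<close> by auto
  show "bounded_multilinear (\<lambda>vs. iter_deriv f vs x)"
    using smooth_on_iter_deriv(1)[OF T(3,2)] eq[OF x] by simp
  have "\<forall>\<^sub>F y in nhds x. (\<lambda>vs. iter_deriv g vs y) = (\<lambda>vs. iter_deriv f vs y)"
    using eventually_nhds_in_open[OF open_Int[OF T(1) assms(2)] x] by eventually_elim (simp add: eq)
  from jet_derivative_cong[OF this] smooth_on_iter_deriv(2)[OF T(3,2)]
  show "jet_derivative (\<lambda>x vs. iter_deriv f vs x) x" by simp
qed (use assms in auto)

lemma smooth_on_cong:
  assumes "smooth_on S f" "\<And>x. x \<in> S \<Longrightarrow> f x = g x"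
  shows "smooth_on S g"
  using assms by (intro smooth_on_local) (auto dest: smooth_on_open)

lemma smooth_on_subset_open:
  assumes "smooth_on S f" "open T" "T \<subseteq> S"
  shows "smooth_on T f"
  using assms by (intro smooth_on_local) (metis IntE smooth_on_open subsetD)

lemma smooth_on_has_derivative:
  assumes "smooth_on S f" "x \<in> S"
  shows "(f has_derivative (\<lambda>v. iter_deriv f [v] x)) (at x)"
  using jet_derivative_has_derivative[OF smooth_on_iter_deriv(2,1)[OF assms], of "[]"] by simp

lemma smooth_on_continuous_on: "smooth_on S f \<Longrightarrow> continuous_on S f"
  by (meson continuous_at_imp_continuous_on has_derivative_continuous smooth_on_has_derivative)

text \<open>The last entry of a list is the direction differentiated first. The jet of the
  derivative in direction \<open>v\<close> is therefore the jet of \<open>f\<close> with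
  \<open>v\<close> appended at the end.\<close>

lemma smooth_on_directional:
  assumes "smooth_on S f"
  shows "smooth_on S (\<lambda>x. frechet_derivative f (at x) v)"
proof -
  let ?D = "\<lambda>x vs. iter_deriv f (vs @ [v]) x"
  have "smooth_on S (\<lambda>x. iter_deriv f [v] x)"
  proof (rule smooth_onI[where D = ?D])
    fix x assume x: "x \<in> S"
    note D = smooth_on_iter_deriv[OF assms x]
    show "bounded_multilinear (?D x)"
      unfolding bounded_multilinear_def
    proof (intro conjI allI)
      show "multilinear (?D x)"
        using multilinear_append[of "\<lambda>vs. iter_deriv f vs x" "[v]"] D(1) by (simp add: bounded_multilinear_def)
      fix k
      obtain C where C: "C \<ge> 0" "\<And>vs. length vs \<le> Suc k \<Longrightarrow> norm (iter_deriv f vs x) \<le> C * prod_list (map norm vs)"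
        using bounded_multilinear_bound[OF D(1)] by metis
      show "\<exists>C. \<forall>vs. length vs = k \<longrightarrow> norm (?D x vs) \<le> C * prod_list (map norm vs)"
        using C(2)[of "_ @ [v]"] by (intro exI[of _ "C * norm v"]) (auto simp: mult_ac)
    qed
    show "jet_derivative ?D x"
      unfolding jet_derivative_def
    proof (intro allI impI)
      fix k and e :: real assume e: "e > 0"
      \<comment> \<open>The appended direction contributes a factor \<open>norm v\<close> to the
        estimate of order \<open>Suc k\<close>.\<close>
      define e' where "e' = e / (1 + norm v)"
      have nv: "1 + norm v > 0" by (simp add: add_pos_nonneg)
      have e': "e' > 0" using e nv by (simp add: e'_def)
      from jet_derivativeD[OF D(2) e', of "Suc k"]
      show "\<forall>\<^sub>F y in at x. \<forall>vs. length vs = k \<longrightarrow>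
        norm (?D y vs - ?D x vs - ?D x ((y - x) # vs)) \<le> e * norm (y - x) * prod_list (map norm vs)"
      proof eventually_elim
        case (elim y)
        show ?case
        proof (intro allI impI)
          fix vs :: "'a list" assume "length vs = k"
          then have "norm (?D y vs - ?D x vs - ?D x ((y - x) # vs))
              \<le> e' * norm (y - x) * (prod_list (map norm vs) * norm v)"
            using elim[rule_format, of "vs @ [v]"] by simp
          also have "\<dots> = (e' * norm v) * norm (y - x) * prod_list (map norm vs)" by (simp add: mult_ac)
          also have "e' * norm v \<le> e"
          proof -
            have "e' * norm v \<le> e' * (1 + norm v)" using e' by (intro mult_left_mono) auto
            also have "\<dots> = e" using nv by (simp add: e'_def)
            finally show ?thesis .
          qed
          finally show "norm (?D y vs - ?D x vs - ?D x ((y - x) # vs)) \<le> e * norm (y - x) * prod_list (map norm vs)"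
            by (simp add: mult_right_mono)
        qed
      qed
    qed
  qed (use assms smooth_on_open in auto)
  then show ?thesis by simp
qed

section \<open>Constant maps, linear maps and composition with linear maps\<close>

lemma bounded_multilinear_const: "bounded_multilinear (\<lambda>vs. if vs = [] then c else 0)"
  by (auto simp: bounded_multilinear_def multilinear_def intro!: exI[of _ "norm c"])

lemma smooth_on_const [simp]: "open S \<Longrightarrow> smooth_on S (\<lambda>x. c)"
  by (rule smooth_onI[where D = "\<lambda>x vs. if vs = [] then c else 0"])
    (auto simp: bounded_multilinear_const jet_derivative_def)

lemma smooth_on_linear:
  assumes f: "bounded_linear f" and "open S"
  shows "smooth_on S f"
proof (rule smooth_onI[where D = "\<lambda>x vs. case vs of [] \<Rightarrow> f x | [v] \<Rightarrow> f v | _ \<Rightarrow> 0"])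
  interpret bounded_linear f by fact
  fix x
  let ?D = "\<lambda>x vs. case vs of [] \<Rightarrow> f x | [v] \<Rightarrow> f v | _ \<Rightarrow> 0"
  \<comment> \<open>The value \<open>f x\<close> sits at the empty list, which has no slot, so it
    cannot disturb linearity in the slots.\<close>
  have split: "?D x (us @ u # vs) = (if us = [] \<and> vs = [] then f u else 0)" for us u vs
    by (auto split: list.splits simp: append_eq_Cons_conv)
  show "bounded_multilinear (?D x)"
    unfolding bounded_multilinear_def
  proof (intro conjI allI)
    show "multilinear (?D x)" unfolding multilinear_def split by (auto simp: add scaleR)
    fix k
    obtain K where K: "\<And>x. norm (f x) \<le> norm x * K" using bounded by blast
    have "norm (?D x vs) \<le> (norm (f x) + \<bar>K\<bar>) * prod_list (map norm vs)" for vs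
    proof (cases "\<exists>v. vs = [v]")
      case True
      then obtain v where v: "vs = [v]" by blast
      have "norm (f v) \<le> norm v * K" by (rule K)
      also have "\<dots> \<le> norm v * \<bar>K\<bar>" by (simp add: mult_left_mono)
      also have "\<dots> \<le> (norm (f x) + \<bar>K\<bar>) * norm v" by (simp add: algebra_simps)
      finally show ?thesis by (simp add: v)
    qed (cases vs; auto split: list.splits)
    then show "\<exists>C. \<forall>vs. length vs = k \<longrightarrow> norm (?D x vs) \<le> C * prod_list (map norm vs)" by blast
  qed
  show "jet_derivative ?D x"
    unfolding jet_derivative_def
  proof (intro allI impI always_eventually)
    fix k vs y and e :: real assume "e > 0"
    have "?D y vs - ?D x vs - ?D x ((y - x) # vs) = 0"
      by (cases vs) (auto simp: diff split: list.splits)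
    then show "norm (?D y vs - ?D x vs - ?D x ((y - x) # vs)) \<le> e * norm (y - x) * prod_list (map norm vs)"
      using \<open>e > 0\<close> by simp
  qed
qed (use assms in auto)

lemma smooth_on_compose_linear:
  fixes f :: "'a::real_normed_vector \<Rightarrow> 'b::real_normed_vector"
  assumes T: "bounded_linear T" and f: "smooth_on S f"
  shows "smooth_on S (\<lambda>x. T (f x))"
proof (rule smooth_onI[where D = "\<lambda>x vs. T (iter_deriv f vs x)"])
  interpret bounded_linear T by fact
  obtain K where K: "K > 0" "\<And>x. norm (T x) \<le> norm x * K" using pos_bounded by blast
  fix x assume x: "x \<in> S"
  note D = smooth_on_iter_deriv[OF f x]
  show "bounded_multilinear (\<lambda>vs. T (iter_deriv f vs x))"
    unfolding bounded_multilinear_def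
  proof (intro conjI allI)
    show "multilinear (\<lambda>vs. T (iter_deriv f vs x))"
      using D(1) linear_axioms by (auto simp: bounded_multilinear_def intro: multilinear_linear)
    fix k
    obtain C where C: "C \<ge> 0" "\<And>vs. length vs \<le> k \<Longrightarrow> norm (iter_deriv f vs x) \<le> C * prod_list (map norm vs)"
      using bounded_multilinear_bound[OF D(1)] by metis
    have "norm (T (iter_deriv f vs x)) \<le> (C * K) * prod_list (map norm vs)" if "length vs = k" for vs
    proof -
      have "norm (T (iter_deriv f vs x)) \<le> norm (iter_deriv f vs x) * K" by (rule K)
      also have "\<dots> \<le> (C * prod_list (map norm vs)) * K"
        using C(2)[of vs] that K(1) by (intro mult_right_mono) auto
      finally show ?thesis by (simp add: mult_ac)
    qed
    then show "\<exists>C. \<forall>vs. length vs = k \<longrightarrow> norm (T (iter_deriv f vs x)) \<le> C * prod_list (map norm vs)"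
      by blast
  qed
  show "jet_derivative (\<lambda>x vs. T (iter_deriv f vs x)) x"
    unfolding jet_derivative_def
  proof (intro allI impI)
    fix k and e :: real assume e: "e > 0"
    have "e / K > 0" using e K(1) by simp
    from jet_derivativeD[OF D(2) this, of k]
    show "\<forall>\<^sub>F y in at x. \<forall>vs. length vs = k \<longrightarrow>
        norm (T (iter_deriv f vs y) - T (iter_deriv f vs x) - T (iter_deriv f ((y - x) # vs) x))
        \<le> e * norm (y - x) * prod_list (map norm vs)"
    proof eventually_elim
      case (elim y)
      show ?case
      proof (intro allI impI)
        fix vs :: "'a list" assume k: "length vs = k"
        have "norm (T (iter_deriv f vs y) - T (iter_deriv f vs x) - T (iter_deriv f ((y - x) # vs) x))
          = norm (T (iter_deriv f vs y - iter_deriv f vs x - iter_deriv f ((y - x) # vs) x))"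
          by (simp only: diff)
        also have "\<dots> \<le> norm (iter_deriv f vs y - iter_deriv f vs x - iter_deriv f ((y - x) # vs) x) * K"
          by (rule K)
        also have "\<dots> \<le> (e / K * norm (y - x) * prod_list (map norm vs)) * K"
          using elim[rule_format, of vs] k K(1) by (intro mult_right_mono) auto
        also have "\<dots> = e * norm (y - x) * prod_list (map norm vs)" using K(1) by simp
        finally show "norm (T (iter_deriv f vs y) - T (iter_deriv f vs x) - T (iter_deriv f ((y - x) # vs) x))
          \<le> e * norm (y - x) * prod_list (map norm vs)" .
      qed
    qed
  qed
qed (use f smooth_on_open in auto)

lemma prod_list_map_norm_le:
  assumes "\<And>x. norm (A x) \<le> norm x * K" "K \<ge> 0"
  shows "prod_list (map norm (map A vs)) \<le> K ^ length vs * prod_list (map norm vs)"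
proof (induction vs)
  case (Cons v vs)
  have "norm (A v) * prod_list (map norm (map A vs)) \<le> (norm v * K) * (K ^ length vs * prod_list (map norm vs))"
    using assms Cons by (intro mult_mono) auto
  then show ?case by (simp add: mult_ac)
qed simp

text \<open>The jet is precomposed slot by slot with \<open>A\<close>, which works between arbitrary
  normed spaces. It lets functions of the base point be regarded as functions on products with
  infinite dimensional fibres.\<close>

lemma smooth_on_precompose_affine:
  assumes A: "bounded_linear A" and f: "smooth_on S f" and T: "open T" "\<And>x. x \<in> T \<Longrightarrow> a + A x \<in> S"
  shows "smooth_on T (\<lambda>x. f (a + A x))"
proof (rule smooth_onI[where D = "\<lambda>x vs. iter_deriv f (map A vs) (a + A x)"])
  interpret bounded_linear A by fact
  obtain K where K: "K > 0" "\<And>x. norm (A x) \<le> norm x * K" using pos_bounded by blast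
  have KA: "prod_list (map norm (map A vs)) \<le> K ^ length vs * prod_list (map norm vs)" for vs
    using K by (intro prod_list_map_norm_le) auto
  fix x assume x: "x \<in> T"
  note D = smooth_on_iter_deriv[OF f T(2)[OF x]]
  show "bounded_multilinear (\<lambda>vs. iter_deriv f (map A vs) (a + A x))"
    unfolding bounded_multilinear_def
  proof (intro conjI allI)
    show "multilinear (\<lambda>vs. iter_deriv f (map A vs) (a + A x))"
      using D(1) linear_axioms multilinear_map[of A "\<lambda>vs. iter_deriv f vs (a + A x)"]
      by (auto simp: bounded_multilinear_def)
    fix k
    obtain C where C: "C \<ge> 0" "\<And>vs. length vs \<le> k \<Longrightarrow> norm (iter_deriv f vs (a + A x)) \<le> C * prod_list (map norm vs)"
      using bounded_multilinear_bound[OF D(1)] by metis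
    have "norm (iter_deriv f (map A vs) (a + A x)) \<le> (C * K ^ k) * prod_list (map norm vs)" if "length vs = k" for vs
    proof -
      have "norm (iter_deriv f (map A vs) (a + A x)) \<le> C * prod_list (map norm (map A vs))"
        using C(2)[of "map A vs"] that by simp
      also have "\<dots> \<le> C * (K ^ length vs * prod_list (map norm vs))"
        using C(1) KA by (intro mult_left_mono) auto
      finally show ?thesis by (simp add: that mult_ac)
    qed
    then show "\<exists>C. \<forall>vs. length vs = k \<longrightarrow> norm (iter_deriv f (map A vs) (a + A x)) \<le> C * prod_list (map norm vs)"
      by blast
  qed
  show "jet_derivative (\<lambda>x vs. iter_deriv f (map A vs) (a + A x)) x"
    unfolding jet_derivative_def
  proof (intro allI impI)
    fix k and e :: real assume e: "e > 0"
    \<comment> \<open>One factor \<open>K\<close> comes from the increment \<open>A (y - x)\<close>,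
      the remaining \<open>k\<close> from the directions.\<close>
    define e' where "e' = e / (K * K ^ k)"
    have e': "e' > 0" using e K(1) by (simp add: e'_def)
    \<comment> \<open>\<open>A\<close> may send points other than \<open>x\<close> to the same
      image, so the estimate is extended to the centre, where it says that the derivative in
      direction zero vanishes.\<close>
    have nb: "\<forall>\<^sub>F z in nhds (a + A x). \<forall>vs. length vs \<le> k \<longrightarrow>
      norm (iter_deriv f vs z - iter_deriv f vs (a + A x) - iter_deriv f ((z - (a + A x)) # vs) (a + A x))
        \<le> e' * norm (z - (a + A x)) * prod_list (map norm vs)"
      using jet_derivativeD[OF D(2) e', of k]
    proof (subst eventually_nhds_conv_at, safe)
      fix vs :: "'b list"
      show "norm (iter_deriv f vs (a + A x) - iter_deriv f vs (a + A x) - iter_deriv f ((a + A x - (a + A x)) # vs) (a + A x))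
        \<le> e' * norm (a + A x - (a + A x)) * prod_list (map norm vs)"
        using multilinear_head(2)[of "\<lambda>vs. iter_deriv f vs (a + A x)" 0 0 vs] D(1)
        by (simp add: bounded_multilinear_def)
    qed
    have "((\<lambda>y. a + A y) \<longlongrightarrow> a + A x) (at x)"
      by (intro tendsto_intros tendsto)
    from filterlim_iff[THEN iffD1, rule_format, OF this nb]
    show "\<forall>\<^sub>F y in at x. \<forall>vs. length vs = k \<longrightarrow>
        norm (iter_deriv f (map A vs) (a + A y) - iter_deriv f (map A vs) (a + A x)
          - iter_deriv f (map A ((y - x) # vs)) (a + A x))
        \<le> e * norm (y - x) * prod_list (map norm vs)"
    proof eventually_elim
      case (elim y)
      show ?case
      proof (intro allI impI)
        fix vs :: "'a list" assume k: "length vs = k"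
        have "norm (iter_deriv f (map A vs) (a + A y) - iter_deriv f (map A vs) (a + A x)
          - iter_deriv f (map A ((y - x) # vs)) (a + A x))
          \<le> e' * norm (A (y - x)) * prod_list (map norm (map A vs))"
          using elim[rule_format, of "map A vs"] k by (simp add: diff)
        also have "\<dots> \<le> e' * (norm (y - x) * K) * (K ^ length vs * prod_list (map norm vs))"
          using e' K by (intro mult_mono KA mult_left_mono) (auto intro: mult_nonneg_nonneg)
        also have "\<dots> = e * norm (y - x) * prod_list (map norm vs)" using K(1) by (simp add: e'_def k)
        finally show "norm (iter_deriv f (map A vs) (a + A y) - iter_deriv f (map A vs) (a + A x)
          - iter_deriv f (map A ((y - x) # vs)) (a + A x)) \<le> e * norm (y - x) * prod_list (map norm vs)" .
      qed
    qed
  qed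
qed (use T in auto)

text \<open>The sum over all ways of distributing the directions between the two factors, each
  factor receiving its share in the original order.\<close>

fun leibniz :: "('b \<Rightarrow> 'c \<Rightarrow> 'd::plus) \<Rightarrow> ('a list \<Rightarrow> 'b) \<Rightarrow> ('a list \<Rightarrow> 'c) \<Rightarrow> 'a list \<Rightarrow> 'd" where
  "leibniz B F G [] = B (F []) (G [])"
| "leibniz B F G (v # vs) = leibniz B (\<lambda>a. F (v # a)) G vs + leibniz B F (\<lambda>a. G (v # a)) vs"

context bounded_bilinear
begin

lemma leibniz_add_left: "leibniz prod (\<lambda>a. F a + F' a) G vs = leibniz prod F G vs + leibniz prod F' G vs"
  by (induction vs arbitrary: F F' G) (auto simp: add_left)

lemma leibniz_add_right: "leibniz prod F (\<lambda>a. G a + G' a) vs = leibniz prod F G vs + leibniz prod F G' vs"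
  by (induction vs arbitrary: F G G') (auto simp: add_right)

lemma leibniz_scaleR_left: "leibniz prod (\<lambda>a. r *\<^sub>R F a) G vs = r *\<^sub>R leibniz prod F G vs"
  by (induction vs arbitrary: F G) (auto simp: scaleR_left scaleR_add_right)

lemma leibniz_scaleR_right: "leibniz prod F (\<lambda>a. r *\<^sub>R G a) vs = r *\<^sub>R leibniz prod F G vs"
  by (induction vs arbitrary: F G) (auto simp: scaleR_right scaleR_add_right)

lemma multilinear_leibniz:
  assumes "multilinear F" "multilinear G"
  shows "multilinear (leibniz prod F G)"
  unfolding multilinear_def
proof (intro conjI allI)
  fix us :: "'d list" and u v vs and r :: real
  show "leibniz prod F G (us @ (u + v) # vs)
      = leibniz prod F G (us @ u # vs) + leibniz prod F G (us @ v # vs)"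
    using assms by (induction us arbitrary: F G)
      (simp_all add: multilinear_head leibniz_add_left leibniz_add_right multilinear_Cons)
  show "leibniz prod F G (us @ (r *\<^sub>R u) # vs) = r *\<^sub>R leibniz prod F G (us @ u # vs)"
    using assms by (induction us arbitrary: F G)
      (simp_all add: multilinear_head leibniz_scaleR_left leibniz_scaleR_right multilinear_Cons scaleR_add_right)
qed

text \<open>The induction moves the norm of the head direction into the constant of the factor that
  receives it; the power of two counts the distributions.\<close>

lemma norm_leibniz_le:
  assumes K: "K \<ge> 0" "\<And>a b. norm (prod a b) \<le> norm a * norm b * K"
    and "C \<ge> 0" "\<And>a. length a \<le> length vs \<Longrightarrow> norm (F a) \<le> C * prod_list (map norm a)"
    and "C' \<ge> 0" "\<And>a. length a \<le> length vs \<Longrightarrow> norm (G a) \<le> C' * prod_list (map norm a)"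
  shows "norm (leibniz prod F G vs) \<le> K * C * C' * 2 ^ length vs * prod_list (map norm vs)"
  using assms(3-)
proof (induction vs arbitrary: F G C C')
  case Nil
  have "norm (prod (F []) (G [])) \<le> norm (F []) * norm (G []) * K" by (rule K)
  also have "\<dots> \<le> C * C' * K"
    using Nil K(1) by (intro mult_right_mono mult_mono) fastforce+
  finally show ?case by (simp add: mult_ac)
next
  case (Cons v vs)
  have "norm (leibniz prod (\<lambda>a. F (v # a)) G vs) \<le> K * (C * norm v) * C' * 2 ^ length vs * prod_list (map norm vs)"
  proof (rule Cons.IH)
    show "norm (F (v # a)) \<le> C * norm v * prod_list (map norm a)" if "length a \<le> length vs" for a
      using Cons.prems(2)[of "v # a"] that by (simp add: mult_ac)
  qed (use Cons.prems in auto)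
  moreover have "norm (leibniz prod F (\<lambda>a. G (v # a)) vs) \<le> K * C * (C' * norm v) * 2 ^ length vs * prod_list (map norm vs)"
  proof (rule Cons.IH)
    show "norm (G (v # a)) \<le> C' * norm v * prod_list (map norm a)" if "length a \<le> length vs" for a
      using Cons.prems(4)[of "v # a"] that by (simp add: mult_ac)
  qed (use Cons.prems in auto)
  ultimately show ?case
    using norm_triangle_ineq[of "leibniz prod (\<lambda>a. F (v # a)) G vs" "leibniz prod F (\<lambda>a. G (v # a)) vs"]
    by (simp add: mult_ac)
qed

text \<open>Both jets at \<open>y\<close> are expanded to first order in \<open>h\<close>. By the
  recursion of \<open>leibniz\<close>, the terms linear in \<open>h\<close> add up to the value at
  \<open>h # vs\<close>; what remains is one remainder term for each factor and the product of the
  two first order parts.\<close>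

lemma smooth_on:
  assumes f: "smooth_on S f" and g: "smooth_on S g"
  shows "smooth_on S (\<lambda>x. prod (f x) (g x))"
proof (rule smooth_onI)
  let ?F = "\<lambda>x vs. iter_deriv f vs x" and ?G = "\<lambda>x vs. iter_deriv g vs x"
  let ?D = "\<lambda>x. leibniz prod (?F x) (?G x)"
  obtain K where K: "K > 0" "\<And>a b. norm (prod a b) \<le> norm a * norm b * K" using pos_bounded by blast
  note bound = norm_leibniz_le[OF less_imp_le[OF K(1)] K(2)]
  show "open S" using f by (rule smooth_on_open)
  show "?D x [] = prod (f x) (g x)" for x by simp
  fix x assume x: "x \<in> S"
  note DF = smooth_on_iter_deriv[OF f x] and DG = smooth_on_iter_deriv[OF g x]
  show "bounded_multilinear (?D x)"
    unfolding bounded_multilinear_def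
  proof (intro conjI allI)
    show "multilinear (?D x)"
      using DF(1) DG(1) by (intro multilinear_leibniz) (auto simp: bounded_multilinear_def)
    fix k
    obtain C where C: "C \<ge> 0" "\<And>vs. length vs \<le> k \<Longrightarrow> norm (?F x vs) \<le> C * prod_list (map norm vs)"
      using bounded_multilinear_bound[OF DF(1)] by metis
    obtain C' where C': "C' \<ge> 0" "\<And>vs. length vs \<le> k \<Longrightarrow> norm (?G x vs) \<le> C' * prod_list (map norm vs)"
      using bounded_multilinear_bound[OF DG(1)] by metis
    show "\<exists>C. \<forall>vs. length vs = k \<longrightarrow> norm (?D x vs) \<le> C * prod_list (map norm vs)"
    proof (intro exI allI impI)
      fix vs :: "'d list" assume "length vs = k"
      then show "norm (?D x vs) \<le> (K * C * C' * 2 ^ k) * prod_list (map norm vs)"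
        using bound[of C vs "?F x" C' "?G x"] C C' by simp
    qed
  qed
  show "jet_derivative ?D x"
    unfolding jet_derivative_def
  proof (intro allI impI)
    fix k and e :: real assume e: "e > 0"
    obtain C where C: "C \<ge> 0" "\<And>vs. length vs \<le> Suc k \<Longrightarrow> norm (?F x vs) \<le> C * prod_list (map norm vs)"
      using bounded_multilinear_bound[OF DF(1)] by metis
    obtain C' where C': "C' \<ge> 0" "\<And>vs. length vs \<le> Suc k \<Longrightarrow> norm (?G x vs) \<le> C' * prod_list (map norm vs)"
      using bounded_multilinear_bound[OF DG(1)] by metis
    \<comment> \<open>In the bracket \<open>2 * C\<close> bounds the first order expansion of
      \<open>f\<close>, \<open>2 * C' + 1\<close> the jet of \<open>g\<close> at \<open>y\<close>,
      and \<open>C * C'\<close> the term quadratic in \<open>h\<close>; the prefactor is that of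
      \<open>norm_leibniz_le\<close>.\<close>
    define c where "c = K * 2 ^ k * (2 * C + 2 * C' + 1 + C * C' + 1)"
    have "2 * C + 2 * C' + 1 + C * C' + 1 > 0" using mult_nonneg_nonneg[OF C(1) C'(1)] C(1) C'(1) by linarith
    then have c: "c > 0" using K(1) by (simp add: c_def)
    \<comment> \<open>\<open>d\<close> is both the accuracy demanded of the two jets and the radius
      for \<open>h\<close>. As a radius it makes the quadratic term small, and being at most 1 it
      gives a bound for the jet of \<open>g\<close> at \<open>y\<close> that does not depend on
      \<open>y\<close>.\<close>
    define d where "d = min 1 (e / c)"
    have d: "d > 0" "d \<le> 1" "c * d \<le> e" using e c by (auto simp: d_def min_def field_simps)
    have "\<forall>\<^sub>F y in at x. dist y x < d" using d(1) by (auto simp: eventually_at)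
    with jet_derivativeD[OF DF(2) d(1), of k] jet_derivativeD[OF DG(2) d(1), of k]
    show "\<forall>\<^sub>F y in at x. \<forall>vs. length vs = k \<longrightarrow>
      norm (?D y vs - ?D x vs - ?D x ((y - x) # vs)) \<le> e * norm (y - x) * prod_list (map norm vs)"
    proof eventually_elim
      case (elim y)
      define h where "h = y - x"
      have h: "norm h \<le> d" "norm h \<le> 1" using elim(3) d(2) by (auto simp: h_def dist_norm)
      define RF where "RF vs = ?F y vs - ?F x vs - ?F x (h # vs)" for vs
      define RG where "RG vs = ?G y vs - ?G x vs - ?G x (h # vs)" for vs
      have RF: "norm (RF vs) \<le> d * norm h * prod_list (map norm vs)" if "length vs \<le> k" for vs
        using elim(1) that by (simp add: RF_def h_def)
      have RG: "norm (RG vs) \<le> d * norm h * prod_list (map norm vs)" if "length vs \<le> k" for vs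
        using elim(2) that by (simp add: RG_def h_def)
      have Fy: "?F y = (\<lambda>vs. (?F x vs + ?F x (h # vs)) + RF vs)"
        and Gy: "?G y = (\<lambda>vs. (?G x vs + ?G x (h # vs)) + RG vs)"
        by (auto simp: RF_def RG_def)
      have Fh: "norm (?F x (h # vs)) \<le> (C * norm h) * prod_list (map norm vs)" if "length vs \<le> k" for vs
        using C(2)[of "h # vs"] that by (simp add: mult_ac)
      have Gh: "norm (?G x (h # vs)) \<le> (C' * norm h) * prod_list (map norm vs)" if "length vs \<le> k" for vs
        using C'(2)[of "h # vs"] that by (simp add: mult_ac)
      have F1: "norm (?F x vs + ?F x (h # vs)) \<le> (2 * C) * prod_list (map norm vs)" if "length vs \<le> k" for vs
      proof -
        have "norm (?F x vs + ?F x (h # vs)) \<le> C * prod_list (map norm vs) + (C * norm h) * prod_list (map norm vs)"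
          using C(2)[of vs] Fh[of vs] that by (intro norm_triangle_mono) auto
        also have "\<dots> \<le> C * prod_list (map norm vs) + (C * 1) * prod_list (map norm vs)"
          using C(1) h(2) by (intro add_mono mult_right_mono mult_left_mono) auto
        finally show ?thesis by simp
      qed
      have Gy_le: "norm (?G y vs) \<le> (2 * C' + 1) * prod_list (map norm vs)" if "length vs \<le> k" for vs
      proof -
        let ?p = "prod_list (map norm vs)"
        have "norm (?G y vs) \<le> norm (?G x vs + ?G x (h # vs)) + norm (RG vs)"
          using norm_triangle_ineq[of "?G x vs + ?G x (h # vs)" "RG vs"] by (simp add: RG_def)
        also have "\<dots> \<le> (C' * ?p + (C' * norm h) * ?p) + d * norm h * ?p"
          using C'(2)[of vs] Gh[of vs] RG[of vs] that by (intro add_mono norm_triangle_mono) auto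
        also have "\<dots> \<le> (C' * ?p + (C' * 1) * ?p) + 1 * 1 * ?p"
          using C'(1) h(2) d by (intro add_mono mult_right_mono mult_left_mono mult_mono) auto
        finally show ?thesis by (simp add: algebra_simps)
      qed
      show ?case
      proof (intro allI impI)
        fix vs :: "'d list" assume k: "length vs = k"
        let ?p = "prod_list (map norm vs)"
        have "?D y vs - ?D x vs - ?D x (h # vs)
          = leibniz prod RF (?G y) vs + leibniz prod (\<lambda>vs. ?F x vs + ?F x (h # vs)) RG vs
            + leibniz prod (\<lambda>vs. ?F x (h # vs)) (\<lambda>vs. ?G x (h # vs)) vs"
          by (subst Fy, subst leibniz_add_left, subst (1) Gy)
            (simp add: leibniz_add_left leibniz_add_right)
        also have "norm \<dots> \<le> K * (d * norm h) * (2 * C' + 1) * 2 ^ k * ?p + K * (2 * C) * (d * norm h) * 2 ^ k * ?p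
            + K * (C * norm h) * (C' * norm h) * 2 ^ k * ?p"
          using k d C C' RF RG Gy_le F1 Fh Gh
          by (intro norm_triangle_mono bound[of _ vs, unfolded k]) auto
        also have "\<dots> = K * 2 ^ k * (d * (2 * C' + 1 + 2 * C) + C * C' * norm h) * norm h * ?p"
          by (simp add: algebra_simps)
        also have "\<dots> \<le> K * 2 ^ k * (d * (2 * C' + 1 + 2 * C) + C * C' * d) * norm h * ?p"
          using K C C' h d by (intro mult_right_mono mult_left_mono add_mono) auto
        also have "\<dots> \<le> c * d * norm h * ?p"
        proof -
          have "K * 2 ^ k * (d * (2 * C' + 1 + 2 * C) + C * C' * d) \<le> c * d"
            using K(1) d by (simp add: c_def algebra_simps)
          then show ?thesis by (intro mult_right_mono) auto
        qed
        also have "\<dots> \<le> e * norm h * ?p" using d by (intro mult_right_mono) auto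
        finally show "norm (?D y vs - ?D x vs - ?D x ((y - x) # vs)) \<le> e * norm (y - x) * ?p"
          by (simp add: h_def)
      qed
    qed
  qed
qed

end


section \<open>Sums and products of smooth functions\<close>

lemma smooth_on_add:
  assumes "smooth_on S f" "smooth_on S g"
  shows "smooth_on S (\<lambda>x. f x + g x)"
proof -
  have S: "open S" using assms(1) by (rule smooth_on_open)

  show ?thesis
  proof (rule smooth_onI[where D = "\<lambda>x vs. iter_deriv f vs x + iter_deriv g vs x"])
    fix x assume x: "x \<in> S"
    note Df = smooth_on_iter_deriv[OF assms(1) x] and Dg = smooth_on_iter_deriv[OF assms(2) x]
    show "bounded_multilinear (\<lambda>vs. iter_deriv f vs x + iter_deriv g vs x)"
      unfolding bounded_multilinear_def
    proof (intro conjI allI)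
      show "multilinear (\<lambda>vs. iter_deriv f vs x + iter_deriv g vs x)"
        using Df(1) Dg(1) by (intro multilinear_plus) (auto simp: bounded_multilinear_def)
      fix k
      obtain C where C: "\<And>vs. length vs \<le> k \<Longrightarrow> norm (iter_deriv f vs x) \<le> C * prod_list (map norm vs)"
        using bounded_multilinear_bound[OF Df(1)] by metis
      obtain C' where C': "\<And>vs. length vs \<le> k \<Longrightarrow> norm (iter_deriv g vs x) \<le> C' * prod_list (map norm vs)"
        using bounded_multilinear_bound[OF Dg(1)] by metis
      show "\<exists>C. \<forall>vs. length vs = k \<longrightarrow> norm (iter_deriv f vs x + iter_deriv g vs x) \<le> C * prod_list (map norm vs)"
      proof (intro exI[of _ "C + C'"] allI impI)
        fix vs :: "'a list" assume "length vs = k"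
        then show "norm (iter_deriv f vs x + iter_deriv g vs x) \<le> (C + C') * prod_list (map norm vs)"
          unfolding distrib_right by (intro norm_triangle_mono C C') auto
      qed
    qed
    show "jet_derivative (\<lambda>x vs. iter_deriv f vs x + iter_deriv g vs x) x"
      unfolding jet_derivative_def
    proof (intro allI impI)
      fix k and e :: real assume "e > 0"
      then have e: "e / 2 > 0" by simp
      from jet_derivativeD[OF Df(2) e, of k] jet_derivativeD[OF Dg(2) e, of k]
      show "\<forall>\<^sub>F y in at x. \<forall>vs. length vs = k \<longrightarrow> norm (iter_deriv f vs y + iter_deriv g vs y
          - (iter_deriv f vs x + iter_deriv g vs x) - (iter_deriv f ((y - x) # vs) x + iter_deriv g ((y - x) # vs) x))
        \<le> e * norm (y - x) * prod_list (map norm vs)"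
      proof eventually_elim
        case (elim y)
        show ?case
        proof (intro allI impI)
          fix vs :: "'a list" assume k: "length vs = k"
          let ?p = "prod_list (map norm vs)"
          have "norm (iter_deriv f vs y + iter_deriv g vs y - (iter_deriv f vs x + iter_deriv g vs x)
            - (iter_deriv f ((y - x) # vs) x + iter_deriv g ((y - x) # vs) x))
            = norm ((iter_deriv f vs y - iter_deriv f vs x - iter_deriv f ((y - x) # vs) x)
              + (iter_deriv g vs y - iter_deriv g vs x - iter_deriv g ((y - x) # vs) x))"
            by (simp add: algebra_simps)
          also have "\<dots> \<le> e / 2 * norm (y - x) * ?p + e / 2 * norm (y - x) * ?p"
            using elim k by (intro norm_triangle_mono) auto
          finally show "norm (iter_deriv f vs y + iter_deriv g vs y - (iter_deriv f vs x + iter_deriv g vs x)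
            - (iter_deriv f ((y - x) # vs) x + iter_deriv g ((y - x) # vs) x)) \<le> e * norm (y - x) * ?p"
            by (simp add: field_simps)
        qed
      qed
    qed
  qed (use S in auto)
qed

lemma smooth_on_sum:
  assumes "open S" "\<And>i. i \<in> I \<Longrightarrow> smooth_on S (f i)"
  shows "smooth_on S (\<lambda>x. \<Sum>i\<in>I. f i x)"
  using assms by (induction I rule: infinite_finite_induct) (auto intro: smooth_on_add)

lemma smooth_on_scaleR:
  "smooth_on S f \<Longrightarrow> smooth_on S g \<Longrightarrow> smooth_on S (\<lambda>x. f x *\<^sub>R g x)"
  by (rule bounded_bilinear.smooth_on[OF bounded_bilinear_scaleR])

lemma smooth_on_prod_list:
  fixes f :: "'i \<Rightarrow> 'a::real_normed_vector \<Rightarrow> real"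
  assumes "open S" "\<And>i. i \<in> set is \<Longrightarrow> smooth_on S (f i)"
  shows "smooth_on S (\<lambda>x. prod_list (map (\<lambda>i. f i x) is))"
  using assms by (induction "is") (auto intro: bounded_bilinear.smooth_on[OF bounded_bilinear_mult])

lemma smooth_on_precompose_linear:
  assumes "bounded_linear A" "smooth_on S f" "open T" "\<And>x. x \<in> T \<Longrightarrow> A x \<in> S"
  shows "smooth_on T (\<lambda>x. f (A x))"
  using smooth_on_precompose_affine[OF assms(1,2,3), of 0] assms(4) by simp

subsection \<open>Smooth maps on Euclidean spaces\<close>

definition lists_of :: "'a set \<Rightarrow> nat \<Rightarrow> 'a list set"
  where "lists_of B k = {bs. set bs \<subseteq> B \<and> length bs = k}"

lemma lists_of_0 [simp]: "lists_of B 0 = {[]}"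
  by (auto simp: lists_of_def)

lemma lists_of_Suc: "lists_of B (Suc k) = (\<lambda>(b, bs). b # bs) ` (B \<times> lists_of B k)"
  by (auto simp: lists_of_def length_Suc_conv image_iff)

lemma finite_lists_of [simp]: "finite B \<Longrightarrow> finite (lists_of B k)"
  unfolding lists_of_def by (rule finite_lists_length_eq)

lemma sum_lists_of_Suc:
  "(\<Sum>bs\<in>lists_of B (Suc k). f bs) = (\<Sum>b\<in>B. \<Sum>bs\<in>lists_of B k. f (b # bs))"
  unfolding lists_of_Suc sum.cartesian_product by (subst sum.reindex) (auto simp: inj_on_def intro!: sum.cong)

text \<open>The coefficient of \<open>bs\<close> in the tensor product of the vectors
  \<open>vs\<close>, if \<open>c v b\<close> is the coefficient of \<open>b\<close> in
  \<open>v\<close>. When \<open>c\<close> is a Gram matrix, it is an entry of a tensor power of that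
  matrix.\<close>

definition list_coeff :: "('u \<Rightarrow> 'b \<Rightarrow> real) \<Rightarrow> 'u list \<Rightarrow> 'b list \<Rightarrow> real"
  where "list_coeff c vs bs = prod_list (map2 c vs bs)"

lemma list_coeff_Cons [simp]: "list_coeff c (v # vs) (b # bs) = c v b * list_coeff c vs bs"
  by (simp add: list_coeff_def)

lemma list_coeff_Nil [simp]: "list_coeff c [] bs = 1"
  by (simp add: list_coeff_def)

text \<open>The spanning set is left open because both the standard basis and a basis orthonormal
  for the metric $g_0$ are used.\<close>

lemma multilinear_expand_basis:
  fixes M :: "'v::euclidean_space list \<Rightarrow> 'h::real_vector"
  assumes "multilinear M" and B: "finite B" "\<And>v. v = (\<Sum>b\<in>B. c v b *\<^sub>R b)"
  shows "M vs = (\<Sum>bs\<in>lists_of B (length vs). list_coeff c vs bs *\<^sub>R M bs)"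
  using assms(1)
proof (induction vs arbitrary: M)
  case (Cons v vs)
  have "M (v # vs) = M ([] @ (\<Sum>b\<in>B. c v b *\<^sub>R b) # vs)" by (simp flip: B(2))
  also have "\<dots> = (\<Sum>b\<in>B. c v b *\<^sub>R M (b # vs))"
    by (subst multilinear_sum[OF Cons.prems B(1)]) auto
  also have "\<dots> = (\<Sum>b\<in>B. c v b *\<^sub>R (\<Sum>bs\<in>lists_of B (length vs). list_coeff c vs bs *\<^sub>R M (b # bs)))"
    using Cons.IH[OF multilinear_Cons[OF Cons.prems]] by simp
  finally show ?case by (simp add: sum_lists_of_Suc scaleR_sum_right)
qed simp

lemma multilinear_expand:
  fixes M :: "'v::euclidean_space list \<Rightarrow> 'h::real_vector"
  assumes "multilinear M"
  shows "M vs = (\<Sum>bs\<in>lists_of Basis (length vs). list_coeff (\<bullet>) vs bs *\<^sub>R M bs)"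
  by (rule multilinear_expand_basis[OF assms]) (auto simp: euclidean_representation)

lemma abs_list_coeff_le:
  "bs \<in> lists_of Basis (length vs) \<Longrightarrow> \<bar>list_coeff (\<bullet>) vs bs\<bar> \<le> prod_list (map norm vs)"
proof (induction vs arbitrary: bs)
  case (Cons v vs)
  then obtain b cs where bs: "bs = b # cs" "b \<in> Basis" "cs \<in> lists_of Basis (length vs)"
    by (auto simp: lists_of_Suc)
  then show ?case using Cons.IH[OF bs(3)] Basis_le_norm[OF bs(2), of v]
    by (simp add: abs_mult mult_mono)
qed simp

text \<open>On a Euclidean space an estimate uniform over all directions reduces to the finitely
  many lists of basis vectors.\<close>

lemma multilinear_norm_le:
  fixes M :: "'v::euclidean_space list \<Rightarrow> 'h::real_normed_vector"
  assumes "multilinear M"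
  shows "norm (M vs) \<le> (\<Sum>bs\<in>lists_of Basis (length vs). norm (M bs)) * prod_list (map norm vs)"
proof -
  have "norm (M vs) \<le> (\<Sum>bs\<in>lists_of Basis (length vs). \<bar>list_coeff (\<bullet>) vs bs\<bar> * norm (M bs))"
    by (subst multilinear_expand[OF assms]) (rule order_trans[OF norm_sum], simp)
  also have "\<dots> \<le> (\<Sum>bs\<in>lists_of Basis (length vs). prod_list (map norm vs) * norm (M bs))"
    by (intro sum_mono mult_right_mono abs_list_coeff_le) auto
  finally show ?thesis by (simp add: sum_distrib_left mult.commute)
qed

lemma multilinear_diff: "multilinear F \<Longrightarrow> multilinear G \<Longrightarrow> multilinear (\<lambda>vs. F vs - G vs)"
  by (simp add: multilinear_def scaleR_diff_right)

text \<open>Uniformity over the directions comes for free in finite dimensions, so closure of a set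
  of functions under directional derivatives already generates a whole jet. This avoids any explicit
  formula for higher derivatives.\<close>

lemma smooth_on_coinduct:
  fixes S :: "'a::euclidean_space set" and \<F> :: "('a \<Rightarrow> 'b::real_normed_vector) set"
  assumes S: "open S" and f: "f \<in> \<F>"
    and step: "\<And>f. f \<in> \<F> \<Longrightarrow>
      \<exists>f'. (\<forall>x\<in>S. (f has_derivative f' x) (at x)) \<and> (\<forall>v. (\<lambda>x. f' x v) \<in> \<F>)"
  shows "smooth_on S f"
proof -
  obtain d where d: "\<And>f x. f \<in> \<F> \<Longrightarrow> x \<in> S \<Longrightarrow> (f has_derivative d f x) (at x)"
    "\<And>f v. f \<in> \<F> \<Longrightarrow> (\<lambda>x. d f x v) \<in> \<F>"
    using step by metis
  \<comment> \<open>The chosen derivatives are iterated along the list from its tail, so that the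
    head is the outermost direction.\<close>
  define g where "g vs = rec_list f (\<lambda>v _ h x. d h x v) vs" for vs
  have g_Nil: "g [] = f" and g_Cons: "g (v # vs) = (\<lambda>x. d (g vs) x v)" for v vs
    by (auto simp: g_def)
  have g_in: "g vs \<in> \<F>" for vs
    by (induction vs) (auto simp: g_Nil g_Cons f d(2))
  have deriv: "(g vs has_derivative (\<lambda>v. g (v # vs) x)) (at x)" if "x \<in> S" for x vs
    using d(1)[OF g_in that] by (simp add: g_Cons)
  define D where "D x vs = g vs x" for x vs
  have mult: "multilinear (D x)" if "x \<in> S" for x
    unfolding multilinear_def D_def
  proof (intro conjI allI)
    fix us vs :: "'a list" and u v :: 'a and r :: real
    have lin: "linear (\<lambda>v. g (v # vs) x)" if "x \<in> S" for x vs
      using has_derivative_linear[OF deriv[OF that]] .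
    \<comment> \<open>Linearity behind a prefix is obtained by differentiating the identity for the
      shorter prefix, which holds on all of the open set \<open>S\<close>.\<close>
    show "g (us @ (u + v) # vs) x = g (us @ u # vs) x + g (us @ v # vs) x"
      using \<open>x \<in> S\<close>
    proof (induction us arbitrary: x)
      case (Cons w us)
      have "((\<lambda>x. g (us @ u # vs) x + g (us @ v # vs) x) has_derivative
        (\<lambda>w. g (w # us @ u # vs) x + g (w # us @ v # vs) x)) (at x)"
        by (intro has_derivative_add deriv Cons.prems)
      then have "(g (us @ (u + v) # vs) has_derivative
        (\<lambda>w. g (w # us @ u # vs) x + g (w # us @ v # vs) x)) (at x)"
        by (rule has_derivative_transform_within_open[OF _ S Cons.prems]) (simp add: Cons.IH)
      from has_derivative_unique[OF this deriv[OF Cons.prems]] show ?case by (metis append_Cons)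
    qed (simp add: linear_add[OF lin])
    show "g (us @ (r *\<^sub>R u) # vs) x = r *\<^sub>R g (us @ u # vs) x"
      using \<open>x \<in> S\<close>
    proof (induction us arbitrary: x)
      case (Cons w us)
      have "((\<lambda>x. r *\<^sub>R g (us @ u # vs) x) has_derivative (\<lambda>w. r *\<^sub>R g (w # us @ u # vs) x)) (at x)"
        by (intro has_derivative_scaleR_right deriv Cons.prems)
      then have "(g (us @ (r *\<^sub>R u) # vs) has_derivative (\<lambda>w. r *\<^sub>R g (w # us @ u # vs) x)) (at x)"
        by (rule has_derivative_transform_within_open[OF _ S Cons.prems]) (simp add: Cons.IH)
      from has_derivative_unique[OF this deriv[OF Cons.prems]] show ?case by (metis append_Cons)
    qed (simp add: linear_scale[OF lin])
  qed
  show ?thesis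
  proof (rule smooth_onI[OF S, where D = D])
    fix x assume x: "x \<in> S"
    show "D x [] = f x" by (simp add: D_def g_Nil)
    show "bounded_multilinear (D x)"
      unfolding bounded_multilinear_def using mult[OF x] multilinear_norm_le[OF mult[OF x]] by metis
    show "jet_derivative D x"
      unfolding jet_derivative_def
    proof (intro allI impI)
      fix k and e :: real assume e: "e > 0"
      let ?B = "lists_of (Basis::'a set) k"
      define e' where "e' = e / (1 + card ?B)"
      have e': "e' > 0" using e by (simp add: e'_def add_pos_nonneg)
      have ce: "card ?B * e' \<le> e"
      proof -
        have "card ?B * e' \<le> (1 + card ?B) * e'" using e' by (intro mult_right_mono) auto
        also have "\<dots> = e" by (simp add: e'_def add_pos_nonneg)
        finally show ?thesis .
      qed
      have "\<forall>\<^sub>F y in at x. norm (D y bs - D x bs - D x ((y - x) # bs)) \<le> e' * norm (y - x)" for bs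
      proof -
        have "((\<lambda>y. norm ((g bs y - g bs x) - g ((y - x) # bs) x) / norm (y - x)) \<longlongrightarrow> 0) (at x)"
          using deriv[OF x, of bs] unfolding has_derivative_iff_norm by simp
        from tendstoD[OF this e'] show ?thesis
        proof eventually_elim
          case (elim y)
          show ?case
          proof (cases "y = x")
            case True
            have "D x (0 # bs) = 0"
              using multilinear_head(2)[OF mult[OF x], of 0 0 bs] by simp
            then show ?thesis using True by simp
          next
            case False
            then show ?thesis using elim by (simp add: D_def divide_less_eq)
          qed
        qed
      qed
      then have "\<forall>\<^sub>F y in at x. \<forall>bs\<in>?B. norm (D y bs - D x bs - D x ((y - x) # bs)) \<le> e' * norm (y - x)"
        by (simp add: eventually_ball_finite)
      moreover have "\<forall>\<^sub>F y in at x. y \<in> S"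
        using S x eventually_at_in_open' by blast
      ultimately show "\<forall>\<^sub>F y in at x. \<forall>vs. length vs = k \<longrightarrow>
        norm (D y vs - D x vs - D x ((y - x) # vs)) \<le> e * norm (y - x) * prod_list (map norm vs)"
      proof eventually_elim
        case (elim y)
        show ?case
        proof (intro allI impI)
          fix vs :: "'a list" assume k: "length vs = k"
          have "multilinear (\<lambda>vs. D y vs - D x vs - D x ((y - x) # vs))"
            by (intro multilinear_diff mult multilinear_Cons x elim)
          from multilinear_norm_le[OF this, of vs]
          have "norm (D y vs - D x vs - D x ((y - x) # vs))
            \<le> (\<Sum>bs\<in>?B. norm (D y bs - D x bs - D x ((y - x) # bs))) * prod_list (map norm vs)"
            by (simp add: k)
          also have "\<dots> \<le> (\<Sum>bs\<in>?B. e' * norm (y - x)) * prod_list (map norm vs)"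
            using elim by (intro mult_right_mono sum_mono) auto
          also have "\<dots> = (card ?B * e') * norm (y - x) * prod_list (map norm vs)" by simp
          also have "\<dots> \<le> e * norm (y - x) * prod_list (map norm vs)"
            using ce by (intro mult_right_mono) auto
          finally show "norm (D y vs - D x vs - D x ((y - x) # vs)) \<le> e * norm (y - x) * prod_list (map norm vs)" .
        qed
      qed
    qed
  qed
qed

text \<open>The chain and product rules make this set closed under directional derivatives.\<close>

inductive_set chain_span :: "'a::euclidean_space set \<Rightarrow> 'c::euclidean_space set \<Rightarrow> ('a \<Rightarrow> 'c) \<Rightarrow>
    ('a \<Rightarrow> 'b::real_normed_vector) set"
  for S T h where
  zero: "(\<lambda>x. 0) \<in> chain_span S T h"
| mult: "smooth_on S k \<Longrightarrow> smooth_on T g \<Longrightarrow> (\<lambda>x. k x *\<^sub>R g (h x)) \<in> chain_span S T h"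
| add: "f \<in> chain_span S T h \<Longrightarrow> f' \<in> chain_span S T h \<Longrightarrow> (\<lambda>x. f x + f' x) \<in> chain_span S T h"

lemma chain_span_sum:
  "finite I \<Longrightarrow> (\<And>i. i \<in> I \<Longrightarrow> f i \<in> chain_span S T h) \<Longrightarrow> (\<lambda>x. \<Sum>i\<in>I. f i x) \<in> chain_span S T h"
  by (induction rule: finite_induct) (auto intro: chain_span.intros)

lemma smooth_on_compose:
  fixes S :: "'a::euclidean_space set" and T :: "'c::euclidean_space set"
    and g :: "'c \<Rightarrow> 'b::real_normed_vector"
  assumes h: "smooth_on S h" and g: "smooth_on T g" and ST: "\<And>x. x \<in> S \<Longrightarrow> h x \<in> T"
  shows "smooth_on S (\<lambda>x. g (h x))"
proof (rule smooth_on_coinduct[where \<F> = "chain_span S T h"])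
  show S: "open S" using h by (rule smooth_on_open)
  show "(\<lambda>x. g (h x)) \<in> chain_span S T h"
    using chain_span.mult[of S "\<lambda>_. 1" T g h] S g by simp
  fix f :: "'a \<Rightarrow> 'b" assume "f \<in> chain_span S T h"
  then show "\<exists>f'. (\<forall>x\<in>S. (f has_derivative f' x) (at x)) \<and> (\<forall>v. (\<lambda>x. f' x v) \<in> chain_span S T h)"
  proof induction
    case zero
    then show ?case by (intro exI[of _ "\<lambda>x v. 0"]) (auto intro: chain_span.zero)
  next
    case (mult k g)
    define h' where "h' x v = iter_deriv h [v] x" for x v
    define k' where "k' x v = iter_deriv k [v] x" for x v
    define g' where "g' y w = iter_deriv g [w] y" for y w
    have sm: "smooth_on S (\<lambda>x. h' x v)" "smooth_on S (\<lambda>x. k' x v)" "smooth_on T (\<lambda>y. g' y w)" for v w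
      using smooth_on_directional[OF h] smooth_on_directional[OF mult(1)] smooth_on_directional[OF mult(2)]
      by (auto simp: h'_def k'_def g'_def)
    \<comment> \<open>Expanding \<open>h' x v\<close> in the basis puts everything that does not
      pass through \<open>h\<close> into scalar coefficients, so each summand is again a smooth
      scalar times a smooth function of \<open>h x\<close>.\<close>
    define f' where "f' x v = (\<Sum>b\<in>Basis. (k x * (h' x v \<bullet> b)) *\<^sub>R g' (h x) b) + k' x v *\<^sub>R g (h x)" for x v
    have "((\<lambda>x. k x *\<^sub>R g (h x)) has_derivative f' x) (at x)" if x: "x \<in> S" for x
    proof -
      have dh: "(h has_derivative h' x) (at x)" and dk: "(k has_derivative k' x) (at x)"
        and dg: "(g has_derivative g' (h x)) (at (h x))"
        unfolding h'_def k'_def g'_def using h mult x ST by (auto intro!: smooth_on_has_derivative simp del: iter_deriv.simps)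
      from has_derivative_scaleR[OF dk has_derivative_compose[OF dh dg]]
      have "((\<lambda>x. k x *\<^sub>R g (h x)) has_derivative (\<lambda>v. k x *\<^sub>R g' (h x) (h' x v) + k' x v *\<^sub>R g (h x))) (at x)" .
      moreover have "k x *\<^sub>R g' (h x) (h' x v) = (\<Sum>b\<in>Basis. (k x * (h' x v \<bullet> b)) *\<^sub>R g' (h x) b)" for v
      proof -
        have lin: "linear (g' (h x))" using dg by (rule has_derivative_linear)
        have "g' (h x) (h' x v) = g' (h x) (\<Sum>b\<in>Basis. (h' x v \<bullet> b) *\<^sub>R b)" by (simp add: euclidean_representation)
        also have "\<dots> = (\<Sum>b\<in>Basis. (h' x v \<bullet> b) *\<^sub>R g' (h x) b)" by (simp add: linear_sum[OF lin] linear_scale[OF lin])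
        finally show ?thesis by (simp add: scaleR_sum_right)
      qed
      ultimately show ?thesis by (simp add: f'_def[abs_def])
    qed
    moreover have "(\<lambda>x. f' x v) \<in> chain_span S T h" for v
      unfolding f'_def
    proof (intro chain_span.add chain_span_sum chain_span.mult sm mult)
      show "smooth_on S (\<lambda>x. k x * (h' x v \<bullet> b))" for b
        by (rule bounded_bilinear.smooth_on[OF bounded_bilinear_mult mult(1)
            smooth_on_compose_linear[OF bounded_linear_inner_left sm(1)]])
    qed auto
    ultimately show ?case by (intro exI[of _ f']) auto
  next
    case (add f1 f2)
    then obtain f1' f2' where
      "\<And>x. x \<in> S \<Longrightarrow> (f1 has_derivative f1' x) (at x)" "\<And>v. (\<lambda>x. f1' x v) \<in> chain_span S T h"
      "\<And>x. x \<in> S \<Longrightarrow> (f2 has_derivative f2' x) (at x)" "\<And>v. (\<lambda>x. f2' x v) \<in> chain_span S T h"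
      by blast
    then show ?case
      by (intro exI[of _ "\<lambda>x v. f1' x v + f2' x v"]) (auto intro: has_derivative_add chain_span.add)
  qed
qed

subsection \<open>The Hilbert space of square integrable functions\<close>

lemma square_integrable_rep_l2: "square_integrable (rep_l2 f)"
  using Quotient3_rep_reflp[OF Quotient3_l2, of f] by simp

lemma abs_l2_rep_l2: "abs_l2 (rep_l2 f) = f"
  by (rule Quotient3_abs_rep[OF Quotient3_l2])

lemma square_integrable_diff:
  "square_integrable f \<Longrightarrow> square_integrable g \<Longrightarrow> square_integrable (\<lambda>x. f x - g x)"
  using square_integrable_add[of f "\<lambda>x. (- 1) * g x"] square_integrable_cmult[of g "- 1"] by simp

lemma diff_abs_l2:
  assumes "square_integrable f" "square_integrable g"
  shows "abs_l2 f - abs_l2 g = abs_l2 (\<lambda>x. f x - g x)"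
  using assms square_integrable_cmult[OF assms(2), of "- 1"]
  by (simp add: minus_l2_def uminus_l2_def scaleC_l2.abs_eq plus_l2.abs_eq)

lemma power2_norm_abs_l2:
  assumes "square_integrable f"
  shows "(norm (abs_l2 f))\<^sup>2 = (\<integral>x. (cmod (f x))\<^sup>2 \<partial>lborel)"
proof -
  have "(norm (abs_l2 f))\<^sup>2 = Re (\<integral>x. cnj (f x) * f x \<partial>lborel)"
    using assms by (simp add: power2_norm_eq_inner inner_l2_def cinner_l2.abs_eq)
  then show ?thesis by (simp only: cnj_mult_self integral_complex_of_real Re_complex_of_real)
qed

lemma nn_integral_diff_l2:
  assumes "square_integrable f" "square_integrable g"
  shows "(\<integral>\<^sup>+x. ennreal ((cmod (f x - g x))\<^sup>2) \<partial>lborel) = ennreal ((norm (abs_l2 f - abs_l2 g))\<^sup>2)"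
  using square_integrable_diff[OF assms]
  unfolding diff_abs_l2[OF assms] power2_norm_abs_l2[OF square_integrable_diff[OF assms]]
  by (intro nn_integral_eq_integral) (simp_all add: square_integrable_def)

text \<open>Fast Cauchy sequences converge almost everywhere because $2a \le 2^k a^2 + 2^{-k}$; the limit is one
  in norm by Fatou's lemma.\<close>

lemma fast_Cauchy_l2:
  fixes Y :: "nat \<Rightarrow> 'l::euclidean_space l2"
  assumes Y: "\<And>n k. n \<le> k \<Longrightarrow> norm (Y k - Y n) \<le> (1 / 2) ^ n"
  shows "\<exists>L. \<forall>n. norm (L - Y n) \<le> (1 / 2) ^ n"
proof -
  define u where "u n = rep_l2 (Y n)" for n
  have u: "square_integrable (u n)" "Y n = abs_l2 (u n)" for n
    by (auto simp: u_def square_integrable_rep_l2 abs_l2_rep_l2)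
  have [measurable]: "u n \<in> borel_measurable lborel" for n
    using u(1) by (simp add: square_integrable_def)
  \<comment> \<open>The weights \<open>2 ^ k\<close> still leave a convergent geometric series,
    because the squared norms of the increments are at most $4^{-k}$.\<close>
  have ae: "AE x in lborel. convergent (\<lambda>n. u n x)"
  proof -
    have "(\<integral>\<^sup>+x. (\<Sum>k. ennreal (2 ^ k * (cmod (u (Suc k) x - u k x))\<^sup>2)) \<partial>lborel)
      = (\<Sum>k. \<integral>\<^sup>+x. ennreal (2 ^ k * (cmod (u (Suc k) x - u k x))\<^sup>2) \<partial>lborel)"
      by (rule nn_integral_suminf) measurable
    also have "\<dots> = (\<Sum>k. ennreal (2 ^ k) * ennreal ((norm (Y (Suc k) - Y k))\<^sup>2))"
      by (simp add: ennreal_mult nn_integral_cmult nn_integral_diff_l2 u)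
    also have "\<dots> \<le> (\<Sum>k. ennreal ((1 / 2) ^ k))"
    proof (rule suminf_le)
      fix k
      have "(norm (Y (Suc k) - Y k))\<^sup>2 \<le> ((1 / 2) ^ k)\<^sup>2"
        using Y[of k "Suc k"] by (intro power_mono) auto
      then have "2 ^ k * (norm (Y (Suc k) - Y k))\<^sup>2 \<le> 2 ^ k * ((1 / 2) ^ k)\<^sup>2"
        by (intro mult_left_mono) auto
      also have "\<dots> = (1 / 2) ^ k" by (simp add: power2_eq_square power_one_over)
      finally show "ennreal (2 ^ k) * ennreal ((norm (Y (Suc k) - Y k))\<^sup>2) \<le> ennreal ((1 / 2) ^ k)"
        by (simp flip: ennreal_mult add: ennreal_leI)
    qed auto
    also have "\<dots> = ennreal (\<Sum>k. (1 / 2) ^ k)"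
      by (intro suminf_ennreal2) (auto intro: summable_geometric)
    finally have "(\<integral>\<^sup>+x. (\<Sum>k. ennreal (2 ^ k * (cmod (u (Suc k) x - u k x))\<^sup>2)) \<partial>lborel) \<noteq> \<infinity>"
      using ennreal_less_top top.not_eq_extremum by (metis infinity_ennreal_def leD)
    then have "AE x in lborel. (\<Sum>k. ennreal (2 ^ k * (cmod (u (Suc k) x - u k x))\<^sup>2)) \<noteq> \<infinity>"
      by (intro nn_integral_noteq_infinite) auto
    then show ?thesis
    proof eventually_elim
      case (elim x)
      have "summable (\<lambda>k. 2 ^ k * (cmod (u (Suc k) x - u k x))\<^sup>2)"
        using elim by (intro summable_suminf_not_top) auto
      then have "summable (\<lambda>k. 2 ^ k * (cmod (u (Suc k) x - u k x))\<^sup>2 + (1 / 2) ^ k)"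
        by (intro summable_add summable_geometric) auto
      then have "summable (\<lambda>k. u (Suc k) x - u k x)"
      proof (rule summable_comparison_test'[where N = 0])
        fix k
        let ?a = "cmod (u (Suc k) x - u k x)"
        have "2 * ?a = 2 * (sqrt (2 ^ k) * ?a) * sqrt ((1 / 2) ^ k)"
          by (simp add: power_one_over real_sqrt_divide)
        also have "\<dots> \<le> (sqrt (2 ^ k) * ?a)\<^sup>2 + (sqrt ((1 / 2) ^ k))\<^sup>2" by (rule sum_squares_bound)
        finally have "2 * ?a \<le> 2 ^ k * ?a\<^sup>2 + (1 / 2) ^ k" by (simp add: power_mult_distrib)
        then show "?a \<le> 2 ^ k * ?a\<^sup>2 + (1 / 2) ^ k" by (smt (verit) norm_ge_zero)
      qed
      then have "convergent (\<lambda>n. (\<Sum>k<n. u (Suc k) x - u k x) + u 0 x)"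
        by (intro convergent_add convergent_const) (simp add: summable_iff_convergent)
      moreover have "(\<Sum>k<n. u (Suc k) x - u k x) + u 0 x = u n x" for n
        using sum_lessThan_telescope[of "\<lambda>k. u k x" n] by simp
      ultimately show "convergent (\<lambda>n. u n x)" by simp
    qed
  qed
  define v where "v x = lim (\<lambda>n. u n x)" for x
  have [measurable]: "v \<in> borel_measurable lborel"
    unfolding v_def by (rule borel_measurable_lim_metric) measurable
  have le: "(\<integral>\<^sup>+x. ennreal ((cmod (v x - u n x))\<^sup>2) \<partial>lborel) \<le> ennreal (((1 / 2) ^ n)\<^sup>2)" for n
  proof -
    have "(\<integral>\<^sup>+x. ennreal ((cmod (v x - u n x))\<^sup>2) \<partial>lborel)
      = (\<integral>\<^sup>+x. liminf (\<lambda>k. ennreal ((cmod (u k x - u n x))\<^sup>2)) \<partial>lborel)"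
    proof (rule nn_integral_cong_AE)
      show "AE x in lborel. ennreal ((cmod (v x - u n x))\<^sup>2) = liminf (\<lambda>k. ennreal ((cmod (u k x - u n x))\<^sup>2))"
        using ae
      proof eventually_elim
        case (elim x)
        then have "(\<lambda>k. u k x) \<longlonglongrightarrow> v x" by (simp add: v_def convergent_LIMSEQ_iff)
        then have "(\<lambda>k. ennreal ((cmod (u k x - u n x))\<^sup>2)) \<longlonglongrightarrow> ennreal ((cmod (v x - u n x))\<^sup>2)"
          by (intro tendsto_intros)
        from lim_imp_Liminf[OF _ this] show ?case by simp
      qed
    qed
    also have "\<dots> \<le> liminf (\<lambda>k. \<integral>\<^sup>+x. ennreal ((cmod (u k x - u n x))\<^sup>2) \<partial>lborel)"
      by (rule nn_integral_liminf) measurable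
    also have "\<dots> = liminf (\<lambda>k. ennreal ((norm (Y k - Y n))\<^sup>2))"
      by (simp add: nn_integral_diff_l2 u)
    also have "\<dots> \<le> liminf (\<lambda>k. ennreal (((1 / 2) ^ n)\<^sup>2))"
    proof (rule Liminf_mono)
      have "ennreal ((norm (Y k - Y n))\<^sup>2) \<le> ennreal (((1 / 2) ^ n)\<^sup>2)" if "k \<ge> n" for k
        using Y[OF that] by (intro ennreal_leI power_mono) auto
      then show "\<forall>\<^sub>F k in sequentially. ennreal ((norm (Y k - Y n))\<^sup>2) \<le> ennreal (((1 / 2) ^ n)\<^sup>2)"
        using eventually_sequentially by blast
    qed
    finally show ?thesis by (simp add: Liminf_const)
  qed
  have d: "square_integrable (\<lambda>x. v x - u n x)" for n
  proof -
    have "integrable lborel (\<lambda>x. (cmod (v x - u n x))\<^sup>2)"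
      using le[of n] by (intro integrableI_bounded) (auto intro: le_less_trans)
    then show ?thesis by (simp add: square_integrable_def)
  qed
  have v: "square_integrable v"
    using square_integrable_add[OF d[of 0] u(1)[of 0]] by simp
  show ?thesis
  proof (intro exI allI)
    fix n
    have "(norm (abs_l2 v - Y n))\<^sup>2 \<le> ((1 / 2) ^ n)\<^sup>2"
      using le[of n] nn_integral_diff_l2[OF v u(1)[of n]] by (simp flip: u(2))
    then show "norm (abs_l2 v - Y n) \<le> (1 / 2) ^ n" by (rule power2_le_imp_le) simp
  qed
qed

instance l2 :: (euclidean_space) complete_space
proof
  fix X :: "nat \<Rightarrow> 'a l2" assume "Cauchy X"
  then have "\<forall>k. \<exists>N. \<forall>m\<ge>N. \<forall>n\<ge>N. norm (X m - X n) < (1 / 2) ^ k"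
    unfolding Cauchy_iff by (metis half_gt_zero_iff zero_less_one zero_less_power)
  then obtain N where N: "\<And>k m n. m \<ge> N k \<Longrightarrow> n \<ge> N k \<Longrightarrow> norm (X m - X n) < (1 / 2) ^ k"
    by metis
  \<comment> \<open>Summing the thresholds gives an index above \<open>N n\<close> for every
    \<open>n\<close> up to \<open>k\<close>, although \<open>N\<close> need not be monotone.\<close>
  define r where "r k = (\<Sum>j\<le>k. N j)" for k
  have r: "N n \<le> r k" if "n \<le> k" for n k
    unfolding r_def using that by (intro member_le_sum) auto
  obtain L where L: "norm (L - X (r n)) \<le> (1 / 2) ^ n" for n
    using fast_Cauchy_l2[of "\<lambda>n. X (r n)"] N r by (meson less_imp_le order_refl)
  have "X \<longlonglongrightarrow> L"
  proof (rule LIMSEQ_I)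
    fix e :: real assume "e > 0"
    then obtain k where k: "(1 / 2) ^ k < e / 2"
      using real_arch_pow_inv[of "e / 2" "1 / 2"] by auto
    have "norm (X n - L) < e" if "n \<ge> N k" for n
    proof -
      have "norm (X n - L) \<le> norm (X n - X (r k)) + norm (L - X (r k))"
        using norm_triangle_ineq4[of "X n - X (r k)" "L - X (r k)"] by simp
      also have "\<dots> < e" using N[OF that r[of k k]] L[of k] k by auto
      finally show ?thesis .
    qed
    then show "\<exists>no. \<forall>n\<ge>no. norm (X n - L) < e" by blast
  qed
  then show "convergent X" by (rule convergentI)
qed

text \<open>The witnesses are the indicator functions of open unit cubes stepping along the
  diagonal; already a single coordinate separates two of them.\<close>

lemma orthonormal_sequence_l2:
  "\<exists>e :: nat \<Rightarrow> 'l::euclidean_space l2. \<forall>i j. cinner (e i) (e j) = (if i = j then 1 else 0)"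
proof -
  define A where "A i = box (real i *\<^sub>R One) (real (Suc i) *\<^sub>R One :: 'l)" for i
  have disj: "A i \<inter> A j = {}" if "i < j" for i j
  proof -
    obtain b :: 'l where b: "b \<in> Basis" using nonempty_Basis by blast
    have "False" if "x \<in> A i" "x \<in> A j" for x
      using that b \<open>i < j\<close> by (auto simp: A_def mem_box algebra_simps dest!: bspec[OF _ b])
    then show ?thesis by blast
  qed
  have m: "measure lborel (A i) = 1" "A i \<in> sets lborel" "emeasure lborel (A i) < \<infinity>" for i
  proof -
    have "measure lborel (A i) = (\<Prod>b\<in>Basis. (real (Suc i) *\<^sub>R One - real i *\<^sub>R One :: 'l) \<bullet> b)"
      unfolding A_def by (intro measure_lborel_box) (auto simp: algebra_simps)
    also have "\<dots> = 1" by (simp add: algebra_simps)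
    finally show "measure lborel (A i) = 1" .
    show "A i \<in> sets lborel" by (simp add: A_def)
    show "emeasure lborel (A i) < \<infinity>" by (simp add: A_def emeasure_lborel_box_eq)
  qed
  define f where "f i x = (indicator (A i) x :: complex)" for i x
  have fi: "integrable lborel (\<lambda>x. indicator (A i) x :: real)" for i
    using m by (intro integrable_real_indicator) auto
  have sq: "square_integrable (f i)" for i
  proof -
    have "(\<lambda>x. (cmod (f i x))\<^sup>2) = (\<lambda>x. indicator (A i) x)"
      by (auto simp: f_def indicator_def)
    then show ?thesis using m fi by (simp add: square_integrable_def f_def[abs_def])
  qed
  have "cinner (abs_l2 (f i)) (abs_l2 (f j)) = (if i = j then 1 else 0)" for i j
  proof -
    have "cinner (abs_l2 (f i)) (abs_l2 (f j)) = (\<integral>x. cnj (f i x) * f j x \<partial>lborel)"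
      using sq by (simp add: cinner_l2.abs_eq)
    also have "\<dots> = (\<integral>x. of_real (if i = j then indicator (A i) x else 0) \<partial>lborel)"
    proof (rule Bochner_Integration.integral_cong)
      fix x show "cnj (f i x) * f j x = of_real (if i = j then indicator (A i) x else 0)"
        using disj[of i j] disj[of j i] by (cases i j rule: linorder_cases) (auto simp: f_def indicator_def)
    qed simp
    also have "\<dots> = (if i = j then 1 else 0)"
      unfolding integral_complex_of_real using m by simp
    finally show ?thesis .
  qed
  then show ?thesis by (intro exI[of _ "\<lambda>i. abs_l2 (f i)"]) blast
qed

subsection \<open>The dual of a Hilbert space\<close>

text \<open>The representing vector minimizes $\frac12\|v\|^2 - \varphi(v)$.\<close>

lemma riesz_representation_real:
  fixes \<phi> :: "'a::{real_inner, complete_space} \<Rightarrow> real"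
  assumes \<phi>: "bounded_linear \<phi>"
  shows "\<exists>u. \<forall>v. \<phi> v = u \<bullet> v"
proof -
  interpret bounded_linear \<phi> by fact
  define Q where "Q v = v \<bullet> v / 2 - \<phi> v" for v
  obtain K where K: "\<And>v. norm (\<phi> v) \<le> norm v * K" using bounded by blast
  have "Q v \<ge> - K\<^sup>2 / 2" for v
  proof -
    have "\<phi> v \<le> norm v * K" using K[of v] by simp
    moreover have "norm v * K \<le> (norm v)\<^sup>2 / 2 + K\<^sup>2 / 2"
      using sum_squares_bound[of "norm v" K] by simp
    ultimately show ?thesis by (simp add: Q_def power2_norm_eq_inner)
  qed
  then have bdd: "bdd_below (range Q)" by (intro bdd_belowI[of _ "- K\<^sup>2 / 2"]) auto
  define m where "m = Inf (range Q)"
  have m: "m \<le> Q v" for v unfolding m_def by (rule cInf_lower[OF _ bdd]) simp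
  have "\<exists>v. Q v < m + inverse (Suc n)" for n
    using cInf_lessD[of "range Q" "m + inverse (Suc n)"] by (auto simp: m_def)
  then obtain v where v: "\<And>n. Q (v n) < m + inverse (Suc n)" by metis
  \<comment> \<open>The parallelogram law; the linear parts cancel because the third term is taken
    at the midpoint.\<close>
  have par: "(norm (a - b))\<^sup>2 = 4 * (Q a + Q b - 2 * Q ((1 / 2) *\<^sub>R (a + b)))" for a b
    unfolding Q_def power2_norm_eq_inner scaleR add
    by (simp add: inner_diff inner_add inner_commute field_simps)
  have "Cauchy v"
    unfolding Cauchy_iff
  proof (intro allI impI)
    fix e :: real assume "e > 0"
    \<comment> \<open>Two values, each exceeding the infimum by less than an eighth of the square of
      \<open>e\<close>, together with the factor 4 of the parallelogram law, bound the squared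
      distance by the square of \<open>e\<close>.\<close>
    then obtain N where N: "inverse (Suc N) < e\<^sup>2 / 8" using reals_Archimedean[of "e\<^sup>2 / 8"] by auto
    have "norm (v i - v j) < e" if "i \<ge> N" "j \<ge> N" for i j
    proof -
      have "inverse (Suc i) \<le> inverse (Suc N)" "inverse (Suc j) \<le> inverse (Suc N)"
        using that by (auto intro!: le_imp_inverse_le)
      then have "Q (v i) + Q (v j) - 2 * Q ((1 / 2) *\<^sub>R (v i + v j)) < e\<^sup>2 / 4"
        using v[of i] v[of j] m[of "(1 / 2) *\<^sub>R (v i + v j)"] N by linarith
      then have "(norm (v i - v j))\<^sup>2 < e\<^sup>2" unfolding par by simp
      then show ?thesis using \<open>e > 0\<close> by (simp add: power2_less_imp_less)
    qed
    then show "\<exists>M. \<forall>m\<ge>M. \<forall>n\<ge>M. norm (v m - v n) < e" by blast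
  qed
  then obtain u where u: "v \<longlonglongrightarrow> u" using Cauchy_convergent convergent_def by blast
  have "(\<lambda>n. Q (v n)) \<longlonglongrightarrow> Q u" unfolding Q_def by (intro tendsto_intros u tendsto) simp
  moreover have "(\<lambda>n. m + inverse (Suc n)) \<longlonglongrightarrow> m + 0"
    by (intro tendsto_intros LIMSEQ_inverse_real_of_nat)
  ultimately have "Q u \<le> m + 0" by (rule LIMSEQ_le) (use v less_imp_le in auto)
  then have min: "Q u \<le> Q w" for w using m[of w] by simp
  have "\<phi> w = u \<bullet> w" for w
  proof -
    define c where "c = u \<bullet> w - \<phi> w"
    define s where "s = w \<bullet> w + 1"
    have s: "s > 0" by (simp add: s_def add_nonneg_pos)
    \<comment> \<open>The minimizer of the quadratic in \<open>t\<close> would have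
      \<open>w \<bullet> w\<close> as its denominator; \<open>s\<close> exceeds it by one, which
      covers \<open>w = 0\<close> and still forces \<open>c\<close> to vanish.\<close>
    define t where "t = - c / s"
    have "0 \<le> Q (u + t *\<^sub>R w) - Q u" using min by simp
    also have "\<dots> = t * c + t\<^sup>2 * (s - 1) / 2"
      by (simp add: Q_def c_def s_def add scaleR inner_add inner_commute algebra_simps power2_eq_square)
    finally have "0 \<le> (2 * s\<^sup>2) * (t * c + t\<^sup>2 * (s - 1) / 2)" by (intro mult_nonneg_nonneg) auto
    also have "\<dots> = 2 * s * c * (t * s) + (t * s)\<^sup>2 * (s - 1)" by (simp add: power2_eq_square field_simps)
    also have "t * s = - c" using s by (simp add: t_def)
    finally have "c\<^sup>2 * (s + 1) \<le> 0" by (simp add: power2_eq_square algebra_simps)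
    then have "c\<^sup>2 \<le> 0" using s by (simp add: mult_le_0_iff)
    then show ?thesis by (simp add: c_def)
  qed
  then show ?thesis by blast
qed

lemma cinner_extI: "(\<And>w. cinner u w = cinner v w) \<Longrightarrow> u = v" for u v :: "'x::complex_inner"
  by (metis Re_cinner vector_eq_rdot)

lemma ev_extI: "(\<And>w. ev f w = ev g w) \<Longrightarrow> f = g"
  by (simp add: ev.rep_eq Rep_cdual_inject[symmetric] blinfun_eqI)

lemma cpt_extI: "(\<And>w. cpt_apply a w = cpt_apply b w) \<Longrightarrow> a = b"
  by (simp add: cpt_apply.rep_eq Rep_cpt_inject[symmetric] blinfun_eqI)

lemma ev_simps [simp]:
  "ev (f + g) w = ev f w + ev g w" "ev (f - g) w = ev f w - ev g w" "ev (- f) w = - ev f w"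
  "ev 0 w = 0" "ev (r *\<^sub>R f) w = r *\<^sub>R ev f w" "ev (c *\<^sub>C f) w = c * ev f w"
  by (transfer, simp add: blinfun.bilinear_simps scaleC_blinfun.rep_eq scaleC_complex_def)+

lemma ev_add_right: "ev f (v + w) = ev f v + ev f w"
  and ev_scaleC_right: "ev f (c *\<^sub>C w) = c * ev f w"
  by (transfer, simp add: clinear_def scaleC_complex_def)+

lemma clinear_ev: "clinear (ev f)"
  by (simp add: clinear_def ev_add_right ev_scaleC_right scaleC_complex_def)

lemma cpt_apply_simps [simp]:
  "cpt_apply (a + b) w = cpt_apply a w + cpt_apply b w"
  "cpt_apply (a - b) w = cpt_apply a w - cpt_apply b w"
  "cpt_apply 0 w = 0" "cpt_apply (r *\<^sub>R a) w = r *\<^sub>R cpt_apply a w"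
  "cpt_apply (c *\<^sub>C a) w = c *\<^sub>C cpt_apply a w"
  "cpt_apply (cpt_compose a b) w = cpt_apply a (cpt_apply b w)"
  by (transfer, simp add: blinfun.bilinear_simps scaleC_blinfun.rep_eq)+

lemma clinear_cpt_apply: "clinear (cpt_apply a)"
  by transfer simp

lemma cpt_apply_sum [simp]: "cpt_apply (\<Sum>i\<in>I. a i) w = (\<Sum>i\<in>I. cpt_apply (a i) w)"
  by (induction I rule: infinite_finite_induct) auto

lemma norm_cpt_apply_le: "norm (cpt_apply a x) \<le> norm a * norm x"
  by transfer (rule norm_blinfun)

lemma norm_cpt_le: "C \<ge> 0 \<Longrightarrow> (\<And>x. norm (cpt_apply a x) \<le> C * norm x) \<Longrightarrow> norm a \<le> C"
  by transfer (rule norm_blinfun_bound)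

lemma ev_dual_compose [simp]: "ev (dual_compose f a) w = ev f (cpt_apply a w)"
  by transfer simp

lemma clinearD:
  assumes "clinear T"
  shows "T (x + y) = T x + T y" "T (c *\<^sub>C x) = c *\<^sub>C T x" "T (r *\<^sub>R x) = r *\<^sub>R T x"
    "T 0 = 0" "T (- x) = - T x" "T (x - y) = T x - T y"
proof -
  show add: "T (x + y) = T x + T y" for x y using assms by (simp add: clinear_def)
  show scaleC: "T (c *\<^sub>C x) = c *\<^sub>C T x" for c using assms by (simp add: clinear_def)
  show scaleR: "T (r *\<^sub>R x) = r *\<^sub>R T x" for x r using assms by (simp add: clinear_def flip: scaleC_of_real)
  show "T 0 = 0" using scaleR[of 0 0] by simp
  show minus: "T (- x) = - T x" for x using scaleR[of "- 1" x] by simp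
  show "T (x - y) = T x - T y" using add[of x "- y"] minus by simp
qed

lemma clinear_linear: "clinear T \<Longrightarrow> linear T"
  by (intro linearI) (simp_all add: clinearD)

lemma clinear_sum: "clinear T \<Longrightarrow> T (\<Sum>i\<in>I. f i) = (\<Sum>i\<in>I. T (f i))"
  using linear_sum[OF clinear_linear] .

lemma norm_cdual_le: "C \<ge> 0 \<Longrightarrow> (\<And>x. norm (ev f x) \<le> C * norm x) \<Longrightarrow> norm f \<le> C"
  by transfer (rule norm_blinfun_bound)

lemma norm_ev_le: "norm (ev f x) \<le> norm f * norm x"
  by transfer (rule norm_blinfun)

lemma cinner_self: "cinner x x = complex_of_real ((norm x)\<^sup>2)" for x :: "'x::complex_inner"
proof -
  have "Im (cinner x x) = 0" using cinner_commute[of x x] by (metis Reals_cnj_iff complex_is_Real_iff)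
  then show ?thesis by (simp add: complex_eq_iff Re_cinner power2_norm_eq_inner)
qed

lemma norm_flat [simp]: "norm (flat v) = norm v"
proof (rule antisym)
  show "norm (flat v) \<le> norm v"
    by (rule norm_cdual_le) (auto simp: ev_flat cinner_Cauchy_Schwarz)
  have "(norm v)\<^sup>2 \<le> norm (flat v) * norm v"
    using norm_ev_le[of "flat v" v] by (simp add: ev_flat cinner_self norm_power)
  then show "norm v \<le> norm (flat v)"
    by (cases "norm v = 0") (auto simp: power2_eq_square)
qed

lemma flat_add: "flat (u + v) = flat u + flat v"
  and flat_scaleC: "flat (c *\<^sub>C v) = cnj c *\<^sub>C flat v"
  and flat_scaleR: "flat (r *\<^sub>R v) = r *\<^sub>R flat v"
  by (rule ev_extI, simp add: ev_flat cinner_add_left cinner_scaleC_left scaleR_conv_of_real flip: scaleC_of_real)+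

text \<open>The real Riesz vector of the real part of \<open>f\<close> represents \<open>f\<close>
  itself, since the imaginary part is found by testing at \<open>\<i> *\<^sub>C v\<close>.
  Completeness enters here.\<close>

lemma flat_sharp [simp]: "flat (sharp f) = f" for f :: "'x::{complex_inner, complete_space} cdual"
proof -
  have "bounded_linear (\<lambda>v. Re (ev f v))"
  proof (rule bounded_linear_intro[where K = "norm f"])
    show "norm (Re (ev f v)) \<le> norm v * norm f" for v
      using norm_ev_le[of f v] abs_Re_le_cmod[of "ev f v"] by (simp add: mult.commute)
  qed (simp_all add: clinearD[OF clinear_ev])
  then obtain u where u: "\<And>v. Re (ev f v) = u \<bullet> v" using riesz_representation_real by blast
  have "ev f v = cinner u v" for v
  proof (rule complex_eqI)
    show "Re (ev f v) = Re (cinner u v)" by (simp add: u Re_cinner)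
    have "Re (ev f (\<i> *\<^sub>C v)) = Re (cinner u (\<i> *\<^sub>C v))" by (simp add: u Re_cinner)
    then show "Im (ev f v) = Im (cinner u v)" by (simp add: ev_scaleC_right cinner_scaleC_right)
  qed
  then have "f = flat u" by (intro ev_extI) (simp add: ev_flat)
  then show ?thesis by (simp add: sharp_flat)
qed

declare sharp_flat [simp]

context
  fixes f g :: "'x::{complex_inner, complete_space} cdual"
begin

lemma sharp_add: "sharp (f + g) = sharp f + sharp g"
  by (metis flat_add flat_sharp sharp_flat)

lemma sharp_scaleC: "sharp (c *\<^sub>C f) = cnj c *\<^sub>C sharp f"
  by (metis complex_cnj_cnj flat_scaleC flat_sharp sharp_flat)

lemma sharp_scaleR: "sharp (r *\<^sub>R f) = r *\<^sub>R sharp f"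
  by (metis flat_scaleR flat_sharp sharp_flat)

lemma norm_sharp [simp]: "norm (sharp f) = norm f"
  by (metis flat_sharp norm_flat)

lemma cinner_sharp: "cinner (sharp f) w = ev f w"
  by (metis ev_flat flat_sharp)

end

lemma bounded_linear_sharp: "bounded_linear (sharp :: 'x::{complex_inner, complete_space} cdual \<Rightarrow> 'x)"
  by (rule bounded_linear_intro[where K = 1]) (auto simp: sharp_add sharp_scaleR)

instance cdual :: ("{complex_inner, complete_space}") complete_space
proof
  fix X :: "nat \<Rightarrow> 'a cdual" assume X: "Cauchy X"
  have "Cauchy (\<lambda>n. sharp (X n))" using bounded_linear_sharp X by (rule bounded_linear.Cauchy)
  then obtain u where u: "(\<lambda>n. sharp (X n)) \<longlonglongrightarrow> u" using Cauchy_convergent convergent_def by blast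
  have "bounded_linear (flat :: 'a \<Rightarrow> 'a cdual)"
    by (rule bounded_linear_intro[where K = 1]) (auto simp: flat_add flat_scaleR)
  from bounded_linear.tendsto[OF this u] show "convergent X" by (auto intro: convergentI)
qed

subsection \<open>Compact operators\<close>

lemma norm_rank_one_le: "norm (rank_one u f) \<le> norm u * norm f"
proof (rule norm_cpt_le)
  fix x
  have "norm (ev f x *\<^sub>C u) \<le> (norm f * norm x) * norm u"
    unfolding norm_scaleC by (intro mult_right_mono norm_ev_le) auto
  then show "norm (cpt_apply (rank_one u f) x) \<le> norm u * norm f * norm x"
    by (simp add: cpt_apply_rank_one mult_ac)
qed auto

lemma rank_one_simps:
  "rank_one (u + v) f = rank_one u f + rank_one v f" "rank_one u (f + g) = rank_one u f + rank_one u g"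
  "rank_one (c *\<^sub>C u) f = c *\<^sub>C rank_one u f" "rank_one u (c *\<^sub>C f) = c *\<^sub>C rank_one u f"
  "rank_one (r *\<^sub>R u) f = r *\<^sub>R rank_one u f" "rank_one u (r *\<^sub>R f) = r *\<^sub>R rank_one u f"
  "rank_one 0 f = 0" "rank_one u 0 = 0"
  by (rule cpt_extI; simp add: cpt_apply_rank_one scaleC_add_right scaleC_add_left scaleC_scaleC
    mult.commute scaleC_scaleR scaleR_conv_of_real flip: scaleC_of_real)+

text \<open>\<open>sharp\<close> is conjugate linear, so the map is sesquilinear over the complex
  numbers; Frechet differentiability sees only the real structure, over which it is
  bilinear.\<close>

lemma bounded_bilinear_rank_one_sharp:
  "bounded_bilinear (\<lambda>f g :: 'x::{complex_inner, complete_space} cdual. rank_one (sharp f) g)"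
proof
  show "\<exists>K. \<forall>f g :: 'x cdual. norm (rank_one (sharp f) g) \<le> norm f * norm g * K"
    by (intro exI[of _ 1] allI) (metis mult.right_neutral norm_rank_one_le norm_sharp)
qed (simp_all add: sharp_add sharp_scaleR rank_one_simps)

lemma cpt_compose_rank_one: "cpt_compose (rank_one u f) a = rank_one u (dual_compose f a)"
  by (rule cpt_extI) (simp add: cpt_apply_rank_one)

lemma cpt_compose_simps:
  "cpt_compose (a + b) c = cpt_compose a c + cpt_compose b c"
  "cpt_compose a (b + c) = cpt_compose a b + cpt_compose a c"
  "cpt_compose (r *\<^sub>R a) c = r *\<^sub>R cpt_compose a c"
  by (rule cpt_extI; simp add: clinearD[OF clinear_cpt_apply])+

lemma cpt_compose_sum: "cpt_compose (\<Sum>i\<in>I. a i) c = (\<Sum>i\<in>I. cpt_compose (a i) c)"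
  by (rule cpt_extI) simp

lemma cpt_adjoint_eqI:
  fixes a b :: "'x::complex_inner cpt"
  assumes "\<And>x y. cinner (cpt_apply b x) y = cinner x (cpt_apply a y)"
  shows "cpt_adjoint a = b"
  unfolding cpt_adjoint_def
proof (rule the_equality)
  fix b' assume "\<forall>x y. cinner (cpt_apply b' x) y = cinner x (cpt_apply a y)"
  then have "cinner (cpt_apply b' x) y = cinner (cpt_apply b x) y" for x y by (simp add: assms)
  then have "cpt_apply b' x = cpt_apply b x" for x by (rule cinner_extI)
  then show "b' = b" by (rule cpt_extI)
qed (use assms in blast)

lemma cinner_sum_right: "cinner x (\<Sum>i\<in>I. f i) = (\<Sum>i\<in>I. cinner x (f i))" for x :: "'x::complex_inner"
proof -
  have "cinner x 0 = 0" using cinner_scaleC_right[of x 0 0] by simp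
  then show ?thesis by (induction I rule: infinite_finite_induct) (auto simp: cinner_add_right)
qed

lemma cinner_sum_left: "cinner (\<Sum>i\<in>I. f i) x = (\<Sum>i\<in>I. cinner (f i) x)" for x :: "'x::complex_inner"
  by (subst cinner_commute, subst cinner_sum_right) (simp add: cinner_commute[symmetric])

text \<open>\<open>cpt_adjoint\<close> is a definite description, so a witness must be exhibited.
  For finite rank operators it is explicit, and the values of \<open>form_prod\<close> are of this
  kind.\<close>

lemma cpt_adjoint_sum_rank_one:
  fixes f :: "'i \<Rightarrow> 'x::{complex_inner, complete_space} cdual"
  shows "cpt_adjoint (\<Sum>i\<in>I. r i *\<^sub>R rank_one (u i) (f i)) = (\<Sum>i\<in>I. r i *\<^sub>R rank_one (sharp (f i)) (flat (u i)))"
  by (rule cpt_adjoint_eqI)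
    (simp add: cpt_apply_rank_one cinner_sum_left cinner_sum_right cinner_scaleC_left cinner_scaleC_right
      ev_flat cinner_sharp flip: scaleC_of_real cinner_commute add: mult.commute)

text \<open>The vectors of \<open>k\<close> may be dependent: the normalized residual of a new
  vector is added if it is nonzero, and nothing is added otherwise.\<close>

lemma complex_gram_schmidt:
  fixes k :: "'x::complex_inner set"
  assumes "finite k"
  shows "\<exists>E. finite E \<and> (\<forall>e\<in>E. \<forall>f\<in>E. cinner e f = (if e = f then 1 else 0)) \<and>
    (\<forall>y\<in>k. y = (\<Sum>e\<in>E. cinner e y *\<^sub>C e))"
  using assms
proof induction
  case (insert y k)
  then obtain E where E: "finite E" "\<And>e f. e \<in> E \<Longrightarrow> f \<in> E \<Longrightarrow> cinner e f = (if e = f then 1 else 0)"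
    "\<And>y. y \<in> k \<Longrightarrow> y = (\<Sum>e\<in>E. cinner e y *\<^sub>C e)" by blast
  define p where "p = (\<Sum>e\<in>E. cinner e y *\<^sub>C e)"
  define w where "w = y - p"
  show ?case
  proof (cases "w = 0")
    case True
    then show ?thesis using E by (intro exI[of _ E]) (auto simp: w_def p_def)
  next
    case False
    have cdiff: "cinner a (b - c) = cinner a b - cinner a c" for a b c :: 'x
      using cinner_add_right[of a "b - c" c] by simp
    have ep: "cinner e p = cinner e y" if "e \<in> E" for e
    proof -
      have "cinner e p = (\<Sum>f\<in>E. if e = f then cinner f y else 0)"
        unfolding p_def cinner_sum_right cinner_scaleC_right using E(2) that by (intro sum.cong) auto
      then show ?thesis using E(1) that by simp
    qed
    have ew: "cinner e w = 0" "cinner w e = 0" if "e \<in> E" for e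
      using ep[OF that] cinner_commute[of w e] by (auto simp: w_def cdiff)
    define q where "q = complex_of_real (1 / norm w) *\<^sub>C w"
    have eq: "cinner e q = 0" "cinner q e = 0" if "e \<in> E" for e
      using ew[OF that] by (auto simp: q_def cinner_scaleC_left cinner_scaleC_right)
    have qq: "cinner q q = 1"
      using False unfolding q_def cinner_scaleC_left cinner_scaleC_right cinner_self[of w]
      by (simp add: power2_eq_square field_simps)
    have q: "q \<notin> E" using eq qq by auto
    have "cinner q y *\<^sub>C q = w"
    proof -
      have "cinner q p = 0" unfolding p_def cinner_sum_right cinner_scaleC_right by (simp add: eq)
      then have "cinner q y = cinner q w" by (simp add: w_def cdiff)
      also have "\<dots> = norm w"
        using False by (simp add: q_def cinner_scaleC_left cinner_self power2_eq_square)
      finally show ?thesis using False by (simp add: q_def scaleC_scaleC)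
    qed
    moreover have "cinner q y' = 0" if "y' \<in> k" for y'
    proof -
      have "cinner q y' = cinner q (\<Sum>e\<in>E. cinner e y' *\<^sub>C e)" using E(3)[OF that] by simp
      then show ?thesis unfolding cinner_sum_right cinner_scaleC_right by (simp add: eq)
    qed
    ultimately show ?thesis
      using E q eq qq by (intro exI[of _ "insert q E"]) (auto simp: w_def p_def)
  qed
qed (auto intro: exI[of _ "{}"])

lemma mult_left_le_imp_le_nonneg: "a * a \<le> a * b \<Longrightarrow> 0 \<le> a \<Longrightarrow> 0 \<le> b \<Longrightarrow> a \<le> b" for a b :: real
  by (cases "a = 0") auto

text \<open>The projection \<open>?p\<close> satisfies
  \<open>?p \<bullet> ?p = ?p \<bullet> x\<close>, so Cauchy-Schwarz makes it a contraction.\<close>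

lemma bessel:
  fixes E :: "'x::complex_inner set"
  assumes "finite E" "\<And>e f. e \<in> E \<Longrightarrow> f \<in> E \<Longrightarrow> cinner e f = (if e = f then 1 else 0)"
  shows "norm (\<Sum>e\<in>E. cinner e x *\<^sub>C e) \<le> norm x"
proof -
  let ?p = "\<Sum>e\<in>E. cinner e x *\<^sub>C e"
  have ep: "cinner e ?p = cinner e x" if "e \<in> E" for e
  proof -
    have "cinner e ?p = (\<Sum>f\<in>E. if e = f then cinner f x else 0)"
      unfolding cinner_sum_right cinner_scaleC_right using assms that by (intro sum.cong) auto
    then show ?thesis using assms(1) that by simp
  qed
  have "cinner ?p ?p = cinner ?p x"
    unfolding cinner_sum_left cinner_scaleC_left using ep by (intro sum.cong) auto
  then have "Re (cinner ?p ?p) = Re (cinner ?p x)" by simp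
  then have "?p \<bullet> ?p = ?p \<bullet> x" unfolding Re_cinner .
  with power2_norm_eq_inner[of ?p] have "norm ?p * norm ?p = ?p \<bullet> x" unfolding power2_eq_square by (rule trans)
  also have "\<dots> \<le> norm ?p * norm x" by (rule norm_cauchy_schwarz)
  finally show ?thesis
    by (rule mult_left_le_imp_le_nonneg[OF _ norm_ge_zero norm_ge_zero])
qed

text \<open>The image of the unit ball under a compact operator has a finite net. Following the
  operator with the orthogonal projection onto the span of that net changes it little.\<close>

lemma finite_rank_dense:
  fixes a :: "'x::complex_inner cpt"
  assumes "\<epsilon> > 0"
  shows "\<exists>(E::'x set) f. finite E \<and> norm (a - (\<Sum>e\<in>E. rank_one e (f e))) \<le> \<epsilon>"
proof -
  let ?K = "closure (cpt_apply a ` cball 0 1)"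
  have "compact ?K" by transfer (simp add: compact_op_def)
  then obtain k where k: "finite k" "?K \<subseteq> (\<Union>x\<in>k. ball x (\<epsilon> / 2))"
    using assms unfolding compact_eq_totally_bounded by (meson half_gt_zero)
  obtain E where E: "finite E" "\<And>e f. e \<in> E \<Longrightarrow> f \<in> E \<Longrightarrow> cinner e f = (if e = f then 1 else 0)"
    "\<And>y. y \<in> k \<Longrightarrow> y = (\<Sum>e\<in>E. cinner e y *\<^sub>C e)"
    using complex_gram_schmidt[OF k(1)] by metis
  define P where "P x = (\<Sum>e\<in>E. cinner e x *\<^sub>C e)" for x
  have Pd: "P (x - y) = P x - P y" for x y
    using cinner_add_right[of _ "x - y" y]
    by (simp add: P_def scaleC_add_left flip: sum.distrib add: eq_diff_eq)
  have small: "norm (cpt_apply a x - P (cpt_apply a x)) \<le> \<epsilon>" if "norm x \<le> 1" for x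
  proof -
    have "cpt_apply a x \<in> ?K" using that closure_subset by fastforce
    then obtain y where y: "y \<in> k" "dist y (cpt_apply a x) < \<epsilon> / 2" using k(2) by auto
    \<comment> \<open>The point \<open>y\<close> of the net is fixed by \<open>P\<close>, so the
      error splits into two terms, each at most half of \<open>\<epsilon>\<close> because
      \<open>P\<close> is a contraction.\<close>
    have "cpt_apply a x - P (cpt_apply a x) = (cpt_apply a x - y) + P (y - cpt_apply a x)"
      using E(3)[OF y(1), folded P_def] by (simp add: Pd)
    also have "norm \<dots> \<le> \<epsilon> / 2 + \<epsilon> / 2"
      using y(2) bessel[OF E(1,2), of "y - cpt_apply a x"]
      by (intro norm_triangle_mono) (auto simp: P_def dist_norm norm_minus_commute)
    finally show ?thesis by simp
  qed
  have "norm (a - (\<Sum>e\<in>E. rank_one e (dual_compose (flat e) a))) \<le> \<epsilon>"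
  proof (rule norm_cpt_le)
    fix x
    have app: "cpt_apply (a - (\<Sum>e\<in>E. rank_one e (dual_compose (flat e) a))) x = cpt_apply a x - P (cpt_apply a x)" for x
      by (simp add: cpt_apply_rank_one ev_flat P_def)
    show "norm (cpt_apply (a - (\<Sum>e\<in>E. rank_one e (dual_compose (flat e) a))) x) \<le> \<epsilon> * norm x"
    proof (cases "x = 0")
      case True
      then show ?thesis by (simp add: clinearD(4)[OF clinear_cpt_apply])
    next
      case False
      then have "norm (cpt_apply (a - (\<Sum>e\<in>E. rank_one e (dual_compose (flat e) a))) ((1 / norm x) *\<^sub>R x)) \<le> \<epsilon>"
        unfolding app by (intro small) simp
      then show ?thesis using False
        by (simp add: clinearD(3)[OF clinear_cpt_apply] divide_simps del: cpt_apply_simps)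
    qed
  qed (use assms in simp)
  with E(1) show ?thesis by (intro exI[of _ E] exI[of _ "\<lambda>e. dual_compose (flat e) a"] conjI)
qed

text \<open>Sums of rank one operators are dense, so values on rank one operators determine a
  continuous linear map. This identifies the choice made in \<open>kuiper_CH\<close>.\<close>

lemma clinear_cpt_unique:
  fixes S T :: "'x::complex_inner cpt \<Rightarrow> 'y::complex_normed_vector"
  assumes "clinear S" "clinear T" "continuous_on UNIV S" "continuous_on UNIV T"
    "\<And>u f. S (rank_one u f) = T (rank_one u f)"
  shows "S a = T a"
proof -
  let ?R = "{\<Sum>e\<in>E. rank_one e (f e) | (E::'x set) f. finite E}"
  have "a \<in> closure ?R"
    unfolding closure_approachable
  proof (intro allI impI)
    fix e :: real assume "e > 0"
    then have "e / 2 > 0" by simp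
    from finite_rank_dense[OF this, of a]
    obtain E f where E: "finite (E::'x set)" "norm (a - (\<Sum>e\<in>E. rank_one e (f e))) \<le> e / 2"
      by (elim exE conjE)
    show "\<exists>y\<in>?R. dist y a < e"
    proof (rule bexI)
      show "dist (\<Sum>e\<in>E. rank_one e (f e)) a < e"
        using E(2) \<open>e > 0\<close> by (simp add: dist_norm norm_minus_commute)
      show "(\<Sum>e\<in>E. rank_one e (f e)) \<in> ?R"
        using E(1) by (intro CollectI exI[of _ E] exI[of _ f] conjI refl)
    qed
  qed
  moreover have "closed {a. S a = T a}" using assms(3,4) by (intro closed_Collect_eq)
  moreover have "?R \<subseteq> {a. S a = T a}" using assms(1,2,5) by (auto simp: clinear_sum)
  ultimately have "a \<in> {a. S a = T a}" by (metis (no_types, lifting) closure_minimal subsetD)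
  then show ?thesis by simp
qed

subsection \<open>Unitary operators\<close>

lemma unitary_opD:
  assumes "unitary_op T"
  shows "clinear T" "surj T" "cinner (T x) (T y) = cinner x y"
  using assms by (auto simp: unitary_op_def)

lemma unitary_op_norm: "unitary_op T \<Longrightarrow> norm (T x) = norm x"
  using unitary_opD(3)[of T x x] by (simp add: norm_eq_sqrt_inner flip: Re_cinner)

lemma unitary_op_bij: "unitary_op T \<Longrightarrow> bij T"
proof -
  assume T: "unitary_op T"
  have "inj T"
  proof (rule injI)
    fix x y assume "T x = T y"
    then have "norm (x - y) = 0"
      by (simp add: unitary_op_norm[OF T, of "x - y", symmetric] clinearD(6)[OF unitary_opD(1)[OF T]])
    then show "x = y" by simp
  qed
  then show "bij T" using unitary_opD(2)[OF T] by (simp add: bij_def)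
qed

lemma unitary_op_bounded_linear: "unitary_op T \<Longrightarrow> bounded_linear T"
  by (rule bounded_linear_intro[where K = 1]) (auto simp: clinearD unitary_opD unitary_op_norm)

lemma unitary_op_inv:
  assumes T: "unitary_op T"
  shows "unitary_op (inv T)"
proof -
  have i: "T (inv T x) = x" "inv T (T x) = x" for x
    using unitary_op_bij[OF T] by (auto simp: bij_is_surj surj_f_inv_f bij_is_inj)
  have inj: "T x = T y \<Longrightarrow> x = y" for x y
    using unitary_op_bij[OF T] by (auto dest: bij_is_inj injD)
  show ?thesis unfolding unitary_op_def
  proof (intro conjI allI)
    show "clinear (inv T)"
      unfolding clinear_def
    proof (intro conjI allI)
      show "inv T (x + y) = inv T x + inv T y" for x y
        by (rule inj) (simp add: i clinearD[OF unitary_opD(1)[OF T]])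
      show "inv T (c *\<^sub>C x) = c *\<^sub>C inv T x" for c x
        by (rule inj) (simp add: i clinearD[OF unitary_opD(1)[OF T]])
    qed
    show "surj (inv T)" using i(2) by (rule surjI)
    show "cinner (inv T x) (inv T y) = cinner x y" for x y
      using unitary_opD(3)[OF T, of "inv T x" "inv T y"] by (simp add: i)
  qed
qed

lemma unitary_op_inv_simps:
  assumes "unitary_op T"
  shows "T (inv T x) = x" "inv T (T x) = x"
  using unitary_op_bij[OF assms] by (auto simp: bij_is_surj surj_f_inv_f bij_is_inj)

definition cpt_conj :: "('x \<Rightarrow> 'x) \<Rightarrow> 'x::complex_inner cpt \<Rightarrow> 'x cpt"
  where "cpt_conj T a = Abs_cpt (Blinfun T o\<^sub>L Rep_cpt a o\<^sub>L Blinfun (inv T))"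

lemma cpt_apply_conj:
  assumes T: "unitary_op T"
  shows "cpt_apply (cpt_conj T a) x = T (cpt_apply a (inv T x))"
proof -
  have B: "blinfun_apply (Blinfun T) = T" "blinfun_apply (Blinfun (inv T)) = inv T"
    using T unitary_op_inv[OF T] by (auto intro!: bounded_linear_Blinfun_apply unitary_op_bounded_linear)
  have "clinear (blinfun_apply (Blinfun T o\<^sub>L Rep_cpt a o\<^sub>L Blinfun (inv T)))"
    using Rep_cpt[of a] unitary_opD(1)[OF T] unitary_opD(1)[OF unitary_op_inv[OF T]]
    by (intro clinear_blinfun_compose) (auto simp: B)
  moreover have "compact_op (Blinfun T o\<^sub>L Rep_cpt a o\<^sub>L Blinfun (inv T))"
    using Rep_cpt[of a] by (intro compact_op_compose_left compact_op_compose_right) auto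
  ultimately show ?thesis
    by (simp add: cpt_conj_def cpt_apply.rep_eq Abs_cpt_inverse B)
qed

lemma cpt_conj_rank_one:
  fixes f :: "'x::{complex_inner, complete_space} cdual"
  assumes "unitary_op T"
  shows "cpt_conj T (rank_one u f) = rank_one (T u) (flat (T (sharp f)))"
proof (rule cpt_extI)
  fix w
  have "ev f (inv T w) = cinner (T (sharp f)) w"
    using unitary_opD(3)[OF assms, of "sharp f" "inv T w"]
    by (simp add: cinner_sharp unitary_op_inv_simps[OF assms])
  then show "cpt_apply (cpt_conj T (rank_one u f)) w = cpt_apply (rank_one (T u) (flat (T (sharp f)))) w"
    by (simp add: cpt_apply_conj[OF assms] cpt_apply_rank_one ev_flat clinearD[OF unitary_opD(1)[OF assms]])
qed

lemma clinear_cpt_conj: "unitary_op T \<Longrightarrow> clinear (cpt_conj T)"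
  unfolding clinear_def by (auto intro!: cpt_extI simp: cpt_apply_conj clinearD unitary_opD)

lemma norm_cpt_conj_le: "unitary_op T \<Longrightarrow> norm (cpt_conj T a) \<le> norm a"
  by (rule norm_cpt_le)
    (auto simp: cpt_apply_conj unitary_op_norm unitary_op_inv
      intro: order_trans[OF norm_cpt_apply_le])

lemma continuous_on_cpt_conj: "unitary_op T \<Longrightarrow> continuous_on UNIV (cpt_conj T)"
  by (intro linear_continuous_on bounded_linear_intro[where K = 1])
    (auto simp: clinearD[OF clinear_cpt_conj] norm_cpt_conj_le)

subsection \<open>Vector valued forms\<close>

lemma multilinear_form [simp]: "multilinear (form_apply F)"
  and alternating_form [simp]: "alternating (form_apply F)"
  using form_apply[of F] by auto

lemma form_apply_slot:
  "form_apply F (us @ (u + v) # vs) = form_apply F (us @ u # vs) + form_apply F (us @ v # vs)"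
  "form_apply F (us @ (r *\<^sub>R u) # vs) = r *\<^sub>R form_apply F (us @ u # vs)"
  "form_apply F (us @ u # vs @ u # ws) = 0"
  using multilinear_form[of F] alternating_form[of F] unfolding multilinear_def alternating_def by blast+

lemma form_extI: "(\<And>vs. form_apply F vs = form_apply G vs) \<Longrightarrow> F = G"
  by (simp add: form_apply_inject[symmetric] fun_eq_iff)

lemmas form_apply_simps [simp] =
  zero_form.rep_eq plus_form.rep_eq minus_form.rep_eq uminus_form.rep_eq scaleR_form.rep_eq scaleC_form.rep_eq

lemma basis_lists_eq: "basis_lists = (\<Union>k\<le>DIM('v). lists_of Basis k :: 'v::euclidean_space list set)"
  by (auto simp: basis_lists_def lists_of_def)

text \<open>Cutting a form off on lists of length at most the dimension leaves a multilinear
  alternating map that vanishes on all of \<open>basis_lists\<close>.\<close>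

lemma form_apply_long:
  fixes F :: "('v::euclidean_space, 'h::real_normed_vector) form"
  assumes "length vs > DIM('v)"
  shows "form_apply F vs = 0"
proof -
  have "(\<lambda>vs. if length vs > DIM('v) then form_apply F vs else 0) vs = 0"
    by (rule form_eq_0)
      (use form_apply[of F] in \<open>auto simp: multilinear_def alternating_def basis_lists_def\<close>)
  then show ?thesis using assms by simp
qed

lemma norm_form_apply_le: "norm (form_apply F vs) \<le> norm F * prod_list (map norm vs)"
  for F :: "('v::euclidean_space, 'h::real_normed_vector) form"
proof (cases "length vs > DIM('v)")
  case False
  then have "lists_of Basis (length vs) \<subseteq> (basis_lists :: 'v list set)"
    unfolding basis_lists_eq by (intro subsetI UN_I[of "length vs"]) auto
  then have "(\<Sum>bs\<in>lists_of Basis (length vs). norm (form_apply F bs)) \<le> norm F"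
    unfolding norm_form_def by (intro sum_mono2) auto
  then show ?thesis
    by (rule order_trans[OF multilinear_norm_le[OF multilinear_form] mult_right_mono]) simp
qed (simp add: form_apply_long)

lemma bounded_linear_form_apply: "bounded_linear (\<lambda>F. form_apply F vs)"
  by (rule bounded_linear_intro[where K = "prod_list (map norm vs)"]) (auto intro: norm_form_apply_le)

lemma tendsto_form:
  fixes f :: "'a \<Rightarrow> ('v::euclidean_space, 'h::real_normed_vector) form"
  assumes "\<And>bs. bs \<in> basis_lists \<Longrightarrow> ((\<lambda>x. form_apply (f x) bs) \<longlongrightarrow> form_apply l bs) F"
  shows "(f \<longlongrightarrow> l) F"
proof -
  have "((\<lambda>x. \<Sum>bs\<in>basis_lists. norm (form_apply (f x) bs - form_apply l bs)) \<longlongrightarrow> (\<Sum>bs\<in>(basis_lists::'v list set). 0)) F"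
    by (intro tendsto_sum tendsto_norm_zero) (rule Lim_null[THEN iffD1, OF assms])
  then have "((\<lambda>x. norm (f x - l)) \<longlongrightarrow> 0) F" by (simp add: norm_form_def)
  then show ?thesis by (rule Lim_null[THEN iffD2, OF tendsto_norm_zero_cancel])
qed

lemma continuous_on_form:
  fixes f :: "'a::topological_space \<Rightarrow> ('v::euclidean_space, 'h::real_normed_vector) form"
  assumes "\<And>vs. continuous_on S (\<lambda>x. form_apply (f x) vs)"
  shows "continuous_on S f"
  unfolding continuous_on_def
proof
  fix x assume "x \<in> S"
  with assms show "(f \<longlongrightarrow> f x) (at x within S)"
    by (intro tendsto_form) (simp add: continuous_on_def)
qed

instance form :: (euclidean_space, "{real_normed_vector, complete_space}") complete_space
proof
  fix X :: "nat \<Rightarrow> ('a, 'b) form" assume X: "Cauchy X"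
  have "\<exists>l. (\<lambda>n. form_apply (X n) vs) \<longlonglongrightarrow> l" for vs
    using Cauchy_convergent[OF bounded_linear.Cauchy[OF bounded_linear_form_apply X]] by (simp add: convergent_def)
  then obtain L where L: "\<And>vs. (\<lambda>n. form_apply (X n) vs) \<longlonglongrightarrow> L vs" by metis
  have "multilinear L"
    unfolding multilinear_def
  proof (intro conjI allI)
    fix us vs :: "'a list" and u v :: 'a and r :: real
    have "(\<lambda>n. form_apply (X n) (us @ (u + v) # vs)) \<longlonglongrightarrow> L (us @ u # vs) + L (us @ v # vs)"
      unfolding form_apply_slot by (intro tendsto_add L)
    then show "L (us @ (u + v) # vs) = L (us @ u # vs) + L (us @ v # vs)"
      by (rule LIMSEQ_unique[OF L])
    have "(\<lambda>n. form_apply (X n) (us @ (r *\<^sub>R u) # vs)) \<longlonglongrightarrow> r *\<^sub>R L (us @ u # vs)"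
      unfolding form_apply_slot by (intro tendsto_scaleR tendsto_const L)
    then show "L (us @ (r *\<^sub>R u) # vs) = r *\<^sub>R L (us @ u # vs)"
      by (rule LIMSEQ_unique[OF L])
  qed
  moreover have "alternating L"
    unfolding alternating_def
  proof (intro allI)
    fix us vs ws :: "'a list" and u :: 'a
    show "L (us @ u # vs @ u # ws) = 0"
      using LIMSEQ_unique[OF L[of "us @ u # vs @ u # ws"]] tendsto_const[of 0] unfolding form_apply_slot by blast
  qed
  ultimately have "form_apply (Abs_form L) = L" by (simp add: Abs_form_inverse)
  then have "X \<longlonglongrightarrow> Abs_form L" by (intro tendsto_form) (simp add: L)
  then show "convergent X" by (rule convergentI)
qed

text \<open>The common shape of charts, their inverses, transition functions and the action of the
  Kuiper operators: a scalar in each degree, an operator on the values and a pullback of the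
  arguments. One composition law and one continuity lemma then serve all of them.\<close>

definition form_twist :: "(nat \<Rightarrow> complex) \<Rightarrow> ('h \<Rightarrow> 'h) \<Rightarrow> ('v \<Rightarrow> 'v) \<Rightarrow>
    ('v::euclidean_space, 'h::complex_normed_vector) form \<Rightarrow> ('v, 'h) form"
  where "form_twist \<mu> U A F = Abs_form (\<lambda>vs. \<mu> (length vs) *\<^sub>C U (form_apply F (map A vs)))"

lemma form_apply_twist:
  assumes "linear U" "linear A"
  shows "form_apply (form_twist \<mu> U A F) vs = \<mu> (length vs) *\<^sub>C U (form_apply F (map A vs))"
proof -
  have "multilinear (\<lambda>vs. U (form_apply F (map A vs)))" "alternating (\<lambda>vs. U (form_apply F (map A vs)))"
    by (rule multilinear_linear[OF assms(1) multilinear_map[OF assms(2) multilinear_form]],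
      rule alternating_linear[OF assms(1) alternating_map[OF alternating_form]])
  then have "multilinear (\<lambda>vs. \<mu> (length vs) *\<^sub>C U (form_apply F (map A vs)))"
    "alternating (\<lambda>vs. \<mu> (length vs) *\<^sub>C U (form_apply F (map A vs)))"
    by (auto simp: multilinear_def alternating_def scaleC_add_right scaleC_scaleR simp del: map_append)
  then show ?thesis by (simp add: form_twist_def Abs_form_inverse)
qed

lemma form_twist_twist:
  assumes "linear U" "linear A" "linear U'" "linear A'" "clinear U"
  shows "form_twist \<mu> U A (form_twist \<mu>' U' A' F) = form_twist (\<lambda>k. \<mu> k * \<mu>' k) (U \<circ> U') (A' \<circ> A) F"
  by (intro form_extI) (simp add: form_apply_twist assms(1-4) linear_compose[OF assms(3,1)]
    linear_compose[OF assms(2,4)] clinearD[OF assms(5)] scaleC_scaleC)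

lemma clinear_form_twist:
  assumes "clinear U" "linear A"
  shows "clinear (form_twist \<mu> U A)"
  unfolding clinear_def
  by (auto intro!: form_extI simp: form_apply_twist assms clinear_linear clinearD[OF assms(1)]
      scaleC_add_right scaleC_scaleC mult.commute)

lemma form_expand:
  "form_apply F vs = (\<Sum>bs\<in>lists_of Basis (length vs). list_coeff (\<bullet>) vs bs *\<^sub>R form_apply F bs)"
  by (rule multilinear_expand) simp

text \<open>After expansion in the basis the moving arguments occur only in scalar coefficients,
  while the form is evaluated on finitely many fixed lists.\<close>

lemma tendsto_form_apply:
  fixes f :: "'a \<Rightarrow> ('v::euclidean_space, 'h::real_normed_vector) form"
  assumes f: "(f \<longlongrightarrow> F) net" and A: "\<And>u. ((\<lambda>x. A x u) \<longlongrightarrow> A' u) net"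
  shows "((\<lambda>x. form_apply (f x) (map (A x) us)) \<longlongrightarrow> form_apply F (map A' us)) net"
proof -
  have c: "((\<lambda>x. list_coeff (\<bullet>) (map (A x) us) bs) \<longlongrightarrow> list_coeff (\<bullet>) (map A' us) bs) net" for bs :: "'v list"
  proof (induction us arbitrary: bs)
    case (Cons u us)
    show ?case by (cases bs) (auto simp: list_coeff_def[of _ _ "[]"] intro!: tendsto_intros A Cons)
  qed simp
  show ?thesis
    by (subst (1 2) form_expand)
      (auto intro!: tendsto_sum tendsto_scaleR c bounded_linear.tendsto[OF bounded_linear_form_apply f])
qed

lemma form_apply_act [simp]: "form_apply (form_act F a) vs = dual_compose (form_apply F vs) a"
proof -
  have "linear (\<lambda>f. dual_compose f a)" by (rule linearI) (auto intro!: ev_extI)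
  then show ?thesis by (simp add: form_act_def form_apply_form_map linear_id[unfolded id_def] id_def)
qed

lemma bounded_bilinear_dual_compose:
  "bounded_bilinear (dual_compose :: 'x::complex_normed_vector cdual \<Rightarrow> 'x cpt \<Rightarrow> 'x cdual)"
proof
  show "\<exists>K. \<forall>f a. norm (dual_compose f a :: 'x cdual) \<le> norm f * norm a * K"
  proof (intro exI[of _ 1] allI norm_cdual_le)
    fix f :: "'x cdual" and a x
    have "norm (ev f (cpt_apply a x)) \<le> norm f * (norm a * norm x)"
      by (rule order_trans[OF norm_ev_le mult_left_mono[OF norm_cpt_apply_le]]) simp
    then show "norm (ev (dual_compose f a) x) \<le> norm f * norm a * 1 * norm x" by (simp add: mult_ac)
  qed simp
qed (auto intro!: ev_extI simp: clinearD[OF clinear_ev])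

lemma bounded_bilinear_form_act:
  "bounded_bilinear (form_act :: ('v::euclidean_space, 'x::complex_normed_vector cdual) form \<Rightarrow> 'x cpt \<Rightarrow> _)"
proof -
  interpret d: bounded_bilinear "dual_compose :: 'x cdual \<Rightarrow> 'x cpt \<Rightarrow> 'x cdual"
    by (rule bounded_bilinear_dual_compose)
  obtain K where K: "\<And>f a. norm (dual_compose f a :: 'x cdual) \<le> norm f * norm a * K"
    using d.bounded by blast
  show ?thesis
  proof
    show "\<exists>K. \<forall>F a. norm (form_act F a :: ('v, 'x cdual) form) \<le> norm F * norm a * K"
    proof (intro exI[of _ K] allI)
      fix F :: "('v, 'x cdual) form" and a
      have "(\<Sum>bs\<in>basis_lists. norm (dual_compose (form_apply F bs) a))
        \<le> (\<Sum>bs\<in>basis_lists. norm (form_apply F bs) * norm a * K)"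
        by (intro sum_mono K)
      then show "norm (form_act F a) \<le> norm F * norm a * K"
        by (simp add: norm_form_def sum_distrib_right)
    qed
  qed (auto intro!: form_extI simp: d.add_left d.add_right d.scaleR_left d.scaleR_right)
qed

lemma iter_deriv_form:
  fixes f :: "'a::real_normed_vector \<Rightarrow> ('v::euclidean_space, 'h::real_normed_vector) form"
  assumes sm: "\<And>vs. smooth_on S (\<lambda>x. form_apply (f x) vs)" and x: "x \<in> S"
  shows "multilinear (\<lambda>vs. iter_deriv (\<lambda>x. form_apply (f x) vs) ws x)"
    and "alternating (\<lambda>vs. iter_deriv (\<lambda>x. form_apply (f x) vs) ws x)"
proof -
  show "multilinear (\<lambda>vs. iter_deriv (\<lambda>x. form_apply (f x) vs) ws x)"
    unfolding multilinear_def
  proof (intro conjI allI)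
    fix us vs :: "'v list" and u v :: 'v and r :: real
    have "(\<lambda>x. form_apply (f x) (us @ (u + v) # vs)) = (\<lambda>x. form_apply (f x) (us @ u # vs) + form_apply (f x) (us @ v # vs))"
      by (simp add: form_apply_slot)
    then show "iter_deriv (\<lambda>x. form_apply (f x) (us @ (u + v) # vs)) ws x =
       iter_deriv (\<lambda>x. form_apply (f x) (us @ u # vs)) ws x + iter_deriv (\<lambda>x. form_apply (f x) (us @ v # vs)) ws x"
      using iter_deriv_add[OF sm sm x] by simp
    have "(\<lambda>x. form_apply (f x) (us @ (r *\<^sub>R u) # vs)) = (\<lambda>x. r *\<^sub>R form_apply (f x) (us @ u # vs))"
      by (simp add: form_apply_slot)
    then show "iter_deriv (\<lambda>x. form_apply (f x) (us @ (r *\<^sub>R u) # vs)) ws x =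
       r *\<^sub>R iter_deriv (\<lambda>x. form_apply (f x) (us @ u # vs)) ws x"
      using iter_deriv_linear[OF bounded_linear_scaleR_right sm x] by simp
  qed
  show "alternating (\<lambda>vs. iter_deriv (\<lambda>x. form_apply (f x) vs) ws x)"
    unfolding alternating_def
  proof (intro allI)
    fix us vs ws' :: "'v list" and u :: 'v
    \<comment> \<open>The zero function is written as a scalar multiple so that linearity of
      \<open>iter_deriv\<close> shows its derivatives to vanish.\<close>
    have "(\<lambda>x. form_apply (f x) (us @ u # vs @ u # ws')) = (\<lambda>x. 0 *\<^sub>R form_apply (f x) [])"
      by (simp add: form_apply_slot)
    then show "iter_deriv (\<lambda>x. form_apply (f x) (us @ u # vs @ u # ws')) ws x = 0"
      using iter_deriv_linear[OF bounded_linear_scaleR_right sm x, of 0] by simp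
  qed
qed

text \<open>A form valued map has form valued derivatives, because the defining equations of forms are linear.\<close>

lemma smooth_on_form:
  fixes f :: "'a::real_normed_vector \<Rightarrow> ('v::euclidean_space, 'h::real_normed_vector) form"
  assumes S: "open S" and sm: "\<And>vs. smooth_on S (\<lambda>x. form_apply (f x) vs)"
  shows "smooth_on S f"
proof (rule smooth_onI[OF S])
  let ?I = "\<lambda>vs ws x. iter_deriv (\<lambda>x. form_apply (f x) vs) ws x"
  define D where "D x ws = Abs_form (\<lambda>vs. ?I vs ws x)" for x ws
  have D: "form_apply (D x ws) vs = ?I vs ws x" if "x \<in> S" for x ws vs
    using iter_deriv_form[of S f x, OF sm that] by (simp add: D_def Abs_form_inverse)
  let ?B = "basis_lists :: 'v list set"
  fix x assume x: "x \<in> S"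
  note b = smooth_on_iter_deriv(1)[OF sm x] and j = smooth_on_iter_deriv(2)[OF sm x]
  show "D x [] = f x" by (intro form_extI) (simp add: D x)
  show "bounded_multilinear (D x)"
    unfolding bounded_multilinear_def
  proof (intro conjI allI)
    show "multilinear (D x)"
      unfolding multilinear_def using b
      by (auto intro!: form_extI simp: D[OF x] bounded_multilinear_def multilinear_def)
    fix k
    have "\<exists>C. \<forall>ws. length ws = k \<longrightarrow> norm (?I bs ws x) \<le> C * prod_list (map norm ws)" for bs
      using b[of bs] by (simp add: bounded_multilinear_def)
    then obtain C where C: "\<And>bs ws. length ws = k \<Longrightarrow> norm (?I bs ws x) \<le> C bs * prod_list (map norm ws)"
      by metis
    show "\<exists>C. \<forall>ws. length ws = k \<longrightarrow> norm (D x ws) \<le> C * prod_list (map norm ws)"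
      by (intro exI[of _ "\<Sum>bs\<in>?B. C bs"])
        (auto simp: norm_form_def D[OF x] sum_distrib_right intro!: sum_mono C)
  qed
  show "jet_derivative D x"
    unfolding jet_derivative_def
  proof (intro allI impI)
    fix k and e :: real assume e: "e > 0"
    define e' where "e' = e / (1 + card ?B)"
    have e': "e' > 0" using e by (simp add: e'_def add_pos_nonneg)
    have ce: "card ?B * e' \<le> e"
    proof -
      have "card ?B * e' \<le> (1 + card ?B) * e'" using e' by (intro mult_right_mono) auto
      also have "\<dots> = e" by (simp add: e'_def add_pos_nonneg)
      finally show ?thesis .
    qed
    have "\<forall>\<^sub>F y in at x. \<forall>bs\<in>?B. \<forall>ws. length ws \<le> k \<longrightarrow>
      norm (?I bs ws y - ?I bs ws x - ?I bs ((y - x) # ws) x) \<le> e' * norm (y - x) * prod_list (map norm ws)"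
      using j e' by (intro eventually_ball_finite ballI jet_derivativeD) auto
    moreover have "\<forall>\<^sub>F y in at x. y \<in> S"
      using S x eventually_at_in_open' by blast
    ultimately show "\<forall>\<^sub>F y in at x. \<forall>vs. length vs = k \<longrightarrow>
      norm (D y vs - D x vs - D x ((y - x) # vs)) \<le> e * norm (y - x) * prod_list (map norm vs)"
    proof eventually_elim
      case (elim y)
      show ?case
      proof (intro allI impI)
        fix ws :: "'a list" assume k: "length ws = k"
        have "norm (D y ws - D x ws - D x ((y - x) # ws))
          = (\<Sum>bs\<in>?B. norm (?I bs ws y - ?I bs ws x - ?I bs ((y - x) # ws) x))"
          unfolding norm_form_def by (simp only: form_apply_simps D x elim)
        also have "\<dots> \<le> (\<Sum>bs\<in>?B. e' * norm (y - x) * prod_list (map norm ws))"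
          using elim k by (intro sum_mono) auto
        also have "\<dots> = (card ?B * e') * norm (y - x) * prod_list (map norm ws)" by simp
        also have "\<dots> \<le> e * norm (y - x) * prod_list (map norm ws)"
          using ce by (intro mult_right_mono) auto
        finally show "norm (D y ws - D x ws - D x ((y - x) # ws)) \<le> e * norm (y - x) * prod_list (map norm ws)" .
      qed
    qed
  qed
qed

subsection \<open>The typical fibre as a Hilbert module\<close>

lemma orthonormal_independent:
  assumes g: "inner_product g" and B: "finite B" "\<And>e f. e \<in> B \<Longrightarrow> f \<in> B \<Longrightarrow> g e f = (if e = f then 1 else 0)"
  shows "independent B"
proof (rule independent_if_scalars_zero[OF B(1)])
  fix u e assume e: "e \<in> B" and s: "(\<Sum>v\<in>B. u v *\<^sub>R v) = 0"
  have l: "linear (g e)" using g by (simp add: inner_product_def bilinear_def)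
  have "g e (\<Sum>v\<in>B. u v *\<^sub>R v) = (\<Sum>v\<in>B. u v * g e v)"
    by (simp add: linear_sum[OF l] linear_scale[OF l])
  also have "\<dots> = (\<Sum>v\<in>B. if e = v then u v else 0)"
    by (rule sum.cong) (auto simp: B(2) e)
  finally show "u e = 0" using s e B(1) by (simp add: linear_0[OF l])
qed

locale orthonormal_frame =
  fixes g :: "'v::euclidean_space \<Rightarrow> 'v \<Rightarrow> real"
  assumes g: "inner_product g" and ex_basis: "\<exists>B. orthonormal_basis g B"
begin

text \<open>The same choice as the one inside \<open>frame_lists\<close>, so that sums over frames
  become sums over lists in one known basis.\<close>

definition B\<^sub>0 :: "'v set" where "B\<^sub>0 = (SOME B. orthonormal_basis g B)"

lemma B\<^sub>0: "orthonormal_basis g B\<^sub>0"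
  unfolding B\<^sub>0_def using ex_basis by (rule someI_ex)

lemma finite_B\<^sub>0 [simp]: "finite B\<^sub>0" and g_B\<^sub>0: "e \<in> B\<^sub>0 \<Longrightarrow> f \<in> B\<^sub>0 \<Longrightarrow> g e f = (if e = f then 1 else 0)"
  using B\<^sub>0 by (auto simp: orthonormal_basis_def)

lemma linear_g: "linear (g u)" "linear (\<lambda>u. g u v)"
  using g by (auto simp: inner_product_def bilinear_def)

lemma g_commute: "g u v = g v u"
  using g unfolding inner_product_def by blast

lemma expand_B\<^sub>0: "v = (\<Sum>e\<in>B\<^sub>0. g v e *\<^sub>R e)"
proof -
  have "independent B\<^sub>0" by (rule orthonormal_independent[OF g finite_B\<^sub>0 g_B\<^sub>0])
  moreover have "card B\<^sub>0 = DIM('v)" using B\<^sub>0 by (simp add: orthonormal_basis_def)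
  ultimately have "span B\<^sub>0 = UNIV" using card_eq_dim[of B\<^sub>0 UNIV] by auto
  then have "v \<in> span B\<^sub>0" by simp
  then obtain u where u: "v = (\<Sum>w\<in>B\<^sub>0. u w *\<^sub>R w)" by (auto simp: span_finite)
  have "g v e = u e" if "e \<in> B\<^sub>0" for e
  proof -
    have "g v e = (\<Sum>w\<in>B\<^sub>0. u w * g w e)"
      unfolding u by (simp add: linear_sum[OF linear_g(2)] linear_scale[OF linear_g(2)])
    also have "\<dots> = (\<Sum>w\<in>B\<^sub>0. if e = w then u w else 0)"
      by (rule sum.cong) (auto simp: g_B\<^sub>0 that)
    finally have "g v e = (\<Sum>w\<in>B\<^sub>0. if e = w then u w else 0)" .
    then show ?thesis using that by simp
  qed
  then show ?thesis by (simp add: u)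
qed

lemma frame_lists_eq: "frame_lists g = (\<Union>k\<le>DIM('v). lists_of B\<^sub>0 k)"
  by (auto simp: frame_lists_def lists_of_def B\<^sub>0_def)

lemma finite_frame_lists [simp]: "finite (frame_lists g)"
  by (simp add: frame_lists_eq)

lemma sum_frame_lists: "(\<Sum>es\<in>frame_lists g. f es) = (\<Sum>k\<le>DIM('v). \<Sum>es\<in>lists_of B\<^sub>0 k. f es)"
  unfolding frame_lists_eq
proof (rule sum.UNION_disjoint)
  show "\<forall>k\<in>{..DIM('v)}. finite (lists_of B\<^sub>0 k)" by simp
qed (auto simp: lists_of_def)

text \<open>Standard basis vectors are expanded in the frame. This ties the norm of forms, defined
  by the standard basis, to the components in which the module product is written.\<close>

lemma norm_form_le_frame:
  "\<exists>C\<ge>0. \<forall>F :: ('v, 'h::real_normed_vector) form. norm F \<le> C * (\<Sum>es\<in>frame_lists g. norm (form_apply F es))"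
proof (intro exI conjI allI)
  let ?c = "\<lambda>bs es. \<bar>list_coeff g bs es\<bar>"
  let ?C = "\<Sum>bs\<in>basis_lists. \<Sum>es\<in>frame_lists g. ?c bs es"
  show "0 \<le> ?C" by (intro sum_nonneg) auto
  fix F :: "('v, 'h) form"
  have "norm (form_apply F bs) \<le> (\<Sum>es\<in>frame_lists g. ?c bs es) * (\<Sum>es\<in>frame_lists g. norm (form_apply F es))"
    if "bs \<in> basis_lists" for bs
  proof -
    have "lists_of B\<^sub>0 (length bs) \<subseteq> frame_lists g"
      using that unfolding frame_lists_eq basis_lists_def by auto
    have "norm (form_apply F bs) \<le> (\<Sum>es\<in>lists_of B\<^sub>0 (length bs). ?c bs es * norm (form_apply F es))"
      by (subst multilinear_expand_basis[OF multilinear_form finite_B\<^sub>0 expand_B\<^sub>0])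
        (rule order_trans[OF norm_sum], simp)
    also have "\<dots> \<le> (\<Sum>es\<in>frame_lists g. ?c bs es * norm (form_apply F es))"
      by (rule sum_mono2) (use \<open>lists_of B\<^sub>0 (length bs) \<subseteq> frame_lists g\<close> in auto)
    also have "\<dots> \<le> (\<Sum>es\<in>frame_lists g. ?c bs es * (\<Sum>es\<in>frame_lists g. norm (form_apply F es)))"
      by (intro sum_mono mult_left_mono member_le_sum) auto
    finally show ?thesis by (simp add: sum_distrib_right)
  qed
  then show "norm F \<le> ?C * (\<Sum>es\<in>frame_lists g. norm (form_apply F es))"
    unfolding norm_form_def by (simp add: sum_distrib_right sum_mono)
qed

context
  fixes x y z :: "('v, 'x::{complex_inner, complete_space} cdual) form"
begin

lemma form_prod_add_right: "form_prod g x (y + z) = form_prod g x y + form_prod g x z"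
  by (simp add: form_prod_def rank_one_simps scaleR_add_right sum.distrib)

lemma form_prod_scaleC_right: "form_prod g x (c *\<^sub>C y) = c *\<^sub>C form_prod g x y"
  by (rule cpt_extI) (simp add: form_prod_def rank_one_simps cpt_apply_rank_one clinear_sum[where T = "(*\<^sub>C) c"]
      clinear_def scaleC_add_right scaleC_scaleC mult.commute scaleC_scaleR)

lemma form_prod_act: "form_prod g x (form_act y a) = cpt_compose (form_prod g x y) a"
  by (simp add: form_prod_def cpt_compose_sum cpt_compose_simps cpt_compose_rank_one)

lemma form_prod_adjoint: "form_prod g y x = cpt_adjoint (form_prod g x y)"
  unfolding form_prod_def by (subst cpt_adjoint_sum_rank_one) simp

lemma norm_form_prod_self_le:
  "norm (form_prod g x x) \<le> (\<Sum>es\<in>frame_lists g. (prod_list (map norm es))\<^sup>2) * (norm x)\<^sup>2"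
proof -
  have "norm ((1 / fact (length es)) *\<^sub>R rank_one (sharp (form_apply x es)) (form_apply x es))
      \<le> (prod_list (map norm es))\<^sup>2 * (norm x)\<^sup>2" for es
  proof -
    have "norm ((1 / fact (length es)) *\<^sub>R rank_one (sharp (form_apply x es)) (form_apply x es))
      \<le> 1 * (norm (form_apply x es) * norm (form_apply x es))"
      unfolding norm_scaleR using norm_rank_one_le[of "sharp (form_apply x es)" "form_apply x es"]
      by (intro mult_mono) (auto simp: fact_ge_1)
    also have "\<dots> \<le> (norm x * prod_list (map norm es)) * (norm x * prod_list (map norm es))"
      unfolding mult_1 by (intro mult_mono norm_form_apply_le) auto
    finally show ?thesis by (simp add: power2_eq_square mult_ac)
  qed
  then show ?thesis unfolding form_prod_def sum_distrib_right by (intro sum_norm_le)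
qed

text \<open>The operator \<open>form_prod g x x\<close> is tested on \<open>v\<close>, the vector of
  the chosen component. The quadratic form is a sum of nonnegative terms, and the one belonging to
  \<open>es\<close> alone is the fourth power of \<open>norm v\<close> divided by a
  factorial.\<close>

lemma norm_form_apply_le_prod:
  assumes "es \<in> frame_lists g"
  shows "(norm (form_apply x es))\<^sup>2 \<le> fact (length es) * norm (form_prod g x x)"
proof -
  define v where "v = sharp (form_apply x es)"
  let ?t = "\<lambda>fs. (1 / fact (length fs)) * (cmod (ev (form_apply x fs) v))\<^sup>2"
  have "cinner v (cpt_apply (form_prod g x x) v) = of_real (\<Sum>fs\<in>frame_lists g. ?t fs)"
  proof -
    have "cinner v ((1 / fact (length fs)) *\<^sub>R ev (form_apply x fs) v *\<^sub>C sharp (form_apply x fs)) = of_real (?t fs)" for fs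
    proof -
      have "cinner v (sharp (form_apply x fs)) = cnj (ev (form_apply x fs) v)"
        by (subst cinner_commute) (simp add: cinner_sharp)
      then show ?thesis
        by (simp add: cinner_scaleC_right complex_norm_square del: of_real_power flip: scaleC_of_real)
    qed
    then show ?thesis by (simp add: form_prod_def cpt_apply_rank_one cinner_sum_right)
  qed
  then have "(\<Sum>fs\<in>frame_lists g. ?t fs) = Re (cinner v (cpt_apply (form_prod g x x) v))"
    by (metis Re_complex_of_real)
  also have "\<dots> \<le> norm v * (norm (form_prod g x x) * norm v)"
    unfolding Re_cinner
    by (rule order_trans[OF norm_cauchy_schwarz mult_left_mono[OF norm_cpt_apply_le]]) simp
  finally have "(\<Sum>fs\<in>frame_lists g. ?t fs) \<le> norm (form_prod g x x) * (norm v)\<^sup>2"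
    by (simp add: power2_eq_square mult_ac)
  moreover have "?t es \<le> (\<Sum>fs\<in>frame_lists g. ?t fs)"
    by (rule member_le_sum) (use assms in auto)
  moreover have "ev (form_apply x es) v = of_real ((norm v)\<^sup>2)"
    by (simp add: v_def cinner_self flip: cinner_sharp)
  moreover have "cmod (of_real ((norm v)\<^sup>2)) = (norm v)\<^sup>2" by (simp add: norm_power)
  ultimately have "(1 / fact (length es)) * ((norm v)\<^sup>2)\<^sup>2 \<le> norm (form_prod g x x) * (norm v)\<^sup>2"
    by (metis (no_types, lifting) order_trans)
  then have "(1 / fact (length es)) * ((norm v)\<^sup>2 * (norm v)\<^sup>2) \<le> norm (form_prod g x x) * (norm v)\<^sup>2"
    unfolding power2_eq_square[of "(norm v)\<^sup>2"] .
  then have "(norm v)\<^sup>2 * (norm v)\<^sup>2 \<le> (fact (length es) * norm (form_prod g x x)) * (norm v)\<^sup>2"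
    by (simp add: divide_le_eq mult_ac)
  then have "(norm v)\<^sup>2 \<le> fact (length es) * norm (form_prod g x x)"
    by (cases "v = 0") (simp, rule mult_right_le_imp_le, assumption, simp)
  then show ?thesis by (simp add: v_def)
qed

text \<open>The operator \<open>b\<close> sends each component to its own member of an orthonormal
  family, so that in the product with its adjoint the cross terms vanish. The square roots
  \<open>s es\<close> reproduce the factorial weights.\<close>

lemma form_prod_positive:
  fixes e :: "nat \<Rightarrow> 'x"
  assumes e: "\<And>i j. cinner (e i) (e j) = (if i = j then 1 else 0)"
  shows "\<exists>b. form_prod g x x = cpt_compose (cpt_adjoint b) b"
proof -
  let ?I = "frame_lists g"
  obtain n :: "'v list \<Rightarrow> nat" where n: "inj_on n ?I"
    using finite_imp_inj_to_nat_seg[OF finite_frame_lists] by blast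
  define s where "s es = sqrt (1 / fact (length es))" for es :: "'v list"
  have s: "s es * s es = 1 / fact (length es)" for es by (simp add: s_def)
  define b where "b = (\<Sum>es\<in>?I. s es *\<^sub>R rank_one (e (n es)) (form_apply x es))"
  have b': "cpt_adjoint b = (\<Sum>es\<in>?I. s es *\<^sub>R rank_one (sharp (form_apply x es)) (flat (e (n es))))"
    unfolding b_def by (rule cpt_adjoint_sum_rank_one)
  have "form_prod g x x = cpt_compose (cpt_adjoint b) b"
  proof (rule cpt_extI)
    fix w
    have bw: "ev (flat (e (n es))) (cpt_apply b w) = of_real (s es) * ev (form_apply x es) w" if "es \<in> ?I" for es
    proof -
      have "ev (flat (e (n es))) (cpt_apply b w)
        = (\<Sum>fs\<in>?I. of_real (s fs) * (ev (form_apply x fs) w * (if n es = n fs then 1 else 0)))"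
        by (simp add: b_def ev_flat cpt_apply_rank_one cinner_sum_right cinner_scaleC_right e
            flip: scaleC_of_real)
      also have "\<dots> = (\<Sum>fs\<in>?I. if es = fs then of_real (s fs) * ev (form_apply x fs) w else 0)"
        using inj_onD[OF n _ that] by (intro sum.cong) auto
      finally have "ev (flat (e (n es))) (cpt_apply b w)
        = (\<Sum>fs\<in>?I. if es = fs then of_real (s fs) * ev (form_apply x fs) w else 0)" .
      then show ?thesis using that by simp
    qed
    have "cpt_apply (cpt_compose (cpt_adjoint b) b) w
      = (\<Sum>es\<in>?I. s es *\<^sub>R (of_real (s es) * ev (form_apply x es) w) *\<^sub>C sharp (form_apply x es))"
      unfolding b' by (simp add: cpt_apply_rank_one bw)
    also have "\<dots> = (\<Sum>es\<in>?I. (1 / fact (length es)) *\<^sub>R ev (form_apply x es) w *\<^sub>C sharp (form_apply x es))"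
      by (intro sum.cong) (simp_all only: s scaleC_scaleC[symmetric] scaleC_of_real scaleR_scaleR)
    finally show "cpt_apply (form_prod g x x) w = cpt_apply (cpt_compose (cpt_adjoint b) b) w"
      by (simp add: form_prod_def cpt_apply_rank_one)
  qed
  then show ?thesis by blast
qed

end

text \<open>Together with \<open>norm_form_prod_self_le\<close> this makes the module norm
  equivalent to the norm of forms, which is how completeness of the module follows from that of the
  space of forms.\<close>

lemma norm_form_le_prod:
  "\<exists>C\<ge>0. \<forall>F :: ('v, 'x::{complex_inner, complete_space} cdual) form. norm F \<le> C * sqrt (norm (form_prod g F F))"
proof -
  obtain C where C: "C \<ge> 0" "\<And>F :: ('v, 'x cdual) form. norm F \<le> C * (\<Sum>es\<in>frame_lists g. norm (form_apply F es))"
    using norm_form_le_frame by blast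
  let ?s = "\<Sum>es\<in>frame_lists g. sqrt (fact (length es))"
  show ?thesis
  proof (intro exI[of _ "C * ?s"] conjI allI)
    fix F :: "('v, 'x cdual) form"
    have "norm (form_apply F es) \<le> sqrt (fact (length es)) * sqrt (norm (form_prod g F F))"
      if "es \<in> frame_lists g" for es
      using real_sqrt_le_mono[OF norm_form_apply_le_prod[OF that, of F]] by (simp add: real_sqrt_mult)
    then have "(\<Sum>es\<in>frame_lists g. norm (form_apply F es)) \<le> ?s * sqrt (norm (form_prod g F F))"
      unfolding sum_distrib_right by (rule sum_mono)
    from order_trans[OF C(2) mult_left_mono[OF this C(1)]]
    show "norm F \<le> C * ?s * sqrt (norm (form_prod g F F))" by (simp add: mult.assoc)
  qed (use C in \<open>auto intro!: mult_nonneg_nonneg sum_nonneg\<close>)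
qed

lemma hilbert_CH_module_form:
  fixes e :: "nat \<Rightarrow> 'x::{complex_inner, complete_space}"
  assumes e: "\<And>i j. cinner (e i) (e j) = (if i = j then 1 else 0)"
  shows "hilbert_CH_module (UNIV :: ('v, 'x cdual) form set) (+) (*\<^sub>C) form_act (form_prod g)"
proof -
  interpret a: bounded_bilinear "form_act :: ('v, 'x cdual) form \<Rightarrow> 'x cpt \<Rightarrow> _"
    by (rule bounded_bilinear_form_act)
  obtain C where C: "C \<ge> 0" "\<And>F :: ('v, 'x cdual) form. norm F \<le> C * sqrt (norm (form_prod g F F))"
    using norm_form_le_prod by blast
  let ?d = "\<lambda>x y :: ('v, 'x cdual) form. let z = x + (- 1) *\<^sub>C y in sqrt (norm (form_prod g z z))"
  have d: "?d x y = sqrt (norm (form_prod g (x - y) (x - y)))" for x y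
  proof -
    have "(- 1) *\<^sub>C y = - y" using scaleC_of_real[of "- 1" y] by simp
    then show ?thesis by (simp add: Let_def)
  qed
  have complete: "\<exists>x\<in>UNIV. (\<lambda>n. ?d (s n) x) \<longlonglongrightarrow> 0"
    if s: "\<forall>e>0. \<exists>N. \<forall>m\<ge>N. \<forall>n\<ge>N. ?d (s m) (s n) < e" for s :: "nat \<Rightarrow> ('v, 'x cdual) form"
  proof -
    have "Cauchy s"
      unfolding Cauchy_iff
    proof (intro allI impI)
      fix r :: real assume r: "r > 0"
      \<comment> \<open>The summand 1 allows for \<open>C = 0\<close>.\<close>
      then have "r / (C + 1) > 0" using C(1) by (simp add: add_nonneg_pos)
      then obtain N where N: "\<And>m n. m \<ge> N \<Longrightarrow> n \<ge> N \<Longrightarrow> ?d (s m) (s n) < r / (C + 1)" using s by blast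
      have "norm (s m - s n) < r" if "m \<ge> N" "n \<ge> N" for m n
      proof -
        have "norm (s m - s n) \<le> C * ?d (s m) (s n)" unfolding d by (rule C(2))
        also have "\<dots> \<le> C * (r / (C + 1))" using N[OF that] C(1) by (intro mult_left_mono) auto
        also have "\<dots> < r" using C(1) r by (simp add: field_simps)
        finally show ?thesis .
      qed
      then show "\<exists>M. \<forall>m\<ge>M. \<forall>n\<ge>M. norm (s m - s n) < r" by blast
    qed
    then obtain l where l: "s \<longlonglongrightarrow> l" using Cauchy_convergent convergent_def by blast
    let ?K = "\<Sum>es\<in>frame_lists g. (prod_list (map norm es))\<^sup>2"
    have "(\<lambda>n. sqrt (?K * (norm (s n - l))\<^sup>2)) \<longlonglongrightarrow> sqrt (?K * (norm (l - l))\<^sup>2)"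
      by (intro tendsto_intros l)
    then have lim: "(\<lambda>n. sqrt (?K * (norm (s n - l))\<^sup>2)) \<longlonglongrightarrow> 0" by simp
    have "(\<lambda>n. ?d (s n) l) \<longlonglongrightarrow> 0"
      unfolding d
      by (rule tendsto_sandwich[OF _ _ tendsto_const lim])
        (auto intro!: always_eventually real_sqrt_le_mono norm_form_prod_self_le)
    then show ?thesis by blast
  qed
  have zero: "x = 0" if "form_prod g x x = 0" for x :: "('v, 'x cdual) form"
    using C(2)[of x] that by simp
  have actC: "form_act (c *\<^sub>C x) b = c *\<^sub>C form_act x b" "form_act x (c *\<^sub>C b) = c *\<^sub>C form_act x b"
    "form_act x (cpt_compose b b') = form_act (form_act x b) b'" for c b b' and x :: "('v, 'x cdual) form"
    by (auto intro!: form_extI ev_extI simp: ev_scaleC_right)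
  show ?thesis
    unfolding hilbert_CH_module_def
  proof (intro conjI)
    show "\<exists>o\<^sub>E\<in>UNIV. (\<forall>x\<in>UNIV. x + o\<^sub>E = x) \<and> (\<forall>x\<in>UNIV. \<exists>y\<in>UNIV. x + y = o\<^sub>E) \<and>
      (\<forall>x\<in>UNIV. form_prod g x x = 0 \<longrightarrow> (x :: ('v, 'x cdual) form) = o\<^sub>E)"
      using zero by (intro bexI[of _ 0]) (auto intro: right_minus)
    show "\<forall>x\<in>UNIV. \<exists>b. form_prod g x x = cpt_compose (cpt_adjoint b) (b :: 'x cpt)"
      using form_prod_positive[OF e] by blast
    show "let d = ?d in \<forall>s. (\<forall>n::nat. s n \<in> UNIV) \<and> (\<forall>e>0. \<exists>N. \<forall>m\<ge>N. \<forall>n\<ge>N. d (s m) (s n) < e) \<longrightarrow>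
        (\<exists>x\<in>UNIV. (\<lambda>n. d (s n) x) \<longlonglongrightarrow> 0)"
      unfolding Let_def[of ?d] using complete by blast
    show "\<forall>x\<in>UNIV. \<forall>y\<in>UNIV. \<forall>z\<in>UNIV. \<forall>a (c::complex). form_prod g x (y + z) = form_prod g x y + form_prod g x (z :: ('v, 'x cdual) form) \<and>
      form_prod g x (c *\<^sub>C y) = c *\<^sub>C form_prod g x y \<and> form_prod g x (form_act y a) = cpt_compose (form_prod g x y) a \<and>
      form_prod g y x = cpt_adjoint (form_prod g x y)"
      by (simp add: form_prod_add_right form_prod_scaleC_right form_prod_act form_prod_adjoint[symmetric])
  qed (auto simp: add.assoc add.commute scaleC_add_right scaleC_add_left scaleC_scaleC a.add_left a.add_right actC)
qed

end

text \<open>Equations in \<open>E\<close> can be checked after the injective map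
  \<open>\<Psi>\<close>, and the elements asserted to exist are pulled back by its inverse. The
  distance is written through \<open>ip\<close>, so completeness is carried over too.\<close>

lemma hilbert_CH_module_transport:
  assumes H: "hilbert_CH_module UNIV fadd fsmul f_act fip"
    and \<Psi>: "bij_betw \<Psi> E UNIV"
    and add: "\<And>x y. x \<in> E \<Longrightarrow> y \<in> E \<Longrightarrow> add x y \<in> E \<and> \<Psi> (add x y) = fadd (\<Psi> x) (\<Psi> y)"
    and smul: "\<And>x c. x \<in> E \<Longrightarrow> smul c x \<in> E \<and> \<Psi> (smul c x) = fsmul c (\<Psi> x)"
    and act: "\<And>x a. x \<in> E \<Longrightarrow> act x a \<in> E \<and> \<Psi> (act x a) = f_act (\<Psi> x) a"
    and ip: "\<And>x y. x \<in> E \<Longrightarrow> y \<in> E \<Longrightarrow> ip x y = fip (\<Psi> x) (\<Psi> y)"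
  shows "hilbert_CH_module E add smul act ip"
proof -
  have inj: "x \<in> E \<Longrightarrow> y \<in> E \<Longrightarrow> x = y \<longleftrightarrow> \<Psi> x = \<Psi> y" for x y
    using \<Psi> by (auto simp: bij_betw_def inj_on_def)
  define \<Phi> where "\<Phi> = inv_into E \<Psi>"
  have \<Phi>: "\<Phi> f \<in> E" "\<Psi> (\<Phi> f) = f" for f
    using \<Psi> by (auto simp: \<Phi>_def bij_betw_def inv_into_into f_inv_into_f)
  note H = H[unfolded hilbert_CH_module_def]
  show ?thesis
    unfolding hilbert_CH_module_def
  proof (intro conjI)
    show "\<forall>x\<in>E. \<forall>y\<in>E. \<forall>z\<in>E. add x y \<in> E \<and> add (add x y) z = add x (add y z) \<and> add x y = add y x"
    proof (intro ballI)
      fix x y z assume E: "x \<in> E" "y \<in> E" "z \<in> E"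
      have "fadd (fadd a b) c = fadd a (fadd b c)" "fadd a b = fadd b a" for a b c
        using H[THEN conjunct1] by blast+
      note f = this(1) this(2)[of "\<Psi> x" "\<Psi> y"]
      have "add (add x y) z = add x (add y z)" using E by (simp add: inj add f(1))
      moreover have "add x y = add y x" using E by (simp add: inj add) (rule f(2))
      ultimately show "add x y \<in> E \<and> add (add x y) z = add x (add y z) \<and> add x y = add y x"
        using add[OF E(1,2)] by blast
    qed
    obtain z where z: "\<And>x. fadd x z = x" "\<And>x. \<exists>y. fadd x y = z" "\<And>x. fip x x = 0 \<longrightarrow> x = z"
      using H[THEN conjunct2, THEN conjunct1] by auto
    show "\<exists>o\<^sub>E\<in>E. (\<forall>x\<in>E. add x o\<^sub>E = x) \<and> (\<forall>x\<in>E. \<exists>y\<in>E. add x y = o\<^sub>E) \<and> (\<forall>x\<in>E. ip x x = 0 \<longrightarrow> x = o\<^sub>E)"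
    proof (rule bexI[of _ "\<Phi> z"], intro conjI ballI)
      fix x assume x: "x \<in> E"
      show "add x (\<Phi> z) = x" using x by (simp add: inj add \<Phi> z)
      obtain y where "fadd (\<Psi> x) y = z" using z(2) by blast
      then have "add x (\<Phi> y) = \<Phi> z" using x by (simp add: inj add \<Phi>)
      then show "\<exists>y\<in>E. add x y = \<Phi> z" using \<Phi>(1) by blast
      show "ip x x = 0 \<longrightarrow> x = \<Phi> z" using x z(3) by (simp add: inj ip \<Phi>)
    qed (rule \<Phi>)
    show "\<forall>x\<in>E. \<forall>y\<in>E. \<forall>c d. smul c x \<in> E \<and> smul c (add x y) = add (smul c x) (smul c y) \<and>
      smul (c + d) x = add (smul c x) (smul d x) \<and> smul c (smul d x) = smul (c * d) x \<and> smul 1 x = x"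
      using H[THEN conjunct2, THEN conjunct2, THEN conjunct1] by (simp add: inj add smul)
    show "\<forall>x\<in>E. \<forall>y\<in>E. \<forall>a b c. act x a \<in> E \<and> act (add x y) a = add (act x a) (act y a) \<and>
      act x (a + b) = add (act x a) (act x b) \<and> act x (cpt_compose a b) = act (act x a) b \<and>
      act (smul c x) a = smul c (act x a) \<and> act x (c *\<^sub>C a) = smul c (act x a)"
      using H[THEN conjunct2, THEN conjunct2, THEN conjunct2, THEN conjunct1] by (simp add: inj add smul act)
    show "\<forall>x\<in>E. \<forall>y\<in>E. \<forall>z\<in>E. \<forall>a c. ip x (add y z) = ip x y + ip x z \<and>
      ip x (smul c y) = c *\<^sub>C ip x y \<and> ip x (act y a) = cpt_compose (ip x y) a \<and>
      ip y x = cpt_adjoint (ip x y)"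
    proof (intro ballI allI)
      fix x y z a c assume E: "x \<in> E" "y \<in> E" "z \<in> E"
      show "ip x (add y z) = ip x y + ip x z \<and>
      ip x (smul c y) = c *\<^sub>C ip x y \<and> ip x (act y a) = cpt_compose (ip x y) a \<and>
      ip y x = cpt_adjoint (ip x y)"
        using H[THEN conjunct2, THEN conjunct2, THEN conjunct2, THEN conjunct2, THEN conjunct1,
          rule_format, of "\<Psi> x" "\<Psi> y" "\<Psi> z" c a] E by (simp add: ip add smul act)
    qed
    show "\<forall>x\<in>E. \<exists>b. ip x x = cpt_compose (cpt_adjoint b) b"
      using H[THEN conjunct2, THEN conjunct2, THEN conjunct2, THEN conjunct2, THEN conjunct2, THEN conjunct1]
      by (simp add: ip)
    let ?d = "\<lambda>x y. let z = add x (smul (- 1) y) in sqrt (norm (ip z z))"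
    let ?d' = "\<lambda>x y. let z = fadd x (fsmul (- 1) y) in sqrt (norm (fip z z))"
    have d: "?d x y = ?d' (\<Psi> x) (\<Psi> y)" if "x \<in> E" "y \<in> E" for x y
      using that by (simp add: Let_def add smul ip)
    show "let d = ?d in \<forall>s. (\<forall>n::nat. s n \<in> E) \<and> (\<forall>e>0. \<exists>N. \<forall>m\<ge>N. \<forall>n\<ge>N. d (s m) (s n) < e) \<longrightarrow>
        (\<exists>x\<in>E. (\<lambda>n. d (s n) x) \<longlonglongrightarrow> 0)"
      unfolding Let_def[of ?d]
    proof (intro allI impI, elim conjE)
      fix s assume s: "\<forall>n::nat. s n \<in> E" "\<forall>e>0. \<exists>N. \<forall>m\<ge>N. \<forall>n\<ge>N. ?d (s m) (s n) < e"
      have "\<forall>e>0. \<exists>N. \<forall>m\<ge>N. \<forall>n\<ge>N. ?d' (\<Psi> (s m)) (\<Psi> (s n)) < e"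
        using s(2) unfolding d[OF s(1)[rule_format] s(1)[rule_format]] .
      then have "\<exists>l. (\<lambda>n. ?d' (\<Psi> (s n)) l) \<longlonglongrightarrow> 0"
        using H[THEN conjunct2, THEN conjunct2, THEN conjunct2, THEN conjunct2, THEN conjunct2, THEN conjunct2]
        by (simp add: Let_def)
      then obtain l where l: "(\<lambda>n. ?d' (\<Psi> (s n)) l) \<longlonglongrightarrow> 0" ..
      have "(\<lambda>n. ?d (s n) (\<Phi> l)) \<longlonglongrightarrow> 0"
        unfolding d[OF s(1)[rule_format] \<Phi>(1)] \<Phi>(2) by (rule l)
      then show "\<exists>x\<in>E. (\<lambda>n. ?d (s n) x) \<longlonglongrightarrow> 0" using \<Phi>(1) by blast
    qed
  qed
qed

subsection \<open>Compatible complex structures\<close>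

text \<open>Generic in \<open>J\<close>, because a second structure on the same symplectic space is
  needed to construct intertwiners.\<close>

locale complex_structure =
  fixes \<omega>\<^sub>0 :: "'v::euclidean_space \<Rightarrow> 'v \<Rightarrow> real" and J :: "'v \<Rightarrow> 'v"
  assumes symplectic: "linear_symplectic \<omega>\<^sub>0" and complex: "linear_complex_structure \<omega>\<^sub>0 J"
begin

abbreviation g where "g \<equiv> metric_of \<omega>\<^sub>0 J"

lemma J: "linear J" "J (J v) = - v" and g: "inner_product g"
  using complex by (auto simp: linear_complex_structure_def)

lemma linear_\<omega>: "linear (\<omega>\<^sub>0 u)" "linear (\<lambda>u. \<omega>\<^sub>0 u v)"
  using symplectic by (auto simp: linear_symplectic_def bilinear_def)

lemma linear_g: "linear (g u)" "linear (\<lambda>u. g u v)"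
  using g by (auto simp: inner_product_def bilinear_def)

lemma g_commute: "g u v = g v u"
  using g unfolding inner_product_def by blast

lemma g_pos: "v \<noteq> 0 \<Longrightarrow> g v v > 0"
  using g by (simp add: inner_product_def)

lemma \<omega>_self [simp]: "\<omega>\<^sub>0 v v = 0"
  using symplectic by (simp add: linear_symplectic_def)

lemma \<omega>_minus: "\<omega>\<^sub>0 (- u) v = - \<omega>\<^sub>0 u v"
  using linear_neg[OF linear_\<omega>(2)] by auto

lemma \<omega>_commute: "\<omega>\<^sub>0 u v = - \<omega>\<^sub>0 v u"
proof -
  have "0 = \<omega>\<^sub>0 (u + v) (u + v)" by simp
  also have "\<dots> = \<omega>\<^sub>0 u u + \<omega>\<^sub>0 v u + (\<omega>\<^sub>0 u v + \<omega>\<^sub>0 v v)"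
    by (simp only: linear_add[OF linear_\<omega>(1)] linear_add[OF linear_\<omega>(2)])
  finally show ?thesis by simp
qed

lemma \<omega>_J: "\<omega>\<^sub>0 (J u) (J v) = \<omega>\<^sub>0 u v"
  using g_commute[of u "J v"] \<omega>_commute[of v u] by (simp add: metric_of_def J \<omega>_minus)

lemma g_J: "g (J u) (J v) = g u v" "g u (J v) = \<omega>\<^sub>0 u v" "g (J u) v = - \<omega>\<^sub>0 u v"
  using \<omega>_J[of "J u" v] by (simp_all add: metric_of_def \<omega>_J J \<omega>_minus)

definition unitary_set :: "'v set \<Rightarrow> bool"
  where "unitary_set E \<longleftrightarrow> finite E \<and> (\<forall>e\<in>E. \<forall>f\<in>E. g e f = (if e = f then 1 else 0) \<and> \<omega>\<^sub>0 e f = 0)"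

lemma unitary_set:
  assumes E: "unitary_set E"
  defines "B \<equiv> E \<union> J ` E"
  shows "finite B" "independent B" "card B = 2 * card E" "E \<inter> J ` E = {}" "inj_on J E"
    "\<And>e f. e \<in> B \<Longrightarrow> f \<in> B \<Longrightarrow> g e f = (if e = f then 1 else 0)"
proof -
  have fin: "finite E" and gE: "\<And>e f. e \<in> E \<Longrightarrow> f \<in> E \<Longrightarrow> g e f = (if e = f then 1 else 0)"
    and wE: "\<And>e f. e \<in> E \<Longrightarrow> f \<in> E \<Longrightarrow> \<omega>\<^sub>0 e f = 0"
    using E by (auto simp: unitary_set_def)
  show "finite B" using fin by (simp add: B_def)
  show inj: "inj_on J E"
    by (rule inj_onI) (metis J(2) minus_equation_iff)
  have ne: "e \<noteq> J f" if "e \<in> E" "f \<in> E" for e f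
    using gE[OF that(1,1)] g_J(2)[of e f] wE[OF that] by auto
  then show disj: "E \<inter> J ` E = {}" by auto
  show "card B = 2 * card E"
    using card_Un_disjoint[OF fin finite_imageI[OF fin] disj] card_image[OF inj] by (simp add: B_def)
  show gB: "g e f = (if e = f then 1 else 0)" if "e \<in> B" "f \<in> B" for e f
  proof -
    have "g e (J f) = 0" "g (J e) f = 0" if "e \<in> E" "f \<in> E" for e f
      using that wE by (simp_all add: g_J(2,3))
    then show ?thesis
      using that ne ne[symmetric] gE inj_onD[OF inj] by (auto simp: B_def g_J(1))
  qed
  show "independent B" by (rule orthonormal_independent[OF g \<open>finite B\<close> gB])
qed

text \<open>In a unitary set of maximal size nothing can be missing: the part of an outside vector
  orthogonal to \<open>E\<close> and to its image under \<open>J\<close> could be normalized and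
  added.\<close>

lemma unitary_basis:
  obtains E where "unitary_set E" "orthonormal_basis g (E \<union> J ` E)" "2 * card E = DIM('v)"
proof -
  have "unitary_set {}" by (simp add: unitary_set_def)
  moreover have "card E \<le> DIM('v)" if "unitary_set E" for E
    using unitary_set(2,3)[OF that] independent_card_le[of "E \<union> J ` E"] by simp
  ultimately obtain E where E: "unitary_set E" and max: "\<And>E'. unitary_set E' \<Longrightarrow> card E' \<le> card E"
    using ex_has_greatest_nat[of unitary_set "{}" card "Suc DIM('v)"] by (auto simp: less_Suc_eq_le)
  define B where "B = E \<union> J ` E"
  note B = unitary_set[OF E, folded B_def]
  have "v \<in> span B" for v
  proof (rule ccontr)
    assume v: "v \<notin> span B"
    define w where "w = v - (\<Sum>b\<in>B. g v b *\<^sub>R b)"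
    have "w \<noteq> 0"
    proof
      assume "w = 0"
      then have "v = (\<Sum>b\<in>B. g v b *\<^sub>R b)" by (simp add: w_def)
      moreover have "(\<Sum>b\<in>B. g v b *\<^sub>R b) \<in> span B" by (intro span_sum span_scale span_base)
      ultimately show False using v by simp
    qed
    have wb: "g w b = 0" if "b \<in> B" for b
    proof -
      have "g (\<Sum>c\<in>B. g v c *\<^sub>R c) b = (\<Sum>c\<in>B. g v c * g c b)"
        by (simp add: linear_sum[OF linear_g(2)] linear_scale[OF linear_g(2)])
      also have "\<dots> = (\<Sum>c\<in>B. if b = c then g v c else 0)"
        by (rule sum.cong) (auto simp: B(6) that)
      also have "\<dots> = g v b" using B(1) that by simp
      finally show ?thesis by (simp add: w_def linear_diff[OF linear_g(2)])
    qed
    define q where "q = (1 / sqrt (g w w)) *\<^sub>R w"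
    have qb: "g q b = 0" if "b \<in> B" for b
      by (simp add: q_def linear_scale[OF linear_g(2)] wb that)
    have qq: "g q q = 1"
      using g_pos[OF \<open>w \<noteq> 0\<close>] by (simp add: q_def linear_scale[OF linear_g(1)] linear_scale[OF linear_g(2)]
        divide_simps flip: real_sqrt_mult)
    \<comment> \<open>Orthogonality to \<open>J e\<close> is the vanishing of the symplectic form on
      \<open>q\<close> and \<open>e\<close>, by \<open>g_J\<close>.\<close>
    have q: "g q e = 0" "g e q = 0" "\<omega>\<^sub>0 q e = 0" "\<omega>\<^sub>0 e q = 0" if "e \<in> E" for e
      using qb[of e] qb[of "J e"] g_commute[of e q] \<omega>_commute[of e q] that by (auto simp: B_def g_J)
    have "q \<notin> E" using q qq by auto
    have "unitary_set (insert q E)"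
      using E q qq \<open>q \<notin> E\<close> unfolding unitary_set_def by auto
    from max[OF this] show False using E \<open>q \<notin> E\<close> by (simp add: unitary_set_def)
  qed
  then have "span B = UNIV" by auto
  then have "card B = DIM('v)" using dim_eq_card_independent[OF B(2)] by (metis dim_UNIV dim_span)
  then show ?thesis
    using that[OF E] B by (simp add: orthonormal_basis_def flip: B_def)
qed

sublocale orthonormal_frame g
  by unfold_locales (use g unitary_basis in blast)+

text \<open>The standard matrix of the symplectic form, with basis vectors indexed by a set so that
  two unitary bases in bijection can be compared by one formula.\<close>

lemma \<omega>_sum:
  fixes a b c d :: "'i \<Rightarrow> real"
  assumes "finite I" and e: "\<And>i j. i \<in> I \<Longrightarrow> j \<in> I \<Longrightarrow> g (e i) (e j) = (if i = j then 1 else 0) \<and> \<omega>\<^sub>0 (e i) (e j) = 0"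
  shows "\<omega>\<^sub>0 (\<Sum>i\<in>I. a i *\<^sub>R e i + b i *\<^sub>R J (e i)) (\<Sum>i\<in>I. c i *\<^sub>R e i + d i *\<^sub>R J (e i))
    = (\<Sum>i\<in>I. b i * c i - a i * d i)"
proof -
  have "\<omega>\<^sub>0 (a i *\<^sub>R e i + b i *\<^sub>R J (e i)) (c j *\<^sub>R e j + d j *\<^sub>R J (e j))
      = (if i = j then b j * c j - a j * d j else 0)" if "i \<in> I" "j \<in> I" for i j
  proof -
    have "\<omega>\<^sub>0 (J (e i)) (e j) = (if i = j then 1 else 0)" "\<omega>\<^sub>0 (e i) (J (e j)) = - (if i = j then 1 else 0)"
      using e[OF that] e[OF that(2,1)] \<omega>_commute[of "e i" "J (e j)"] by (auto simp: metric_of_def)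
    then show ?thesis
      using e[OF that] by (auto simp: linear_add[OF linear_\<omega>(1)] linear_add[OF linear_\<omega>(2)]
        linear_scale[OF linear_\<omega>(1)] linear_scale[OF linear_\<omega>(2)] \<omega>_J)
  qed
  then have "(\<Sum>j\<in>I. \<Sum>i\<in>I. \<omega>\<^sub>0 (a i *\<^sub>R e i + b i *\<^sub>R J (e i)) (c j *\<^sub>R e j + d j *\<^sub>R J (e j)))
    = (\<Sum>j\<in>I. \<Sum>i\<in>I. if i = j then b j * c j - a j * d j else 0)"
    by (intro sum.cong) auto
  then show ?thesis
    using \<open>finite I\<close> by (simp add: linear_sum[OF linear_\<omega>(1)] linear_sum[OF linear_\<omega>(2)])
qed

lemma expand_unitary:
  assumes E: "unitary_set E" "orthonormal_basis g (E \<union> J ` E)"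
  shows "v = (\<Sum>e\<in>E. g v e *\<^sub>R e + g v (J e) *\<^sub>R J e)"
proof -
  note B = unitary_set[OF E(1)]
  have "card (E \<union> J ` E) = DIM('v)" using E(2) by (simp add: orthonormal_basis_def)
  then have "span (E \<union> J ` E) = UNIV" using card_eq_dim[of "E \<union> J ` E" UNIV] B(1,2) by auto
  then obtain u where u: "v = (\<Sum>w\<in>E \<union> J ` E. u w *\<^sub>R w)" using span_finite[OF B(1)] by auto
  have "g v w = u w" if "w \<in> E \<union> J ` E" for w
  proof -
    have "g v w = (\<Sum>c\<in>E \<union> J ` E. u c * g c w)"
      by (subst u) (simp add: linear_sum[OF linear_g(2)] linear_scale[OF linear_g(2)])
    also have "\<dots> = (\<Sum>c\<in>E \<union> J ` E. if w = c then u c else 0)"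
      by (rule sum.cong) (auto simp: B(6)[OF _ that])
    finally show ?thesis using B(1) that by simp
  qed
  then have "v = (\<Sum>w\<in>E \<union> J ` E. g v w *\<^sub>R w)" using u by simp
  also have "\<dots> = (\<Sum>e\<in>E. g v e *\<^sub>R e) + (\<Sum>e\<in>J ` E. g v e *\<^sub>R e)"
    using E(1) B(4) by (intro sum.union_disjoint) (auto simp: unitary_set_def)
  also have "(\<Sum>e\<in>J ` E. g v e *\<^sub>R e) = (\<Sum>e\<in>E. g v (J e) *\<^sub>R J e)"
    by (rule sum.reindex_cong[OF B(5)]) auto
  finally show ?thesis by (simp add: sum.distrib)
qed

lemma Sp_bij:
  assumes "S \<in> Sp \<omega>\<^sub>0"
  shows "bij (blinfun_apply S)" "Blinfun (inv S) \<in> Sp \<omega>\<^sub>0"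
    "S (Blinfun (inv S) v) = v" "Blinfun (inv S) (S v) = v"
proof -
  have S: "\<omega>\<^sub>0 (S u) (S v) = \<omega>\<^sub>0 u v" for u v using assms by (simp add: Sp_def)
  have l: "linear (blinfun_apply S)" by (simp add: blinfun.bounded_linear_right bounded_linear.linear)
  have "inj (blinfun_apply S)"
  proof (rule linear_injective_0[THEN iffD2, OF l], intro allI impI)
    fix u assume "blinfun_apply S u = 0"
    then have "\<omega>\<^sub>0 u v = 0" for v using S[of u v] linear_0[OF linear_\<omega>(2)] by simp
    then show "u = 0" using symplectic by (simp add: linear_symplectic_def)
  qed
  then show b: "bij (blinfun_apply S)"
    using linear_injective_imp_surjective[OF l] by (simp add: bij_def)
  have i: "S (inv S v) = v" "inv S (S v) = v" for v
    using b by (auto simp: bij_is_surj surj_f_inv_f bij_is_inj)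
  have "linear (inv S)" by (rule inj_linear_imp_inv_linear[OF l bij_is_inj[OF b]])
  then have [simp]: "blinfun_apply (Blinfun (inv S)) = inv S"
    by (intro bounded_linear_Blinfun_apply linear_conv_bounded_linear[THEN iffD1])
  have "\<omega>\<^sub>0 (inv S u) (inv S v) = \<omega>\<^sub>0 u v" for u v using S[of "inv S u" "inv S v"] by (simp add: i)
  then show "Blinfun (inv S) \<in> Sp \<omega>\<^sub>0" by (simp add: Sp_def)
  show "S (Blinfun (inv S) v) = v" "Blinfun (inv S) (S v) = v" by (simp_all add: i)
qed

text \<open>The bivector $\sum_e J e \otimes e$ is dual to the symplectic form, hence invariant.\<close>

lemma sum_Sp_invariant:
  fixes \<gamma> :: "'v \<Rightarrow> 'v \<Rightarrow> real"
  assumes S: "S \<in> Sp \<omega>\<^sub>0" and \<gamma>: "bilinear \<gamma>"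
  shows "(\<Sum>e\<in>B\<^sub>0. \<gamma> (S (J e)) (S e)) = (\<Sum>e\<in>B\<^sub>0. \<gamma> (J e) e)"
proof -
  have \<gamma>l: "linear (\<gamma> u)" "linear (\<lambda>u. \<gamma> u v)" for u v using \<gamma> by (auto simp: bilinear_def)
  let ?T = "Blinfun (inv S)"
  have SJ: "linear (\<lambda>v. S (J v))"
    using linear_compose[OF J(1) bounded_linear.linear[OF blinfun.bounded_linear_right[of S]]] by (simp add: o_def)
  \<comment> \<open>The left side is the \<open>g\<close>-adjoint of \<open>S\<close> applied to
    \<open>f\<close>; for symplectic \<open>S\<close> it is the inverse of \<open>S\<close>
    conjugated by \<open>J\<close>.\<close>
  have w: "(\<Sum>e\<in>B\<^sub>0. g (S e) f *\<^sub>R e) = - J (?T (J f))" for f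
  proof -
    have "g (S e) f = g (- J (?T (J f))) e" for e
    proof -
      have "g (S e) f = \<omega>\<^sub>0 (J f) (S e)" by (subst g_commute) (simp add: metric_of_def)
      also have "\<dots> = \<omega>\<^sub>0 (S (?T (J f))) (S e)" by (simp add: Sp_bij[OF S])
      also have "\<dots> = \<omega>\<^sub>0 (?T (J f)) e" using S by (simp add: Sp_def)
      also have "\<dots> = g (- J (?T (J f))) e" by (simp add: metric_of_def linear_neg[OF J(1)] J)
      finally show ?thesis .
    qed
    then show ?thesis using expand_B\<^sub>0[of "- J (?T (J f))"] by simp
  qed
  have "(\<Sum>e\<in>B\<^sub>0. \<gamma> (S (J e)) (S e)) = (\<Sum>e\<in>B\<^sub>0. \<gamma> (S (J e)) (\<Sum>f\<in>B\<^sub>0. g (S e) f *\<^sub>R f))"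
    by (simp flip: expand_B\<^sub>0)
  also have "\<dots> = (\<Sum>f\<in>B\<^sub>0. \<gamma> (S (J (\<Sum>e\<in>B\<^sub>0. g (S e) f *\<^sub>R e))) f)"
    unfolding linear_sum[OF SJ] linear_sum[OF \<gamma>l(1)] linear_sum[OF \<gamma>l(2)]
      linear_scale[OF SJ] linear_scale[OF \<gamma>l(1)] linear_scale[OF \<gamma>l(2)] by (rule sum.swap)
  also have "\<dots> = (\<Sum>f\<in>B\<^sub>0. \<gamma> (J f) f)"
    unfolding w by (simp add: linear_neg[OF J(1)] J Sp_bij[OF S])
  finally show ?thesis .
qed

text \<open>Unitary bases for \<open>J\<close> and \<open>J'\<close> are matched by a bijection,
  which is extended complex linearly. The symplectic form has the same matrix in both bases, so the
  extension is symplectic.\<close>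

lemma exists_intertwiner:
  assumes J': "linear_complex_structure \<omega>\<^sub>0 J'"
  shows "\<exists>S\<in>Sp \<omega>\<^sub>0. \<forall>v. S (J v) = J' (S v)"
proof -
  interpret J': complex_structure \<omega>\<^sub>0 J' by unfold_locales (fact symplectic, fact J')
  obtain E where E: "unitary_set E" "orthonormal_basis g (E \<union> J ` E)" "2 * card E = DIM('v)"
    by (rule unitary_basis)
  obtain E' where E': "J'.unitary_set E'" "2 * card E' = DIM('v)"
    using J'.unitary_basis by metis
  have fin: "finite E" "finite E'" using E(1) E'(1) by (auto simp: unitary_set_def J'.unitary_set_def)
  obtain \<phi> where \<phi>: "bij_betw \<phi> E E'"
    using finite_same_card_bij[OF fin] E(3) E'(2) by auto
  have e: "g e f = (if e = f then 1 else 0) \<and> \<omega>\<^sub>0 e f = 0" if "e \<in> E" "f \<in> E" for e f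
    using E(1) that by (auto simp: unitary_set_def)
  have e': "J'.g (\<phi> e) (\<phi> f) = (if e = f then 1 else 0) \<and> \<omega>\<^sub>0 (\<phi> e) (\<phi> f) = 0"
    if "e \<in> E" "f \<in> E" for e f
  proof -
    have "\<phi> e \<in> E'" "\<phi> f \<in> E'" "\<phi> e = \<phi> f \<longleftrightarrow> e = f"
      using \<phi> that by (auto simp: bij_betw_def inj_on_def)
    then show ?thesis using E'(1) by (auto simp: J'.unitary_set_def)
  qed
  define S where "S v = (\<Sum>e\<in>E. g v e *\<^sub>R \<phi> e + g v (J e) *\<^sub>R J' (\<phi> e))" for v
  have "linear S"
    unfolding S_def
    by (rule linearI) (simp_all add: linear_add[OF linear_g(2)] linear_scale[OF linear_g(2)]
        scaleR_add_left sum.distrib scaleR_sum_right scaleR_add_right)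
  then have [simp]: "blinfun_apply (Blinfun S) = S"
    by (intro bounded_linear_Blinfun_apply linear_conv_bounded_linear[THEN iffD1])
  have gJ: "g (J v) (J e) = g v e" "g (J v) e = - g v (J e)" for v e
    using g_J(1)[of v e] g_J(2)[of v e] g_J(3)[of v e] by auto
  have "S (J v) = J' (S v)" for v
    unfolding S_def linear_sum[OF J'.J(1)] linear_add[OF J'.J(1)] linear_scale[OF J'.J(1)] J'.J(2)
    by (intro sum.cong refl) (simp only: gJ(1), simp add: gJ(2))
  moreover have "\<omega>\<^sub>0 (S u) (S v) = \<omega>\<^sub>0 u v" for u v
  proof -
    have "\<omega>\<^sub>0 (S u) (S v) = (\<Sum>e\<in>E. g u (J e) * g v e - g u e * g v (J e))"
      unfolding S_def by (rule J'.\<omega>_sum[OF fin(1) e'])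
    also have "\<dots> = \<omega>\<^sub>0 u v"
      using \<omega>_sum[of E "\<lambda>e. e" "g u" "\<lambda>e. g u (J e)" "g v" "\<lambda>e. g v (J e)", OF fin(1) e]
      by (simp flip: expand_unitary[OF E(1,2)])
    finally show ?thesis .
  qed
  ultimately show ?thesis by (intro bexI[of _ "Blinfun S"]) (auto simp: Sp_def)
qed

lemma Sp_compose: "S \<in> Sp \<omega>\<^sub>0 \<Longrightarrow> T \<in> Sp \<omega>\<^sub>0 \<Longrightarrow> S o\<^sub>L T \<in> Sp \<omega>\<^sub>0"
  by (simp add: Sp_def)

lemma bounded_bilinear_\<omega>: "bounded_bilinear \<omega>\<^sub>0"
  using symplectic by (simp add: linear_symplectic_def bilinear_conv_bounded_bilinear)

text \<open>The coefficients in the orthonormal basis control the norm. The constant is what bounds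
  intertwiners uniformly when the complex structure is perturbed.\<close>

lemma g_coercive: "\<exists>c>0. \<forall>v. c * (norm v)\<^sup>2 \<le> g v v"
proof -
  obtain C where C: "\<And>v. norm v \<le> C * (\<Sum>e\<in>B\<^sub>0. \<bar>g v e\<bar>)" "C > 0"
  proof
    let ?C = "1 + (\<Sum>e\<in>B\<^sub>0. norm e)"
    show "?C > 0" by (simp add: add_pos_nonneg sum_nonneg)
    fix v
    have "norm v \<le> (\<Sum>e\<in>B\<^sub>0. \<bar>g v e\<bar> * norm e)"
      by (subst expand_B\<^sub>0) (rule order_trans[OF norm_sum], simp)
    also have "\<dots> \<le> (\<Sum>e\<in>B\<^sub>0. \<bar>g v e\<bar> * ?C)"
    proof (intro sum_mono mult_left_mono)
      fix e assume "e \<in> B\<^sub>0"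
      then have "norm e \<le> (\<Sum>e\<in>B\<^sub>0. norm e)" by (intro member_le_sum) auto
      then show "norm e \<le> ?C" by simp
    qed auto
    finally show "norm v \<le> ?C * (\<Sum>e\<in>B\<^sub>0. \<bar>g v e\<bar>)" by (simp add: sum_distrib_left mult.commute)
  qed
  have gvv: "g v v = (\<Sum>e\<in>B\<^sub>0. (g v e)\<^sup>2)" for v
  proof -
    have "g v v = g v (\<Sum>e\<in>B\<^sub>0. g v e *\<^sub>R e)" by (simp flip: expand_B\<^sub>0)
    then show ?thesis by (simp add: linear_sum[OF linear_g(1)] linear_scale[OF linear_g(1)] power2_eq_square)
  qed
  let ?D = "C\<^sup>2 * (1 + card B\<^sub>0)"
  show ?thesis
  proof (intro exI[of _ "1 / ?D"] conjI allI)
    show "1 / ?D > 0" using C(2) by (simp add: add_pos_nonneg)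
    fix v
    have "(norm v)\<^sup>2 \<le> (C * (\<Sum>e\<in>B\<^sub>0. \<bar>g v e\<bar>))\<^sup>2" using C(1) by (rule power_mono) simp
    also have "\<dots> = C\<^sup>2 * (\<Sum>e\<in>B\<^sub>0. \<bar>g v e\<bar>)\<^sup>2" by (simp add: power_mult_distrib)
    also have "(\<Sum>e\<in>B\<^sub>0. \<bar>g v e\<bar>)\<^sup>2 \<le> card B\<^sub>0 * (\<Sum>e\<in>B\<^sub>0. \<bar>g v e\<bar>\<^sup>2)"
      using sum_squared_le_sum_of_squares[of "\<lambda>e. \<bar>g v e\<bar>" B\<^sub>0] by (simp add: mult.commute)
    also have "\<dots> \<le> (1 + card B\<^sub>0) * g v v"
      unfolding gvv power2_abs by (intro mult_right_mono sum_nonneg) auto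
    finally have "(norm v)\<^sup>2 \<le> ?D * g v v" by (simp add: mult_left_mono mult.assoc)
    then show "1 / ?D * (norm v)\<^sup>2 \<le> g v v"
      using \<open>1 / ?D > 0\<close> C(2) by (simp add: divide_le_eq add_pos_nonneg mult.commute)
  qed
qed

text \<open>Intertwiners with structures converging to \<open>J\<close> stay bounded; a limit point commutes with \<open>J\<close>, and
  dividing by it produces intertwiners converging to the identity.\<close>

lemma exists_intertwiner_near:
  assumes "\<epsilon> > 0"
  shows "\<exists>\<delta>>0. \<forall>J' :: 'v \<Rightarrow>\<^sub>L 'v. linear_complex_structure \<omega>\<^sub>0 (blinfun_apply J') \<and> norm (J' - Blinfun J) < \<delta> \<longrightarrow>
    (\<exists>S\<in>Sp \<omega>\<^sub>0. norm (S - id_blinfun) < \<epsilon> \<and>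
      (\<forall>v. blinfun_apply S (J v) = blinfun_apply J' (blinfun_apply S v)))"
proof (rule ccontr)
  interpret \<omega>: bounded_bilinear \<omega>\<^sub>0 by (rule bounded_bilinear_\<omega>)
  assume neg: "\<not> ?thesis"
  have "\<exists>J' :: 'v \<Rightarrow>\<^sub>L 'v. linear_complex_structure \<omega>\<^sub>0 (blinfun_apply J') \<and> norm (J' - Blinfun J) < \<delta> \<and>
    (\<forall>S\<in>Sp \<omega>\<^sub>0. (\<forall>v. blinfun_apply S (J v) = blinfun_apply J' (blinfun_apply S v)) \<longrightarrow> \<not> norm (S - id_blinfun) < \<epsilon>)" if "\<delta> > 0" for \<delta>
    using neg that by blast
  then have "\<forall>n. \<exists>J' :: 'v \<Rightarrow>\<^sub>L 'v. linear_complex_structure \<omega>\<^sub>0 (blinfun_apply J') \<and> norm (J' - Blinfun J) < inverse (Suc n) \<and>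
    (\<forall>S\<in>Sp \<omega>\<^sub>0. (\<forall>v. blinfun_apply S (J v) = blinfun_apply J' (blinfun_apply S v)) \<longrightarrow> \<not> norm (S - id_blinfun) < \<epsilon>)"
    by simp
  then obtain Jn :: "nat \<Rightarrow> 'v \<Rightarrow>\<^sub>L 'v" where Jn: "\<And>n. linear_complex_structure \<omega>\<^sub>0 (blinfun_apply (Jn n))"
    "\<And>n. norm (Jn n - Blinfun J) < inverse (Suc n)"
    and far: "\<And>n (S :: 'v \<Rightarrow>\<^sub>L 'v). S \<in> Sp \<omega>\<^sub>0 \<Longrightarrow> (\<And>v. blinfun_apply S (J v) = blinfun_apply (Jn n) (blinfun_apply S v)) \<Longrightarrow> norm (S - id_blinfun) \<ge> \<epsilon>"
    by (metis not_le)
  have J_app [simp]: "blinfun_apply (Blinfun J) = J"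
    using J(1) by (intro bounded_linear_Blinfun_apply linear_conv_bounded_linear[THEN iffD1])
  obtain Sn where Sn: "\<And>n. Sn n \<in> Sp \<omega>\<^sub>0" "\<And>n v. Sn n (J v) = Jn n (Sn n v)"
    using exists_intertwiner[OF Jn(1)] by metis
  obtain K where K: "K > 0" "\<And>u v. norm (\<omega>\<^sub>0 u v) \<le> norm u * norm v * K" using \<omega>.pos_bounded by blast
  obtain c where c: "c > 0" "\<And>v. c * (norm v)\<^sup>2 \<le> g v v" using g_coercive by blast
  have "(\<lambda>n. Jn n - Blinfun J) \<longlonglongrightarrow> 0"
    by (rule tendsto_norm_zero_cancel, rule tendsto_sandwich[OF _ _ tendsto_const LIMSEQ_inverse_real_of_nat])
      (auto intro!: always_eventually less_imp_le Jn(2) simp del: of_nat_Suc)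
  then have lim_J: "Jn \<longlonglongrightarrow> Blinfun J" by (rule LIM_zero_cancel)
  \<comment> \<open>With this threshold the perturbation of the complex structure uses up at most
    half of the coercivity constant \<open>c\<close>.\<close>
  obtain N where N: "inverse (Suc N) < c / (2 * K)"
    using reals_Archimedean[of "c / (2 * K)"] c(1) K(1) by auto
  \<comment> \<open>\<open>Sn n\<close> carries the metric of \<open>J\<close> to that of
    \<open>Jn n\<close>, and the latter still dominates half of \<open>c\<close> times the squared
    norm.\<close>
  have bound: "norm (Sn n v) \<le> sqrt (2 / c * (norm (Blinfun J) * K)) * norm v" if "n \<ge> N" for n v
  proof -
    let ?w = "Sn n v"
    have "norm (Jn n - Blinfun J) \<le> c / (2 * K)"
      using Jn(2)[of n] N that le_imp_inverse_le[of "real (Suc N)" "real (Suc n)"] by linarith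
    then have "norm ((Jn n - Blinfun J) ?w) \<le> c / (2 * K) * norm ?w"
      using norm_blinfun[of "Jn n - Blinfun J" ?w] by (meson mult_right_mono norm_ge_zero order_trans)
    then have "norm ((Jn n - Blinfun J) ?w) * norm ?w * K \<le> c / (2 * K) * norm ?w * norm ?w * K"
      using K(1) by (intro mult_right_mono) auto
    then have "\<bar>\<omega>\<^sub>0 ((Jn n - Blinfun J) ?w) ?w\<bar> \<le> c / 2 * (norm ?w)\<^sup>2"
      using K(2)[of "(Jn n - Blinfun J) ?w" ?w] K(1) by (simp add: power2_eq_square)
    then have "c * (norm ?w)\<^sup>2 \<le> \<omega>\<^sub>0 (Jn n ?w) ?w + c / 2 * (norm ?w)\<^sup>2"
      using c(2)[of ?w] unfolding metric_of_def blinfun.diff_left \<omega>.diff_left J_app abs_le_iff by argo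
    also have "\<omega>\<^sub>0 (Jn n ?w) ?w = \<omega>\<^sub>0 (Sn n (J v)) (Sn n v)" by (simp add: Sn(2))
    also have "\<dots> = \<omega>\<^sub>0 (J v) v" using Sn(1) by (simp add: Sp_def)
    also have "\<dots> \<le> norm (Blinfun J) * K * (norm v)\<^sup>2"
    proof -
      have "\<omega>\<^sub>0 (J v) v \<le> norm (J v) * norm v * K" using K(2)[of "J v" v] by simp
      also have "\<dots> \<le> norm (Blinfun J) * norm v * norm v * K"
        using norm_blinfun[of "Blinfun J" v] K(1) by (intro mult_right_mono) auto
      finally show ?thesis by (simp add: power2_eq_square mult_ac)
    qed
    finally have "(norm ?w)\<^sup>2 \<le> 2 / c * (norm (Blinfun J) * K) * (norm v)\<^sup>2"
      using c(1) by (simp add: field_simps)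
    from real_sqrt_le_mono[OF this] show ?thesis
      unfolding real_sqrt_mult[of _ "(norm v)\<^sup>2"] by simp
  qed
  have "bounded (range (\<lambda>n. Sn (n + N)))"
    unfolding bounded_iff using bound c(1) K(1)
    by (intro exI[of _ "sqrt (2 / c * (norm (Blinfun J) * K))"]) (auto intro!: norm_blinfun_bound)
  from bounded_imp_convergent_subsequence[OF this]
  obtain S r where r: "strict_mono r" and S: "(\<lambda>n. Sn (r n + N)) \<longlonglongrightarrow> S"
    by (auto simp: o_def)
  have rN: "strict_mono (\<lambda>n. r n + N)" using r by (simp add: strict_mono_def)
  have lim_J': "(\<lambda>n. Jn (r n + N)) \<longlonglongrightarrow> Blinfun J"
    using LIMSEQ_subseq_LIMSEQ[OF lim_J rN] by (simp add: o_def)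
  have "\<omega>\<^sub>0 (S u) (S v) = \<omega>\<^sub>0 u v" for u v
  proof -
    have "(\<lambda>n. \<omega>\<^sub>0 (Sn (r n + N) u) (Sn (r n + N) v)) \<longlonglongrightarrow> \<omega>\<^sub>0 (S u) (S v)"
      by (intro \<omega>.tendsto blinfun.tendsto S tendsto_const)
    then have "(\<lambda>n. \<omega>\<^sub>0 u v) \<longlonglongrightarrow> \<omega>\<^sub>0 (S u) (S v)" using Sn(1) by (simp add: Sp_def)
    then show ?thesis using LIMSEQ_unique[OF tendsto_const] by metis
  qed
  then have SSp: "S \<in> Sp \<omega>\<^sub>0" by (simp add: Sp_def)
  have SJ: "S (J v) = J (S v)" for v
  proof -
    have "(\<lambda>n. Sn (r n + N) (J v)) \<longlonglongrightarrow> S (J v)" by (intro blinfun.tendsto S tendsto_const)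
    moreover have "(\<lambda>n. Jn (r n + N) (Sn (r n + N) v)) \<longlonglongrightarrow> Blinfun J (S v)"
      by (intro blinfun.tendsto S lim_J' tendsto_const)
    ultimately show ?thesis using LIMSEQ_unique by (simp add: Sn(2))
  qed
  \<comment> \<open>The inverse of the limit commutes with \<open>J\<close>, so composing with it on
    the right keeps the intertwining relation and moves the limit to the identity.\<close>
  let ?T = "Blinfun (inv S)"
  note T = Sp_bij[OF SSp]
  have TJ: "?T (J v) = J (?T v)" for v
    using arg_cong[OF SJ[of "?T v"], of ?T] T by simp
  have "(\<lambda>n. Sn (r n + N) o\<^sub>L ?T) \<longlonglongrightarrow> (S o\<^sub>L ?T)"
    by (intro bounded_bilinear.tendsto[OF bounded_bilinear_blinfun_compose] S tendsto_const)
  moreover have "S o\<^sub>L ?T = id_blinfun" by (rule blinfun_eqI) (simp add: T)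
  ultimately have "(\<lambda>n. Sn (r n + N) o\<^sub>L ?T) \<longlonglongrightarrow> id_blinfun" by simp
  from LIMSEQ_D[OF this assms] obtain n where "norm ((Sn (r n + N) o\<^sub>L ?T) - id_blinfun) < \<epsilon>" by blast
  moreover have "norm ((Sn (r n + N) o\<^sub>L ?T) - id_blinfun) \<ge> \<epsilon>"
    by (rule far[of _ "r n + N"]) (simp_all add: Sp_compose Sn T TJ)
  ultimately show False by simp
qed

end

subsection \<open>The module product in coordinates\<close>

lemma list_coeff_map: "list_coeff c (map f us) bs = list_coeff (\<lambda>u. c (f u)) us bs"
  by (induction us arbitrary: bs) (auto simp: list_coeff_def zip_Cons1 split: list.splits)

text \<open>Distributivity, slot by slot: sums over lists of products of coefficients turn a Gram
  matrix into the entries of its tensor power.\<close>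

lemma sum_list_coeff:
  assumes "length ps = k" "length qs = k"
  shows "(\<Sum>es\<in>lists_of B k. list_coeff c es ps * list_coeff c es qs)
    = list_coeff (\<lambda>p q. \<Sum>e\<in>B. c e p * c e q :: real) ps qs"
  using assms
proof (induction k arbitrary: ps qs)
  case (Suc k)
  then obtain p ps' q qs' where [simp]: "ps = p # ps'" "qs = q # qs'" "length ps' = k" "length qs' = k"
    by (metis length_Suc_conv)
  have "(\<Sum>es\<in>lists_of B (Suc k). list_coeff c es ps * list_coeff c es qs)
    = (\<Sum>e\<in>B. (c e p * c e q) * (\<Sum>es\<in>lists_of B k. list_coeff c es ps' * list_coeff c es qs'))"
    by (simp add: sum_lists_of_Suc sum_distrib_left mult_ac)
  then show ?case by (simp add: Suc.IH sum_distrib_right)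
qed simp

lemma rank_one_sharp_scaleC:
  "rank_one (sharp (c *\<^sub>C f)) (c *\<^sub>C g) = (cmod c)\<^sup>2 *\<^sub>R rank_one (sharp f) g"
  for f :: "'x::{complex_inner, complete_space} cdual"
  by (simp only: sharp_scaleC rank_one_simps scaleC_scaleC complex_norm_square[symmetric] scaleC_of_real)

text \<open>The frame is separated from the forms: it enters only through \<open>\<Gamma>\<close>,
  the Gram matrix of coordinate covectors, while the forms are evaluated on fixed basis lists.
  Smoothness of the product thereby reduces to that of \<open>\<Gamma>\<close>.\<close>

lemma (in orthonormal_frame) form_prod_twist:
  fixes b b' :: "('v, 'x::{complex_inner, complete_space} cdual) form"
  assumes A: "linear A"
  defines "\<Gamma> \<equiv> \<lambda>p q. \<Sum>e\<in>B\<^sub>0. (A e \<bullet> p) * (A e \<bullet> q)"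
  shows "form_prod g (form_twist \<nu> id A b) (form_twist \<nu> id A b') =
    (\<Sum>k\<le>DIM('v). \<Sum>bs\<in>lists_of Basis k. \<Sum>cs\<in>lists_of Basis k.
      ((cmod (\<nu> k))\<^sup>2 / fact k * list_coeff \<Gamma> bs cs) *\<^sub>R rank_one (sharp (form_apply b bs)) (form_apply b' cs))"
proof -
  interpret R: bounded_bilinear "\<lambda>f g :: 'x cdual. rank_one (sharp f) g"
    by (rule bounded_bilinear_rank_one_sharp)
  let ?R = "\<lambda>bs cs. rank_one (sharp (form_apply b bs)) (form_apply b' cs)"
  let ?c = "list_coeff (\<lambda>e. (\<bullet>) (A e))"
  have summand: "(1 / fact k) *\<^sub>R rank_one (sharp (form_apply (form_twist \<nu> id A b) es)) (form_apply (form_twist \<nu> id A b') es)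
    = (\<Sum>bs\<in>lists_of Basis k. \<Sum>cs\<in>lists_of Basis k. ((cmod (\<nu> k))\<^sup>2 / fact k * (?c es bs * ?c es cs)) *\<^sub>R ?R bs cs)"
    if "es \<in> lists_of B\<^sub>0 k" for es k
  proof -
    have k: "length es = k" using that by (simp add: lists_of_def)
    have e: "form_apply F (map A es) = (\<Sum>bs\<in>lists_of Basis k. ?c es bs *\<^sub>R form_apply F bs)"
      for F :: "('v, 'x cdual) form"
      by (subst form_expand) (simp add: list_coeff_map k)
    have "rank_one (sharp (form_apply b (map A es))) (form_apply b' (map A es))
      = (\<Sum>bs\<in>lists_of Basis k. \<Sum>cs\<in>lists_of Basis k. (?c es bs * ?c es cs) *\<^sub>R ?R bs cs)"
      unfolding e R.sum_left unfolding R.sum_right by (simp add: R.scaleR_left R.scaleR_right mult.commute)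
    then show ?thesis
      by (simp add: form_apply_twist linear_id A rank_one_sharp_scaleC k scaleR_sum_right mult_ac)
  qed
  have "form_prod g (form_twist \<nu> id A b) (form_twist \<nu> id A b')
    = (\<Sum>k\<le>DIM('v). \<Sum>es\<in>lists_of B\<^sub>0 k. (1 / fact (length es)) *\<^sub>R
        rank_one (sharp (form_apply (form_twist \<nu> id A b) es)) (form_apply (form_twist \<nu> id A b') es))"
    unfolding form_prod_def by (rule sum_frame_lists)
  also have "\<dots> = (\<Sum>k\<le>DIM('v). \<Sum>es\<in>lists_of B\<^sub>0 k. \<Sum>bs\<in>lists_of Basis k. \<Sum>cs\<in>lists_of Basis k.
      ((cmod (\<nu> k))\<^sup>2 / fact k * (?c es bs * ?c es cs)) *\<^sub>R ?R bs cs)"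
  proof (intro sum.cong refl)
    fix k es assume es: "es \<in> lists_of B\<^sub>0 k"
    then have "length es = k" by (simp add: lists_of_def)
    with summand[OF es] show "(1 / fact (length es)) *\<^sub>R
        rank_one (sharp (form_apply (form_twist \<nu> id A b) es)) (form_apply (form_twist \<nu> id A b') es)
      = (\<Sum>bs\<in>lists_of Basis k. \<Sum>cs\<in>lists_of Basis k.
        ((cmod (\<nu> k))\<^sup>2 / fact k * (?c es bs * ?c es cs)) *\<^sub>R ?R bs cs)"
      by simp
  qed
  also have "\<dots> = (\<Sum>k\<le>DIM('v). \<Sum>bs\<in>lists_of Basis k. \<Sum>cs\<in>lists_of Basis k.
      ((cmod (\<nu> k))\<^sup>2 / fact k * list_coeff \<Gamma> bs cs) *\<^sub>R ?R bs cs)"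
  proof (rule sum.cong[OF refl])
    fix k
    have "(\<Sum>es\<in>lists_of B\<^sub>0 k. \<Sum>bs\<in>lists_of Basis k. \<Sum>cs\<in>lists_of Basis k.
        ((cmod (\<nu> k))\<^sup>2 / fact k * (?c es bs * ?c es cs)) *\<^sub>R ?R bs cs)
      = (\<Sum>bs\<in>lists_of Basis k. \<Sum>cs\<in>lists_of Basis k. \<Sum>es\<in>lists_of B\<^sub>0 k.
        ((cmod (\<nu> k))\<^sup>2 / fact k * (?c es bs * ?c es cs)) *\<^sub>R ?R bs cs)"
      by (subst sum.swap) (intro sum.cong refl sum.swap)
    also have "\<dots> = (\<Sum>bs\<in>lists_of Basis k. \<Sum>cs\<in>lists_of Basis k.
      ((cmod (\<nu> k))\<^sup>2 / fact k * list_coeff \<Gamma> bs cs) *\<^sub>R ?R bs cs)"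
    proof (intro sum.cong refl)
      fix bs cs :: "'v list" assume "bs \<in> lists_of Basis k" "cs \<in> lists_of Basis k"
      then have "list_coeff \<Gamma> bs cs = (\<Sum>es\<in>lists_of B\<^sub>0 k. ?c es bs * ?c es cs)"
        unfolding \<Gamma>_def by (subst sum_list_coeff) (auto simp: lists_of_def)
      then show "(\<Sum>es\<in>lists_of B\<^sub>0 k. ((cmod (\<nu> k))\<^sup>2 / fact k * (?c es bs * ?c es cs)) *\<^sub>R ?R bs cs)
        = ((cmod (\<nu> k))\<^sup>2 / fact k * list_coeff \<Gamma> bs cs) *\<^sub>R ?R bs cs"
        by (simp add: sum_distrib_left scaleR_sum_left)
    qed
    finally show "(\<Sum>es\<in>lists_of B\<^sub>0 k. \<Sum>bs\<in>lists_of Basis k. \<Sum>cs\<in>lists_of Basis k.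
        ((cmod (\<nu> k))\<^sup>2 / fact k * (?c es bs * ?c es cs)) *\<^sub>R ?R bs cs)
      = (\<Sum>bs\<in>lists_of Basis k. \<Sum>cs\<in>lists_of Basis k.
      ((cmod (\<nu> k))\<^sup>2 / fact k * list_coeff \<Gamma> bs cs) *\<^sub>R ?R bs cs)" .
  qed
  finally show ?thesis .
qed

subsection \<open>Coordinates and frames\<close>

text \<open>In finite dimensions convergence on a basis is joint convergence with the argument.
  Linearity is asked only eventually, since inverse frames are linear only over the domain of the
  chart.\<close>

lemma tendsto_linear_family:
  fixes A :: "'i \<Rightarrow> 'a::euclidean_space \<Rightarrow> 'b::real_normed_vector"
  assumes "\<And>b. b \<in> Basis \<Longrightarrow> ((\<lambda>x. A x b) \<longlongrightarrow> A' b) F" "(f \<longlongrightarrow> v) F"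
    and lin: "\<forall>\<^sub>F x in F. linear (A x)" "linear A'"
  shows "((\<lambda>x. A x (f x)) \<longlongrightarrow> A' v) F"
proof -
  have e: "T w = (\<Sum>b\<in>Basis. (w \<bullet> b) *\<^sub>R T b)" if "linear T" for T :: "'a \<Rightarrow> 'b" and w
    by (subst euclidean_representation[of w, symmetric])
      (simp only: linear_sum[OF that] linear_scale[OF that])
  have "((\<lambda>x. \<Sum>b\<in>Basis. (f x \<bullet> b) *\<^sub>R A x b) \<longlongrightarrow> (\<Sum>b\<in>Basis. (v \<bullet> b) *\<^sub>R A' b)) F"
    using assms by (intro tendsto_sum tendsto_scaleR tendsto_inner tendsto_const) auto
  then have "((\<lambda>x. \<Sum>b\<in>Basis. (f x \<bullet> b) *\<^sub>R A x b) \<longlongrightarrow> A' v) F"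
    by (simp flip: e[OF lin(2)])
  moreover have "\<forall>\<^sub>F x in F. (\<Sum>b\<in>Basis. (f x \<bullet> b) *\<^sub>R A x b) = A x (f x)"
    using lin(1) by eventually_elim (rule e[symmetric])
  ultimately show ?thesis by (rule Lim_transform_eventually)
qed

lemma smooth_on_linear_family:
  fixes A :: "'i::real_normed_vector \<Rightarrow> 'a::euclidean_space \<Rightarrow> 'b::real_normed_vector"
  assumes A: "\<And>b. b \<in> Basis \<Longrightarrow> smooth_on S (\<lambda>x. A x b)" and f: "smooth_on S f"
    and lin: "\<And>x. x \<in> S \<Longrightarrow> linear (A x)"
  shows "smooth_on S (\<lambda>x. A x (f x))"
proof (rule smooth_on_cong)
  show "smooth_on S (\<lambda>x. \<Sum>b\<in>Basis. (f x \<bullet> b) *\<^sub>R A x b)"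
    by (intro smooth_on_sum smooth_on_scaleR smooth_on_compose_linear[OF bounded_linear_inner_left f] A
        smooth_on_open[OF f])
  fix x assume "x \<in> S"
  note l = lin[OF this]
  show "(\<Sum>b\<in>Basis. (f x \<bullet> b) *\<^sub>R A x b) = A x (f x)"
    by (subst (2) euclidean_representation[of "f x", symmetric])
      (simp only: linear_sum[OF l] linear_scale[OF l])
qed

text \<open>Limits along \<open>nhds\<close> compose without any care for points mapped to the
  centre.\<close>

lemma tendsto_nhds:
  assumes "continuous_on S f" "open S" "x \<in> S"
  shows "(f \<longlongrightarrow> f x) (nhds x)"
proof (rule topological_tendstoI)
  fix U assume U: "open U" "f x \<in> U"
  have "open (f -` U \<inter> S)" using assms U by (simp add: continuous_on_open_vimage)
  then have "\<forall>\<^sub>F y in nhds x. y \<in> f -` U \<inter> S"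
    using assms U by (intro eventually_nhds_in_open) auto
  then show "\<forall>\<^sub>F y in nhds x. f y \<in> U" by eventually_elim simp
qed

locale atlas =
  fixes MA :: "('m::topological_space, 'v::euclidean_space) chart set"
  assumes atlas: "smooth_atlas MA"
begin

lemma ex_chart: "\<exists>c\<in>MA. m \<in> fst c"
  using atlas by (auto simp: smooth_atlas_def)

context
  fixes c assumes c: "c \<in> MA"
begin

lemma chart: "open (fst c)" "open (snd c ` fst c)" "homeomorphism (fst c) (snd c ` fst c) (snd c) (chart_inv c)"
  using atlas c by (auto simp: smooth_atlas_def)

lemma chart_inv [simp]: "m \<in> fst c \<Longrightarrow> chart_inv c (snd c m) = m"
  using chart(3) by (simp add: homeomorphism_def)

lemma chart_inv_image:
  assumes "x \<in> snd c ` (U \<inter> fst c)"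
  shows "chart_inv c x \<in> U \<inter> fst c" "snd c (chart_inv c x) = x"
  using assms by auto

lemma open_chart_image:
  assumes "open U"
  shows "open (snd c ` (U \<inter> fst c))"
proof -
  have "continuous_on (snd c ` fst c) (chart_inv c)" using chart(3) by (simp add: homeomorphism_def)
  then have "open (snd c ` fst c \<inter> chart_inv c -` U)"
    using continuous_on_open_vimage[OF chart(2)] assms by (auto simp: Int_commute)
  moreover have "snd c ` fst c \<inter> chart_inv c -` U = snd c ` (U \<inter> fst c)" by auto
  ultimately show ?thesis by simp
qed

lemma tendsto_chart:
  assumes "m \<in> fst c"
  shows "(snd c \<longlongrightarrow> snd c m) (nhds m)"
proof -
  have "continuous_on (fst c) (snd c)" using chart(3) by (simp add: homeomorphism_def)
  then show ?thesis using chart(1) assms by (rule tendsto_nhds)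
qed

lemma tendsto_coordinate:
  assumes "m \<in> fst c" and f: "smooth_on (snd c ` (U \<inter> fst c)) f" "m \<in> U"
  shows "((\<lambda>m. f (snd c m)) \<longlongrightarrow> f (snd c m)) (nhds m)"
proof -
  have "(f \<longlongrightarrow> f (snd c m)) (nhds (snd c m))"
    using smooth_on_continuous_on[OF f(1)] smooth_on_open[OF f(1)] by (rule tendsto_nhds) (use assms in auto)
  then show ?thesis by (rule filterlim_compose[OF _ tendsto_chart[OF assms(1)]])
qed

end

lemma transition: "c \<in> MA \<Longrightarrow> d \<in> MA \<Longrightarrow> smooth_on (snd c ` (fst c \<inter> fst d)) (snd d \<circ> chart_inv c)"
  using atlas by (simp add: smooth_atlas_def)

lemma jacobian:
  assumes "c \<in> MA" "d \<in> MA" "m \<in> fst c" "m \<in> fst d"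
  shows "((snd d \<circ> chart_inv c) has_derivative jacobian c d m) (at (snd c m))"
proof -
  have "((snd d \<circ> chart_inv c) has_derivative (\<lambda>v. iter_deriv (snd d \<circ> chart_inv c) [v] (snd c m))) (at (snd c m))"
    using assms by (intro smooth_on_has_derivative[OF transition]) auto
  then show ?thesis by (simp add: jacobian_def frechet_derivative_def)
qed

lemma linear_jacobian: "c \<in> MA \<Longrightarrow> d \<in> MA \<Longrightarrow> m \<in> fst c \<Longrightarrow> m \<in> fst d \<Longrightarrow> linear (jacobian c d m)"
  using has_derivative_linear[OF jacobian] .

lemma jacobian_self [simp]:
  assumes c: "c \<in> MA" "m \<in> fst c"
  shows "jacobian c c m u = u"
proof -
  have "((\<lambda>x. x) has_derivative (\<lambda>h. h)) (at (snd c m))" by (rule has_derivative_ident)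
  then have "((snd c \<circ> chart_inv c) has_derivative (\<lambda>h. h)) (at (snd c m))"
    by (rule has_derivative_transform_within_open[OF _ chart(2)[OF c(1)]]) (use c in auto)
  from has_derivative_unique[OF jacobian[OF c(1,1,2,2)] this] show ?thesis by simp
qed

lemma jacobian_jacobian:
  assumes "c \<in> MA" "d \<in> MA" "e \<in> MA" "m \<in> fst c" "m \<in> fst d" "m \<in> fst e"
  shows "jacobian d e m (jacobian c d m u) = jacobian c e m u"
proof -
  have "((snd e \<circ> chart_inv d) has_derivative jacobian d e m) (at ((snd d \<circ> chart_inv c) (snd c m)))"
    using assms by (simp add: jacobian)
  from has_derivative_compose[OF jacobian[OF assms(1,2,4,5)] this]
  have "((\<lambda>x. (snd e \<circ> chart_inv d) ((snd d \<circ> chart_inv c) x)) has_derivative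
    (\<lambda>u. jacobian d e m (jacobian c d m u))) (at (snd c m))" .
  moreover have "open (snd c ` (fst d \<inter> fst c))"
    using assms by (intro open_chart_image chart(1))
  ultimately have "((snd e \<circ> chart_inv c) has_derivative (\<lambda>u. jacobian d e m (jacobian c d m u))) (at (snd c m))"
    by (rule has_derivative_transform_within_open) (use assms in auto)
  from has_derivative_unique[OF this jacobian[OF assms(1,3,4,6)]] show ?thesis by metis
qed

lemma smooth_jacobian:
  assumes "c \<in> MA" "d \<in> MA"
  shows "smooth_on (snd c ` (fst d \<inter> fst c)) (\<lambda>x. jacobian c d (chart_inv c x) u)"
  using smooth_on_directional[OF transition[OF assms], of u]
  unfolding Int_commute[of "fst d"]
  by (rule smooth_on_cong) (use assms in \<open>auto simp: jacobian_def\<close>)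

lemma smooth_jacobian_chart:
  assumes "c \<in> MA" "d \<in> MA" "e \<in> MA"
  shows "smooth_on (snd c ` (fst d \<inter> fst e \<inter> fst c)) (\<lambda>x. jacobian d e (chart_inv c x) u)"
proof (rule smooth_on_cong)
  let ?S = "snd c ` (fst d \<inter> fst e \<inter> fst c)"
  have "smooth_on ?S (snd d \<circ> chart_inv c)"
    by (rule smooth_on_subset_open[OF transition[OF assms(1,2)] open_chart_image[OF assms(1)]])
      (use chart(1)[OF assms(2)] chart(1)[OF assms(3)] in auto)
  then show "smooth_on ?S (\<lambda>x. jacobian d e (chart_inv d ((snd d \<circ> chart_inv c) x)) u)"
    by (rule smooth_on_compose[OF _ smooth_jacobian[OF assms(2,3)]]) (use assms in auto)
  show "jacobian d e (chart_inv d ((snd d \<circ> chart_inv c) x)) u = jacobian d e (chart_inv c x) u"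
    if "x \<in> ?S" for x
    using that assms by auto
qed

lemma coord_vec_same [simp]: "c \<in> MA \<Longrightarrow> m \<in> fst c \<Longrightarrow> coord_vec MA c m u c = u"
  by (simp add: coord_vec_def)

lemma coord_vec_in:
  assumes "c \<in> MA" "m \<in> fst c"
  shows "coord_vec MA c m u \<in> tangent_space MA m"
  unfolding tangent_space_def coord_vec_def using assms by (auto simp: jacobian_jacobian)

lemma tangent_jacobian:
  assumes "c \<in> MA" "d \<in> MA" "m \<in> fst c" "m \<in> fst d" "\<tau> \<in> tangent_space MA m"
  shows "\<tau> d = jacobian c d m (\<tau> c)"
  using assms unfolding tangent_space_def by blast

lemma tangent_eq_coord_vec:
  assumes "c \<in> MA" "m \<in> fst c" "\<tau> \<in> tangent_space MA m"
  shows "coord_vec MA c m (\<tau> c) = \<tau>"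
proof
  fix d
  show "coord_vec MA c m (\<tau> c) d = \<tau> d"
  proof (cases "d \<in> MA \<and> m \<in> fst d")
    case True
    with tangent_jacobian[OF assms(1) _ assms(2) _ assms(3), of d] show ?thesis by (simp add: coord_vec_def)
  next
    case False
    then have "\<tau> d = 0" using assms(3) unfolding tangent_space_def by blast
    then show ?thesis using False by (auto simp: coord_vec_def)
  qed
qed

lemma coord_vec_linear:
  assumes "c \<in> MA" "m \<in> fst c"
  shows "coord_vec MA c m (u + v) = (\<lambda>d. coord_vec MA c m u d + coord_vec MA c m v d)"
    "coord_vec MA c m (r *\<^sub>R u) = (\<lambda>d. r *\<^sub>R coord_vec MA c m u d)"
  using assms by (auto simp: coord_vec_def fun_eq_iff linear_add[OF linear_jacobian] linear_scale[OF linear_jacobian])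

lemma bilinear_coord:
  assumes "tangent_bilinear MA m B" "c \<in> MA" "m \<in> fst c"
  shows "bilinear (\<lambda>u v. B (coord_vec MA c m u) (coord_vec MA c m v))"
proof -
  note T = coord_vec_in[OF assms(2,3)]
  have "B (\<lambda>d. coord_vec MA c m u d + coord_vec MA c m v d) (coord_vec MA c m w)
      = B (coord_vec MA c m u) (coord_vec MA c m w) + B (coord_vec MA c m v) (coord_vec MA c m w)"
    "B (\<lambda>d. r *\<^sub>R coord_vec MA c m u d) (coord_vec MA c m w) = r * B (coord_vec MA c m u) (coord_vec MA c m w)"
    "B (coord_vec MA c m w) (\<lambda>d. coord_vec MA c m u d + coord_vec MA c m v d)
      = B (coord_vec MA c m w) (coord_vec MA c m u) + B (coord_vec MA c m w) (coord_vec MA c m v)"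
    "B (coord_vec MA c m w) (\<lambda>d. r *\<^sub>R coord_vec MA c m u d) = r * B (coord_vec MA c m w) (coord_vec MA c m u)"
    for u v w r
    using assms(1)[unfolded tangent_bilinear_def, rule_format, OF T[of u] T[of v] T[of w], of r] by auto
  then show ?thesis
    unfolding bilinear_def by (auto intro!: linearI simp: coord_vec_linear[OF assms(2,3)])
qed

context
  fixes \<omega>\<^sub>0 \<omega> m A
  assumes A: "symplectic_frame \<omega>\<^sub>0 MA \<omega> m A"
begin

lemma frame_in: "A v \<in> tangent_space MA m"
  using A by (auto simp: symplectic_frame_def bij_betw_def)

lemma frame_linear: "A (u + v) = (\<lambda>c. A u c + A v c)" "A (r *\<^sub>R u) = (\<lambda>c. r *\<^sub>R A u c)"
  and frame_\<omega>: "\<omega> m (A u) (A v) = \<omega>\<^sub>0 u v"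
  using A by (auto simp: symplectic_frame_def)

lemma frame_inv: "\<tau> \<in> tangent_space MA m \<Longrightarrow> A (inv_into UNIV A \<tau>) = \<tau>" "inv_into UNIV A (A v) = v"
  using A by (auto simp: symplectic_frame_def bij_betw_def f_inv_into_f)

lemma frame_inj: "A u = A v \<longleftrightarrow> u = v"
  using frame_inv(2) by metis

lemma linear_frame_coord: "linear (\<lambda>v. A v c)"
  by (rule linearI) (simp_all add: frame_linear)

context
  fixes c assumes c: "c \<in> MA" "m \<in> fst c"
begin

lemma coord_frame: "coord_vec MA c m (A v c) = A v"
  by (rule tangent_eq_coord_vec[OF c frame_in])

lemma inv_frame_coord:
  defines "B \<equiv> \<lambda>u. inv_into UNIV A (coord_vec MA c m u)"
  shows "A (B u) c = u" "B (A v c) = v" "linear B"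
proof -
  have AB: "A (B u) = coord_vec MA c m u" for u
    unfolding B_def by (rule frame_inv(1)[OF coord_vec_in[OF c]])
  show "A (B u) c = u" using c by (simp add: AB)
  show "B (A v c) = v" by (simp add: B_def coord_frame frame_inv(2))
  show "linear B"
  proof (rule linearI)
    show "B (u + v) = B u + B v" for u v
      by (subst frame_inj[symmetric]) (simp add: AB frame_linear coord_vec_linear[OF c])
    show "B (r *\<^sub>R v) = r *\<^sub>R B v" for r v
      by (subst frame_inj[symmetric]) (simp add: AB frame_linear coord_vec_linear[OF c])
  qed
qed

end

end

end

section \<open>The covering group, the principal bundle and the continuity of frames\<close>

locale metaplectic_bundle = complex_structure \<omega>\<^sub>0 J\<^sub>0 + atlas MA
  for \<omega>\<^sub>0 :: "'v::euclidean_space \<Rightarrow> 'v \<Rightarrow> real" and J\<^sub>0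
    and MA :: "('m::{t2_space, second_countable_topology}, 'v) chart set" +
  fixes lam :: "'g::topological_group_add \<Rightarrow> 'v \<Rightarrow>\<^sub>L 'v"
    and \<omega> :: "'m \<Rightarrow> ('m, 'v) tvec \<Rightarrow> ('m, 'v) tvec \<Rightarrow> real"
    and \<pi>P :: "'p::topological_space \<Rightarrow> 'm" and ract :: "'p \<Rightarrow> 'g \<Rightarrow> 'p"
    and PA :: "('m set \<times> ('p \<Rightarrow> 'g)) set"
    and Lam :: "'p \<Rightarrow> 'v \<Rightarrow> ('m, 'v) tvec"
    and JM :: "'m \<Rightarrow> ('m, 'v) tvec \<Rightarrow> ('m, 'v) tvec"
  assumes cover: "connected_double_cover \<omega>\<^sub>0 lam"
    and manifold: "symplectic_manifold MA \<omega>"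
    and metaplectic: "metaplectic_structure \<omega>\<^sub>0 lam MA \<omega> \<pi>P ract PA Lam"
    and acs: "compatible_positive_acs MA \<omega> JM"
begin

lemma lam_add: "lam (h + k) = lam h o\<^sub>L lam k"
  and covering: "covering_space UNIV lam (Sp \<omega>\<^sub>0)"
  using cover by (auto simp: connected_double_cover_def)

lemma lam_in: "lam h \<in> Sp \<omega>\<^sub>0"
  using covering_space_imp_surjective[OF covering] by blast

lemma lam_surj: "S \<in> Sp \<omega>\<^sub>0 \<Longrightarrow> \<exists>h. lam h = S"
  using covering_space_imp_surjective[OF covering] by (metis rangeE)

lemma lam_0: "lam 0 = id_blinfun"
proof (rule blinfun_eqI)
  fix v
  have "lam 0 (lam 0 v) = lam 0 v" using lam_add[of 0 0] by (metis add.right_neutral blinfun_apply_blinfun_compose)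
  then show "lam 0 v = id_blinfun v" using Sp_bij(1)[OF lam_in[of 0]] by (simp add: bij_def inj_def)
qed

lemma lam_minus: "lam (- h) (lam h v) = v" "lam h (lam (- h) v) = v"
proof -
  have "(lam (- h) o\<^sub>L lam h) v = v" "(lam h o\<^sub>L lam (- h)) v = v"
    by (simp_all add: lam_0 flip: lam_add)
  then show "lam (- h) (lam h v) = v" "lam h (lam (- h) v) = v" by simp_all
qed

lemma continuous_lam: "continuous_on UNIV lam"
  by (rule covering_space_imp_continuous[OF covering])

text \<open>The sheet through the neutral element is selected, so that the section takes the
  identity to \<open>0\<close>.\<close>

lemma local_section:
  obtains W s where "openin (top_of_set (Sp \<omega>\<^sub>0)) W" "id_blinfun \<in> W" "continuous_on W s"
    "\<forall>A\<in>W. lam (s A) = A" "s id_blinfun = 0"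
proof -
  obtain T W s where T: "0 \<in> T" "lam 0 \<in> W" "openin (top_of_set (Sp \<omega>\<^sub>0)) W" "homeomorphism T W lam s"
    using covering_space_local_homeomorphism[OF covering UNIV_I[of 0]] by metis
  show ?thesis
    using T homeomorphism_apply1[OF T(4,1)] by (intro that[of W s]) (auto simp: homeomorphism_def lam_0)
qed

text \<open>A continuous local section pulls the given neighbourhood back to a neighbourhood of the
  identity. It will lift small symplectic corrections to small group elements.\<close>

lemma lam_near_identity:
  assumes "open V" "0 \<in> V"
  shows "\<exists>\<epsilon>>0. \<forall>S\<in>Sp \<omega>\<^sub>0. norm (S - id_blinfun) < \<epsilon> \<longrightarrow> (\<exists>h\<in>V. lam h = S)"
proof -
  obtain W s where W: "openin (top_of_set (Sp \<omega>\<^sub>0)) W" "id_blinfun \<in> W" "continuous_on W s"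
    "\<forall>A\<in>W. lam (s A) = A" "s id_blinfun = 0" by (rule local_section)
  have "openin (top_of_set W) (W \<inter> s -` V)" by (rule continuous_openin_preimage_gen[OF W(3) assms(1)])
  then have "openin (top_of_set (Sp \<omega>\<^sub>0)) (W \<inter> s -` V)" using W(1) by (rule openin_trans)
  then obtain O' where O': "open O'" "W \<inter> s -` V = Sp \<omega>\<^sub>0 \<inter> O'" using openin_open by metis
  moreover have "id_blinfun \<in> W \<inter> s -` V" using W assms by simp
  ultimately obtain \<epsilon> where \<epsilon>: "\<epsilon> > 0" "ball id_blinfun \<epsilon> \<subseteq> O'" by (metis IntD2 open_contains_ball)
  show ?thesis
  proof (intro exI[of _ \<epsilon>] conjI ballI impI \<epsilon>(1))
    fix S assume "S \<in> Sp \<omega>\<^sub>0" "norm (S - id_blinfun) < \<epsilon>"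
    then have "S \<in> W \<inter> s -` V" using \<epsilon>(2) unfolding O'(2) by (auto simp: dist_norm norm_minus_commute)
    then show "\<exists>h\<in>V. lam h = S" using W(4) by blast
  qed
qed

lemma principal: "principal_bundle lam MA \<pi>P ract PA"
  and frame: "symplectic_frame \<omega>\<^sub>0 MA \<omega> (\<pi>P r) (Lam r)"
  and Lam_ract: "Lam (ract r h) = Lam r \<circ> lam h"
  using metaplectic by (auto simp: metaplectic_structure_def)

lemma continuous_\<pi>P: "continuous_on UNIV \<pi>P"
  and ract: "ract r 0 = r" "ract (ract r h) k = ract r (h + k)" "\<pi>P (ract r h) = \<pi>P r"
  using principal by (auto simp: principal_bundle_def)

lemma ex_triv: "\<exists>(U, \<Phi>)\<in>PA. m \<in> U"
proof -
  have "m \<in> (\<Union>(U, \<Phi>)\<in>PA. U)" using principal by (simp add: principal_bundle_def)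
  then show ?thesis by auto
qed

context
  fixes U \<Phi> assumes UPA: "(U, \<Phi>) \<in> PA"
begin

lemma triv: "open U"
    "homeomorphic_map (top_of_set (\<pi>P -` U)) (prod_topology (top_of_set U) euclidean) (\<lambda>r. (\<pi>P r, \<Phi> r))"
    "\<pi>P r \<in> U \<Longrightarrow> \<Phi> (ract r h) = \<Phi> r + h"
proof -
  have "\<forall>(U, \<Phi>)\<in>PA. open U \<and>
      homeomorphic_map (top_of_set (\<pi>P -` U)) (prod_topology (top_of_set U) euclidean) (\<lambda>r. (\<pi>P r, \<Phi> r)) \<and>
      (\<forall>r\<in>\<pi>P -` U. \<forall>g. \<Phi> (ract r g) = \<Phi> r + g)"
    using principal by (simp add: principal_bundle_def)
  from bspec[OF this UPA] show "open U"
    "homeomorphic_map (top_of_set (\<pi>P -` U)) (prod_topology (top_of_set U) euclidean) (\<lambda>r. (\<pi>P r, \<Phi> r))"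
    "\<pi>P r \<in> U \<Longrightarrow> \<Phi> (ract r h) = \<Phi> r + h" by auto
qed

lemma triv_inv:
  assumes "m \<in> U"
  shows "\<pi>P (triv_inv \<pi>P \<Phi> m h) = m" "\<Phi> (triv_inv \<pi>P \<Phi> m h) = h"
    "\<And>r. \<pi>P r = m \<Longrightarrow> \<Phi> r = h \<Longrightarrow> r = triv_inv \<pi>P \<Phi> m h"
proof -
  have "inj_on (\<lambda>r. (\<pi>P r, \<Phi> r)) (\<pi>P -` U)" "(\<lambda>r. (\<pi>P r, \<Phi> r)) ` (\<pi>P -` U) = U \<times> UNIV"
    using homeomorphic_imp_injective_map[OF triv(2)] homeomorphic_imp_surjective_map[OF triv(2)]
    by (simp_all add: topspace_prod_topology)
  then have inj: "inj_on (\<lambda>r. (\<pi>P r, \<Phi> r)) (\<pi>P -` U)"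
    and "(m, h) \<in> (\<lambda>r. (\<pi>P r, \<Phi> r)) ` (\<pi>P -` U)"
    using assms by auto
  then obtain r where r: "\<pi>P r = m" "\<Phi> r = h" by auto
  have ex: "\<exists>!r. \<pi>P r = m \<and> \<Phi> r = h"
    using r assms inj_onD[OF inj] by (intro ex1I[of _ r]) auto
  show "\<pi>P (triv_inv \<pi>P \<Phi> m h) = m" "\<Phi> (triv_inv \<pi>P \<Phi> m h) = h"
    using theI'[OF ex] by (auto simp: triv_inv_def)
  then show "\<And>r. \<pi>P r = m \<Longrightarrow> \<Phi> r = h \<Longrightarrow> r = triv_inv \<pi>P \<Phi> m h" using ex by blast
qed

lemma triv_inv_ract:
  assumes "m \<in> U"
  shows "triv_inv \<pi>P \<Phi> m (h + k) = ract (triv_inv \<pi>P \<Phi> m h) k"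
  by (rule triv_inv(3)[OF assms, symmetric]) (simp_all add: ract triv_inv assms triv(3))

lemma continuous_\<Phi>: "continuous_on (\<pi>P -` U) \<Phi>"
proof -
  have "continuous_map (top_of_set (\<pi>P -` U)) euclidean (snd \<circ> (\<lambda>r. (\<pi>P r, \<Phi> r)))"
    using homeomorphic_imp_continuous_map[OF triv(2)]
    by (rule continuous_map_compose) (rule continuous_map_snd)
  then show ?thesis by (simp add: o_def)
qed

lemma tendsto_\<Phi>: "\<pi>P r \<in> U \<Longrightarrow> (\<Phi> \<longlongrightarrow> \<Phi> r) (nhds r)"
proof -
  assume r: "\<pi>P r \<in> U"
  have "open (\<pi>P -` U)" using open_vimage[OF triv(1) continuous_\<pi>P] .
  from tendsto_nhds[OF continuous_\<Phi> this] r show ?thesis by simp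
qed

text \<open>Restricting the smoothness of the frames to a local section of the covering at the identity.\<close>

lemma smooth_section:
  assumes c: "c \<in> MA"
  shows "smooth_on (snd c ` (U \<inter> fst c)) (\<lambda>x. Lam (triv_inv \<pi>P \<Phi> (chart_inv c x) 0) v c)"
proof -
  let ?S = "snd c ` (U \<inter> fst c)"
  let ?L = "\<lambda>x v. Lam (triv_inv \<pi>P \<Phi> (chart_inv c x) 0) v c"
  obtain W s where T: "openin (top_of_set (Sp \<omega>\<^sub>0)) W" "id_blinfun \<in> W"
    and s: "continuous_on W s" "\<forall>A\<in>W. lam (s A) = A" and s0: "s id_blinfun = 0" by (rule local_section)
  let ?F = "\<lambda>(x, A). Blinfun (\<lambda>v. Lam (triv_inv \<pi>P \<Phi> (chart_inv c x) (s A)) v c)"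
  have F: "smooth_on_subset (?S \<times> W) ?F"
    using metaplectic UPA c T(1) s unfolding metaplectic_structure_def by blast
  have "smooth_on ?S (\<lambda>x. Blinfun (?L x))"
  proof (rule smooth_on_local)
    show "open ?S" by (rule open_chart_image[OF c triv(1)])
    fix x assume x: "x \<in> ?S"
    have "(x, id_blinfun) \<in> ?S \<times> W" using x T(2) by simp
    from bspec[OF F[unfolded smooth_on_subset_def] this]
    obtain V G where V: "(x, id_blinfun) \<in> V" "smooth_on V G" and G: "\<forall>y\<in>(?S \<times> W) \<inter> V. G y = ?F y"
      by (elim exE conjE)
    let ?T = "{y. (y, id_blinfun) \<in> V}"
    \<comment> \<open>Freezing the group variable at the identity is precomposition with the affine
      map that sends \<open>y\<close> to \<open>(y, id_blinfun)\<close>.\<close>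
    have bl: "bounded_linear (\<lambda>y::'v. (y, 0::'v \<Rightarrow>\<^sub>L 'v))" by (intro bounded_linear_intros)
    have oT: "open ?T"
    proof -
      have "continuous_on UNIV (\<lambda>y::'v. (y, id_blinfun::'v \<Rightarrow>\<^sub>L 'v))" by (intro continuous_intros)
      from open_vimage[OF smooth_on_open[OF V(2)] this] show ?thesis by (simp add: vimage_def)
    qed
    have "smooth_on ?T (\<lambda>y. G ((0, id_blinfun) + (y, 0)))"
      by (rule smooth_on_precompose_affine[OF bl V(2) oT]) simp
    moreover have "G ((0, id_blinfun) + (y, 0)) = Blinfun (?L y)" if "y \<in> ?T \<inter> ?S" for y
      using bspec[OF G, of "(y, id_blinfun)"] that T(2) s0 by auto
    ultimately show "\<exists>T g. open T \<and> x \<in> T \<and> smooth_on T g \<and> (\<forall>y\<in>T \<inter> ?S. g y = Blinfun (?L y))"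
      using V(1) oT by (intro exI[of _ ?T] exI[of _ "\<lambda>y. G ((0, id_blinfun) + (y, 0))"]) simp
  qed
  then have "smooth_on ?S (\<lambda>x. blinfun_apply (Blinfun (?L x)) v)"
    by (rule smooth_on_compose_linear[OF blinfun.bounded_linear_left])
  moreover have "blinfun_apply (Blinfun (?L x)) = ?L x" for x
    using linear_frame_coord[OF frame] by (intro bounded_linear_Blinfun_apply linear_conv_bounded_linear[THEN iffD1])
  ultimately show ?thesis by simp
qed

end

lemma ex_ract: "\<pi>P r = \<pi>P r' \<Longrightarrow> \<exists>h. r' = ract r h"
proof -
  assume eq: "\<pi>P r = \<pi>P r'"
  obtain U \<Phi> where U: "(U, \<Phi>) \<in> PA" "\<pi>P r \<in> U" using ex_triv[of "\<pi>P r"] by auto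
  have "r' = triv_inv \<pi>P \<Phi> (\<pi>P r) (\<Phi> r + (- \<Phi> r + \<Phi> r'))"
    by (rule triv_inv(3)[OF U]) (simp_all add: eq algebra_simps)
  also have "\<dots> = ract r (- \<Phi> r + \<Phi> r')"
    unfolding triv_inv_ract[OF U] triv_inv(3)[OF U refl refl, symmetric] ..
  finally show ?thesis by blast
qed

lemma ract_inj: "ract r h = ract r k \<Longrightarrow> h = k"
proof -
  assume eq: "ract r h = ract r k"
  obtain U \<Phi> where U: "(U, \<Phi>) \<in> PA" "\<pi>P r \<in> U" using ex_triv[of "\<pi>P r"] by auto
  have "\<Phi> r + h = \<Phi> r + k" by (simp only: triv(3)[OF U, symmetric] eq)
  then show "h = k" by (rule add_left_imp_eq)
qed

lemma tendsto_\<pi>P: "(\<pi>P \<longlongrightarrow> \<pi>P r) (nhds r)"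
  by (rule tendsto_nhds[OF continuous_\<pi>P]) auto

lemma tendsto_lam: "(lam \<longlongrightarrow> lam h) (nhds h)"
  by (rule tendsto_nhds[OF continuous_lam]) auto

text \<open>In a trivialization, \<open>q\<close> is the local section over its base point moved by
  \<open>\<Phi> q\<close>. Its frame is that of the smooth section composed with
  \<open>lam (\<Phi> q)\<close>, and both factors are continuous.\<close>

lemma tendsto_Lam:
  assumes c: "c \<in> MA" "\<pi>P r \<in> fst c"
  shows "((\<lambda>q. Lam q v c) \<longlongrightarrow> Lam r v c) (nhds r)"
proof -
  obtain U \<Phi> where U: "(U, \<Phi>) \<in> PA" "\<pi>P r \<in> U" using ex_triv[of "\<pi>P r"] by auto
  let ?L = "\<lambda>m v. Lam (triv_inv \<pi>P \<Phi> m 0) v c"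
  have eq: "Lam q v c = ?L (\<pi>P q) (lam (\<Phi> q) v)" if "\<pi>P q \<in> U" for q
  proof -
    have "q = ract (triv_inv \<pi>P \<Phi> (\<pi>P q) 0) (\<Phi> q)"
      using triv_inv_ract[OF U(1) that, of 0 "\<Phi> q"] triv_inv(3)[OF U(1) that refl refl] by simp
    then show ?thesis using fun_cong[OF Lam_ract, of "triv_inv \<pi>P \<Phi> (\<pi>P q) 0" "\<Phi> q" v] by simp
  qed
  have ev: "\<forall>\<^sub>F m in nhds (\<pi>P r). m \<in> U \<inter> fst c"
    using U c triv(1)[OF U(1)] chart(1)[OF c(1)] by (intro eventually_nhds_in_open) auto
  have L0: "((\<lambda>m. ?L m b) \<longlongrightarrow> ?L (\<pi>P r) b) (nhds (\<pi>P r))" for b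
  proof (rule Lim_transform_eventually)
    have "((\<lambda>m. ?L (chart_inv c (snd c m)) b) \<longlongrightarrow> ?L (chart_inv c (snd c (\<pi>P r))) b) (nhds (\<pi>P r))"
      by (rule tendsto_coordinate[OF c smooth_section[OF U(1) c(1)] U(2)])
    then show "((\<lambda>m. ?L (chart_inv c (snd c m)) b) \<longlongrightarrow> ?L (\<pi>P r) b) (nhds (\<pi>P r))"
      unfolding chart_inv[OF c] .
    show "\<forall>\<^sub>F m in nhds (\<pi>P r). ?L (chart_inv c (snd c m)) b = ?L m b"
      using ev by eventually_elim (simp add: chart_inv[OF c(1)])
  qed
  have L: "((\<lambda>q. ?L (\<pi>P q) b) \<longlongrightarrow> ?L (\<pi>P r) b) (nhds r)" for b
    by (rule filterlim_compose[OF L0 tendsto_\<pi>P])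
  have l: "((\<lambda>q. lam (\<Phi> q) v) \<longlongrightarrow> lam (\<Phi> r) v) (nhds r)"
    by (intro blinfun.tendsto tendsto_const filterlim_compose[OF tendsto_lam tendsto_\<Phi>[OF U]])
  have "((\<lambda>q. ?L (\<pi>P q) (lam (\<Phi> q) v)) \<longlongrightarrow> ?L (\<pi>P r) (lam (\<Phi> r) v)) (nhds r)"
    by (rule tendsto_linear_family[OF L l]) (auto intro!: always_eventually linear_frame_coord[OF frame])
  moreover have "\<forall>\<^sub>F q in nhds r. \<pi>P q \<in> U"
    using topological_tendstoD[OF tendsto_\<pi>P triv(1)[OF U(1)] U(2)] .
  then have "\<forall>\<^sub>F q in nhds r. ?L (\<pi>P q) (lam (\<Phi> q) v) = Lam q v c"
    by eventually_elim (simp add: eq)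
  ultimately have "((\<lambda>q. Lam q v c) \<longlongrightarrow> ?L (\<pi>P r) (lam (\<Phi> r) v)) (nhds r)"
    by (rule Lim_transform_eventually)
  then show ?thesis by (simp add: eq U)
qed

abbreviation \<omega>c :: "('m, 'v) chart \<Rightarrow> 'm \<Rightarrow> 'v \<Rightarrow> 'v \<Rightarrow> real"
  where "\<omega>c c m u v \<equiv> \<omega> m (coord_vec MA c m u) (coord_vec MA c m v)"

lemma bilinear_\<omega>c: "c \<in> MA \<Longrightarrow> m \<in> fst c \<Longrightarrow> bilinear (\<omega>c c m)"
  using manifold by (intro bilinear_coord) (auto simp: symplectic_manifold_def smooth_tensor_def)

lemma tendsto_\<omega>c:
  assumes c: "c \<in> MA" "m \<in> fst c"
  shows "((\<lambda>m. \<omega>c c m u v) \<longlongrightarrow> \<omega>c c m u v) (nhds m)"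
proof -
  have "smooth_on (snd c ` (UNIV \<inter> fst c)) (coord_tensor MA \<omega> c u v)"
    using manifold c by (auto simp: symplectic_manifold_def smooth_tensor_def)
  from tendsto_coordinate[OF c this]
  have "((\<lambda>m. coord_tensor MA \<omega> c u v (snd c m)) \<longlongrightarrow> \<omega>c c m u v) (nhds m)"
    using c by (simp add: coord_tensor_def)
  moreover have "\<forall>\<^sub>F m in nhds m. m \<in> fst c" using c chart(1) by (intro eventually_nhds_in_open) auto
  then have "\<forall>\<^sub>F m in nhds m. coord_tensor MA \<omega> c u v (snd c m) = \<omega>c c m u v"
    by eventually_elim (use c in \<open>simp add: coord_tensor_def\<close>)
  ultimately show ?thesis by (rule Lim_transform_eventually)
qed

lemma tendsto_\<omega>c_compose:
  assumes c: "c \<in> MA" "m \<in> fst c" and p: "(p \<longlongrightarrow> m) F" and f: "(f \<longlongrightarrow> u) F" "(f' \<longlongrightarrow> v) F"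
  shows "((\<lambda>x. \<omega>c c (p x) (f x) (f' x)) \<longlongrightarrow> \<omega>c c m u v) F"
proof -
  have ev: "\<forall>\<^sub>F x in F. p x \<in> fst c"
    using topological_tendstoD[OF p chart(1)[OF c(1)] c(2)] .
  have l: "linear (\<lambda>u. \<omega>c c m u v)" "linear (\<omega>c c m u)" if "m \<in> fst c" for m u v
    using bilinear_\<omega>c[OF c(1) that] by (auto simp: bilinear_def)
  have "((\<lambda>x. \<omega>c c (p x) (f x) b) \<longlongrightarrow> \<omega>c c m u b) F" for b
    by (rule tendsto_linear_family[where A = "\<lambda>x u. \<omega>c c (p x) u b", OF filterlim_compose[OF tendsto_\<omega>c[OF c] p] f(1)])
      (use ev l c in \<open>auto elim: eventually_mono\<close>)
  then show ?thesis
    by (rule tendsto_linear_family[where A = "\<lambda>x. \<omega>c c (p x) (f x)", OF _ f(2)])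
      (use ev l c in \<open>auto elim: eventually_mono\<close>)
qed

text \<open>The inverse of a frame depends continuously on it, since its coefficients are values of the
  symplectic form.\<close>

lemma inv_frame_expand:
  assumes c: "c \<in> MA" "\<pi>P q \<in> fst c"
  shows "inv_into UNIV (Lam q) (coord_vec MA c (\<pi>P q) u) = (\<Sum>e\<in>B\<^sub>0. \<omega>c c (\<pi>P q) (Lam q (J\<^sub>0 e) c) u *\<^sub>R e)"
proof -
  let ?v = "inv_into UNIV (Lam q) (coord_vec MA c (\<pi>P q) u)"
  have "g ?v e = \<omega>c c (\<pi>P q) (Lam q (J\<^sub>0 e) c) u" for e
  proof -
    have "g ?v e = \<omega>\<^sub>0 (J\<^sub>0 e) ?v" by (subst g_commute) (simp add: metric_of_def)
    also have "\<dots> = \<omega> (\<pi>P q) (Lam q (J\<^sub>0 e)) (Lam q ?v)" by (simp add: frame_\<omega>[OF frame])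
    finally show ?thesis by (simp add: coord_frame[OF frame c] frame_inv(1)[OF frame coord_vec_in[OF c]])
  qed
  then show ?thesis using expand_B\<^sub>0[of ?v] by simp
qed

lemma tendsto_inv_frame:
  assumes c: "c \<in> MA" "\<pi>P r \<in> fst c"
  shows "((\<lambda>q. inv_into UNIV (Lam q) (coord_vec MA c (\<pi>P q) u)) \<longlongrightarrow>
    inv_into UNIV (Lam r) (coord_vec MA c (\<pi>P r) u)) (nhds r)"
proof -
  have "((\<lambda>q. \<Sum>e\<in>B\<^sub>0. \<omega>c c (\<pi>P q) (Lam q (J\<^sub>0 e) c) u *\<^sub>R e) \<longlongrightarrow>
    (\<Sum>e\<in>B\<^sub>0. \<omega>c c (\<pi>P r) (Lam r (J\<^sub>0 e) c) u *\<^sub>R e)) (nhds r)"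
    by (intro tendsto_sum tendsto_scaleR tendsto_const tendsto_\<omega>c_compose c tendsto_\<pi>P tendsto_Lam)
  moreover have "\<forall>\<^sub>F q in nhds r. \<pi>P q \<in> fst c"
    using topological_tendstoD[OF tendsto_\<pi>P chart(1)[OF c(1)] c(2)] .
  then have "\<forall>\<^sub>F q in nhds r. (\<Sum>e\<in>B\<^sub>0. \<omega>c c (\<pi>P q) (Lam q (J\<^sub>0 e) c) u *\<^sub>R e)
    = inv_into UNIV (Lam q) (coord_vec MA c (\<pi>P q) u)"
    by eventually_elim (simp add: inv_frame_expand[OF c(1)])
  ultimately show ?thesis by (subst inv_frame_expand[OF c]) (rule Lim_transform_eventually)
qed

section \<open>The almost complex structure read in frames\<close>

lemma JM:
  assumes "\<sigma> \<in> tangent_space MA m" "\<tau> \<in> tangent_space MA m"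
  shows "JM m \<sigma> \<in> tangent_space MA m" "JM m (\<lambda>c. \<sigma> c + \<tau> c) = (\<lambda>c. JM m \<sigma> c + JM m \<tau> c)"
    "JM m (\<lambda>c. r *\<^sub>R \<sigma> c) = (\<lambda>c. r *\<^sub>R JM m \<sigma> c)" "JM m (JM m \<sigma>) = (\<lambda>c. - \<sigma> c)"
  using acs assms unfolding compatible_positive_acs_def by blast+

lemma JM_metric:
  assumes "\<sigma> \<in> tangent_space MA m" "\<tau> \<in> tangent_space MA m"
  shows "\<omega> m (JM m \<sigma>) \<tau> = \<omega> m (JM m \<tau>) \<sigma>" "\<sigma> \<noteq> (\<lambda>_. 0) \<Longrightarrow> \<omega> m (JM m \<sigma>) \<sigma> > 0"
  using acs assms unfolding compatible_positive_acs_def riemannian_metric_def by blast+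

abbreviation JMc :: "('m, 'v) chart \<Rightarrow> 'm \<Rightarrow> 'v \<Rightarrow> 'v"
  where "JMc c m u \<equiv> JM m (coord_vec MA c m u) c"

lemma smooth_JMc:
  "c \<in> MA \<Longrightarrow> smooth_on (snd c ` fst c) (\<lambda>x. JMc c (chart_inv c x) u)"
  using acs unfolding compatible_positive_acs_def by blast

lemma linear_JMc:
  assumes c: "c \<in> MA" "m \<in> fst c"
  shows "linear (JMc c m)"
  by (rule linearI) (simp_all add: coord_vec_linear[OF c] JM(2) JM(3)[OF coord_vec_in[OF c] coord_vec_in[OF c]] coord_vec_in[OF c])

lemma tendsto_JMc:
  assumes c: "c \<in> MA" "m \<in> fst c"
  shows "((\<lambda>m. JMc c m u) \<longlongrightarrow> JMc c m u) (nhds m)"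
proof -
  have "smooth_on (snd c ` (UNIV \<inter> fst c)) (\<lambda>x. JMc c (chart_inv c x) u)"
    using smooth_JMc[OF c(1)] by simp
  from tendsto_coordinate[OF c this]
  have "((\<lambda>m. JMc c (chart_inv c (snd c m)) u) \<longlongrightarrow> JMc c m u) (nhds m)"
    using c by simp
  moreover have "\<forall>\<^sub>F m in nhds m. m \<in> fst c" using c chart(1) by (intro eventually_nhds_in_open) auto
  then have "\<forall>\<^sub>F m in nhds m. JMc c (chart_inv c (snd c m)) u = JMc c m u"
    by eventually_elim (use c in simp)
  ultimately show ?thesis by (rule Lim_transform_eventually)
qed

text \<open>The structure $J_M$ transported to the model space by the frame \<open>r\<close>. A
  frame is reduced when this is $J_0$, and moving \<open>r\<close> into the reduced bundle means
  intertwining $J_0$ with \<open>JP r\<close>.\<close>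

definition JP :: "'p \<Rightarrow> 'v \<Rightarrow> 'v"
  where "JP r v = inv_into UNIV (Lam r) (JM (\<pi>P r) (Lam r v))"

lemma Lam_JP: "Lam r (JP r v) = JM (\<pi>P r) (Lam r v)"
  unfolding JP_def by (rule frame_inv(1)[OF frame JM(1)[OF frame_in[OF frame] frame_in[OF frame]]])

lemma JP_structure: "linear_complex_structure \<omega>\<^sub>0 (JP r)"
  unfolding linear_complex_structure_def inner_product_def
proof (intro conjI allI impI)
  note inj = frame_inj[OF frame, of r] and L = frame_linear[OF frame, of r] and T = frame_in[OF frame, of r]
  show lin: "linear (JP r)"
  proof (rule linearI)
    show "JP r (u + v) = JP r u + JP r v" for u v
      by (subst inj[symmetric]) (simp add: Lam_JP L JM T)
    show "JP r (a *\<^sub>R v) = a *\<^sub>R JP r v" for a v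
      by (subst inj[symmetric]) (simp add: Lam_JP L JM(3)[OF T T])
  qed
  show "JP r (JP r v) = - v" for v
    by (subst inj[symmetric]) (use L(2)[of "- 1" v] in \<open>simp add: Lam_JP JM(4)[OF T T]\<close>)
  show "bilinear (metric_of \<omega>\<^sub>0 (JP r))"
    unfolding bilinear_def metric_of_def
    using linear_\<omega>(1) linear_compose[OF lin linear_\<omega>(2)] by (auto simp: o_def)
  have m: "metric_of \<omega>\<^sub>0 (JP r) u v = \<omega> (\<pi>P r) (JM (\<pi>P r) (Lam r u)) (Lam r v)" for u v
    by (simp add: metric_of_def Lam_JP flip: frame_\<omega>[OF frame, of r])
  show "metric_of \<omega>\<^sub>0 (JP r) u v = metric_of \<omega>\<^sub>0 (JP r) v u" for u v
    unfolding m by (rule JM_metric[OF T T])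
  fix v :: 'v assume "v \<noteq> 0"
  then have "Lam r v \<noteq> Lam r 0" by (simp add: inj)
  moreover have "Lam r 0 = (\<lambda>_. 0)" using L(2)[of 0 0] by simp
  ultimately show "metric_of \<omega>\<^sub>0 (JP r) v v > 0"
    unfolding m by (intro JM_metric(2)[OF T T]) simp
qed

lemma tendsto_JP: "((\<lambda>q. JP q v) \<longlongrightarrow> JP r v) (nhds r)"
proof -
  obtain c where c: "c \<in> MA" "\<pi>P r \<in> fst c" using ex_chart by blast
  have ev: "\<forall>\<^sub>F q in nhds r. \<pi>P q \<in> fst c"
    using topological_tendstoD[OF tendsto_\<pi>P chart(1)[OF c(1)] c(2)] .
  have eq: "JP q v = inv_into UNIV (Lam q) (coord_vec MA c (\<pi>P q) (JMc c (\<pi>P q) (Lam q v c)))"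
    if "\<pi>P q \<in> fst c" for q
    unfolding JP_def using JM(1)[OF frame_in[OF frame] frame_in[OF frame], of q v]
    by (simp add: coord_frame[OF frame c(1) that] tangent_eq_coord_vec[OF c(1) that])
  have J: "((\<lambda>q. JMc c (\<pi>P q) (Lam q v c)) \<longlongrightarrow> JMc c (\<pi>P r) (Lam r v c)) (nhds r)"
    by (rule tendsto_linear_family[OF filterlim_compose[OF tendsto_JMc[OF c] tendsto_\<pi>P] tendsto_Lam[OF c]])
      (use ev c in \<open>auto elim!: eventually_mono intro: linear_JMc\<close>)
  have "((\<lambda>q. inv_into UNIV (Lam q) (coord_vec MA c (\<pi>P q) (JMc c (\<pi>P q) (Lam q v c)))) \<longlongrightarrow>
    inv_into UNIV (Lam r) (coord_vec MA c (\<pi>P r) (JMc c (\<pi>P r) (Lam r v c)))) (nhds r)"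
    by (rule tendsto_linear_family[OF tendsto_inv_frame[OF c] J])
      (use ev c in \<open>auto elim!: eventually_mono intro: inv_frame_coord(3)[OF frame]\<close>)
  moreover have "\<forall>\<^sub>F q in nhds r. inv_into UNIV (Lam q) (coord_vec MA c (\<pi>P q) (JMc c (\<pi>P q) (Lam q v c))) = JP q v"
    using ev by eventually_elim (simp add: eq)
  ultimately show ?thesis unfolding eq[OF c(2)] by (rule Lim_transform_eventually)
qed

end

subsection \<open>Associated bundles\<close>

text \<open>The subgroup \<open>S\<close> is a parameter because the bundles of functionals and of
  compact operators are quotients by the whole covering group, while the reduced bundle is a
  quotient by the subgroup \<open>K_tilde\<close>.\<close>

locale assoc_action =
  fixes ract :: "'p \<Rightarrow> 'g::group_add \<Rightarrow> 'p" and S :: "'g set" and \<kappa> :: "'g \<Rightarrow> 'f \<Rightarrow> 'f"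
  assumes ract_0: "ract r 0 = r" and ract_add: "ract (ract r h) k = ract r (h + k)"
    and ract_free: "ract r h = ract r k \<Longrightarrow> h = k"
    and S: "0 \<in> S" "h \<in> S \<Longrightarrow> k \<in> S \<Longrightarrow> h + k \<in> S" "h \<in> S \<Longrightarrow> - h \<in> S"
    and \<kappa>_0: "\<kappa> 0 v = v" and \<kappa>_add: "\<kappa> h (\<kappa> k v) = \<kappa> (h + k) v"
begin

abbreviation cls where "cls \<equiv> assoc_class ract S \<kappa>"

lemma mem_cls: "(r', w) \<in> cls (r, v) \<longleftrightarrow> (\<exists>h\<in>S. r' = ract r (- h) \<and> w = \<kappa> h v)"
  by (auto simp: assoc_class_def)

lemma cls_translate:
  assumes "h \<in> S"
  shows "cls (ract r (- h), \<kappa> h v) = cls (r, v)"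
proof -
  have "cls (ract r (- h), \<kappa> h v) = {(ract r (- (k + h)), \<kappa> (k + h) v) | k. k \<in> S}"
    by (simp add: assoc_class_def ract_add \<kappa>_add minus_add)
  also have "\<dots> = cls (r, v)"
  proof -
    have "\<exists>k'\<in>S. k = k' + h" if "k \<in> S" for k
      using S(2)[OF that S(3)[OF assms]] by (intro bexI[of _ "k + - h"]) auto
    then show ?thesis using S(2)[OF _ assms] by (fastforce simp: assoc_class_def)
  qed
  finally show ?thesis .
qed

lemma self_mem_cls: "(r, v) \<in> cls (r, v)"
  unfolding mem_cls using S(1) by (intro bexI[of _ 0]) (auto simp: ract_0 \<kappa>_0)

lemma mem_cls_same: "(r, w) \<in> cls (r, v) \<longleftrightarrow> w = v"
proof
  assume "(r, w) \<in> cls (r, v)"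
  then obtain h where h: "r = ract r (- h)" "w = \<kappa> h v" unfolding mem_cls by blast
  from h(1) have "- h = 0" by (metis ract_0 ract_free)
  then show "w = v" using h(2) by (simp add: \<kappa>_0)
qed (simp add: self_mem_cls)

lemma class_coord_cls [simp]: "class_coord r (cls (r, v)) = v"
  unfolding class_coord_def mem_cls_same by simp

text \<open>The chosen representative is known only up to a group element, so operations defined
  through it have to be shown invariant under this translation.\<close>

lemma class_rep_cls:
  obtains h where "h \<in> S" "class_rep (cls (r, v)) = ract r (- h)"
proof -
  have "(SOME z. z \<in> cls (r, v)) \<in> cls (r, v)" using self_mem_cls by (rule someI)
  then show ?thesis
    using that mem_cls[of "fst (SOME z. z \<in> cls (r, v))" "snd (SOME z. z \<in> cls (r, v))"]
    by (auto simp: class_rep_def)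
qed

end

text \<open>The fibre is an abstract complete complex inner product space with an infinite
  orthonormal sequence; $L^2$ is put in its place at the end.\<close>

locale kuiper_bundle = metaplectic_bundle \<omega>\<^sub>0 J\<^sub>0 MA lam \<omega> \<pi>P ract PA Lam JM
  for \<omega>\<^sub>0 :: "'v::euclidean_space \<Rightarrow> 'v \<Rightarrow> real" and J\<^sub>0
    and MA :: "('m::{t2_space, second_countable_topology}, 'v) chart set"
    and lam :: "'g::topological_group_add \<Rightarrow> 'v \<Rightarrow>\<^sub>L 'v"
    and \<omega> and \<pi>P :: "'p::topological_space \<Rightarrow> 'm" and ract PA Lam JM +
  fixes sw :: "'g \<Rightarrow> 'x::{complex_inner, complete_space} \<Rightarrow>\<^sub>L 'x"
    and KJ :: "('p \<times> 'x cdual) set \<Rightarrow> 'm \<times> 'x cdual"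
  assumes sw_unitary: "unitary_op (blinfun_apply (sw h))"
    and sw_add: "sw (h + k) = sw h o\<^sub>L sw k"
    and orthonormal: "\<exists>e :: nat \<Rightarrow> 'x. \<forall>i j. cinner (e i) (e j) = (if i = j then 1 else 0)"
    and kuiper: "kuiper_map \<pi>P ract sw KJ"
begin

lemma sw_0: "sw 0 v = v"
proof -
  have "sw 0 (sw 0 v) = sw 0 v" using arg_cong[OF sw_add[of 0 0], of "\<lambda>T. blinfun_apply T v"] by simp
  then show ?thesis using unitary_op_bij[OF sw_unitary[of 0]] by (simp add: bij_def inj_def)
qed

lemma sw_sw: "sw h (sw k v) = sw (h + k) v"
  by (simp add: sw_add)

lemma sw_minus: "sw (- h) (sw h v) = v" "sw h (sw (- h) v) = v"
  by (simp_all add: sw_sw sw_0)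

lemma clinear_sw: "clinear (blinfun_apply (sw h))"
  by (rule unitary_opD(1)[OF sw_unitary])

lemma ev_dual_rep [simp]: "ev (dual_rep sw h f) w = ev f (sw (- h) w)"
proof -
  have "clinear (blinfun_apply (Rep_cdual f o\<^sub>L sw (- h)))"
    using Rep_cdual[of f] clinear_sw by (intro clinear_blinfun_compose) auto
  then show ?thesis by (simp add: dual_rep_def ev.rep_eq Abs_cdual_inverse)
qed

lemma cpt_apply_CH_rep [simp]: "cpt_apply (CH_rep sw h a) w = sw h (cpt_apply a (sw (- h) w))"
proof -
  have "clinear (blinfun_apply (sw h o\<^sub>L Rep_cpt a o\<^sub>L sw (- h)))"
    using Rep_cpt[of a] clinear_sw by (intro clinear_blinfun_compose) auto
  moreover have "compact_op (sw h o\<^sub>L Rep_cpt a o\<^sub>L sw (- h))"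
    using Rep_cpt[of a] by (intro compact_op_compose_left compact_op_compose_right) auto
  ultimately show ?thesis by (simp add: CH_rep_def cpt_apply.rep_eq Abs_cpt_inverse)
qed

lemma linear_dual_rep: "linear (dual_rep sw h)"
  by (rule linearI) (auto intro!: ev_extI)

lemma linear_lam: "linear (blinfun_apply (lam h))"
  by (rule bounded_linear.linear[OF blinfun.bounded_linear_right])

lemma form_apply_rep [simp]:
  "form_apply (form_rep lam sw h F) vs = dual_rep sw h (form_apply F (map (lam (- h)) vs))"
  unfolding form_rep_def by (rule form_apply_form_map[OF linear_lam linear_dual_rep])

lemma dual_rep_0: "dual_rep sw 0 f = f"
  by (rule ev_extI) (simp add: sw_0)

sublocale dual: assoc_action ract UNIV "dual_rep sw"
  by unfold_locales (auto simp: ract dual_rep_0 minus_add sw_sw intro: ract_inj ev_extI)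

sublocale CH: assoc_action ract UNIV "CH_rep sw"
  by unfold_locales (auto simp: ract sw_0 minus_add sw_sw intro: ract_inj cpt_extI)

abbreviation "Kt \<equiv> K_tilde g lam"

text \<open>For symplectic maps the metric is preserved exactly when $J_0$ is, by nondegeneracy of
  the symplectic form. In this form membership can be compared with the condition for a translated
  frame to be reduced.\<close>

lemma Kt_iff: "k \<in> Kt \<longleftrightarrow> (\<forall>v. lam k (J\<^sub>0 v) = J\<^sub>0 (lam k v))"
proof
  have lam_\<omega>: "\<omega>\<^sub>0 (lam k u) (lam k v) = \<omega>\<^sub>0 u v" for u v using lam_in[of k] by (simp add: Sp_def)
  assume "k \<in> Kt"
  then have eq: "\<omega>\<^sub>0 (J\<^sub>0 (lam k u)) (lam k v) = \<omega>\<^sub>0 (lam k (J\<^sub>0 u)) (lam k v)" for u v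
    by (simp add: K_tilde_def metric_of_def lam_\<omega>)
  show "\<forall>v. lam k (J\<^sub>0 v) = J\<^sub>0 (lam k v)"
  proof
    fix u
    have "\<omega>\<^sub>0 (lam k (J\<^sub>0 u) - J\<^sub>0 (lam k u)) w = 0" for w
      using eq[of u "lam (- k) w"] by (simp add: lam_minus linear_diff[OF linear_\<omega>(2)])
    then have "lam k (J\<^sub>0 u) - J\<^sub>0 (lam k u) = 0" using symplectic unfolding linear_symplectic_def by blast
    then show "lam k (J\<^sub>0 u) = J\<^sub>0 (lam k u)" by simp
  qed
next
  assume *: "\<forall>v. lam k (J\<^sub>0 v) = J\<^sub>0 (lam k v)"
  have "\<omega>\<^sub>0 (lam k u) (lam k v) = \<omega>\<^sub>0 u v" for u v using lam_in[of k] by (simp add: Sp_def)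
  then show "k \<in> Kt" by (simp add: K_tilde_def metric_of_def *[rule_format, symmetric])
qed

lemma Kt_group: "0 \<in> Kt" "h \<in> Kt \<Longrightarrow> k \<in> Kt \<Longrightarrow> h + k \<in> Kt" "h \<in> Kt \<Longrightarrow> - h \<in> Kt"
proof -
  show "0 \<in> Kt" by (simp add: Kt_iff lam_0)
  show "h \<in> Kt \<Longrightarrow> k \<in> Kt \<Longrightarrow> h + k \<in> Kt" by (simp add: Kt_iff lam_add)
  assume h: "h \<in> Kt"
  have "lam (- h) (J\<^sub>0 v) = J\<^sub>0 (lam (- h) v)" for v
  proof -
    have "lam h (J\<^sub>0 (lam (- h) v)) = J\<^sub>0 v" using h by (simp add: Kt_iff lam_minus)
    then show ?thesis by (metis lam_minus(1))
  qed
  then show "- h \<in> Kt" by (simp add: Kt_iff)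
qed

sublocale F: assoc_action ract Kt "form_rep lam sw"
proof (unfold_locales, goal_cases)
  case (7 v)
  show ?case by (rule form_extI) (simp add: lam_0 dual_rep_0)
next
  case (8 h k v)
  have "blinfun_apply (lam (- k - h)) = (\<lambda>v. lam (- k) (lam (- h) v))" using lam_add[of "- k" "- h"] by (simp add: fun_eq_iff)
  then show ?case by (intro form_extI) (simp add: minus_add dual.\<kappa>_add o_def)
qed (auto simp: ract Kt_group intro: ract_inj)

subsubsection \<open>The unitary operators given by the Kuiper map\<close>

text \<open>The Kuiper map of a single fibre read in the frame \<open>r\<close>. Its conjugate
  \<open>cU\<close> by the Riesz maps acts on the Hilbert space itself, where
  \<open>unitary_op\<close> applies and from which the inverse \<open>iU\<close> is taken.\<close>

definition U :: "'p \<Rightarrow> 'x cdual \<Rightarrow> 'x cdual" where "U r f = snd (KJ (dual.cls (r, f)))"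
definition cU :: "'p \<Rightarrow> 'x \<Rightarrow> 'x" where "cU r v = sharp (U r (flat v))"
definition iU :: "'p \<Rightarrow> 'x cdual \<Rightarrow> 'x cdual" where "iU r f = flat (inv (cU r) (sharp f))"

lemma fst_KJ: "fst (KJ (dual.cls (r, f))) = \<pi>P r"
  and clinear_U: "clinear (U r)" and surj_U: "surj (U r)"
  and dual_inner_U: "dual_inner (U r f) (U r f') = dual_inner f f'"
  using kuiper unfolding kuiper_map_def Let_def U_def[abs_def] by auto

lemma continuous_KJ: "continuous_on UNIV (\<lambda>z. KJ (dual.cls z))"
proof -
  have "continuous_map (assoc_topology UNIV dual.cls) euclidean KJ"
    using kuiper by (simp add: kuiper_map_def Let_def homeomorphic_imp_continuous_map)
  then have "open {z. KJ (dual.cls z) \<in> V}" if "open V" for V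
    using that unfolding continuous_map_def openin_assoc_topology topspace_assoc_topology by auto
  then show ?thesis by (simp add: continuous_on_open_vimage vimage_def)
qed

lemma tendsto_U:
  assumes "(q \<longlongrightarrow> r) F" "(f \<longlongrightarrow> f0) F"
  shows "((\<lambda>x. U (q x) (f x)) \<longlongrightarrow> U r f0) F"
proof -
  have "((\<lambda>z. KJ (dual.cls z)) \<longlongrightarrow> KJ (dual.cls (r, f0))) (nhds (r, f0))"
    by (rule tendsto_nhds[OF continuous_KJ]) auto
  from filterlim_compose[OF this tendsto_Pair[OF assms]] show ?thesis
    unfolding U_def by (rule tendsto_snd)
qed

lemma unitary_cU: "unitary_op (cU r)"
  unfolding unitary_op_def
proof (intro conjI allI)
  show "clinear (cU r)"
    unfolding clinear_def cU_def
    by (simp add: flat_add flat_scaleC clinearD[OF clinear_U] sharp_add sharp_scaleC)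
  show "surj (cU r)"
  proof (rule surjI)
    fix v show "cU r (sharp (inv (U r) (flat v))) = v"
      by (simp add: cU_def surj_f_inv_f[OF surj_U])
  qed
  show "cinner (cU r v) (cU r w) = cinner v w" for v w
    using dual_inner_U[of r "flat w" "flat v"] by (simp add: dual_inner_def cU_def)
qed

lemma U_eq: "U r f = flat (cU r (sharp f))"
  by (simp add: cU_def)

lemma ev_U: "ev (U r f) w = ev f (inv (cU r) w)"
  using unitary_opD(3)[OF unitary_cU, of r "sharp f" "inv (cU r) w"]
  by (simp add: U_eq ev_flat cinner_sharp unitary_op_inv_simps[OF unitary_cU])

lemma linear_U: "linear (U r)"
  by (rule clinear_linear[OF clinear_U])

lemma norm_U: "norm (U r f) = norm f"
  by (simp add: U_eq unitary_op_norm[OF unitary_cU])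

lemma U_iU [simp]: "U r (iU r f) = f"
  by (simp add: U_eq iU_def unitary_op_inv_simps[OF unitary_cU])

lemma iU_U [simp]: "iU r (U r f) = f"
  by (simp add: U_eq iU_def unitary_op_inv_simps[OF unitary_cU])

lemma clinear_iU: "clinear (iU r)"
  using unitary_opD(1)[OF unitary_op_inv[OF unitary_cU[of r]]]
  by (simp add: clinear_def iU_def flat_add flat_scaleC sharp_add sharp_scaleC)

text \<open>Inversion need not be continuous for strong convergence, but the operators are
  isometric: the distance of \<open>iU (q x) (f x)\<close> from \<open>iU r f0\<close> equals that
  of \<open>f x\<close> from \<open>U (q x) (iU r f0)\<close>, which tends to zero.\<close>

lemma tendsto_iU:
  assumes "(q \<longlongrightarrow> r) F" "(f \<longlongrightarrow> f0) F"
  shows "((\<lambda>x. iU (q x) (f x)) \<longlongrightarrow> iU r f0) F"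
proof -
  have "((\<lambda>x. f x - U (q x) (iU r f0)) \<longlongrightarrow> f0 - U r (iU r f0)) F"
    by (rule tendsto_diff[OF assms(2) tendsto_U[OF assms(1) tendsto_const]])
  then have "((\<lambda>x. norm (f x - U (q x) (iU r f0))) \<longlongrightarrow> 0) F"
    using tendsto_norm_zero[of "\<lambda>x. f x - U (q x) (iU r f0)"] by simp
  moreover have "norm (f x - U (q x) (iU r f0)) = norm (iU (q x) (f x) - iU r f0)" for x
    by (subst (2) norm_U[of "q x", symmetric]) (simp add: clinearD[OF clinear_U])
  ultimately have "((\<lambda>x. norm (iU (q x) (f x) - iU r f0)) \<longlongrightarrow> 0) F" by simp
  from tendsto_norm_zero_cancel[OF this] show ?thesis by (rule Lim_null[THEN iffD2])
qed

lemma U_translate: "U (ract r (- h)) (dual_rep sw h f) = U r f"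
  by (simp add: U_def dual.cls_translate)

lemma cU_translate: "cU (ract r (- h)) (sw h v) = cU r v"
proof -
  have "flat (sw h v) = dual_rep sw h (flat v)"
    using unitary_opD(3)[OF sw_unitary[of h], of v] by (intro ev_extI) (metis ev_dual_rep ev_flat sw_minus(2))
  then show ?thesis by (simp add: cU_def U_translate)
qed

lemma conj_translate: "cpt_conj (cU (ract r (- h))) (CH_rep sw h a) = cpt_conj (cU r) a"
proof (rule cpt_extI)
  fix w
  note u = unitary_op_inv_simps[OF unitary_cU]
  have "cU r (sw (- h) (inv (cU (ract r (- h))) w)) = w"
    by (simp add: cU_translate[of r h, symmetric] sw_minus u)
  then have "sw (- h) (inv (cU (ract r (- h))) w) = inv (cU r) w" by (metis u(2))
  then show "cpt_apply (cpt_conj (cU (ract r (- h))) (CH_rep sw h a)) w = cpt_apply (cpt_conj (cU r) a) w"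
    by (simp add: cpt_apply_conj[OF unitary_cU] cU_translate)
qed

lemma kuiper_check_eq: "kuiper_check KJ (assoc_class ract UNIV (\<lambda>h. blinfun_apply (sw h)) (r, v)) = (\<pi>P r, cU r v)"
proof -
  have "flat (sw h v) = dual_rep sw h (flat v)" for h
    using unitary_opD(3)[OF sw_unitary[of h], of v] by (intro ev_extI) (metis ev_dual_rep ev_flat sw_minus(2))
  then have "map_prod id flat ` assoc_class ract UNIV (\<lambda>h. blinfun_apply (sw h)) (r, v) = dual.cls (r, flat v)"
    by (fastforce simp: assoc_class_def image_iff)
  then show ?thesis
    using fst_KJ[of r "flat v"] by (simp add: kuiper_check_def cU_def U_def map_prod_def split_beta)
qed

text \<open>Conjugation by \<open>cU r\<close> shows that the choice in \<open>kuiper_CH\<close> has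
  something to choose from, and \<open>clinear_cpt_unique\<close> shows that every admissible
  candidate has these values.\<close>

lemma kuiper_CH: "kuiper_CH \<pi>P ract sw KJ (CH.cls (r, a)) = (\<pi>P r, cpt_conj (cU r) a)"
proof -
  define P where "P JCH \<longleftrightarrow> (let cls = CH.cls in
      (\<forall>r a. fst (JCH (cls (r, a))) = \<pi>P r) \<and>
      (\<forall>r. clinear (\<lambda>a. snd (JCH (cls (r, a)))) \<and> continuous_on UNIV (\<lambda>a. snd (JCH (cls (r, a))))) \<and>
      (\<forall>r v f. JCH (cls (r, rank_one v f)) = (\<pi>P r,
        rank_one (snd (kuiper_check KJ (assoc_class ract UNIV (\<lambda>g. blinfun_apply (sw g)) (r, v))))
          (snd (KJ (dual.cls (r, f)))))))" for JCH :: "('p \<times> 'x cpt) set \<Rightarrow> 'm \<times> 'x cpt"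
  \<comment> \<open>Defined through the chosen representative; \<open>conj_translate\<close> makes
    the value independent of it.\<close>
  define K0 :: "('p \<times> 'x cpt) set \<Rightarrow> 'm \<times> 'x cpt"
    where "K0 x = (\<pi>P (class_rep x), cpt_conj (cU (class_rep x)) (class_coord (class_rep x) x))" for x
  have K0: "K0 (CH.cls (r, a)) = (\<pi>P r, cpt_conj (cU r) a)" for r a
  proof -
    obtain h where h: "class_rep (CH.cls (r, a)) = ract r (- h)" using CH.class_rep_cls by blast
    have "CH.cls (r, a) = CH.cls (ract r (- h), CH_rep sw h a)" by (simp add: CH.cls_translate)
    then have "class_coord (ract r (- h)) (CH.cls (r, a)) = CH_rep sw h a" by simp
    then show ?thesis by (simp add: K0_def h ract conj_translate)
  qed
  have rank: "cpt_conj (cU r) (rank_one v f) = rank_one (cU r v) (U r f)" for r v f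
    by (simp add: cpt_conj_rank_one[OF unitary_cU] U_eq)
  have "P K0"
    unfolding P_def Let_def K0 kuiper_check_eq
    by (simp add: rank U_def[symmetric] clinear_cpt_conj[OF unitary_cU] continuous_on_cpt_conj[OF unitary_cU])
  from someI[of P, OF this] have "P (SOME JCH. P JCH)" .
  then have PK: "P (kuiper_CH \<pi>P ract sw KJ)" by (simp add: kuiper_CH_def P_def)
  have "snd (kuiper_CH \<pi>P ract sw KJ (CH.cls (r, a))) = cpt_conj (cU r) a"
  proof (rule clinear_cpt_unique[where S = "\<lambda>a. snd (kuiper_CH \<pi>P ract sw KJ (CH.cls (r, a)))"])
    show "snd (kuiper_CH \<pi>P ract sw KJ (CH.cls (r, rank_one u f))) = cpt_conj (cU r) (rank_one u f)" for u f
      using PK by (simp add: P_def Let_def kuiper_check_eq rank U_def)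
  qed (use PK in \<open>auto simp: P_def Let_def intro: clinear_cpt_conj[OF unitary_cU] continuous_on_cpt_conj[OF unitary_cU]\<close>)
  moreover have "fst (kuiper_CH \<pi>P ract sw KJ (CH.cls (r, a))) = \<pi>P r"
    using PK by (simp add: P_def Let_def)
  ultimately show ?thesis by (simp add: prod_eq_iff)
qed

text \<open>The preimage supplied by \<open>inv_into\<close> may be represented in any frame over
  the base point of \<open>q\<close>. Translating it to \<open>q\<close> makes its coordinate
  comparable, and conjugation by \<open>cU q\<close> is injective.\<close>

lemma kuiper_CH_inv_coord:
  "class_coord q (inv_into (CH.cls ` UNIV) (kuiper_CH \<pi>P ract sw KJ) (\<pi>P q, a)) = cpt_conj (inv (cU q)) a"
proof -
  let ?y = "inv_into (CH.cls ` UNIV) (kuiper_CH \<pi>P ract sw KJ) (\<pi>P q, a)"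
  note u = unitary_op_inv_simps[OF unitary_cU[of q]]
  have ii: "inv (inv (cU q)) = cU q" by (rule inv_inv_eq[OF unitary_op_bij[OF unitary_cU]])
  have c: "cpt_conj (cU q) (cpt_conj (inv (cU q)) a) = a" "cpt_conj (inv (cU q)) (cpt_conj (cU q) b) = b" for a b
    by (rule cpt_extI; simp add: cpt_apply_conj[OF unitary_cU] cpt_apply_conj[OF unitary_op_inv[OF unitary_cU]] ii u)+
  have "kuiper_CH \<pi>P ract sw KJ (CH.cls (q, cpt_conj (inv (cU q)) a)) = (\<pi>P q, a)"
    by (simp add: kuiper_CH c)
  then have "(\<pi>P q, a) \<in> kuiper_CH \<pi>P ract sw KJ ` CH.cls ` UNIV" by (metis imageI UNIV_I)
  then have y: "?y \<in> CH.cls ` UNIV" "kuiper_CH \<pi>P ract sw KJ ?y = (\<pi>P q, a)"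
    by (rule inv_into_into, rule f_inv_into_f)
  then obtain r b where rb: "?y = CH.cls (r, b)" by auto
  then have "\<pi>P r = \<pi>P q" using y(2) by (simp add: kuiper_CH)
  then obtain h where h: "q = ract r h" using ex_ract by blast
  then have yq: "?y = CH.cls (q, CH_rep sw (- h) b)"
    unfolding rb unfolding h using CH.cls_translate[of "- h" r b] by simp
  then have "cpt_conj (cU q) (CH_rep sw (- h) b) = a" using y(2) by (simp add: kuiper_CH)
  then show ?thesis using c(2)[of "CH_rep sw (- h) b"] by (simp add: yq)
qed

subsubsection \<open>Reduced frames\<close>

abbreviation "R \<equiv> reduced_frames J\<^sub>0 \<pi>P Lam JM"

lemma R_iff: "r \<in> R \<longleftrightarrow> (\<forall>v. JP r v = J\<^sub>0 v)"
proof -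
  have "Lam r (J\<^sub>0 v) = JM (\<pi>P r) (Lam r v) \<longleftrightarrow> JP r v = J\<^sub>0 v" for v
    unfolding Lam_JP[symmetric] frame_inj[OF frame] by (rule eq_commute)
  then show ?thesis by (simp add: reduced_frames_def)
qed

lemma R_ract: "ract r h \<in> R \<longleftrightarrow> (\<forall>v. lam h (J\<^sub>0 v) = JP r (lam h v))"
proof -
  have "Lam (ract r h) (J\<^sub>0 v) = JM (\<pi>P (ract r h)) (Lam (ract r h) v) \<longleftrightarrow> lam h (J\<^sub>0 v) = JP r (lam h v)" for v
    by (simp add: Lam_ract ract Lam_JP[symmetric] frame_inj[OF frame])
  then show ?thesis by (simp add: reduced_frames_def)
qed

lemma R_ract_Kt: "r \<in> R \<Longrightarrow> ract r h \<in> R \<longleftrightarrow> h \<in> Kt"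
  unfolding R_ract Kt_iff by (simp add: R_iff)

text \<open>An intertwiner of $J_0$ with the structure seen in an arbitrary frame, lifted to the
  covering group, moves that frame into the reduced bundle.\<close>

lemma ex_R: "\<exists>q\<in>R. \<pi>P q = m"
proof -
  obtain U \<Phi> where U: "(U, \<Phi>) \<in> PA" "m \<in> U" using ex_triv[of m] by auto
  define r where "r = triv_inv \<pi>P \<Phi> m 0"
  obtain S where S: "S \<in> Sp \<omega>\<^sub>0" "\<And>v. S (J\<^sub>0 v) = JP r (S v)"
    using exists_intertwiner[OF JP_structure] by blast
  obtain h where "lam h = S" using lam_surj[OF S(1)] by blast
  then have "ract r h \<in> R" using S(2) by (simp add: R_ract)
  moreover have "\<pi>P (ract r h) = m" by (simp add: ract r_def triv_inv[OF U])
  ultimately show ?thesis by blast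
qed

text \<open>The reduced bundle projects openly: nearby complex structures are intertwined by symplectic maps
  close to the identity, which lift to the covering group.\<close>

lemma R_open_projection:
  assumes r: "r \<in> R" and N: "open N" "r \<in> N"
  shows "\<exists>V. open V \<and> \<pi>P r \<in> V \<and> (\<forall>m\<in>V. \<exists>q\<in>R \<inter> N. \<pi>P q = m)"
proof -
  obtain U \<Phi> where U: "(U, \<Phi>) \<in> PA" "\<pi>P r \<in> U" using ex_triv[of "\<pi>P r"] by auto
  \<comment> \<open>Stated for an arbitrary neighbourhood, because it serves both the continuity of
    the section \<open>\<sigma>\<close> and the control of the corrected frames.\<close>
  have box: "\<exists>V G. open V \<and> open G \<and> \<pi>P r \<in> V \<and> V \<subseteq> U \<and> \<Phi> r \<in> G \<and> (\<forall>m\<in>V. \<forall>h\<in>G. triv_inv \<pi>P \<Phi> m h \<in> N)"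
    if "open N" "r \<in> N" for N
  proof -
    let ?f = "\<lambda>r. (\<pi>P r, \<Phi> r)"
    have "openin (top_of_set (\<pi>P -` U)) (\<pi>P -` U \<inter> N)" using that by (simp add: openin_open_Int)
    then have "openin (prod_topology (top_of_set U) euclidean) (?f ` (\<pi>P -` U \<inter> N))"
      using homeomorphic_imp_open_map[OF triv(2)[OF U(1)]] by (simp add: open_map_def)
    note box = this[unfolded openin_prod_topology_alt, THEN spec, THEN spec, THEN mp]
    have "(\<pi>P r, \<Phi> r) \<in> ?f ` (\<pi>P -` U \<inter> N)" using U that by auto
    from box[OF this] obtain V G where VG: "openin (top_of_set U) V" "open G" "\<pi>P r \<in> V" "\<Phi> r \<in> G"
      "V \<times> G \<subseteq> ?f ` (\<pi>P -` U \<inter> N)"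
      by (elim exE conjE) (simp only: open_openin)
    have "triv_inv \<pi>P \<Phi> m h \<in> N" if "m \<in> V" "h \<in> G" for m h
    proof -
      have "(m, h) \<in> ?f ` (\<pi>P -` U \<inter> N)" using VG(5) that by blast
      then obtain q where "q \<in> N" "\<pi>P q = m" "\<Phi> q = h" "m \<in> U" by auto
      then show ?thesis using triv_inv(3)[OF U(1), of m q h] by simp
    qed
    moreover have "open V" "V \<subseteq> U" using VG(1) triv(1)[OF U(1)] openin_open_eq by auto
    ultimately show ?thesis using VG by blast
  qed
  \<comment> \<open>The local section through \<open>r\<close> with constant group component. Away
    from the base point of \<open>r\<close> it need not be reduced; a group element close to
    \<open>0\<close> will correct it.\<close>
  define \<sigma> where "\<sigma> m = triv_inv \<pi>P \<Phi> m (\<Phi> r)" for m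
  have \<sigma>r: "\<sigma> (\<pi>P r) = r" using triv_inv(3)[OF U refl refl] by (simp add: \<sigma>_def)
  have "(\<sigma> \<longlongrightarrow> \<sigma> (\<pi>P r)) (nhds (\<pi>P r))"
  proof (rule topological_tendstoI)
    fix N' assume "open N'" "\<sigma> (\<pi>P r) \<in> N'"
    with box[of N'] obtain V G where "open V" "\<pi>P r \<in> V" "\<Phi> r \<in> G" "\<forall>m\<in>V. \<forall>h\<in>G. triv_inv \<pi>P \<Phi> m h \<in> N'"
      by (auto simp: \<sigma>r)
    then show "\<forall>\<^sub>F m in nhds (\<pi>P r). \<sigma> m \<in> N'"
      unfolding eventually_nhds \<sigma>_def by blast
  qed
  then have \<sigma>: "(\<sigma> \<longlongrightarrow> r) (nhds (\<pi>P r))" by (simp add: \<sigma>r)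
  obtain V G where V: "open V" "open G" "\<pi>P r \<in> V" "V \<subseteq> U" "\<Phi> r \<in> G"
    "\<And>m h. m \<in> V \<Longrightarrow> h \<in> G \<Longrightarrow> triv_inv \<pi>P \<Phi> m h \<in> N" using box[OF N] by blast
  have "continuous_on UNIV (\<lambda>h. \<Phi> r + h)" by (intro continuous_intros)
  from open_vimage[OF V(2) this] have "open ((\<lambda>h. \<Phi> r + h) -` G)" .
  from lam_near_identity[OF this] obtain \<epsilon> where \<epsilon>: "\<epsilon> > 0"
    "\<And>S. S \<in> Sp \<omega>\<^sub>0 \<Longrightarrow> norm (S - id_blinfun) < \<epsilon> \<Longrightarrow> \<exists>h. \<Phi> r + h \<in> G \<and> lam h = S"
    using V(5) by auto
  obtain \<delta> where \<delta>: "\<delta> > 0" "\<And>J' :: 'v \<Rightarrow>\<^sub>L 'v. linear_complex_structure \<omega>\<^sub>0 (blinfun_apply J') \<Longrightarrow>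
    norm (J' - Blinfun J\<^sub>0) < \<delta> \<Longrightarrow>
    \<exists>S\<in>Sp \<omega>\<^sub>0. norm (S - id_blinfun) < \<epsilon> \<and> (\<forall>v. blinfun_apply S (J\<^sub>0 v) = blinfun_apply J' (blinfun_apply S v))"
    using exists_intertwiner_near[OF \<epsilon>(1)] by auto
  have JP_app [simp]: "blinfun_apply (Blinfun (JP q)) = JP q" for q
    using JP_structure[of q] by (intro bounded_linear_Blinfun_apply linear_conv_bounded_linear[THEN iffD1])
      (simp add: linear_complex_structure_def)
  have J_app [simp]: "blinfun_apply (Blinfun J\<^sub>0) = J\<^sub>0"
    using J(1) by (intro bounded_linear_Blinfun_apply linear_conv_bounded_linear[THEN iffD1])
  have "((\<lambda>m. Blinfun (JP (\<sigma> m))) \<longlongrightarrow> Blinfun J\<^sub>0) (nhds (\<pi>P r))"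
  proof (rule tendsto_componentwise1)
    fix b :: 'v
    have "((\<lambda>m. JP (\<sigma> m) b) \<longlongrightarrow> JP r b) (nhds (\<pi>P r))" by (rule filterlim_compose[OF tendsto_JP \<sigma>])
    then show "((\<lambda>m. blinfun_apply (Blinfun (JP (\<sigma> m))) b) \<longlongrightarrow> blinfun_apply (Blinfun J\<^sub>0) b) (nhds (\<pi>P r))"
      using r by (simp add: R_iff)
  qed
  from tendstoD[OF this \<delta>(1)] have "\<forall>\<^sub>F m in nhds (\<pi>P r). norm (Blinfun (JP (\<sigma> m)) - Blinfun J\<^sub>0) < \<delta>"
    by (simp add: dist_norm)
  then obtain V' where V': "open V'" "\<pi>P r \<in> V'" "\<And>m. m \<in> V' \<Longrightarrow> norm (Blinfun (JP (\<sigma> m)) - Blinfun J\<^sub>0) < \<delta>"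
    unfolding eventually_nhds by blast
  show ?thesis
  proof (intro exI[of _ "V \<inter> V'"] conjI ballI)
    fix m assume m: "m \<in> V \<inter> V'"
    have "linear_complex_structure \<omega>\<^sub>0 (blinfun_apply (Blinfun (JP (\<sigma> m))))" using JP_structure by simp
    from \<delta>(2)[OF this V'(3)] m obtain S where S: "S \<in> Sp \<omega>\<^sub>0" "norm (S - id_blinfun) < \<epsilon>"
      "\<And>v. blinfun_apply S (J\<^sub>0 v) = JP (\<sigma> m) (blinfun_apply S v)" by auto
    obtain h where h: "\<Phi> r + h \<in> G" "lam h = S" using \<epsilon>(2)[OF S(1,2)] by blast
    have mU: "m \<in> U" using m V(4) by auto
    have "ract (\<sigma> m) h \<in> R" using S(3) by (simp add: R_ract h)
    moreover have "ract (\<sigma> m) h \<in> N"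
      using V(6)[of m "\<Phi> r + h"] m h by (simp add: \<sigma>_def triv_inv_ract[OF U(1) mU])
    moreover have "\<pi>P (ract (\<sigma> m) h) = m" by (simp add: ract \<sigma>_def triv_inv[OF U(1) mU])
    ultimately show "\<exists>q\<in>R \<inter> N. \<pi>P q = m" by blast
  qed (use V V' in auto)
qed

end

subsection \<open>Charts of the reduced bundle\<close>

lemma form_twist_id:
  assumes "\<And>k. \<mu> k = 1" "\<And>f. U f = f" "\<And>v. A v = v"
  shows "form_twist \<mu> U A F = F"
proof -
  have "linear U" "linear A" using assms by (auto intro: linearI)
  then show ?thesis by (intro form_extI) (simp add: form_apply_twist assms map_idI)
qed

lemma tendsto_scaleC: "(f \<longlongrightarrow> l) F \<Longrightarrow> ((\<lambda>x. c *\<^sub>C f x) \<longlongrightarrow> c *\<^sub>C l) F"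
  for l :: "'a::complex_normed_vector"
  by (rule bounded_linear.tendsto[OF bounded_linear_scaleC])

text \<open>The operators are required to converge together with their arguments, not in norm,
  because this is what \<open>tendsto_U\<close> and \<open>tendsto_iU\<close> provide.\<close>

lemma tendsto_form_twist:
  fixes f :: "'i \<Rightarrow> ('v::euclidean_space, 'h::complex_normed_vector) form"
  assumes F: "(f \<longlongrightarrow> f0) net" and A: "\<And>u. ((\<lambda>x. A x u) \<longlongrightarrow> A0 u) net"
    and U: "\<And>h h0. (h \<longlongrightarrow> h0) net \<Longrightarrow> ((\<lambda>x. U x (h x)) \<longlongrightarrow> U0 h0) net"
    and lin: "\<forall>\<^sub>F x in net. linear (U x) \<and> linear (A x)" "linear U0" "linear A0"
  shows "((\<lambda>x. form_twist \<mu> (U x) (A x) (f x)) \<longlongrightarrow> form_twist \<mu> U0 A0 f0) net"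
proof (rule tendsto_form)
  fix bs :: "'v list"
  have "((\<lambda>x. \<mu> (length bs) *\<^sub>C U x (form_apply (f x) (map (A x) bs))) \<longlongrightarrow>
    \<mu> (length bs) *\<^sub>C U0 (form_apply f0 (map A0 bs))) net"
    by (intro tendsto_scaleC U tendsto_form_apply F A)
  moreover have "\<forall>\<^sub>F x in net. \<mu> (length bs) *\<^sub>C U x (form_apply (f x) (map (A x) bs))
    = form_apply (form_twist \<mu> (U x) (A x) (f x)) bs"
    using lin(1) by eventually_elim (simp add: form_apply_twist)
  ultimately show "((\<lambda>x. form_apply (form_twist \<mu> (U x) (A x) (f x)) bs) \<longlongrightarrow> form_apply (form_twist \<mu> U0 A0 f0) bs) net"
    unfolding form_apply_twist[OF lin(2,3)] by (rule Lim_transform_eventually)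
qed

lemma smooth_on_list_coeff:
  assumes "open S" "\<And>u w. smooth_on S (\<lambda>x. c x u w)"
  shows "smooth_on S (\<lambda>x. list_coeff (c x) us ws)"
proof -
  have "smooth_on S (\<lambda>x. prod_list (map (\<lambda>(u, w). c x u w) (zip us ws)))"
    by (rule smooth_on_prod_list) (use assms in auto)
  then show ?thesis by (simp add: list_coeff_def)
qed

lemma open_Times_UNIV: "open S \<Longrightarrow> open (S \<times> UNIV)"
  by (simp add: open_Times)

lemma smooth_on_fst: "smooth_on S f \<Longrightarrow> smooth_on (S \<times> UNIV) (\<lambda>z. f (fst z))"
  by (rule smooth_on_precompose_linear[OF bounded_linear_fst]) (auto intro: open_Times_UNIV dest: smooth_on_open)

text \<open>The parameter enters through coefficients of the pullback and the form enters linearly.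
  The operator on values is the identity, as it is in transition functions once the Kuiper operators
  have cancelled.\<close>

lemma smooth_on_form_twist:
  fixes A :: "'i::real_normed_vector \<Rightarrow> 'v::euclidean_space \<Rightarrow> 'v"
  assumes A: "\<And>u. smooth_on S (\<lambda>x. A x u)" and lin: "\<And>x. x \<in> S \<Longrightarrow> linear (A x)"
  shows "smooth_on (S \<times> UNIV) (\<lambda>(x, b). form_twist \<nu> id (A x) (b :: ('v, 'h::complex_normed_vector) form))"
proof (rule smooth_on_form)
  have S: "open S" using A by (rule smooth_on_open)
  then show oS: "open (S \<times> (UNIV :: ('v, 'h) form set))" by (rule open_Times_UNIV)
  fix vs :: "'v list"
  let ?f = "\<lambda>z. \<nu> (length vs) *\<^sub>C (\<Sum>bs\<in>lists_of Basis (length vs).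
    list_coeff (\<lambda>u. (\<bullet>) (A (fst z) u)) vs bs *\<^sub>R form_apply (snd z :: ('v, 'h) form) bs)"
  have "smooth_on (S \<times> UNIV) ?f"
  proof (intro smooth_on_compose_linear[OF bounded_linear_scaleC] smooth_on_sum smooth_on_scaleR oS)
    fix bs
    have "smooth_on S (\<lambda>x. list_coeff (\<lambda>u. (\<bullet>) (A x u)) vs bs)"
      by (intro smooth_on_list_coeff S smooth_on_compose_linear[OF bounded_linear_inner_left A])
    then show "smooth_on (S \<times> UNIV) (\<lambda>z. list_coeff (\<lambda>u. (\<bullet>) (A (fst z) u)) vs bs)"
      by (rule smooth_on_fst)
    show "smooth_on (S \<times> UNIV) (\<lambda>z. form_apply (snd z :: ('v, 'h) form) bs)"
      by (rule smooth_on_linear[OF bounded_linear_compose[OF bounded_linear_form_apply bounded_linear_snd] oS])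
  qed
  then show "smooth_on (S \<times> UNIV) (\<lambda>z. form_apply (case z of (x, b) \<Rightarrow> form_twist \<nu> id (A x) (b :: ('v, 'h) form)) vs)"
  proof (rule smooth_on_cong)
    fix z :: "'i \<times> ('v, 'h) form" assume "z \<in> S \<times> UNIV"
    then have l: "linear (A (fst z))" using lin by auto
    have "form_apply (snd z) (map (A (fst z)) vs) = (\<Sum>bs\<in>lists_of Basis (length vs).
      list_coeff (\<lambda>u. (\<bullet>) (A (fst z) u)) vs bs *\<^sub>R form_apply (snd z) bs)"
      by (subst form_expand) (simp add: list_coeff_map)
    then show "?f z = form_apply (case z of (x, b) \<Rightarrow> form_twist \<nu> id (A x) b) vs"
      by (simp add: split_beta form_apply_twist linear_id l)
  qed
qed

context kuiper_bundle
begin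

abbreviation "E \<equiv> assoc_topology R F.cls"
abbreviation "p \<equiv> \<lambda>h :: ('p \<times> ('v, 'x cdual) form) set. \<pi>P (class_rep h)"
abbreviation "A c q v \<equiv> Lam q v c"
abbreviation "B c q u \<equiv> inv_into UNIV (Lam q) (coord_vec MA c (\<pi>P q) u)"
abbreviation "chart_map c \<mu> \<equiv> induced_chart MA sw \<pi>P ract Lam KJ c \<mu>"
abbreviation "act \<equiv> reduced_act g lam sw \<pi>P ract KJ"
abbreviation "ip \<equiv> reduced_prod g sw \<pi>P ract KJ"

section \<open>Charts and operations evaluated on representatives\<close>

lemma reduced_class_eq: "reduced_class g lam sw ract = F.cls"
  by (simp add: fun_eq_iff reduced_class_def)

lemma chart_map_eq:
  "chart_map c \<mu> x = form_twist \<mu> (U (class_rep x)) (B c (class_rep x)) (class_coord (class_rep x) x)"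
  by (simp add: induced_chart_def form_twist_def U_def Let_def)

lemma topspace_E: "x \<in> topspace E \<longleftrightarrow> (\<exists>q\<in>R. \<exists>f. x = F.cls (q, f))"
  unfolding topspace_assoc_topology by auto

lemma rep_cls:
  assumes "q \<in> R"
  obtains h where "h \<in> Kt" "class_rep (F.cls (q, f)) = ract q (- h)" "ract q (- h) \<in> R"
    "class_coord (ract q (- h)) (F.cls (q, f)) = form_rep lam sw h f"
proof -
  obtain h where h: "h \<in> Kt" "class_rep (F.cls (q, f)) = ract q (- h)" using F.class_rep_cls by blast
  have "class_coord (ract q (- h)) (F.cls (ract q (- h), form_rep lam sw h f)) = form_rep lam sw h f" by simp
  then show ?thesis
    using that h R_ract_Kt[OF assms] Kt_group(3) by (simp add: F.cls_translate)
qed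

lemma p_cls [simp]: "q \<in> R \<Longrightarrow> p (F.cls (q, f)) = \<pi>P q"
  using rep_cls[of q f] by (metis ract(3))

lemma rep_in: "x \<in> topspace E \<Longrightarrow> class_rep x \<in> R"
  unfolding topspace_E using rep_cls by metis

text \<open>Two reduced frames over the same point differ by an element of \<open>Kt\<close>, so a
  point of the reduced bundle has a coordinate in every reduced frame over its base point.\<close>

lemma cls_at:
  assumes x: "x \<in> topspace E" and q: "q \<in> R" "\<pi>P q = p x"
  shows "x = F.cls (q, class_coord q x)"
proof -
  obtain r f where r: "r \<in> R" "x = F.cls (r, f)" using x unfolding topspace_E by blast
  obtain h where h: "q = ract r h" using ex_ract[of r q] q r by auto
  then have "- h \<in> Kt" using R_ract_Kt[OF r(1)] q(1) Kt_group(3) by blast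
  from F.cls_translate[OF this, of r f] have "x = F.cls (q, form_rep lam sw (- h) f)" by (simp add: h r)
  then show ?thesis by simp
qed

lemma cls_in: "q \<in> R \<Longrightarrow> F.cls (q, f) \<in> topspace E"
  unfolding topspace_E by blast

lemma linear_A: "linear (A c q)"
  by (rule linear_frame_coord[OF frame])

context
  fixes c assumes c: "c \<in> MA"
begin

lemma linear_B: "\<pi>P q \<in> fst c \<Longrightarrow> linear (B c q)"
  by (rule inv_frame_coord(3)[OF frame c])

lemma A_B: "\<pi>P q \<in> fst c \<Longrightarrow> A c q (B c q u) = u"
  by (rule inv_frame_coord(1)[OF frame c])

lemma B_A: "\<pi>P q \<in> fst c \<Longrightarrow> B c q (A c q u) = u"
  by (rule inv_frame_coord(2)[OF frame c])

text \<open>Passing to the chosen representative changes the inverse frame by \<open>lam h\<close>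
  and the Kuiper operator by \<open>dual_rep sw h\<close>. Both changes cancel against
  \<open>form_rep lam sw h\<close> in the coordinate.\<close>

lemma chart_map_cls:
  assumes q: "q \<in> R" "\<pi>P q \<in> fst c"
  shows "chart_map c \<mu> (F.cls (q, f)) = form_twist \<mu> (U q) (B c q) f"
proof -
  obtain h where h: "h \<in> Kt" "class_rep (F.cls (q, f)) = ract q (- h)"
    "class_coord (ract q (- h)) (F.cls (q, f)) = form_rep lam sw h f"
    using rep_cls[OF q(1)] by metis
  have q': "\<pi>P (ract q (- h)) \<in> fst c" using q(2) by (simp add: ract)
  have "B c (ract q (- h)) u = lam h (B c q u)" for u
  proof -
    have "Lam (ract q (- h)) (lam h (B c q u)) = Lam q (B c q u)"
      by (simp add: Lam_ract lam_minus)
    also have "\<dots> = coord_vec MA c (\<pi>P q) u"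
      by (rule frame_inv(1)[OF frame coord_vec_in[OF c q(2)]])
    finally have "B c (ract q (- h)) u = inv_into UNIV (Lam (ract q (- h))) (Lam (ract q (- h)) (lam h (B c q u)))"
      by (simp add: ract)
    then show ?thesis by (simp only: frame_inv(2)[OF frame])
  qed
  then have B: "map (\<lambda>u. lam (- h) (B c (ract q (- h)) u)) vs = map (B c q) vs" for vs
    by (simp add: lam_minus)
  show ?thesis
  proof (rule form_extI)
    fix vs
    show "form_apply (chart_map c \<mu> (F.cls (q, f))) vs = form_apply (form_twist \<mu> (U q) (B c q) f) vs"
      unfolding chart_map_eq h(2,3) form_apply_twist[OF linear_U linear_B[OF q(2)]]
        form_apply_twist[OF linear_U linear_B[OF q']] form_apply_rep map_map o_def B U_translate ..
  qed
qed

definition fib where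
  "fib \<mu> q b = F.cls (q, form_twist (\<lambda>k. inverse (\<mu> k)) (iU q) (A c q) b)"

lemma fib_in: "q \<in> R \<Longrightarrow> fib \<mu> q b \<in> topspace E" "q \<in> R \<Longrightarrow> p (fib \<mu> q b) = \<pi>P q"
  by (auto simp: fib_def cls_in)

lemma twist_inverse:
  assumes \<mu>: "\<And>k. \<mu> k \<noteq> 0" and q: "\<pi>P q \<in> fst c"
  shows "form_twist \<mu> (U q) (B c q) (form_twist (\<lambda>k. inverse (\<mu> k)) (iU q) (A c q) b) = b"
    "form_twist (\<lambda>k. inverse (\<mu> k)) (iU q) (A c q) (form_twist \<mu> (U q) (B c q) b) = b"
  using form_twist_twist[OF linear_U linear_B[OF q] clinear_linear[OF clinear_iU] linear_A clinear_U]
    form_twist_twist[OF clinear_linear[OF clinear_iU] linear_A linear_U linear_B[OF q] clinear_iU]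
  by (simp_all add: form_twist_id \<mu> A_B[OF q] B_A[OF q])

lemma chart_map_fib:
  assumes "\<And>k. \<mu> k \<noteq> 0" "q \<in> R" "\<pi>P q \<in> fst c"
  shows "chart_map c \<mu> (fib \<mu> q b) = b"
  unfolding fib_def chart_map_cls[OF assms(2,3)] by (rule twist_inverse(1)[OF assms(1,3)])

lemma fib_chart_map:
  assumes "\<And>k. \<mu> k \<noteq> 0" "x \<in> topspace E" "q \<in> R" "\<pi>P q = p x" "p x \<in> fst c"
  shows "fib \<mu> q (chart_map c \<mu> x) = x"
proof -
  have x: "x = F.cls (q, class_coord q x)" by (rule cls_at[OF assms(2-4)])
  have q: "\<pi>P q \<in> fst c" using assms(4,5) by simp
  have "chart_map c \<mu> x = form_twist \<mu> (U q) (B c q) (class_coord q x)"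
    by (subst x) (rule chart_map_cls[OF assms(3) q])
  then have "fib \<mu> q (chart_map c \<mu> x) = F.cls (q, class_coord q x)"
    by (simp add: fib_def twist_inverse(2)[OF assms(1) q])
  then show ?thesis by (simp flip: x)
qed

lemma fibre_inv_eq:
  assumes "\<And>k. \<mu> k \<noteq> 0" "q \<in> R" "\<pi>P q \<in> fst c"
  shows "fibre_inv E p (chart_map c \<mu>) (\<pi>P q) b = fib \<mu> q b"
  unfolding fibre_inv_def
proof (rule the_equality)
  fix x assume "x \<in> topspace E \<and> p x = \<pi>P q \<and> chart_map c \<mu> x = b"
  then show "x = fib \<mu> q b" using fib_chart_map[of \<mu> x q] assms by auto
qed (use fib_in chart_map_fib assms in auto)

lemma chart_map_rep:
  assumes "x \<in> topspace E" "q \<in> R" "\<pi>P q = p x" "p x \<in> fst c"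
  shows "chart_map c \<mu> x = form_twist \<mu> (U q) (B c q) (class_coord q x)"
  by (subst cls_at[OF assms(1-3)]) (rule chart_map_cls, use assms in auto)

lemma add_chart:
  assumes "x \<in> topspace E" "y \<in> topspace E" "p y = p x"
  shows "assoc_add F.cls x y \<in> topspace E" "p (assoc_add F.cls x y) = p x"
    "p x \<in> fst c \<Longrightarrow> chart_map c \<mu> (assoc_add F.cls x y) = chart_map c \<mu> x + chart_map c \<mu> y"
proof -
  let ?q = "class_rep x"
  have q: "?q \<in> R" by (rule rep_in[OF assms(1)])
  have e: "assoc_add F.cls x y = F.cls (?q, class_coord ?q x + class_coord ?q y)"
    by (simp add: assoc_add_def Let_def)
  show "assoc_add F.cls x y \<in> topspace E" "p (assoc_add F.cls x y) = p x"
    unfolding e using q by (auto simp: cls_in)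
  assume m: "p x \<in> fst c"
  show "chart_map c \<mu> (assoc_add F.cls x y) = chart_map c \<mu> x + chart_map c \<mu> y"
    unfolding e chart_map_cls[OF q m]
    using chart_map_rep[OF assms(1) q refl m] chart_map_rep[OF assms(2) q, unfolded assms(3), OF refl m]
    by (simp add: clinearD[OF clinear_form_twist[OF clinear_U linear_B[OF m]]])
qed

lemma scale_chart:
  assumes "x \<in> topspace E"
  shows "assoc_scaleC F.cls a x \<in> topspace E" "p (assoc_scaleC F.cls a x) = p x"
    "p x \<in> fst c \<Longrightarrow> chart_map c \<mu> (assoc_scaleC F.cls a x) = a *\<^sub>C chart_map c \<mu> x"
proof -
  let ?q = "class_rep x"
  have q: "?q \<in> R" by (rule rep_in[OF assms(1)])
  have e: "assoc_scaleC F.cls a x = F.cls (?q, a *\<^sub>C class_coord ?q x)"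
    by (simp add: assoc_scaleC_def Let_def)
  show "assoc_scaleC F.cls a x \<in> topspace E" "p (assoc_scaleC F.cls a x) = p x"
    unfolding e using q by (auto simp: cls_in)
  assume m: "p x \<in> fst c"
  show "chart_map c \<mu> (assoc_scaleC F.cls a x) = a *\<^sub>C chart_map c \<mu> x"
    unfolding e chart_map_cls[OF q m]
    using chart_map_rep[OF assms(1) q refl m]
    by (simp add: clinearD[OF clinear_form_twist[OF clinear_U linear_B[OF m]]])
qed

lemma act_chart:
  assumes "x \<in> topspace E"
  shows "act x a \<in> topspace E" "p (act x a) = p x"
    "p x \<in> fst c \<Longrightarrow> chart_map c \<mu> (act x a) = form_act (chart_map c \<mu> x) a"
proof -
  let ?q = "class_rep x"
  have q: "?q \<in> R" by (rule rep_in[OF assms(1)])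
  have e: "act x a = F.cls (?q, form_act (class_coord ?q x) (cpt_conj (inv (cU ?q)) a))"
    by (simp add: reduced_act_def Let_def reduced_class_eq kuiper_CH_inv_coord)
  show "act x a \<in> topspace E" "p (act x a) = p x"
    unfolding e using q by (auto simp: cls_in)
  assume m: "p x \<in> fst c"
  have ii: "inv (inv (cU ?q)) = cU ?q" by (rule inv_inv_eq[OF unitary_op_bij[OF unitary_cU]])
  \<comment> \<open>The conjugation by \<open>inv (cU ?q)\<close> is exactly what carries right
    composition through the Kuiper operator; the result no longer depends on the frame.\<close>
  have U: "U ?q (dual_compose f (cpt_conj (inv (cU ?q)) a)) = dual_compose (U ?q f) a" for f
    by (rule ev_extI)
      (simp add: ev_U cpt_apply_conj[OF unitary_op_inv[OF unitary_cU]] ii unitary_op_inv_simps[OF unitary_cU])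
  have s: "z *\<^sub>C dual_compose f a = dual_compose (z *\<^sub>C f) a" for z and f :: "'x cdual"
    by (rule ev_extI) simp
  show "chart_map c \<mu> (act x a) = form_act (chart_map c \<mu> x) a"
    unfolding e chart_map_cls[OF q m] chart_map_rep[OF assms(1) q refl m]
    by (rule form_extI) (simp add: form_apply_twist linear_U linear_B[OF m] U s)
qed

end

text \<open>Conjugating a rank one operator applies the unitary operator to its vector and its
  functional. The Kuiper operators thus move inside the product, where those contained in the charts
  absorb them.\<close>

lemma conj_form_prod:
  "cpt_conj (cU q) (form_prod g f h) = form_prod g (form_twist (\<lambda>k. 1) (U q) id f) (form_twist (\<lambda>k. 1) (U q) id h)"
proof -
  note lc = clinear_cpt_conj[OF unitary_cU[of q]]
  have "cpt_conj (cU q) (rank_one (sharp f) h) = rank_one (sharp (U q f)) (U q h)" for f h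
    by (simp add: cpt_conj_rank_one[OF unitary_cU] U_eq)
  then show ?thesis
    by (simp add: form_prod_def clinear_sum[OF lc] clinearD[OF lc] form_apply_twist linear_U linear_id)
qed

text \<open>The inverse metric in coordinates. By invariance of the bivector the frame \<open>r\<close> need not be reduced,
  so that it may be taken from a smooth local section.\<close>

definition inverse_metric :: "('m, 'v) chart \<Rightarrow> 'p \<Rightarrow> 'v \<Rightarrow> 'v \<Rightarrow> real"
  where "inverse_metric c r u w = (\<Sum>e\<in>B\<^sub>0. - ((JM (\<pi>P r) (Lam r (J\<^sub>0 e)) c \<bullet> u) * (A c r e \<bullet> w)))"

text \<open>Since \<open>q\<close> is the translate of \<open>r\<close> by \<open>h\<close> and is
  reduced, \<open>JP r (lam h (J\<^sub>0 e))\<close> is \<open>- lam h e\<close>. Hence the left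
  side is the sum of \<open>\<gamma>\<close> over the bivector transformed by \<open>lam h\<close>,
  and invariance removes \<open>h\<close>.\<close>

lemma inverse_metric:
  assumes q: "q \<in> R" "\<pi>P r = \<pi>P q"
  shows "(\<Sum>e\<in>B\<^sub>0. (A c q e \<bullet> u) * (A c q e \<bullet> w)) = inverse_metric c r u w"
proof -
  obtain h where h: "q = ract r h" using ex_ract[OF q(2)] by blast
  define \<gamma> where "\<gamma> x y = - ((A c r (JP r x) \<bullet> u) * (A c r y \<bullet> w))" for x y
  have JPl: "linear (JP r)" using JP_structure by (simp add: linear_complex_structure_def)
  have "bilinear \<gamma>"
    unfolding bilinear_def \<gamma>_def
    by (auto intro!: linearI simp: linear_add[OF JPl] linear_scale[OF JPl] linear_add[OF linear_A] linear_scale[OF linear_A]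
        inner_add_left algebra_simps)
  from sum_Sp_invariant[OF lam_in[of h] this]
  have "(\<Sum>e\<in>B\<^sub>0. \<gamma> (lam h (J\<^sub>0 e)) (lam h e)) = (\<Sum>e\<in>B\<^sub>0. \<gamma> (J\<^sub>0 e) e)" .
  moreover have "\<gamma> (lam h (J\<^sub>0 e)) (lam h e) = (A c q e \<bullet> u) * (A c q e \<bullet> w)" for e
  proof -
    have "JP r (lam h (J\<^sub>0 e)) = lam h (J\<^sub>0 (J\<^sub>0 e))" using q(1) by (simp add: h R_ract)
    also have "\<dots> = - lam h e" by (simp add: J blinfun.minus_right)
    finally show ?thesis by (simp add: \<gamma>_def h Lam_ract linear_neg[OF linear_A])
  qed
  ultimately show ?thesis by (simp add: inverse_metric_def \<gamma>_def Lam_JP)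
qed

lemma ip_chart:
  assumes c: "c \<in> MA" and \<mu>: "\<And>k. \<mu> k \<noteq> 0" and x: "x \<in> topspace E" "y \<in> topspace E" "p y = p x" "p x \<in> fst c"
    and r: "\<pi>P r = p x"
  shows "ip x y = (\<Sum>k\<le>DIM('v). \<Sum>bs\<in>lists_of Basis k. \<Sum>cs\<in>lists_of Basis k.
      ((cmod (inverse (\<mu> k)))\<^sup>2 / fact k * list_coeff (inverse_metric c r) bs cs) *\<^sub>R
        rank_one (sharp (form_apply (chart_map c \<mu> x) bs)) (form_apply (chart_map c \<mu> y) cs))"
proof -
  let ?q = "class_rep x" let ?\<nu> = "\<lambda>k. inverse (\<mu> k)"
  have q: "?q \<in> R" by (rule rep_in[OF x(1)])
  \<comment> \<open>Undoing the scalars and the coordinate pullback of the chart leaves the Kuiper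
    operator alone.\<close>
  have t: "form_twist ?\<nu> id (A c ?q) (form_twist \<mu> (U ?q) (B c ?q) f) = form_twist (\<lambda>k. 1) (U ?q) id f" for f
  proof -
    have "(\<lambda>v. B c ?q (A c ?q v)) = id" using B_A[OF c x(4)] by (simp add: fun_eq_iff)
    then show ?thesis
      using form_twist_twist[OF linear_id linear_A linear_U linear_B[OF c x(4)], where \<mu> = ?\<nu> and \<mu>' = \<mu>] \<mu>
      by (simp add: clinear_def o_def)
  qed
  have "ip x y = cpt_conj (cU ?q) (form_prod g (class_coord ?q x) (class_coord ?q y))"
    by (simp add: reduced_prod_def Let_def kuiper_CH)
  also have "\<dots> = form_prod g (form_twist ?\<nu> id (A c ?q) (chart_map c \<mu> x)) (form_twist ?\<nu> id (A c ?q) (chart_map c \<mu> y))"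
    unfolding conj_form_prod chart_map_rep[OF c x(1) q refl x(4)]
      chart_map_rep[OF c x(2) q, unfolded x(3), OF refl x(4)] t ..
  also have "\<dots> = (\<Sum>k\<le>DIM('v). \<Sum>bs\<in>lists_of Basis k. \<Sum>cs\<in>lists_of Basis k.
      ((cmod (inverse (\<mu> k)))\<^sup>2 / fact k * list_coeff (inverse_metric c r) bs cs) *\<^sub>R
        rank_one (sharp (form_apply (chart_map c \<mu> x) bs)) (form_apply (chart_map c \<mu> y) cs))"
    unfolding form_prod_twist[OF linear_A] inverse_metric[OF q r] ..
  finally show ?thesis .
qed

lemma hilbert_fibre:
  "hilbert_CH_module {x \<in> topspace E. p x = m} (assoc_add F.cls) (assoc_scaleC F.cls) act ip"
proof -
  obtain e :: "nat \<Rightarrow> 'x" where e: "\<And>i j. cinner (e i) (e j) = (if i = j then 1 else 0)"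
    using orthonormal by blast
  obtain c where c: "c \<in> MA" "m \<in> fst c" using ex_chart by blast
  obtain q where q: "q \<in> R" "\<pi>P q = m" using ex_R by blast
  let ?\<mu> = "\<lambda>k::nat. 1::complex"
  have qc: "\<pi>P q \<in> fst c" using q c by simp
  \<comment> \<open>The coordinate frame need not be orthonormal, so the chart alone does not turn
    \<open>ip\<close> into \<open>form_prod g\<close>. Pulling back along the reduced frame
    \<open>q\<close> does, and it commutes with the action.\<close>
  define T where "T = (form_twist ?\<mu> id (A c q) :: ('v, 'x cdual) form \<Rightarrow> _)"
  define T' where "T' = (form_twist ?\<mu> id (B c q) :: ('v, 'x cdual) form \<Rightarrow> _)"
  have idl: "clinear (id :: 'x cdual \<Rightarrow> _)" by (simp add: clinear_def)
  have T: "T (T' f) = f" "T' (T f) = f" for f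
    unfolding T_def T'_def
    using form_twist_twist[OF linear_id linear_A linear_id linear_B[OF c(1) qc] idl]
      form_twist_twist[OF linear_id linear_B[OF c(1) qc] linear_id linear_A idl]
    by (simp_all add: form_twist_id A_B[OF c(1) qc] B_A[OF c(1) qc])
  have Tl: "clinear T" unfolding T_def by (rule clinear_form_twist[OF idl linear_A])
  have Ta: "T (form_act f a) = form_act (T f) a" for f a
    by (rule form_extI) (simp add: T_def form_apply_twist linear_A linear_id)
  let ?E = "{x \<in> topspace E. p x = m}"
  let ?\<Psi> = "\<lambda>x. T (chart_map c ?\<mu> x)"
  show ?thesis
  proof (rule hilbert_CH_module_transport[OF hilbert_CH_module_form[OF e], where \<Psi> = ?\<Psi>])
    show "bij_betw ?\<Psi> ?E UNIV"
    proof (rule bij_betw_byWitness[where f' = "\<lambda>b. fib c ?\<mu> q (T' b)"])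
      show "\<forall>x\<in>?E. fib c ?\<mu> q (T' (?\<Psi> x)) = x"
        using fib_chart_map[OF c(1), of ?\<mu>] q c by (auto simp: T)
      show "\<forall>b\<in>UNIV. ?\<Psi> (fib c ?\<mu> q (T' b)) = b"
        using chart_map_fib[OF c(1), of ?\<mu>] q qc by (auto simp: T)
      show "(\<lambda>b. fib c ?\<mu> q (T' b)) ` UNIV \<subseteq> ?E" using fib_in[OF c(1)] q by auto
    qed simp
    fix x y a b assume "x \<in> ?E"
    then have x: "x \<in> topspace E" "p x = m" "p x \<in> fst c" using c by auto
    show "assoc_scaleC F.cls b x \<in> ?E \<and> ?\<Psi> (assoc_scaleC F.cls b x) = b *\<^sub>C ?\<Psi> x"
      using scale_chart[OF c(1) x(1)] x by (simp add: clinearD[OF Tl])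
    show "act x a \<in> ?E \<and> ?\<Psi> (act x a) = form_act (?\<Psi> x) a"
      using act_chart[OF c(1) x(1)] x by (simp add: Ta)
    assume "y \<in> ?E"
    then have y: "y \<in> topspace E" "p y = m" "p y \<in> fst c" using c by auto
    have yx: "p y = p x" using x y by simp
    show "assoc_add F.cls x y \<in> ?E \<and> ?\<Psi> (assoc_add F.cls x y) = ?\<Psi> x + ?\<Psi> y"
      using add_chart[OF c(1) x(1) y(1) yx] x by (simp add: clinearD[OF Tl])
    have "form_prod g (?\<Psi> x) (?\<Psi> y) = (\<Sum>k\<le>DIM('v). \<Sum>bs\<in>lists_of Basis k. \<Sum>cs\<in>lists_of Basis k.
      ((cmod (inverse 1))\<^sup>2 / fact k * list_coeff (inverse_metric c q) bs cs) *\<^sub>R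
        rank_one (sharp (form_apply (chart_map c ?\<mu> x) bs)) (form_apply (chart_map c ?\<mu> y) cs))"
      unfolding T_def form_prod_twist[OF linear_A] inverse_metric[OF q(1) refl] by simp
    also have "\<dots> = ip x y"
      using ip_chart[OF c(1) _ x(1) y(1) yx x(3), of ?\<mu> q] q x by simp
    finally show "ip x y = form_prod g (?\<Psi> x) (?\<Psi> y)" by (rule sym)
  qed
qed

subsection \<open>Topology of the reduced bundle\<close>

lemma open_if_eventually: "(\<And>x. x \<in> S \<Longrightarrow> \<forall>\<^sub>F y in nhds x. y \<in> S) \<Longrightarrow> open S"
proof (subst open_subopen, intro ballI)
  fix x assume *: "\<And>x. x \<in> S \<Longrightarrow> \<forall>\<^sub>F y in nhds x. y \<in> S" "x \<in> S"
  from *(1)[OF *(2)] obtain T where "open T" "x \<in> T" "\<forall>y\<in>T. y \<in> S" unfolding eventually_nhds by auto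
  then show "\<exists>T. open T \<and> x \<in> T \<and> T \<subseteq> S" by (intro exI[of _ T]) auto
qed

lemma openin_E_vimage:
  assumes "\<And>q f. q \<in> R \<Longrightarrow> P (F.cls (q, f)) \<longleftrightarrow> Q (q, f)" "open {z. Q z}"
  shows "openin E {x \<in> topspace E. P x}"
  unfolding openin_assoc_topology
proof
  show "{x \<in> topspace E. P x} \<subseteq> F.cls ` (R \<times> UNIV)" by (auto simp: topspace_assoc_topology)
  have "{z \<in> R \<times> UNIV. F.cls z \<in> {x \<in> topspace E. P x}} = R \<times> UNIV \<inter> {z. Q z}"
    using assms(1) cls_in by auto
  then show "openin (top_of_set (R \<times> UNIV)) {z \<in> R \<times> UNIV. F.cls z \<in> {x \<in> topspace E. P x}}"
    using assms(2) by (simp add: openin_open_Int)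
qed

lemma eventually_\<pi>P_fst:
  assumes "open V" "\<pi>P (fst z) \<in> V"
  shows "\<forall>\<^sub>F z in nhds z. \<pi>P (fst z) \<in> V"
proof -
  have "((\<lambda>z. \<pi>P (fst z)) \<longlongrightarrow> \<pi>P (fst z)) (nhds z)"
    by (rule filterlim_compose[OF tendsto_\<pi>P tendsto_fst[OF filterlim_ident]])
  from topological_tendstoD[OF this assms] show ?thesis .
qed

lemma tendsto_fst_nhds: "(fst \<longlongrightarrow> fst z) (nhds z)" and tendsto_snd_nhds: "(snd \<longlongrightarrow> snd z) (nhds z)"
  using tendsto_fst[OF filterlim_ident, of z] tendsto_snd[OF filterlim_ident, of z] by simp_all

lemma continuous_p: "continuous_map E euclidean p"
  unfolding continuous_map_def
proof (intro conjI allI impI)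
  fix V :: "'m set" assume "openin euclidean V"
  then have V: "open V" by simp
  have "open {z :: 'p \<times> ('v, 'x cdual) form. \<pi>P (fst z) \<in> V}"
    by (rule open_if_eventually) (use eventually_\<pi>P_fst[OF V] in simp)
  then show "openin E {x \<in> topspace E. p x \<in> V}"
    by (rule openin_E_vimage[rotated]) simp
qed auto

context
  fixes c :: "('m, 'v) chart" and V and \<mu> :: "nat \<Rightarrow> complex"
  assumes c: "c \<in> MA" and V: "open V" "V \<subseteq> fst c" and \<mu>: "\<And>k::nat. \<mu> k \<noteq> 0"
begin

lemma tendsto_chart_twist:
  assumes "\<pi>P (fst z) \<in> fst c"
  shows "((\<lambda>(q, f). form_twist \<mu> (U q) (B c q) f) \<longlongrightarrow> form_twist \<mu> (U (fst z)) (B c (fst z)) (snd z)) (nhds z)"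
  unfolding split_beta
proof (rule tendsto_form_twist)
  show "((\<lambda>x. B c (fst x) u) \<longlongrightarrow> B c (fst z) u) (nhds z)" for u
    by (rule filterlim_compose[OF tendsto_inv_frame[OF c assms] tendsto_fst_nhds])
  show "\<forall>\<^sub>F x in nhds z. linear (U (fst x)) \<and> linear (B c (fst x))"
    using eventually_\<pi>P_fst[OF chart(1)[OF c] assms] by eventually_elim (simp add: linear_U linear_B[OF c])
  show "((\<lambda>x. U (fst x) (h x)) \<longlongrightarrow> U (fst z) h0) (nhds z)" if "(h \<longlongrightarrow> h0) (nhds z)" for h h0
    by (rule tendsto_U[OF tendsto_fst_nhds that])
qed (rule tendsto_snd_nhds linear_U linear_B[OF c assms])+

lemma tendsto_fib_twist:
  assumes "\<pi>P (fst z) \<in> fst c"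
  shows "((\<lambda>(q, b). (q, form_twist (\<lambda>k. inverse (\<mu> k)) (iU q) (A c q) b)) \<longlongrightarrow>
    (fst z, form_twist (\<lambda>k. inverse (\<mu> k)) (iU (fst z)) (A c (fst z)) (snd z))) (nhds z)"
  unfolding split_beta
proof (rule tendsto_Pair[OF tendsto_fst_nhds tendsto_form_twist])
  show "((\<lambda>x. A c (fst x) u) \<longlongrightarrow> A c (fst z) u) (nhds z)" for u
    by (rule filterlim_compose[OF tendsto_Lam[OF c assms] tendsto_fst_nhds])
  show "((\<lambda>x. iU (fst x) (h x)) \<longlongrightarrow> iU (fst z) h0) (nhds z)" if "(h \<longlongrightarrow> h0) (nhds z)" for h h0
    by (rule tendsto_iU[OF tendsto_fst_nhds that])
  show "\<forall>\<^sub>F x in nhds z. linear (iU (fst x)) \<and> linear (A c (fst x))"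
    by (intro always_eventually allI conjI clinear_linear[OF clinear_iU] linear_A)
qed (rule tendsto_snd_nhds clinear_linear[OF clinear_iU] linear_A)+

lemma homeomorphic_chart:
  "homeomorphic_map (subtopology E {x. p x \<in> V}) (prod_topology (top_of_set V) euclidean)
    (\<lambda>x. (p x, chart_map c \<mu> x))"
proof -
  let ?X = "subtopology E {x. p x \<in> V}" let ?f = "\<lambda>x. (p x, chart_map c \<mu> x)"
  have top: "topspace ?X = {x \<in> topspace E. p x \<in> V}" by auto
  have oX: "openin E {x \<in> topspace E. p x \<in> V}"
    using continuous_p V(1) by (simp add: continuous_map_def)
  have "continuous_map ?X euclidean (chart_map c \<mu>)"
    unfolding continuous_map_def
  proof (intro conjI allI impI)
    fix W :: "('v, 'x cdual) form set" assume "openin euclidean W"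
    then have W: "open W" by simp
    let ?t = "\<lambda>(q, f). form_twist \<mu> (U q) (B c q) f"
    have "open {z. \<pi>P (fst z) \<in> V \<and> ?t z \<in> W}"
    proof (rule open_if_eventually, clarify)
      fix q f assume z: "\<pi>P (fst (q, f)) \<in> V" "form_twist \<mu> (U q) (B c q) f \<in> W"
      then have "\<pi>P (fst (q, f)) \<in> fst c" using V(2) by auto
      from topological_tendstoD[OF tendsto_chart_twist[OF this] W] z
      have "\<forall>\<^sub>F y in nhds (q, f). ?t y \<in> W" by simp
      with eventually_\<pi>P_fst[OF V(1) z(1)]
      show "\<forall>\<^sub>F y in nhds (q, f). y \<in> {z. \<pi>P (fst z) \<in> V \<and> ?t z \<in> W}"
        by eventually_elim simp
    qed
    then have "openin E {x \<in> topspace E. p x \<in> V \<and> chart_map c \<mu> x \<in> W}"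
    proof (rule openin_E_vimage[rotated])
      show "p (F.cls (q, f)) \<in> V \<and> chart_map c \<mu> (F.cls (q, f)) \<in> W \<longleftrightarrow> \<pi>P (fst (q, f)) \<in> V \<and> ?t (q, f) \<in> W"
        if "q \<in> R" for q f
        using that V(2) chart_map_cls[OF c that] by auto
    qed
    then have "openin ?X ({x \<in> topspace E. p x \<in> V \<and> chart_map c \<mu> x \<in> W} \<inter> {x. p x \<in> V})"
      by (rule openin_subtopology_Int)
    moreover have "{x \<in> topspace E. p x \<in> V \<and> chart_map c \<mu> x \<in> W} \<inter> {x. p x \<in> V}
      = {x \<in> topspace ?X. chart_map c \<mu> x \<in> W}" by auto
    ultimately show "openin ?X {x \<in> topspace ?X. chart_map c \<mu> x \<in> W}" by simp
  qed auto
  moreover have "continuous_map ?X (top_of_set V) p"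
    using continuous_p by (auto simp: continuous_map_in_subtopology continuous_map_from_subtopology)
  ultimately have cont: "continuous_map ?X (prod_topology (top_of_set V) euclidean) ?f"
    by (simp add: continuous_map_paired)
  \<comment> \<open>The inverse chart is continuous in the frame and the form together, but the
    frame must stay in the reduced bundle. \<open>R_open_projection\<close> supplies reduced frames
    near \<open>q0\<close> over every point near its base point.\<close>
  have open_map: "open_map ?X (prod_topology (top_of_set V) euclidean) ?f"
    unfolding open_map_def openin_prod_topology_alt
  proof (intro allI impI)
    fix W m0 b0 assume W: "openin ?X W" and mb: "(m0, b0) \<in> ?f ` W"
    have WE: "openin E W"
    proof -
      obtain W' where "openin E W'" "W = W' \<inter> {x. p x \<in> V}" using W by (auto simp: openin_subtopology)
      then have "W = W' \<inter> {x \<in> topspace E. p x \<in> V}" using openin_subset by blast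
      then show ?thesis using openin_Int[OF \<open>openin E W'\<close> oX] by simp
    qed
    obtain x0 where x0: "x0 \<in> W" "p x0 = m0" "chart_map c \<mu> x0 = b0" using mb by auto
    then have x0': "x0 \<in> topspace E" "p x0 \<in> V" "p x0 \<in> fst c" using openin_subset[OF W] top V(2) by auto
    define q0 where "q0 = class_rep x0"
    have q0: "q0 \<in> R" "\<pi>P q0 = p x0" by (auto simp: q0_def rep_in[OF x0'(1)])
    let ?t = "\<lambda>(q, b). (q, form_twist (\<lambda>k. inverse (\<mu> k)) (iU q) (A c q) b)"
    have fx: "F.cls (?t (q0, b0)) = x0"
      using fib_chart_map[OF c, where \<mu> = \<mu>, OF \<mu> x0'(1) q0 x0'(3)] by (simp add: fib_def[OF c] x0)
    obtain O' where O': "open O'" "{z \<in> R \<times> UNIV. F.cls z \<in> W} = R \<times> UNIV \<inter> O'"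
      using WE unfolding openin_assoc_topology openin_open by auto
    have "?t (q0, b0) \<in> {z \<in> R \<times> UNIV. F.cls z \<in> W}" using fx x0(1) q0(1) by simp
    then have "?t (q0, b0) \<in> O'" unfolding O'(2) by blast
    moreover have "\<pi>P (fst (q0, b0)) \<in> fst c" using q0 x0' by simp
    from tendsto_fib_twist[OF this] have "(?t \<longlongrightarrow> ?t (q0, b0)) (nhds (q0, b0))" by simp
    ultimately have "\<forall>\<^sub>F z in nhds (q0, b0). ?t z \<in> O'" using O'(1) by (auto dest: topological_tendstoD)
    then obtain S where S: "open S" "(q0, b0) \<in> S" "\<And>z. z \<in> S \<Longrightarrow> ?t z \<in> O'"
      unfolding eventually_nhds by blast
    obtain N G where NG: "open N" "open G" "q0 \<in> N" "b0 \<in> G" "N \<times> G \<subseteq> S"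
      using open_prod_elim[OF S(1,2)] by (metis mem_Sigma_iff)
    obtain M where M: "open M" "\<pi>P q0 \<in> M" "\<And>m. m \<in> M \<Longrightarrow> \<exists>q\<in>R \<inter> N. \<pi>P q = m"
      using R_open_projection[OF q0(1) NG(1,3)] by blast
    show "\<exists>M G. openin (top_of_set V) M \<and> openin euclidean G \<and> m0 \<in> M \<and> b0 \<in> G \<and> M \<times> G \<subseteq> ?f ` W"
    proof (intro exI conjI)
      show "openin (top_of_set V) (V \<inter> M)" using M(1) by (rule openin_open_Int)
      show "openin euclidean G" using NG by simp
      show "m0 \<in> V \<inter> M" using M(2) q0 x0 x0' by simp
      show "b0 \<in> G" by fact
      show "(V \<inter> M) \<times> G \<subseteq> ?f ` W"
      proof clarify
        fix m b assume m: "m \<in> V" "m \<in> M" and b: "b \<in> G"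
        obtain q where q: "q \<in> R" "q \<in> N" "\<pi>P q = m" using M(3)[OF m(2)] by auto
        have qc: "\<pi>P q \<in> fst c" using q m V(2) by auto
        have "?t (q, b) \<in> R \<times> UNIV \<inter> O'" using S(3)[of "(q, b)"] NG(5) q b by auto
        then have "F.cls (?t (q, b)) \<in> W" unfolding O'(2)[symmetric] by blast
        then have "fib c \<mu> q b \<in> W" by (simp add: fib_def[OF c])
        moreover have "?f (fib c \<mu> q b) = (m, b)"
          using fib_in(2)[OF c q(1)] q(3) chart_map_fib[OF c, where \<mu> = \<mu>, OF \<mu> q(1) qc] by simp
        ultimately show "(m, b) \<in> ?f ` W" by (metis (no_types, lifting) imageI)
      qed
    qed
  qed
  have surj: "?f ` topspace ?X = topspace (prod_topology (top_of_set V) euclidean)"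
  proof -
    have "(m, b) \<in> ?f ` topspace ?X" if "m \<in> V" for m b
    proof -
      obtain q where q: "q \<in> R" "\<pi>P q = m" using ex_R by blast
      then have "fib c \<mu> q b \<in> topspace ?X" "?f (fib c \<mu> q b) = (m, b)"
        using fib_in[OF c q(1)] chart_map_fib[OF c, where \<mu> = \<mu>, OF \<mu> q(1)] that V(2) top by auto
      then show ?thesis by (metis (no_types, lifting) imageI)
    qed
    then show ?thesis by auto
  qed
  have inj: "inj_on ?f (topspace ?X)"
  proof (rule inj_onI)
    fix x y assume xy: "x \<in> topspace ?X" "y \<in> topspace ?X" "?f x = ?f y"
    obtain q where q: "q \<in> R" "\<pi>P q = p x" using ex_R by blast
    have "x = fib c \<mu> q (chart_map c \<mu> x)"
      using fib_chart_map[OF c, where \<mu> = \<mu>, OF \<mu>, of x q] q xy V(2) by auto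
    also have "\<dots> = fib c \<mu> q (chart_map c \<mu> y)" using xy by simp
    also have "\<dots> = y" using fib_chart_map[OF c, where \<mu> = \<mu>, OF \<mu>, of y q] q xy V(2) by auto
    finally show "x = y" .
  qed
  show ?thesis by (rule bijective_open_imp_homeomorphic_map[OF cont open_map surj inj])
qed

end

end

subsection \<open>Smoothness of the bundle structure\<close>

context kuiper_bundle
begin

text \<open>The section of frames and $J_M$ are smooth when both their arguments and their
  components are taken in the chart \<open>c\<close>; the Jacobian then carries the components over
  to \<open>d\<close>.\<close>

lemma smooth_inverse_metric:
  assumes c: "c \<in> MA" "d \<in> MA" and P: "(W, \<Phi>) \<in> PA"
  defines "r \<equiv> \<lambda>x. triv_inv \<pi>P \<Phi> (chart_inv c x) 0"
  shows "smooth_on (snd c ` (W \<inter> fst d \<inter> fst c)) (\<lambda>x. inverse_metric d (r x) u w)"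
proof -
  let ?S = "snd c ` (W \<inter> fst d \<inter> fst c)"
  have S: "open ?S"
    using triv(1)[OF P] chart(1)[OF c(2)] by (intro open_chart_image[OF c(1)] open_Int)
  have x: "chart_inv c x \<in> W" "chart_inv c x \<in> fst c" "chart_inv c x \<in> fst d" if "x \<in> ?S" for x
    using chart_inv_image[OF c(1) that] by auto
  have \<pi>r: "\<pi>P (r x) = chart_inv c x" if "x \<in> ?S" for x
    unfolding r_def by (rule triv_inv(1)[OF P x(1)[OF that]])
  have jac: "smooth_on ?S (\<lambda>x. jacobian c d (chart_inv c x) v)" for v
    by (rule smooth_on_subset_open[OF smooth_jacobian[OF c] S]) auto
  have jac_lin: "linear (jacobian c d (chart_inv c x))" if "x \<in> ?S" for x
    by (rule linear_jacobian[OF c x(2,3)[OF that]])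
  have L: "smooth_on ?S (\<lambda>x. A c (r x) v)" for v
    unfolding r_def by (rule smooth_on_subset_open[OF smooth_section[OF P c(1)] S]) auto
  have JL: "smooth_on ?S (\<lambda>x. JMc c (chart_inv c x) (A c (r x) v))" for v
  proof (rule smooth_on_linear_family[OF _ L])
    show "smooth_on ?S (\<lambda>x. JMc c (chart_inv c x) b)" for b
      by (rule smooth_on_subset_open[OF smooth_JMc[OF c(1)] S]) auto
    show "linear (JMc c (chart_inv c x))" if "x \<in> ?S" for x
      by (rule linear_JMc[OF c(1) x(2)[OF that]])
  qed
  have dL: "smooth_on ?S (\<lambda>x. A d (r x) v)" for v
  proof (rule smooth_on_cong[OF smooth_on_linear_family[OF jac L jac_lin]])
    fix y assume y: "y \<in> ?S"
    show "jacobian c d (chart_inv c y) (A c (r y) v) = A d (r y) v"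
      using tangent_jacobian[OF c x(2,3)[OF y], of "Lam (r y) v"] frame_in[OF frame[of "r y"], of v]
      by (simp add: \<pi>r[OF y])
  qed
  have dJL: "smooth_on ?S (\<lambda>x. JM (\<pi>P (r x)) (Lam (r x) v) d)" for v
  proof (rule smooth_on_cong[OF smooth_on_linear_family[OF jac JL jac_lin]])
    fix y assume y: "y \<in> ?S"
    have T: "Lam (r y) v \<in> tangent_space MA (chart_inv c y)"
      using frame_in[OF frame[of "r y"], of v] by (simp add: \<pi>r[OF y])
    show "jacobian c d (chart_inv c y) (JMc c (chart_inv c y) (A c (r y) v)) = JM (\<pi>P (r y)) (Lam (r y) v) d"
      using tangent_jacobian[OF c x(2,3)[OF y] JM(1)[OF T T]]
      by (simp add: \<pi>r[OF y] tangent_eq_coord_vec[OF c(1) x(2)[OF y] T])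
  qed
  have "smooth_on ?S (\<lambda>x. \<Sum>e\<in>B\<^sub>0. (- 1) *\<^sub>R ((JM (\<pi>P (r x)) (Lam (r x) (J\<^sub>0 e)) d \<bullet> u) *\<^sub>R (A d (r x) e \<bullet> w)))"
    by (intro smooth_on_sum S smooth_on_compose_linear[OF bounded_linear_scaleR_right] smooth_on_scaleR
        smooth_on_compose_linear[OF bounded_linear_inner_left] dL dJL)
  then show ?thesis by (simp add: inverse_metric_def)
qed

context
  fixes c\<^sub>1 c :: "('m, 'v) chart" and V and \<mu> :: "nat \<Rightarrow> complex"
  assumes c\<^sub>1: "c\<^sub>1 \<in> MA" and V: "open V" "V \<subseteq> fst c\<^sub>1" and \<mu>: "\<And>k. \<mu> k \<noteq> 0" and c: "c \<in> MA"
begin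

lemma fibre_inv_chart:
  fixes b
  assumes "m \<in> V"
  defines "y \<equiv> fibre_inv E p (chart_map c\<^sub>1 \<mu>) m b"
  shows "y \<in> topspace E" "p y = m" "chart_map c\<^sub>1 \<mu> y = b"
    "q \<in> R \<Longrightarrow> \<pi>P q = m \<Longrightarrow> y = fib c\<^sub>1 \<mu> q b"
proof -
  have eq: "y = fib c\<^sub>1 \<mu> q b" if "q \<in> R" "\<pi>P q = m" for q
    using fibre_inv_eq[OF c\<^sub>1, where \<mu> = \<mu>, OF \<mu> that(1), of b] assms V(2) that by auto
  then show "q \<in> R \<Longrightarrow> \<pi>P q = m \<Longrightarrow> y = fib c\<^sub>1 \<mu> q b" .
  obtain q where q: "q \<in> R" "\<pi>P q = m" using ex_R by blast
  then have "\<pi>P q \<in> fst c\<^sub>1" using V(2) assms(1) by auto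
  then show "y \<in> topspace E" "p y = m" "chart_map c\<^sub>1 \<mu> y = b"
    using eq[OF q] fib_in[OF c\<^sub>1 q(1)] q(2) chart_map_fib[OF c\<^sub>1, where \<mu> = \<mu>, OF \<mu> q(1)] by auto
qed

lemma smooth_act:
  "smooth_on (snd c ` (V \<inter> fst c) \<times> UNIV \<times> UNIV)
    (\<lambda>(x, b, a). chart_map c\<^sub>1 \<mu> (act (fibre_inv E p (chart_map c\<^sub>1 \<mu>) (chart_inv c x) b) a))"
proof (rule smooth_on_cong)
  let ?S = "snd c ` (V \<inter> fst c) \<times> (UNIV :: (('v, 'x cdual) form \<times> 'x cpt) set)"
  have S: "open ?S" by (rule open_Times_UNIV[OF open_chart_image[OF c V(1)]])
  show "smooth_on (snd c ` (V \<inter> fst c) \<times> UNIV \<times> UNIV)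
    (\<lambda>z. form_act (fst (snd z) :: ('v, 'x cdual) form) (snd (snd z)))"
    unfolding UNIV_Times_UNIV
    by (intro bounded_bilinear.smooth_on[OF bounded_bilinear_form_act] smooth_on_linear S)
      (auto intro!: bounded_linear_compose[OF bounded_linear_fst bounded_linear_snd]
        bounded_linear_compose[OF bounded_linear_snd bounded_linear_snd])
  fix z :: "'v \<times> ('v, 'x cdual) form \<times> 'x cpt" assume "z \<in> snd c ` (V \<inter> fst c) \<times> UNIV \<times> UNIV"
  then obtain x b a where z: "z = (x, b, a)" "x \<in> snd c ` (V \<inter> fst c)" by (cases z) auto
  have m: "chart_inv c x \<in> V" using chart_inv_image[OF c z(2)] by auto
  note y = fibre_inv_chart(1-3)[OF m, of b]
  show "form_act (fst (snd z)) (snd (snd z)) = (case z of (x, b, a) \<Rightarrow>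
    chart_map c\<^sub>1 \<mu> (act (fibre_inv E p (chart_map c\<^sub>1 \<mu>) (chart_inv c x) b) a))"
    using act_chart(3)[OF c\<^sub>1 y(1), of \<mu> a] m V(2) by (auto simp: z(1) y(2,3))
qed

lemma smooth_ip:
  "smooth_on (snd c ` (V \<inter> fst c) \<times> UNIV \<times> UNIV)
    (\<lambda>(x, b, b'). ip (fibre_inv E p (chart_map c\<^sub>1 \<mu>) (chart_inv c x) b) (fibre_inv E p (chart_map c\<^sub>1 \<mu>) (chart_inv c x) b'))"
proof (rule smooth_on_local)
  let ?S = "snd c ` (V \<inter> fst c)"
  let ?G = "\<lambda>(x, b, b'). ip (fibre_inv E p (chart_map c\<^sub>1 \<mu>) (chart_inv c x) b) (fibre_inv E p (chart_map c\<^sub>1 \<mu>) (chart_inv c x) b')"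
  have S: "open ?S" by (rule open_chart_image[OF c V(1)])
  show "open (?S \<times> (UNIV :: ('v, 'x cdual) form set) \<times> (UNIV :: ('v, 'x cdual) form set))"
    unfolding UNIV_Times_UNIV by (rule open_Times_UNIV[OF S])
  fix z :: "'v \<times> ('v, 'x cdual) form \<times> ('v, 'x cdual) form" assume "z \<in> ?S \<times> UNIV \<times> UNIV"
  then have z: "fst z \<in> ?S" by auto
  \<comment> \<open>Around the given point a trivialization supplies a smooth section
    \<open>r\<close> of frames. It need not be reduced, which \<open>ip_chart\<close>
    allows.\<close>
  obtain W \<Phi> where W: "(W, \<Phi>) \<in> PA" "chart_inv c (fst z) \<in> W" using ex_triv[of "chart_inv c (fst z)"] by auto
  define r where "r x = triv_inv \<pi>P \<Phi> (chart_inv c x) 0" for x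
  let ?T = "snd c ` (W \<inter> fst c\<^sub>1 \<inter> fst c)"
  let ?f = "\<lambda>z :: 'v \<times> ('v, 'x cdual) form \<times> ('v, 'x cdual) form.
    \<Sum>k\<le>DIM('v). \<Sum>bs\<in>lists_of Basis k. \<Sum>cs\<in>lists_of Basis k.
      ((cmod (inverse (\<mu> k)))\<^sup>2 / fact k) *\<^sub>R (list_coeff (inverse_metric c\<^sub>1 (r (fst z))) bs cs *\<^sub>R
        rank_one (sharp (form_apply (fst (snd z)) bs)) (form_apply (snd (snd z)) cs))"
  have T: "open ?T"
    using triv(1)[OF W(1)] chart(1)[OF c\<^sub>1] by (intro open_chart_image[OF c] open_Int)
  have T': "open (?T \<times> (UNIV :: (('v, 'x cdual) form \<times> ('v, 'x cdual) form) set))"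
    by (rule open_Times_UNIV[OF T])
  have lin: "bounded_linear (\<lambda>z :: 'v \<times> ('v, 'x cdual) form \<times> ('v, 'x cdual) form. form_apply (fst (snd z)) bs)"
    "bounded_linear (\<lambda>z :: 'v \<times> ('v, 'x cdual) form \<times> ('v, 'x cdual) form. form_apply (snd (snd z)) bs)" for bs
    using bounded_linear_compose[OF bounded_linear_form_apply bounded_linear_compose[OF bounded_linear_fst bounded_linear_snd]]
      bounded_linear_compose[OF bounded_linear_form_apply bounded_linear_compose[OF bounded_linear_snd bounded_linear_snd]]
    by auto
  have "smooth_on (?T \<times> UNIV) ?f"
    by (intro smooth_on_sum T' smooth_on_compose_linear[OF bounded_linear_scaleR_right] smooth_on_scaleR
        smooth_on_fst smooth_on_list_coeff T smooth_inverse_metric[OF c c\<^sub>1 W(1), folded r_def]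
        bounded_bilinear.smooth_on[OF bounded_bilinear_rank_one_sharp] smooth_on_linear[OF lin(1)] smooth_on_linear[OF lin(2)])
  moreover have "?f y = ?G y" if y: "y \<in> (?T \<times> UNIV) \<inter> (?S \<times> UNIV \<times> UNIV)" for y
  proof -
    obtain x b b' where xb: "y = (x, b, b')" by (cases y) auto
    have x: "x \<in> ?T" "x \<in> ?S" using y by (auto simp: xb)
    have m: "chart_inv c x \<in> V" "chart_inv c x \<in> W" "chart_inv c x \<in> fst c\<^sub>1"
      using chart_inv_image[OF c x(2)] chart_inv_image[OF c x(1)] by auto
    note f = fibre_inv_chart(1-3)[OF m(1), of b] and f' = fibre_inv_chart(1-3)[OF m(1), of b']
    have "\<pi>P (r x) = chart_inv c x" unfolding r_def by (rule triv_inv(1)[OF W(1) m(2)])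
    then have "\<pi>P (r x) = p (fibre_inv E p (chart_map c\<^sub>1 \<mu>) (chart_inv c x) b)" by (simp add: f(2))
    from ip_chart[OF c\<^sub>1, where \<mu> = \<mu>, OF \<mu> f(1) f'(1) _ _ this]
    show ?thesis using m(3) by (simp add: xb f(2,3) f'(2,3))
  qed
  moreover have "z \<in> ?T \<times> UNIV"
  proof -
    have "chart_inv c (fst z) \<in> W \<inter> fst c\<^sub>1 \<inter> fst c" "snd c (chart_inv c (fst z)) = fst z"
      using chart_inv_image[OF c z] W(2) V(2) by auto
    then have "fst z \<in> ?T" by (metis imageI)
    then show ?thesis by (cases z) simp
  qed
  ultimately show "\<exists>T g. open T \<and> z \<in> T \<and> smooth_on T g \<and> (\<forall>y\<in>T \<inter> (?S \<times> UNIV \<times> UNIV). g y = ?G y)"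
    using T' by (intro exI[of _ "?T \<times> UNIV"] exI[of _ ?f]) simp
qed

context
  fixes c\<^sub>2 :: "('m, 'v) chart" and W and \<nu> :: "nat \<Rightarrow> complex"
  assumes c\<^sub>2: "c\<^sub>2 \<in> MA" and W: "open W" "W \<subseteq> fst c\<^sub>2" and \<nu>: "\<And>k. \<nu> k \<noteq> 0"
begin

text \<open>Both charts are read in one reduced frame \<open>q\<close>, so \<open>U q\<close>
  cancels \<open>iU q\<close> and the two frames compose to a Jacobian. It leads from the second
  chart back to the first because forms are pulled back.\<close>

lemma transition_eq:
  assumes m: "m \<in> V" "m \<in> W"
  shows "chart_map c\<^sub>2 \<nu> (fibre_inv E p (chart_map c\<^sub>1 \<mu>) m b)
    = form_twist (\<lambda>k. \<nu> k * inverse (\<mu> k)) id (jacobian c\<^sub>2 c\<^sub>1 m) b"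
proof -
  obtain q where q: "q \<in> R" "\<pi>P q = m" using ex_R by blast
  have m': "\<pi>P q \<in> fst c\<^sub>1" "\<pi>P q \<in> fst c\<^sub>2" using q m V(2) W(2) by auto
  have "A c\<^sub>1 q (B c\<^sub>2 q u) = jacobian c\<^sub>2 c\<^sub>1 m u" for u
    using m' c\<^sub>1 frame_inv(1)[OF frame coord_vec_in[OF c\<^sub>2 m'(2)]] by (simp only:) (simp add: coord_vec_def q)
  then have "(\<lambda>v. A c\<^sub>1 q v) \<circ> B c\<^sub>2 q = jacobian c\<^sub>2 c\<^sub>1 m" "U q \<circ> iU q = id"
    by (auto simp: fun_eq_iff)
  then show ?thesis
    unfolding fibre_inv_chart(4)[OF m(1) q] fib_def[OF c\<^sub>1] chart_map_cls[OF c\<^sub>2 q(1) m'(2)]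
      form_twist_twist[OF linear_U linear_B[OF c\<^sub>2 m'(2)] clinear_linear[OF clinear_iU] linear_A clinear_U]
    by simp
qed

lemma smooth_transition:
  "smooth_on (snd c ` (V \<inter> W \<inter> fst c) \<times> UNIV)
    (\<lambda>(x, b). chart_map c\<^sub>2 \<nu> (fibre_inv E p (chart_map c\<^sub>1 \<mu>) (chart_inv c x) b))"
proof (rule smooth_on_cong)
  let ?S = "snd c ` (V \<inter> W \<inter> fst c)"
  have S: "open ?S" by (rule open_chart_image[OF c open_Int[OF V(1) W(1)]])
  have x: "chart_inv c x \<in> V \<inter> W" if "x \<in> ?S" for x using chart_inv_image[OF c that] by auto
  show "smooth_on (?S \<times> UNIV) (\<lambda>(x, b). form_twist (\<lambda>k. \<nu> k * inverse (\<mu> k)) id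
    (jacobian c\<^sub>2 c\<^sub>1 (chart_inv c x)) (b :: ('v, 'x cdual) form))"
  proof (rule smooth_on_form_twist)
    show "smooth_on ?S (\<lambda>x. jacobian c\<^sub>2 c\<^sub>1 (chart_inv c x) u)" for u
      by (rule smooth_on_subset_open[OF smooth_jacobian_chart[OF c c\<^sub>2 c\<^sub>1] S]) (use V(2) W(2) in auto)
    show "linear (jacobian c\<^sub>2 c\<^sub>1 (chart_inv c x))" if "x \<in> ?S" for x
      by (rule linear_jacobian[OF c\<^sub>2 c\<^sub>1]) (use x[OF that] V(2) W(2) in auto)
  qed
  fix z :: "'v \<times> ('v, 'x cdual) form" assume "z \<in> ?S \<times> UNIV"
  then have "fst z \<in> ?S" by auto
  from x[OF this] transition_eq[of "chart_inv c (fst z)" "snd z"]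
  show "(case z of (x, b) \<Rightarrow> form_twist (\<lambda>k. \<nu> k * inverse (\<mu> k)) id (jacobian c\<^sub>2 c\<^sub>1 (chart_inv c x)) b)
    = (case z of (x, b) \<Rightarrow> chart_map c\<^sub>2 \<nu> (fibre_inv E p (chart_map c\<^sub>1 \<mu>) (chart_inv c x) b))"
    by (simp add: split_beta)
qed

end

end

lemma continuous_on_form_twist:
  fixes L :: "'v::euclidean_space \<Rightarrow> 'v"
  assumes "linear L"
  shows "continuous_on UNIV (form_twist \<mu> id L :: ('v, 'h::complex_normed_vector) form \<Rightarrow> _)"
proof (rule continuous_on_form)
  fix vs
  have "continuous_on UNIV (\<lambda>b :: ('v, 'h) form. \<mu> (length vs) *\<^sub>C form_apply b (map L vs))"
    by (rule linear_continuous_on[OF bounded_linear_compose[OF bounded_linear_scaleC bounded_linear_form_apply]])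
  then show "continuous_on UNIV (\<lambda>b :: ('v, 'h) form. form_apply (form_twist \<mu> id L b) vs)"
    by (simp add: form_apply_twist linear_id assms)
qed

lemma transition_automorphism:
  assumes c: "c\<^sub>1 \<in> MA" "c\<^sub>2 \<in> MA" and m: "m \<in> fst c\<^sub>1" "m \<in> fst c\<^sub>2" and \<mu>: "\<And>k. \<mu> k \<noteq> 0"
  shows "CH_automorphism form_act (form_twist \<mu> id (jacobian c\<^sub>2 c\<^sub>1 m) :: ('v, 'x cdual) form \<Rightarrow> _)"
proof -
  let ?T = "form_twist \<mu> id (jacobian c\<^sub>2 c\<^sub>1 m) :: ('v, 'x cdual) form \<Rightarrow> _"
  let ?T' = "form_twist (\<lambda>k. inverse (\<mu> k)) id (jacobian c\<^sub>1 c\<^sub>2 m) :: ('v, 'x cdual) form \<Rightarrow> _"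
  note l = linear_jacobian[OF c(2,1) m(2,1)] linear_jacobian[OF c(1,2) m(1,2)]
  have idl: "clinear (id :: 'x cdual \<Rightarrow> _)" by (simp add: clinear_def)
  have TT: "?T (?T' b) = b" "?T' (?T b) = b" for b
    using form_twist_twist[OF linear_id l(1) linear_id l(2) idl] form_twist_twist[OF linear_id l(2) linear_id l(1) idl]
    by (simp_all add: form_twist_id \<mu> jacobian_jacobian c m)
  then have inv: "inv ?T = ?T'"
    by (intro inv_equality) auto
  have s: "z *\<^sub>C dual_compose f a = dual_compose (z *\<^sub>C f) a" for z and f :: "'x cdual" and a
    by (rule ev_extI) simp
  show ?thesis
    unfolding CH_automorphism_def
  proof (intro conjI allI)
    show "clinear ?T" by (rule clinear_form_twist[OF idl l(1)])
    show "homeomorphism UNIV UNIV ?T (inv ?T)"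
      unfolding inv homeomorphism_def
      using continuous_on_form_twist[OF l(1)] continuous_on_form_twist[OF l(2)] TT surjI[of ?T, OF TT(1)] surjI[of ?T', OF TT(2)]
      by auto
    show "?T (form_act h a) = form_act (?T h) a" for h a
      by (rule form_extI) (simp add: form_apply_twist linear_id l s)
  qed
qed

lemma reduced_bundle:
  "smooth_hilbert_CH_bundle MA form_act E p (assoc_add F.cls) (assoc_scaleC F.cls) act ip
    (induced_atlas MA sw \<pi>P ract Lam KJ)"
proof -
  have atlasE: "\<exists>c \<mu>. c \<in> MA \<and> open V \<and> V \<subseteq> fst c \<and> (\<forall>k. \<mu> k \<noteq> 0) \<and> \<psi> = chart_map c \<mu>"
    if "(V, \<psi>) \<in> induced_atlas MA sw \<pi>P ract Lam KJ" for V \<psi>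
    using that unfolding induced_atlas_def by blast
  show ?thesis
    unfolding smooth_hilbert_CH_bundle_def
  proof (intro conjI)
    show "continuous_map E euclidean p" by (rule continuous_p)
    show "\<forall>m. hilbert_CH_module {x \<in> topspace E. p x = m} (assoc_add F.cls) (assoc_scaleC F.cls) act ip"
      using hilbert_fibre by blast
    show "(\<Union>(V, \<psi>)\<in>induced_atlas MA sw \<pi>P ract Lam KJ. V) = UNIV"
    proof -
      have "\<exists>(V, \<psi>)\<in>induced_atlas MA sw \<pi>P ract Lam KJ. m \<in> V" for m
      proof -
        obtain c where c: "c \<in> MA" "m \<in> fst c" using ex_chart by blast
        have "(fst c, chart_map c (\<lambda>k. 1)) \<in> induced_atlas MA sw \<pi>P ract Lam KJ"
          unfolding induced_atlas_def using c(1) chart(1)[OF c(1)] by (intro CollectI exI[of _ c] exI[of _ "fst c"] exI[of _ "\<lambda>k. 1"]) simp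
        then show ?thesis using c(2) by (intro bexI[of _ "(fst c, chart_map c (\<lambda>k. 1))"]) auto
      qed
      then show ?thesis by blast
    qed
    show "\<forall>(V, \<psi>)\<in>induced_atlas MA sw \<pi>P ract Lam KJ. open V \<and>
      homeomorphic_map (subtopology E {x. p x \<in> V}) (prod_topology (top_of_set V) euclidean) (\<lambda>x. (p x, \<psi> x)) \<and>
      (\<forall>x\<in>topspace E. \<forall>y\<in>topspace E. p x \<in> V \<and> p y = p x \<longrightarrow>
        \<psi> (assoc_add F.cls x y) = \<psi> x + \<psi> y \<and> (\<forall>c. \<psi> (assoc_scaleC F.cls c x) = c *\<^sub>C \<psi> x))"
    proof (clarify)
      fix V \<psi> assume "(V, \<psi>) \<in> induced_atlas MA sw \<pi>P ract Lam KJ"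
      from atlasE[OF this] obtain c \<mu> where c: "c \<in> MA" "open V" "V \<subseteq> fst c" and \<mu>: "\<And>k. \<mu> k \<noteq> 0" and \<psi>: "\<psi> = chart_map c \<mu>"
        by blast
      show "open V \<and>
        homeomorphic_map (subtopology E {x. p x \<in> V}) (prod_topology (top_of_set V) euclidean) (\<lambda>x. (p x, \<psi> x)) \<and>
        (\<forall>x\<in>topspace E. \<forall>y\<in>topspace E. p x \<in> V \<and> p y = p x \<longrightarrow>
          \<psi> (assoc_add F.cls x y) = \<psi> x + \<psi> y \<and> (\<forall>c. \<psi> (assoc_scaleC F.cls c x) = c *\<^sub>C \<psi> x))"
        unfolding \<psi>
      proof (intro conjI ballI impI allI)
        show "homeomorphic_map (subtopology E {x. p x \<in> V}) (prod_topology (top_of_set V) euclidean) (\<lambda>x. (p x, chart_map c \<mu> x))"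
          by (rule homeomorphic_chart[OF c \<mu>])
        fix x y a assume x: "x \<in> topspace E" and y: "y \<in> topspace E" and xy: "p x \<in> V \<and> p y = p x"
        have m: "p x \<in> fst c" using xy c(3) by blast
        show "chart_map c \<mu> (assoc_add F.cls x y) = chart_map c \<mu> x + chart_map c \<mu> y"
          using add_chart(3)[OF c(1) x y _ m] xy by blast
        show "chart_map c \<mu> (assoc_scaleC F.cls a x) = a *\<^sub>C chart_map c \<mu> x"
          by (rule scale_chart(3)[OF c(1) x m])
      qed (rule c)
    qed
    show "\<forall>(V, \<psi>)\<in>induced_atlas MA sw \<pi>P ract Lam KJ. \<forall>(W, \<phi>)\<in>induced_atlas MA sw \<pi>P ract Lam KJ.
      (\<forall>m\<in>V \<inter> W. CH_automorphism form_act (\<lambda>b. \<phi> (fibre_inv E p \<psi> m b))) \<and>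
      (\<forall>c\<in>MA. smooth_on (snd c ` (V \<inter> W \<inter> fst c) \<times> UNIV) (\<lambda>(x, b). \<phi> (fibre_inv E p \<psi> (chart_inv c x) b)))"
    proof (clarify)
      fix V \<psi> W \<phi> assume "(V, \<psi>) \<in> induced_atlas MA sw \<pi>P ract Lam KJ" "(W, \<phi>) \<in> induced_atlas MA sw \<pi>P ract Lam KJ"
      from atlasE[OF this(1)] atlasE[OF this(2)] obtain c\<^sub>1 \<mu> c\<^sub>2 \<nu>
        where c: "c\<^sub>1 \<in> MA" "open V" "V \<subseteq> fst c\<^sub>1" "c\<^sub>2 \<in> MA" "open W" "W \<subseteq> fst c\<^sub>2"
          and \<mu>: "\<And>k. \<mu> k \<noteq> 0" and \<nu>: "\<And>k. \<nu> k \<noteq> 0" and \<psi>: "\<psi> = chart_map c\<^sub>1 \<mu>" and \<phi>: "\<phi> = chart_map c\<^sub>2 \<nu>"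
        by blast
      show "(\<forall>m\<in>V \<inter> W. CH_automorphism form_act (\<lambda>b. \<phi> (fibre_inv E p \<psi> m b))) \<and>
        (\<forall>c\<in>MA. smooth_on (snd c ` (V \<inter> W \<inter> fst c) \<times> UNIV) (\<lambda>(x, b). \<phi> (fibre_inv E p \<psi> (chart_inv c x) b)))"
        unfolding \<psi> \<phi>
      proof (intro conjI ballI)
        fix m assume "m \<in> V \<inter> W"
        then have m: "m \<in> V" "m \<in> W" by auto
        show "CH_automorphism form_act (\<lambda>b. chart_map c\<^sub>2 \<nu> (fibre_inv E p (chart_map c\<^sub>1 \<mu>) m b))"
          unfolding transition_eq[OF c(1,2,3), where \<mu> = \<mu>, OF \<mu> c(1) c(4,5,6), where \<nu> = \<nu>, OF \<nu> m]
          by (rule transition_automorphism) (use c m \<mu> \<nu> in auto)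
      next
        fix d assume "d \<in> MA"
        from smooth_transition[OF c(1,2,3), where \<mu> = \<mu>, OF \<mu> this c(4,5,6), where \<nu> = \<nu>, OF \<nu>]
        show "smooth_on (snd d ` (V \<inter> W \<inter> fst d) \<times> UNIV)
          (\<lambda>(x, b). chart_map c\<^sub>2 \<nu> (fibre_inv E p (chart_map c\<^sub>1 \<mu>) (chart_inv d x) b))" .
      qed
    qed
    show "\<forall>(V, \<psi>)\<in>induced_atlas MA sw \<pi>P ract Lam KJ. \<forall>c\<in>MA.
      smooth_on (snd c ` (V \<inter> fst c) \<times> UNIV \<times> UNIV) (\<lambda>(x, b, a). \<psi> (act (fibre_inv E p \<psi> (chart_inv c x) b) a)) \<and>
      smooth_on (snd c ` (V \<inter> fst c) \<times> UNIV \<times> UNIV)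
        (\<lambda>(x, b, b'). ip (fibre_inv E p \<psi> (chart_inv c x) b) (fibre_inv E p \<psi> (chart_inv c x) b'))"
    proof (clarify)
      fix V \<psi> and d :: "'m set" and d' assume "(V, \<psi>) \<in> induced_atlas MA sw \<pi>P ract Lam KJ" and d: "(d, d') \<in> MA"
      from atlasE[OF this(1)] obtain c \<mu> where c: "c \<in> MA" "open V" "V \<subseteq> fst c" and \<mu>: "\<And>k. \<mu> k \<noteq> 0" and \<psi>: "\<psi> = chart_map c \<mu>"
        by blast
      show "smooth_on (snd (d, d') ` (V \<inter> fst (d, d')) \<times> UNIV \<times> UNIV) (\<lambda>(x, b, a). \<psi> (act (fibre_inv E p \<psi> (chart_inv (d, d') x) b) a)) \<and>
        smooth_on (snd (d, d') ` (V \<inter> fst (d, d')) \<times> UNIV \<times> UNIV)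
        (\<lambda>(x, b, b'). ip (fibre_inv E p \<psi> (chart_inv (d, d') x) b) (fibre_inv E p \<psi> (chart_inv (d, d') x) b'))"
        unfolding \<psi> using smooth_act[OF c, where \<mu> = \<mu>, OF \<mu> d] smooth_ip[OF c, where \<mu> = \<mu>, OF \<mu> d] by blast
    qed
  qed
qed

end

theorem theorem10:
  fixes \<omega>\<^sub>0 :: "'v::euclidean_space \<Rightarrow> 'v \<Rightarrow> real" and J\<^sub>0 :: "'v \<Rightarrow> 'v"
    and \<iota> :: "'l::euclidean_space \<Rightarrow> 'v"
    and lam :: "'g::topological_group_add \<Rightarrow> 'v \<Rightarrow>\<^sub>L 'v"
    and sw :: "'g \<Rightarrow> 'l l2 \<Rightarrow>\<^sub>L 'l l2"
    and MA :: "('m::{t2_space, second_countable_topology}, 'v) chart set"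
    and \<omega> :: "'m \<Rightarrow> ('m, 'v) tvec \<Rightarrow> ('m, 'v) tvec \<Rightarrow> real"
    and \<pi>P :: "'p::topological_space \<Rightarrow> 'm" and ract :: "'p \<Rightarrow> 'g \<Rightarrow> 'p"
    and PA :: "('m set \<times> ('p \<Rightarrow> 'g)) set"
    and Lam :: "'p \<Rightarrow> 'v \<Rightarrow> ('m, 'v) tvec"
    and J :: "('p \<times> 'l l2 cdual) set \<Rightarrow> 'm \<times> 'l l2 cdual"
    and JM :: "'m \<Rightarrow> ('m, 'v) tvec \<Rightarrow> ('m, 'v) tvec"
  assumes "linear_symplectic \<omega>\<^sub>0"
    and "linear_complex_structure \<omega>\<^sub>0 J\<^sub>0"
    and "lagrangian_parametrization \<omega>\<^sub>0 J\<^sub>0 \<iota>"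
    and "connected_double_cover \<omega>\<^sub>0 lam"
    and "segal_shale_weil \<omega>\<^sub>0 J\<^sub>0 \<iota> lam sw"
    and "symplectic_manifold MA \<omega>"
    and "metaplectic_structure \<omega>\<^sub>0 lam MA \<omega> \<pi>P ract PA Lam"
    and "kuiper_map \<pi>P ract sw J"
    and "compatible_positive_acs MA \<omega> JM"
  defines "g\<^sub>0 \<equiv> metric_of \<omega>\<^sub>0 J\<^sub>0"
  defines "cls \<equiv> reduced_class g\<^sub>0 lam sw ract"
  shows "smooth_hilbert_CH_bundle MA form_act
    (assoc_topology (reduced_frames J\<^sub>0 \<pi>P Lam JM) cls)
    (\<lambda>h. \<pi>P (class_rep h))
    (assoc_add cls) (assoc_scaleC cls)
    (reduced_act g\<^sub>0 lam sw \<pi>P ract J) (reduced_prod g\<^sub>0 sw \<pi>P ract J)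
    (induced_atlas MA sw \<pi>P ract Lam J)"
proof -
  interpret kuiper_bundle \<omega>\<^sub>0 J\<^sub>0 MA lam \<omega> \<pi>P ract PA Lam JM sw J
  proof unfold_locales
    show "smooth_atlas MA" using assms(6) by (simp add: symplectic_manifold_def)
    show "unitary_op (blinfun_apply (sw h))" "sw (h + k) = sw h o\<^sub>L sw k" for h k
      using assms(5) by (auto simp: segal_shale_weil_def)
    show "\<exists>e :: nat \<Rightarrow> 'l l2. \<forall>i j. cinner (e i) (e j) = (if i = j then 1 else 0)"
      by (rule orthonormal_sequence_l2)
  qed (fact assms)+
  show ?thesis
    using reduced_bundle unfolding cls_def g\<^sub>0_def reduced_class_eq .
qed

end
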